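(* Fix $r>0$ and let $P=P_r\subset\mathbb{R}^3$ be the isohedral triakis octahedron with parameter $r$ described in the context. For $k\in\{0,1,2,3\}$ let $G(k)$ be the symmetry group of the $k$-skeleton $P(k)$ (which is $W(\mathrm{B}_3)$), $\mathcal{H}_{P(k)}$ the space of $P(k)$-harmonic functions and $\mathcal{H}_{G(k)}$ the space of $G(k)$-harmonic functions. Then $\mathcal{H}_{G(k)}\subsetneq\mathcal{H}_{P(k)}$ if and only if one of the following holds: (i) $k=0$ and $r=r_0:=3\cdot2^{-3/4}=1.78381\cdots$; (ii) $k=1$ and $r=r_1:=2.24580\cdots$, the unique positive root of $16r^8+32r^7+40r^6-48r^5-396r^4-432r^3-810r^2-972r-729=0$; (iii) $k\in\{2,3\}$ and $r=r_2:=1.82977\cdots$, the unique positive root of $4r^4+8r^3+6r^2-18r-81=0$. If any of these is the case, then $\dim\mathcal{H}_{G(k)}=48<\dim\mathcal{H}_{P(k)}=96$, and as modules over $\mathbb{R}[\partial]$ (acting by constant-coefficient differential operators), $\mathcal{H}_{G(k)}=\mathcal{H}_{\mathrm{B}_3}$ is generated by $$\Delta_{\mathrm{B}_3}(x)=x_1x_2x_3(x_1^2-x_2^2)(x_2^2-x_3^2)(x_3^2-x_1^2),$$ while $\mathcal{H}_{P(k)}$ is generated by $$F(x)=\Delta_{\mathrm{B}_3}(x)\,\{5(x_1^4+x_2^4+x_3^4)-13(x_1^2x_2^2+x_2^2x_3^2+x_3^2x_1^2)\}.$$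
   Context: Let $\Omega$ be the regular octahedron with vertices $\mathrm{A}^{\pm}=(\pm1,0,0)$, $\mathrm{B}^{\pm}=(0,\pm1,0)$, $\mathrm{C}^{\pm}=(0,0,\pm1)$; its faces are $\mathrm{A}^a\mathrm{B}^b\mathrm{C}^c$, $a,b,c\in\{+,-\}$. For $r>0$ put $\mathrm{D}^{abc}=r(\mathrm{A}^a+\mathrm{B}^b+\mathrm{C}^c)/3$ (the point on the ray from the origin through the center of face $\mathrm{A}^a\mathrm{B}^b\mathrm{C}^c$ at $r$ times the distance of that center). The triakis octahedron $P$ is obtained from $\Omega$ by adjoining (or, for $r<1$, excavating) on each face the pyramid with apex $\mathrm{D}^{abc}$. Combinatorially, for every $r>0$ (even when faces become coplanar), $P$ has the 14 vertices $\mathrm{A}^{\pm},\mathrm{B}^{\pm},\mathrm{C}^{\pm},\mathrm{D}^{abc}$; 36 edges $\mathrm{A}^a\mathrm{B}^b,\mathrm{A}^a\mathrm{C}^c,\mathrm{B}^b\mathrm{C}^c$ (edges of $\Omega$) and $\mathrm{A}^a\mathrm{D}^{abc},\mathrm{B}^b\mathrm{D}^{abc},\mathrm{C}^c\mathrm{D}^{abc}$; and 24 triangular faces $\mathrm{A}^a\mathrm{B}^b\mathrm{D}^{abc},\mathrm{A}^a\mathrm{C}^c\mathrm{D}^{abc},\mathrm{B}^b\mathrm{C}^c\mathrm{D}^{abc}$, with $a,b,c$ ranging over $\pm$. $P(k)$ is the union of the $k$-dimensional faces ($P(3)$ the solid), and $G(k)$ is the group of orthogonal transformations of $\mathbb{R}^3$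 preserving $P(k)$. A continuous $f$ on $\mathbb{R}^3$ is $P(k)$-harmonic if $f(x)=\frac{1}{|P(k)|}\int_{P(k)}f(x+\rho y)\,d\mu_k(y)$ for all $x\in\mathbb{R}^3$, $\rho>0$, where $\mu_k$ is $k$-dimensional Euclidean measure and $|P(k)|=\mu_k(P(k))$. For $G\subset O(3)$, a $G$-harmonic function is a distribution solution of $\varphi(\partial)f=0$ for all $G$-invariant polynomials $\varphi$ with $\varphi(0)=0$, $\partial=(\partial_1,\partial_2,\partial_3)$; $\mathcal{H}_G$ is the space of these. $W(\mathrm{B}_3)$ is the group of signed $3\times3$ permutation matrices (symmetry group of the cube $[-1,1]^3$ and of $\Omega$), and $\mathcal{H}_{\mathrm{B}_3}=\mathcal{H}_{W(\mathrm{B}_3)}$. *)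

theory Defs
  imports "HOL-Analysis.Analysis" "HOL-Library.Function_Algebras" "HOL-Library.Poly_Mapping"
begin

definition signs :: "real set" where
  "signs = {1, -1}"

definition vA :: "real \<Rightarrow> real^3" where "vA a = vector [a, 0, 0]"
definition vB :: "real \<Rightarrow> real^3" where "vB b = vector [0, b, 0]"
definition vC :: "real \<Rightarrow> real^3" where "vC c = vector [0, 0, c]"

definition vD :: "real \<Rightarrow> real \<Rightarrow> real \<Rightarrow> real \<Rightarrow> real^3" where
  "vD r a b c = (r / 3) *\<^sub>R (vA a + vB b + vC c)"

definition vertices :: "real \<Rightarrow> (real^3) set" where
  "vertices r = vA ` signs \<union> vB ` signs \<union> vC ` signs \<union>
     (\<Union>a\<in>signs. \<Union>b\<in>signs. \<Union>c\<in>signs. {vD r a b c})"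

text \<open>Each edge and each face is listed exactly once, as a tuple of its vertices.\<close>

definition edges :: "real \<Rightarrow> ((real^3) \<times> (real^3)) set" where
  "edges r = (\<Union>a\<in>signs. \<Union>b\<in>signs. \<Union>c\<in>signs.
     {(vA a, vB b), (vA a, vC c), (vB b, vC c),
      (vA a, vD r a b c), (vB b, vD r a b c), (vC c, vD r a b c)})"

definition faces :: "real \<Rightarrow> ((real^3) \<times> (real^3) \<times> (real^3)) set" where
  "faces r = (\<Union>a\<in>signs. \<Union>b\<in>signs. \<Union>c\<in>signs.
     {(vA a, vB b, vD r a b c), (vA a, vC c, vD r a b c), (vB b, vC c, vD r a b c)})"

definition octahedron :: "(real^3) set" where
  "octahedron = convex hull (vA ` signs \<union> vB ` signs \<union> vC ` signs)"

definition pyramids :: "real \<Rightarrow> (real^3) set" where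
  "pyramids r = (\<Union>a\<in>signs. \<Union>b\<in>signs. \<Union>c\<in>signs.
     convex hull {vA a, vB b, vC c, vD r a b c})"

text \<open>For \<open>r < 1\<close> the apices lie inside the octahedron and the pyramids are excavated;
  the closure restores the boundary of the remaining solid.\<close>

definition solid :: "real \<Rightarrow> (real^3) set" where
  "solid r = (if r < 1 then closure (octahedron - pyramids r) else octahedron \<union> pyramids r)"

definition skeleton :: "real \<Rightarrow> nat \<Rightarrow> (real^3) set" where
  "skeleton r k =
     (if k = 0 then vertices r
      else if k = 1 then (\<Union>(u, v)\<in>edges r. convex hull {u, v})
      else if k = 2 then (\<Union>(u, v, w)\<in>faces r. convex hull {u, v, w})
      else solid r)"

text \<open>Integration over the \<open>k\<close>-skeleton with respect to \<open>k\<close>-dimensional Euclidean measure: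
  counting measure, arc length, surface area and volume.  Edges and faces are parametrised
  affinely with the corresponding Jacobian factor.  For every \<open>r > 0\<close> two distinct edges
  (faces) meet in a set of length (area) zero, so summing over them integrates over the union.\<close>

definition skeleton_integral :: "real \<Rightarrow> nat \<Rightarrow> (real^3 \<Rightarrow> real) \<Rightarrow> real" where
  "skeleton_integral r k f =
     (if k = 0 then (\<Sum>v\<in>vertices r. f v)
      else if k = 1 then
        (\<Sum>(u, v)\<in>edges r. norm (v - u) * (LINT t:{0..1}|lborel. f (u + t *\<^sub>R (v - u))))
      else if k = 2 then
        (\<Sum>(u, v, w)\<in>faces r. norm (cross3 (v - u) (w - u)) *
           (LINT p:{(s, t). 0 \<le> s \<and> 0 \<le> t \<and> s + t \<le> 1}|lborel.
              f (u + fst p *\<^sub>R (v - u) + snd p *\<^sub>R (w - u))))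
      else (LINT y:solid r|lborel. f y))"

definition skeleton_size :: "real \<Rightarrow> nat \<Rightarrow> real" where
  "skeleton_size r k = skeleton_integral r k (\<lambda>_. 1)"

definition P_harmonic :: "real \<Rightarrow> nat \<Rightarrow> (real^3 \<Rightarrow> real) set" where
  "P_harmonic r k = {f. continuous_on UNIV f \<and>
     (\<forall>x. \<forall>\<rho>>0. f x = (1 / skeleton_size r k) * skeleton_integral r k (\<lambda>y. f (x + \<rho> *\<^sub>R y)))}"

definition sym_group :: "(real^3) set \<Rightarrow> (real^3^3) set" where
  "sym_group S = {A. orthogonal_matrix A \<and> (\<lambda>x. A *v x) ` S = S}"

definition W_B3 :: "(real^3^3) set" where
  "W_B3 = {A. \<exists>\<sigma> \<epsilon>. bij \<sigma> \<and> (\<forall>i. \<epsilon> i \<in> signs) \<and> A = (\<chi> i j. if j = \<sigma> i then \<epsilon> i else 0)}"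

text \<open>A real polynomial in three variables is a finitely supported map from exponent vectors
  to coefficients.\<close>

type_synonym poly3 = "(nat^3) \<Rightarrow>\<^sub>0 real"

definition eval3 :: "poly3 \<Rightarrow> real^3 \<Rightarrow> real" where
  "eval3 q x = (\<Sum>\<alpha>\<in>Poly_Mapping.keys q. Poly_Mapping.lookup q \<alpha> * (\<Prod>i\<in>UNIV. (x $ i) ^ (\<alpha> $ i)))"

definition invariant :: "(real^3^3) set \<Rightarrow> poly3 \<Rightarrow> bool" where
  "invariant G q \<longleftrightarrow> (\<forall>A\<in>G. \<forall>x. eval3 q (A *v x) = eval3 q x)"

definition partial :: "3 \<Rightarrow> (real^3 \<Rightarrow> real) \<Rightarrow> real^3 \<Rightarrow> real" where
  "partial i f x = deriv (\<lambda>t. f (x + t *\<^sub>R axis i 1)) 0"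

definition mpartial :: "nat^3 \<Rightarrow> (real^3 \<Rightarrow> real) \<Rightarrow> real^3 \<Rightarrow> real" where
  "mpartial \<alpha> f = (partial 1 ^^ (\<alpha> $ 1)) ((partial 2 ^^ (\<alpha> $ 2)) ((partial 3 ^^ (\<alpha> $ 3)) f))"

definition diff_op :: "poly3 \<Rightarrow> (real^3 \<Rightarrow> real) \<Rightarrow> real^3 \<Rightarrow> real" where
  "diff_op q f x = (\<Sum>\<alpha>\<in>Poly_Mapping.keys q. Poly_Mapping.lookup q \<alpha> * mpartial \<alpha> f x)"

definition smooth :: "(real^3 \<Rightarrow> real) \<Rightarrow> bool" where
  "smooth f \<longleftrightarrow> (\<forall>js. foldr partial js f differentiable_on UNIV)"

definition support :: "(real^3 \<Rightarrow> real) \<Rightarrow> (real^3) set" where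
  "support f = closure {x. f x \<noteq> 0}"

definition test_function :: "(real^3 \<Rightarrow> real) \<Rightarrow> bool" where
  "test_function \<psi> \<longleftrightarrow> smooth \<psi> \<and> compact (support \<psi>)"

text \<open>A distribution is a linear functional on test functions satisfying, on each compact set,
  a bound by finitely many derivatives.  It is represented as a total functional with the
  conventional value 0 outside the test functions, so that equality and linear
  independence have their usual meaning.\<close>

type_synonym functional3 = "(real^3 \<Rightarrow> real) \<Rightarrow> real"

definition distribution :: "functional3 \<Rightarrow> bool" where
  "distribution T \<longleftrightarrow>
     (\<forall>\<psi>. \<not> test_function \<psi> \<longrightarrow> T \<psi> = 0) \<and>
     (\<forall>\<psi> \<eta>. test_function \<psi> \<longrightarrow> test_function \<eta> \<longrightarrow> T (\<lambda>x. \<psi> x + \<eta> x) = T \<psi> + T \<eta>) \<and>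
     (\<forall>c \<psi>. test_function \<psi> \<longrightarrow> T (\<lambda>x. c * \<psi> x) = c * T \<psi>) \<and>
     (\<forall>K. compact K \<longrightarrow> (\<exists>C N. \<forall>\<psi>. test_function \<psi> \<longrightarrow> support \<psi> \<subseteq> K \<longrightarrow>
        \<bar>T \<psi>\<bar> \<le> C * (\<Sum>\<alpha> | (\<Sum>i\<in>UNIV. \<alpha> $ i) \<le> N. SUP x. \<bar>mpartial \<alpha> \<psi> x\<bar>)))"

text \<open>The distribution with which a continuous function is identified.\<close>

definition regular :: "(real^3 \<Rightarrow> real) \<Rightarrow> functional3" where
  "regular f \<psi> = (if test_function \<psi> then (LINT x|lborel. f x * \<psi> x) else 0)"

definition dist_op :: "poly3 \<Rightarrow> functional3 \<Rightarrow> functional3" where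
  "dist_op q T \<psi> = (if test_function \<psi>
     then (\<Sum>\<alpha>\<in>Poly_Mapping.keys q. Poly_Mapping.lookup q \<alpha> * (-1) ^ (\<Sum>i\<in>UNIV. \<alpha> $ i) * T (mpartial \<alpha> \<psi>)) else 0)"

definition G_harmonic :: "(real^3^3) set \<Rightarrow> functional3 set" where
  "G_harmonic G = {T. distribution T \<and>
     (\<forall>\<phi>. invariant G \<phi> \<longrightarrow> eval3 \<phi> 0 = 0 \<longrightarrow> dist_op \<phi> T = (\<lambda>_. 0))}"

text \<open>Dimension of a real vector space of functions with pointwise operations; the library's
  convention assigns 0 to infinite-dimensional spaces, so a positive value entails finite
  dimension.\<close>

definition fdim :: "('a \<Rightarrow> real) set \<Rightarrow> nat" where
  "fdim V = vector_space.dim (\<lambda>(c::real) f x. c * f x) V"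

definition poly_r1 :: "real \<Rightarrow> real" where
  "poly_r1 r = 16*r^8 + 32*r^7 + 40*r^6 - 48*r^5 - 396*r^4 - 432*r^3 - 810*r^2 - 972*r - 729"

definition poly_r2 :: "real \<Rightarrow> real" where
  "poly_r2 r = 4*r^4 + 8*r^3 + 6*r^2 - 18*r - 81"

definition crit_r0 :: real where "crit_r0 = 3 * 2 powr (- 3 / 4)"
definition crit_r1 :: real where "crit_r1 = (THE r. r > 0 \<and> poly_r1 r = 0)"
definition crit_r2 :: real where "crit_r2 = (THE r. r > 0 \<and> poly_r2 r = 0)"

definition Delta_B3 :: "real^3 \<Rightarrow> real" where
  "Delta_B3 x = x$1 * x$2 * x$3 * ((x$1)^2 - (x$2)^2) * ((x$2)^2 - (x$3)^2) * ((x$3)^2 - (x$1)^2)"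

definition F_gen :: "real^3 \<Rightarrow> real" where
  "F_gen x = Delta_B3 x * (5 * ((x$1)^4 + (x$2)^4 + (x$3)^4)
     - 13 * ((x$1)^2 * (x$2)^2 + (x$2)^2 * (x$3)^2 + (x$3)^2 * (x$1)^2))"

end

theory Submission
  imports Defs "HOL-Computational_Algebra.Polynomial" "HOL-Real_Asymp.Real_Asymp"
begin

text \<open>
  Testing a mean value property against smooth functions and expanding in the radius turns it
  into the vanishing of \<open>f\<close> under the homogeneous operators whose symbols are the moments of the
  skeleton. By symmetry these are generated by the elementary symmetric polynomials
  \<open>e1, e2, e3\<close> in the squares, and the moments of degree 2 and 6 always give \<open>e1\<close> and \<open>e3\<close>. The
  moment of degree 4 gives \<open>e2\<close> unless \<open>\<mu>(4,0,0) = 3 \<mu>(2,2,0)\<close>, which is the polynomial equation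
  for the critical radius; there the moment of degree 8 only gives the square of \<open>e2\<close>. The solution spaces are
  computed by solving the resulting linear recurrences for the values of the distribution on a
  fixed finite set of derivatives.
\<close>

text \<open>A mean value property is assumed of a function that is merely continuous, so no operator
  can be applied to it directly. The shift is therefore moved onto bump functions, and the algebra
  is done for linear functionals on test functions: a functional whose derivatives of some high
  order all vanish is determined by its values on derivatives of one fixed bump.

  The numbers 48 = 2 * 4 * 6 and 96 = 2 * 6 * 8 are the products of the degrees of
  \<open>e1\<close>, \<open>e2\<close>, \<open>e3\<close> and of \<open>e1\<close>,
  \<open>e3\<close>, \<open>e22\<close>. Each triple is a complete intersection, so its kernel is
  generated by a single polynomial, of degree 9 = 1 + 3 + 5 or 13 = 1 + 5 + 7, which has to change
  sign under the reflections of the group. In degree 9 only \<open>Delta_B3\<close> qualifies. In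
  degree 13 the alternating polynomials form a plane with leading exponents (9,3,1) and (7,5,1), and
  the Laplacian leaves one line of it; this is where the coefficients 5 and -13 of
  \<open>F_gen\<close> come from.\<close>

section \<open>Partial derivatives and smooth functions\<close>

lemma partial_eqI:
  assumes "(f has_derivative f') (at x)"
  shows "partial i f x = f' (axis i 1)"
proof -
  have "((\<lambda>t. x + t *\<^sub>R axis i (1::real)) has_derivative (\<lambda>t. t *\<^sub>R axis i 1)) (at 0)"
    by (auto intro!: derivative_eq_intros)
  moreover have "(f has_derivative f') (at (x + 0 *\<^sub>R axis i (1::real)))"
    using assms by simp
  ultimately have "((\<lambda>t. f (x + t *\<^sub>R axis i 1)) has_derivative (\<lambda>t. f' (t *\<^sub>R axis i 1))) (at 0)"
    using has_derivative_compose by blast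
  moreover have "(\<lambda>t. f' (t *\<^sub>R axis i 1)) = (*) (f' (axis i 1))"
    using linear_scale[OF has_derivative_linear[OF assms]] by (auto simp: mult.commute)
  ultimately have "((\<lambda>t. f (x + t *\<^sub>R axis i 1)) has_field_derivative f' (axis i 1)) (at 0)"
    by (simp add: has_field_derivative_def)
  then show ?thesis
    unfolding partial_def by (rule DERIV_imp_deriv)
qed

lemma vec3_axis_sum: "h = (\<Sum>i\<in>UNIV. h $ i *\<^sub>R axis i (1::real))"
  using basis_expansion[of h] by (simp add: scalar_mult_eq_scaleR)

lemma has_derivative_partial:
  assumes "f differentiable (at x)"
  shows "(f has_derivative (\<lambda>h. \<Sum>i\<in>UNIV. h $ i * partial i f x)) (at x)"
proof -
  obtain f' where f': "(f has_derivative f') (at x)"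
    using assms by (auto simp: differentiable_def)
  have "f' h = (\<Sum>i\<in>UNIV. h $ i * partial i f x)" for h
  proof -
    have "f' h = f' (\<Sum>i\<in>UNIV. h $ i *\<^sub>R axis i (1::real))"
      by (simp flip: vec3_axis_sum)
    also have "\<dots> = (\<Sum>i\<in>UNIV. h $ i * partial i f x)"
      using has_derivative_linear[OF f']
      by (simp add: linear_sum linear_scale partial_eqI[OF f'])
    finally show ?thesis .
  qed
  then have "f' = (\<lambda>h. \<Sum>i\<in>UNIV. h $ i * partial i f x)" by auto
  then show ?thesis using f' by simp
qed

lemma DERIV_partial_line:
  assumes "f differentiable (at (x + t *\<^sub>R axis i 1))"
  shows "((\<lambda>t. f (x + t *\<^sub>R axis i 1)) has_field_derivative partial i f (x + t *\<^sub>R axis i 1)) (at t)"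
proof -
  have "((\<lambda>t. x + t *\<^sub>R axis i (1::real)) has_derivative (\<lambda>t. t *\<^sub>R axis i 1)) (at t)"
    by (auto intro!: derivative_eq_intros)
  from has_derivative_compose[OF this has_derivative_partial[OF assms]]
  show ?thesis
    unfolding has_field_derivative_def
    by (rule has_derivative_eq_rhs)
       (auto simp: axis_def if_distrib[of "\<lambda>x. _ * x"] if_distrib[of "\<lambda>x. x * _"] mult.commute cong: if_cong)
qed

lemma smooth_partial: "smooth f \<Longrightarrow> smooth (partial i f)"
  unfolding smooth_def
proof
  fix js assume "\<forall>js. foldr partial js f differentiable_on UNIV"
  then have "foldr partial (js @ [i]) f differentiable_on UNIV" by blast
  then show "foldr partial js (partial i f) differentiable_on UNIV" by simp
qed

lemma smooth_differentiable: "smooth f \<Longrightarrow> f differentiable (at x)"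
  unfolding smooth_def by (drule spec[of _ "[]"]) (simp add: differentiable_on_def)

lemma smooth_continuous_on: "smooth f \<Longrightarrow> continuous_on S f"
  by (meson continuous_at_imp_continuous_on differentiable_imp_continuous_within smooth_differentiable)

lemma smooth_isCont: "smooth f \<Longrightarrow> isCont f x"
  by (simp add: differentiable_imp_continuous_within smooth_differentiable)

text \<open>\<open>smooth\<close> is the largest class of everywhere differentiable functions that
  is stable under \<open>partial\<close>, so smoothness is proved by exhibiting any such
  class.\<close>

lemma smooth_coinduct:
  assumes "P f" and d: "\<And>f x. P f \<Longrightarrow> f differentiable (at x)" and p: "\<And>f i. P f \<Longrightarrow> P (partial i f)"
  shows "smooth f"
proof -
  have "P (foldr partial js f)" for js
    by (induction js) (auto simp: assms)
  then show ?thesis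
    using d by (auto simp: smooth_def differentiable_on_def)
qed

text \<open>The sum and product rules express derivatives inside the algebra generated by
  \<open>B\<close>, so stability under \<open>partial\<close> has to be checked on generators
  only.\<close>

inductive alg_closure :: "(real^3 \<Rightarrow> real) set \<Rightarrow> (real^3 \<Rightarrow> real) \<Rightarrow> bool" for B where
  base: "f \<in> B \<Longrightarrow> alg_closure B f"
| const: "alg_closure B (\<lambda>x. c)"
| add: "alg_closure B f \<Longrightarrow> alg_closure B g \<Longrightarrow> alg_closure B (\<lambda>x. f x + g x)"
| mult: "alg_closure B f \<Longrightarrow> alg_closure B g \<Longrightarrow> alg_closure B (\<lambda>x. f x * g x)"

lemma partial_const: "partial i (\<lambda>x. c) = (\<lambda>x. 0)"
  by (auto intro!: ext partial_eqI[of _ "\<lambda>_. 0", THEN trans])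

lemma partial_add:
  assumes "f differentiable (at x)" "g differentiable (at x)"
  shows "partial i (\<lambda>x. f x + g x) x = partial i f x + partial i g x"
  by (subst partial_eqI[OF has_derivative_add[OF has_derivative_partial[OF assms(1)] has_derivative_partial[OF assms(2)]]])
     (simp add: axis_def if_distrib[of "\<lambda>x. x * _"] cong: if_cong)

lemma partial_mult:
  assumes "f differentiable (at x)" "g differentiable (at x)"
  shows "partial i (\<lambda>x. f x * g x) x = partial i f x * g x + f x * partial i g x"
  by (subst partial_eqI[OF has_derivative_mult[OF has_derivative_partial[OF assms(1)] has_derivative_partial[OF assms(2)]]])
     (simp add: axis_def if_distrib[of "\<lambda>x. x * _"] cong: if_cong)

lemma alg_closure_smooth:
  assumes "alg_closure B f"
    and d: "\<And>f x. f \<in> B \<Longrightarrow> f differentiable (at x)"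
    and p: "\<And>f i. f \<in> B \<Longrightarrow> alg_closure B (partial i f)"
  shows "smooth f"
proof -
  have D: "alg_closure B f \<Longrightarrow> (\<forall>x. f differentiable (at x))" for f
    by (induction rule: alg_closure.induct) (auto simp: d)
  have "alg_closure B f \<Longrightarrow> alg_closure B (partial i f)" for f i
  proof (induction rule: alg_closure.induct)
    case (base f) then show ?case by (rule p)
  next
    case (const c) then show ?case by (simp add: partial_const alg_closure.const)
  next
    case (add f g)
    have "partial i (\<lambda>x. f x + g x) = (\<lambda>x. partial i f x + partial i g x)"
      using D add by (auto simp: partial_add)
    then show ?case using add by (auto intro: alg_closure.add)
  next
    case (mult f g)
    have "partial i (\<lambda>x. f x * g x) = (\<lambda>x. partial i f x * g x + f x * partial i g x)"
      using D mult by (auto simp: partial_mult)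
    then show ?case using mult by (auto intro!: alg_closure.add alg_closure.mult)
  qed
  with D show ?thesis
    by (intro smooth_coinduct[of "alg_closure B"]) (auto simp: assms(1))
qed

lemma alg_closure_smooth_id: "alg_closure {f. smooth f} f \<Longrightarrow> smooth f"
  by (rule alg_closure_smooth) (auto simp: smooth_differentiable smooth_partial alg_closure.base)

lemma smooth_const: "smooth (\<lambda>x. c)"
  by (rule alg_closure_smooth_id) (rule alg_closure.const)

lemma smooth_add: "smooth f \<Longrightarrow> smooth g \<Longrightarrow> smooth (\<lambda>x. f x + g x)"
  by (rule alg_closure_smooth_id) (auto intro: alg_closure.intros)

lemma smooth_mult: "smooth f \<Longrightarrow> smooth g \<Longrightarrow> smooth (\<lambda>x. f x * g x)"
  by (rule alg_closure_smooth_id) (auto intro: alg_closure.intros)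

lemma smooth_sum: "(\<And>i. i \<in> A \<Longrightarrow> smooth (f i)) \<Longrightarrow> smooth (\<lambda>x. \<Sum>i\<in>A. f i x)"
  by (induction A rule: infinite_finite_induct) (auto intro: smooth_add smooth_const)

lemma smooth_coord: "smooth (\<lambda>x. x $ i)"
proof -
  have p: "partial j (\<lambda>x. x $ i) = (\<lambda>x. axis j 1 $ i)" for j
    by (rule ext, rule partial_eqI) (intro bounded_linear_imp_has_derivative bounded_linear_vec_nth)
  have "alg_closure {\<lambda>x. x $ i} (\<lambda>x. x $ i)" by (simp add: alg_closure.base)
  then show ?thesis
    by (rule alg_closure_smooth) (auto simp: p alg_closure.const linear_imp_differentiable bounded_linear_vec_nth bounded_linear.linear)
qed

lemma smooth_diff: "smooth f \<Longrightarrow> smooth g \<Longrightarrow> smooth (\<lambda>x. f x - g x)"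
  using smooth_add[OF _ smooth_mult[OF smooth_const[of "-1"]], of f g] by simp

lemma partial_cmult: "f differentiable (at x) \<Longrightarrow> partial i (\<lambda>x. c * f x) x = c * partial i f x"
  using partial_mult[of "\<lambda>_. c" x f i] by (simp add: partial_const)

lemma partial_sum:
  assumes "\<And>k. k \<in> A \<Longrightarrow> f k differentiable (at x)"
  shows "partial i (\<lambda>x. \<Sum>k\<in>A. f k x) x = (\<Sum>k\<in>A. partial i (f k) x)"
  using assms
proof (induction A rule: infinite_finite_induct)
  case (insert a A)
  then show ?case by (simp add: partial_add)
qed (auto simp: partial_const)

text \<open>An increment of \<open>f\<close> in direction \<open>i\<close> is an integral of
  \<open>partial i f\<close>. It is differentiated in direction \<open>j\<close> under the integral
  sign, and then the length of the increment is sent to 0.\<close>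

lemma partial_commute:
  assumes "smooth f"
  shows "partial i (partial j f) = partial j (partial i f)"
proof
  fix x
  let ?i = "axis i (1::real)" and ?j = "axis j (1::real)"
  note sm = smooth_partial[OF assms]
  have v: "partial j f (x + s *\<^sub>R ?i) - partial j f x
      = integral {0..s} (\<lambda>\<sigma>. partial j (partial i f) (x + \<sigma> *\<^sub>R ?i))" if "s \<in> {0..1}" for s
  proof -
    have ftc: "f (x + t *\<^sub>R ?j + s *\<^sub>R ?i) - f (x + t *\<^sub>R ?j)
        = integral {0..s} (\<lambda>\<sigma>. partial i f (x + t *\<^sub>R ?j + \<sigma> *\<^sub>R ?i))" for t
    proof (rule integral_unique[symmetric])
      have "((\<lambda>\<sigma>. partial i f (x + t *\<^sub>R ?j + \<sigma> *\<^sub>R ?i)) has_integral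
          f (x + t *\<^sub>R ?j + s *\<^sub>R ?i) - f (x + t *\<^sub>R ?j + 0 *\<^sub>R ?i)) {0..s}"
        using that
        by (intro fundamental_theorem_of_calculus)
           (auto simp flip: has_real_derivative_iff_has_vector_derivative
             intro!: has_field_derivative_at_within DERIV_partial_line smooth_differentiable assms)
      then show "((\<lambda>\<sigma>. partial i f (x + t *\<^sub>R ?j + \<sigma> *\<^sub>R ?i)) has_integral
          f (x + t *\<^sub>R ?j + s *\<^sub>R ?i) - f (x + t *\<^sub>R ?j)) {0..s}" by simp
    qed
    have "((\<lambda>t. integral (cbox 0 s) (\<lambda>\<sigma>. partial i f (x + \<sigma> *\<^sub>R ?i + t *\<^sub>R ?j))) has_field_derivative
        integral (cbox 0 s) (\<lambda>\<sigma>. partial j (partial i f) (x + \<sigma> *\<^sub>R ?i + 0 *\<^sub>R ?j))) (at 0 within UNIV)"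
    proof (rule leibniz_rule_field_derivative)
      fix t \<sigma> :: real
      show "((\<lambda>t. partial i f (x + \<sigma> *\<^sub>R ?i + t *\<^sub>R ?j)) has_field_derivative
          partial j (partial i f) (x + \<sigma> *\<^sub>R ?i + t *\<^sub>R ?j)) (at t within UNIV)"
        by (intro DERIV_partial_line smooth_differentiable sm)
    next
      fix t :: real
      show "(\<lambda>\<sigma>. partial i f (x + \<sigma> *\<^sub>R ?i + t *\<^sub>R ?j)) integrable_on cbox 0 s"
        by (intro integrable_continuous continuous_on_compose2[OF smooth_continuous_on[OF sm, of UNIV]]
            continuous_intros) auto
    next
      show "continuous_on (UNIV \<times> cbox 0 s) (\<lambda>(t, \<sigma>). partial j (partial i f) (x + \<sigma> *\<^sub>R ?i + t *\<^sub>R ?j))"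
        unfolding split_def
        by (intro continuous_on_compose2[OF smooth_continuous_on[OF smooth_partial[OF sm], of UNIV]]
            continuous_intros) auto
    qed auto
    moreover have "((\<lambda>t. f (x + s *\<^sub>R ?i + t *\<^sub>R ?j) - f (x + t *\<^sub>R ?j)) has_field_derivative
        partial j f (x + s *\<^sub>R ?i + 0 *\<^sub>R ?j) - partial j f (x + 0 *\<^sub>R ?j)) (at 0)"
      by (intro DERIV_diff DERIV_partial_line smooth_differentiable assms)
    moreover have "(\<lambda>t. f (x + s *\<^sub>R ?i + t *\<^sub>R ?j) - f (x + t *\<^sub>R ?j))
        = (\<lambda>t. integral (cbox 0 s) (\<lambda>\<sigma>. partial i f (x + \<sigma> *\<^sub>R ?i + t *\<^sub>R ?j)))"
      using ftc by (simp add: add_ac)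
    ultimately show ?thesis
      using DERIV_unique by fastforce
  qed
  have c: "continuous_on {0..1} (\<lambda>\<sigma>. partial j (partial i f) (x + \<sigma> *\<^sub>R ?i))"
    by (intro continuous_on_compose2[OF smooth_continuous_on[OF smooth_partial[OF sm], of UNIV]]
            continuous_intros) auto
  have "((\<lambda>s. integral {0..s} (\<lambda>\<sigma>. partial j (partial i f) (x + \<sigma> *\<^sub>R ?i))) has_real_derivative
      partial j (partial i f) (x + 0 *\<^sub>R ?i)) (at 0 within {0..1})"
    by (rule integral_has_real_derivative[OF c]) auto
  then have "((\<lambda>s. partial j f (x + s *\<^sub>R ?i) - partial j f x) has_real_derivative
      partial j (partial i f) (x + 0 *\<^sub>R ?i)) (at 0 within {0..1})"
    by (rule has_field_derivative_transform_within[of _ _ _ _ 1]) (auto simp: v)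
  from DERIV_add[OF this DERIV_const[of "partial j f x"]]
  have 1: "((\<lambda>s. partial j f (x + s *\<^sub>R ?i)) has_real_derivative
      partial j (partial i f) x) (at 0 within {0..1})"
    by simp
  have 2: "((\<lambda>s. partial j f (x + s *\<^sub>R ?i)) has_real_derivative
      partial i (partial j f) (x + 0 *\<^sub>R ?i)) (at 0 within {0..1})"
    by (rule has_field_derivative_at_within[OF DERIV_partial_line[OF smooth_differentiable[OF sm]]])
  \<comment> \<open>The integral was differentiated on \<open>{0..1}\<close> only. A one-sided
    derivative is still unique because 0 is a limit point of this interval.\<close>
  have "at (0::real) within {0..1} \<noteq> bot"
    by (simp add: trivial_limit_within)
  with has_field_derivative_unique[OF 1 2]
  show "partial i (partial j f) x = partial j (partial i f) x"
    by simp
qed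

text \<open>Three separate exponents instead of an exponent vector turn recurrences in the order of
  differentiation into plain arithmetic.\<close>

definition D3 :: "nat \<Rightarrow> nat \<Rightarrow> nat \<Rightarrow> (real^3 \<Rightarrow> real) \<Rightarrow> real^3 \<Rightarrow> real" where
  "D3 a b c f = (partial 1 ^^ a) ((partial 2 ^^ b) ((partial 3 ^^ c) f))"

lemma mpartial_D3: "mpartial \<alpha> f = D3 (\<alpha>$1) (\<alpha>$2) (\<alpha>$3) f"
  by (simp add: mpartial_def D3_def)

lemma smooth_funpow: "smooth f \<Longrightarrow> smooth ((partial i ^^ n) f)"
  by (induction n) (auto simp: smooth_partial)

lemma smooth_D3: "smooth f \<Longrightarrow> smooth (D3 a b c f)"
  by (simp add: D3_def smooth_funpow)

lemma partial_funpow_commute: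
  assumes "smooth f"
  shows "partial i ((partial j ^^ n) f) = (partial j ^^ n) (partial i f)"
proof (induction n)
  case (Suc n)
  then show ?case
    using partial_commute[OF smooth_funpow[OF assms, where i = j and n = n], of i j] by simp
qed simp

lemma partial_D3:
  assumes "smooth f"
  shows "partial 1 (D3 a b c f) = D3 (Suc a) b c f"
    "partial 2 (D3 a b c f) = D3 a (Suc b) c f"
    "partial 3 (D3 a b c f) = D3 a b (Suc c) f"
  using assms by (auto simp: D3_def partial_funpow_commute smooth_funpow smooth_partial)

lemma D3_0 [simp]: "D3 0 0 0 f = f" by (simp add: D3_def)

lemma D3_D3:
  assumes "smooth f"
  shows "D3 a b c (D3 a' b' c' f) = D3 (a + a') (b + b') (c + c') f"
proof -
  have 3: "(partial 3 ^^ n) (D3 a b c f) = D3 a b (n + c) f" for n a b c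
    by (induction n) (auto simp: partial_D3 assms)
  have 2: "(partial 2 ^^ n) (D3 a b c f) = D3 a (n + b) c f" for n a b c
    by (induction n) (auto simp: partial_D3 assms)
  have 1: "(partial 1 ^^ n) (D3 a b c f) = D3 (n + a) b c f" for n a b c
    by (induction n) (auto simp: partial_D3 assms)
  show ?thesis
    by (subst D3_def) (simp add: 1 2 3)
qed

lemma D3_induct:
  assumes "P f" "\<And>f i. P f \<Longrightarrow> P (partial i f)"
  shows "P (D3 a b c f)"
proof -
  have *: "P g \<Longrightarrow> P ((partial i ^^ n) g)" for g i n
    by (induction n) (auto simp: assms)
  show ?thesis by (simp add: D3_def * assms)
qed

lemma smooth_partial_add: "smooth f \<Longrightarrow> smooth g \<Longrightarrow> partial i (\<lambda>x. f x + g x) = (\<lambda>x. partial i f x + partial i g x)"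
  by (auto simp: partial_add smooth_differentiable)

lemma smooth_partial_cmult: "smooth f \<Longrightarrow> partial i (\<lambda>x. c * f x) = (\<lambda>x. c * partial i f x)"
  by (auto simp: partial_cmult smooth_differentiable)

section \<open>Bump functions and test functions\<close>

text \<open>\<open>flat 1\<close> is the classical exp(-1/t). The polynomial in u = 1/t makes the
  family stable under differentiation: the derivative of p(u) exp(-u) with respect to t is u^2 (p -
  p')(u) exp(-u).\<close>

definition flat :: "real poly \<Rightarrow> real \<Rightarrow> real" where
  "flat p t = (if t > 0 then poly p (1 / t) * exp (- 1 / t) else 0)"

text \<open>The free power \<open>k\<close> absorbs the factor u that appears when a coefficient is
  split off \<open>p\<close>.\<close>

lemma poly_exp_decay: "((\<lambda>u. u ^ k * poly p u * exp (- u)) \<longlongrightarrow> (0::real)) at_top"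
proof (induction p arbitrary: k)
  case (pCons a p)
  have "((\<lambda>u. a * (u ^ k / exp u) + u ^ Suc k * poly p u * exp (- u)) \<longlongrightarrow> a * 0 + 0) at_top"
    by (intro tendsto_intros tendsto_power_div_exp_0 pCons.IH)
  then show ?case
    by (simp add: algebra_simps exp_minus divide_inverse)
qed simp

lemma flat_has_derivative:
  "(flat p has_field_derivative flat ([:0, 0, 1:] * (p - pderiv p)) t) (at t)"
proof -
  let ?q = "[:0, 0, 1:] * (p - pderiv p)"
  consider "t > 0" | "t < 0" | "t = 0" by linarith
  then show ?thesis
  proof cases
    case 1
    have "((\<lambda>t. poly p (1 / t) * exp (- 1 / t)) has_field_derivative flat ?q t) (at t)"
      using 1 unfolding flat_def
      by (auto intro!: derivative_eq_intros DERIV_chain'[of "\<lambda>t. 1 / t" _ _ _ "poly p"] poly_DERIV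
          simp: field_simps power2_eq_square)
    then show ?thesis
      by (rule has_field_derivative_transform_within_open[of _ _ _ "{0<..}"]) (use 1 in \<open>auto simp: flat_def\<close>)
  next
    case 2
    have "((\<lambda>t. 0) has_field_derivative flat ?q t) (at t)"
      using 2 by (simp add: flat_def)
    then show ?thesis
      by (rule has_field_derivative_transform_within_open[of _ _ _ "{..<0}"]) (use 2 in \<open>auto simp: flat_def\<close>)
  next
    case 3
    have "((\<lambda>h. flat p h / h) \<longlongrightarrow> 0) (at 0)"
    proof (rule filterlim_split_at)
      have "\<forall>\<^sub>F h in at_left 0. flat p h / h = 0"
        by (rule eventually_at_leftI[of "-1"]) (auto simp: flat_def)
      then show "((\<lambda>h. flat p h / h) \<longlongrightarrow> 0) (at_left 0)"
        by (simp add: tendsto_eventually)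
      \<comment> \<open>With u = 1/h, flatness at 0 from the right becomes exponential decay at
        infinity.\<close>
      have "((\<lambda>u. u ^ 1 * poly p u * exp (- u)) \<longlongrightarrow> 0) at_top"
        by (rule poly_exp_decay)
      moreover have "\<forall>\<^sub>F u in at_top. u ^ 1 * poly p u * exp (- u) = flat p (inverse u) / inverse u"
        using eventually_gt_at_top[of 0] by eventually_elim (simp add: flat_def divide_inverse)
      ultimately have "((\<lambda>u. flat p (inverse u) / inverse u) \<longlongrightarrow> 0) at_top"
        by (rule Lim_transform_eventually)
      then show "((\<lambda>h. flat p h / h) \<longlongrightarrow> 0) (at_right 0)"
        by (simp add: filterlim_at_right_to_top)
    qed
    then show ?thesis
      using 3 by (simp add: has_field_derivative_iff flat_def)
  qed
qed

lemma smooth_flat: "smooth (\<lambda>x. flat p (s * x $ i + c))"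
proof -
  define B where "B = {f. \<exists>p. f = (\<lambda>x::real^3. flat p (s * x $ i + c))}"
  have d: "((\<lambda>x::real^3. flat p (s * x $ i + c)) has_derivative
      (\<lambda>h. flat ([:0, 0, 1:] * (p - pderiv p)) (s * x $ i + c) * (s * h $ i))) (at x)" for p x
    using flat_has_derivative[of p "s * x $ i + c"] unfolding has_field_derivative_def
    by (rule has_derivative_compose[rotated])
       (auto intro!: derivative_eq_intros bounded_linear_imp_has_derivative bounded_linear_vec_nth)
  have "alg_closure B (\<lambda>x. flat p (s * x $ i + c))"
    by (auto simp: B_def intro: alg_closure.base)
  then show ?thesis
  proof (rule alg_closure_smooth)
    show "f differentiable at x" if "f \<in> B" for f x
      using that d by (auto simp: B_def differentiable_def)
    show "alg_closure B (partial j f)" if "f \<in> B" for f j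
    proof -
      obtain p where f: "f = (\<lambda>x. flat p (s * x $ i + c))" using \<open>f \<in> B\<close> unfolding B_def by blast
      have "partial j f = (\<lambda>x. flat ([:0, 0, 1:] * (p - pderiv p)) (s * x $ i + c) * (s * axis j 1 $ i))"
        unfolding f by (rule ext, rule partial_eqI, rule d)
      moreover have "alg_closure B (\<lambda>x. flat ([:0, 0, 1:] * (p - pderiv p)) (s * x $ i + c) * (s * axis j 1 $ i))"
        by (rule alg_closure.mult[OF alg_closure.base alg_closure.const]) (unfold B_def, blast)
      ultimately show ?thesis by simp
    qed
  qed
qed

lemma flat_1_pos: "flat 1 t > 0 \<longleftrightarrow> t > 0" "flat 1 t \<ge> 0" "flat 1 t = 0 \<longleftrightarrow> t \<le> 0"
  by (auto simp: flat_def)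

lemma continuous_on_flat: "continuous_on S (flat p)"
  by (rule DERIV_continuous_on[OF has_field_derivative_at_within[OF flat_has_derivative]])

definition box_bump :: "real^3 \<Rightarrow> real^3 \<Rightarrow> real^3 \<Rightarrow> real" where
  "box_bump l u x = (\<Prod>i\<in>UNIV. flat 1 (x $ i - l $ i) * flat 1 (u $ i - x $ i))"

text \<open>Compact support is recorded by one radius for all coordinates: \<psi> is 0 on the
  boundary of a cube and outside it. Integration along coordinate lines works well with this
  form.\<close>

definition vanish :: "real \<Rightarrow> (real^3 \<Rightarrow> real) \<Rightarrow> bool" where
  "vanish R \<psi> \<longleftrightarrow> (\<forall>x i. \<bar>x $ i\<bar> \<ge> R \<longrightarrow> \<psi> x = 0)"

lemma smooth_prod: "(\<And>i. i \<in> A \<Longrightarrow> smooth (f i)) \<Longrightarrow> smooth (\<lambda>x. \<Prod>i\<in>A. f i x)"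
  by (induction A rule: infinite_finite_induct) (auto intro: smooth_mult smooth_const)

lemma smooth_box_bump: "smooth (box_bump l u)"
  unfolding box_bump_def
  using smooth_flat[of 1 1 _ "- l $ _"] smooth_flat[of 1 "-1" _ "u $ _"]
  by (auto intro!: smooth_prod smooth_mult)

lemma box_bump_pos: "box_bump l u x > 0 \<longleftrightarrow> (\<forall>i. l $ i < x $ i \<and> x $ i < u $ i)"
  and box_bump_nonneg: "box_bump l u x \<ge> 0"
proof -
  show nn: "box_bump l u x \<ge> 0" unfolding box_bump_def by (intro prod_nonneg) (simp add: flat_1_pos)
  have "box_bump l u x = 0 \<longleftrightarrow> (\<exists>i. \<not> (l $ i < x $ i \<and> x $ i < u $ i))"
    unfolding box_bump_def by (auto simp: flat_1_pos not_less)
  then show "box_bump l u x > 0 \<longleftrightarrow> (\<forall>i. l $ i < x $ i \<and> x $ i < u $ i)"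
    using nn unfolding less_le by (metis less_le)
qed

lemma bounded_of_coords:
  assumes "\<And>x i. x \<in> S \<Longrightarrow> \<bar>x $ i\<bar> \<le> R"
  shows "bounded (S :: (real^3) set)"
proof (rule boundedI[of _ "3 * R"])
  fix x assume "x \<in> S"
  have "norm x \<le> (\<Sum>i\<in>UNIV. \<bar>x $ i\<bar>)" by (rule norm_le_l1_cart)
  also have "\<dots> \<le> 3 * R"
    using assms[OF \<open>x \<in> S\<close>, of 1] assms[OF \<open>x \<in> S\<close>, of 2] assms[OF \<open>x \<in> S\<close>, of 3] by (simp add: sum_3)
  finally show "norm x \<le> 3 * R" .
qed

lemma test_functionI:
  assumes "smooth \<psi>" "vanish R \<psi>" shows "test_function \<psi>"
proof -
  have "bounded {x. \<psi> x \<noteq> 0}"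
  proof (rule bounded_of_coords[of _ R])
    fix x i assume "x \<in> {x. \<psi> x \<noteq> 0}"
    then show "\<bar>x $ i\<bar> \<le> R" using assms(2) unfolding vanish_def
      by (metis linear mem_Collect_eq)
  qed
  then show ?thesis using assms by (simp add: test_function_def support_def)
qed

lemma test_function_vanish:
  assumes "test_function \<psi>" obtains R where "R \<ge> 1" "vanish R \<psi>"
proof -
  have "bounded (closure {x. \<psi> x \<noteq> 0})"
    using assms by (auto simp: support_def test_function_def compact_imp_bounded)
  then have "bounded {x. \<psi> x \<noteq> 0}"
    by (rule bounded_subset[OF _ closure_subset])
  then obtain b where b: "\<And>x. \<psi> x \<noteq> 0 \<Longrightarrow> norm x \<le> b" by (auto simp: bounded_iff)
  have "vanish (\<bar>b\<bar> + 1) \<psi>"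
    unfolding vanish_def
  proof (intro allI impI)
    fix x :: "real^3" and i assume "\<bar>b\<bar> + 1 \<le> \<bar>x $ i\<bar>"
    with component_le_norm_cart[of x i] have "norm x > b" by linarith
    with b show "\<psi> x = 0" by force
  qed
  then show thesis using that[of "\<bar>b\<bar> + 1"] by simp
qed

lemma test_function_smooth: "test_function \<psi> \<Longrightarrow> smooth \<psi>"
  by (simp add: test_function_def)

lemma vanish_mono: "vanish R \<psi> \<Longrightarrow> R \<le> R' \<Longrightarrow> vanish R' \<psi>"
  unfolding vanish_def by (meson order_trans)

text \<open>At distance exactly \<open>R\<close> a function may vanish without being zero nearby.
  Moving out by one unit provides a whole ball of zeros, hence a zero derivative.\<close>

lemma vanish_partial:
  assumes "vanish R \<psi>" shows "vanish (R + 1) (partial i \<psi>)"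
  unfolding vanish_def
proof (intro allI impI)
  fix x :: "real^3" and j assume x: "R + 1 \<le> \<bar>x $ j\<bar>"
  have "(\<psi> has_derivative (\<lambda>h. 0)) (at x)"
  proof (rule has_derivative_transform_within[of "\<lambda>_. 0" _ _ _ 1])
    fix y assume "dist y x < 1"
    then have "\<bar>y $ j - x $ j\<bar> < 1"
      by (metis (no_types) component_le_norm_cart dist_norm le_less_trans vector_minus_component)
    with x have "R \<le> \<bar>y $ j\<bar>" by linarith
    with assms show "0 = \<psi> y" unfolding vanish_def by metis
  qed auto
  from partial_eqI[OF this] show "partial i \<psi> x = 0" .
qed

lemma test_function_partial: "test_function \<psi> \<Longrightarrow> test_function (partial i \<psi>)"
  by (metis test_functionI test_function_smooth test_function_vanish smooth_partial vanish_partial)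

lemma test_function_D3: "test_function \<psi> \<Longrightarrow> test_function (D3 a b c \<psi>)"
  by (rule D3_induct) (auto simp: test_function_partial)

lemma test_function_add:
  assumes "test_function f" "test_function g" shows "test_function (\<lambda>x. f x + g x)"
proof -
  obtain R S where "vanish R f" "vanish S g"
    using assms by (metis test_function_vanish)
  then have "vanish (max R S) (\<lambda>x. f x + g x)" using vanish_mono[of R f "max R S"] vanish_mono[of S g "max R S"]
    unfolding vanish_def by (metis add_0 max.cobounded1 max.cobounded2)
  with assms show ?thesis by (blast intro: test_functionI smooth_add test_function_smooth)
qed

lemma test_function_mult:
  assumes "smooth f" "test_function g" shows "test_function (\<lambda>x. f x * g x)"
proof -
  obtain R where "vanish R g" using assms by (metis test_function_vanish)
  then have "vanish R (\<lambda>x. f x * g x)" by (auto simp: vanish_def)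
  with assms show ?thesis by (blast intro: test_functionI smooth_mult test_function_smooth)
qed

lemma test_function_cmult: "test_function g \<Longrightarrow> test_function (\<lambda>x. c * g x)"
  by (rule test_function_mult[OF smooth_const])

lemma test_function_box_bump: "test_function (box_bump l u)"
proof -
  have "vanish (norm l + norm u) (box_bump l u)"
    unfolding vanish_def
  proof (intro allI impI)
    fix x :: "real^3" and i assume "norm l + norm u \<le> \<bar>x $ i\<bar>"
    with component_le_norm_cart[of l i] component_le_norm_cart[of u i] norm_ge_zero[of l] norm_ge_zero[of u]
    have "\<not> (l $ i < x $ i \<and> x $ i < u $ i)" by linarith
    then have "\<not> 0 < box_bump l u x" unfolding box_bump_pos by blast
    then show "box_bump l u x = 0" using box_bump_nonneg[of l u x] by linarith
  qed
  then show ?thesis by (rule test_functionI[OF smooth_box_bump])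
qed

section \<open>Splitting a test function into derivatives and a multiple of a fixed bump\<close>

definition setc :: "real^3 \<Rightarrow> 3 \<Rightarrow> real \<Rightarrow> real^3" where
  "setc x i s = x + (s - x $ i) *\<^sub>R axis i 1"

lemma setc_nth: "setc x i s $ j = (if j = i then s else x $ j)"
  by (auto simp: setc_def axis_def)

lemma setc_setc [simp]: "setc (setc x i s) i t = setc x i t"
  by (simp add: vec_eq_iff setc_nth)

lemma setc_commute: "i \<noteq> j \<Longrightarrow> setc (setc x i s) j t = setc (setc x j t) i s"
  by (simp add: vec_eq_iff setc_nth)

lemma setc_same [simp]: "setc x i (x $ i) = x"
  by (simp add: vec_eq_iff setc_nth)

text \<open>A variable endpoint is moved into the affine argument
  \<open>l \<theta> + m \<theta> * x $ i\<close>, so that the domain of integration stays fixed. A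
  derivative along \<open>i\<close> then only multiplies the weight \<open>w\<close> by
  \<open>m\<close>, which keeps the family stable under \<open>partial\<close>.\<close>

definition pint :: "(real \<Rightarrow> real) \<Rightarrow> (real \<Rightarrow> real) \<Rightarrow> (real \<Rightarrow> real) \<Rightarrow> 3 \<Rightarrow> (real^3 \<Rightarrow> real) \<Rightarrow> real^3 \<Rightarrow> real" where
  "pint w l m i g x = integral {0..1} (\<lambda>\<theta>. w \<theta> * g (setc x i (l \<theta> + m \<theta> * x $ i)))"

lemma pint_has_derivative:
  assumes w: "continuous_on UNIV w" and l: "continuous_on UNIV l" and m: "continuous_on UNIV m"
    and g: "smooth g"
  shows "(pint w l m i g has_derivative
    (\<lambda>h. \<Sum>j\<in>UNIV. h $ j * pint (\<lambda>\<theta>. if j = i then w \<theta> * m \<theta> else w \<theta>) l m i (partial j g) x)) (at x)"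
proof -
  let ?y = "\<lambda>x \<theta>. setc x i (l \<theta> + m \<theta> * x $ i)"
  let ?c = "\<lambda>j x \<theta>. (if j = i then w \<theta> * m \<theta> else w \<theta>) * partial j g (?y x \<theta>)"
  \<comment> \<open>\<open>leibniz_rule\<close> asks for the total derivative as a continuous family
    of bounded linear maps; it is assembled here from coordinate functionals.\<close>
  define fx where "fx x \<theta> = (\<Sum>j\<in>UNIV. ?c j x \<theta> *\<^sub>R blinfun_inner_left (axis j (1::real)))" for x \<theta>
  have fx: "blinfun_apply (fx x \<theta>) h = (\<Sum>j\<in>UNIV. h $ j * ?c j x \<theta>)" for x \<theta> h
    by (simp add: fx_def blinfun.sum_left blinfun.scaleR_left inner_axis mult.commute)
  have wc: "continuous_on S (\<lambda>p. w (f p))" "continuous_on S (\<lambda>p. l (f p))" "continuous_on S (\<lambda>p. m (f p))"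
    if "continuous_on S f" for S :: "'z::topological_space set" and f
    using that w l m by (auto intro: continuous_on_compose2)
  have cy: "continuous_on S (\<lambda>p. ?y (a p) (b p))" if "continuous_on S a" "continuous_on S b"
    for S :: "'z::topological_space set" and a b
    unfolding setc_def using that by (intro continuous_intros wc)
  have cg: "continuous_on S (\<lambda>p. g' (?y (a p) (b p)))" if "continuous_on S a" "continuous_on S b" "smooth g'"
    for S :: "'z::topological_space set" and a b g'
    using continuous_on_compose2[OF smooth_continuous_on[OF that(3), of UNIV] cy[OF that(1,2)]] by auto
  have cc: "continuous_on S (\<lambda>p. ?c j (a p) (b p))" if "continuous_on S a" "continuous_on S b"
    for S :: "'z::topological_space set" and a b j
    using that by (cases "j = i") (auto intro!: continuous_intros wc cg smooth_partial g)
  have "((\<lambda>x. integral (cbox 0 1) (\<lambda>\<theta>. w \<theta> * g (?y x \<theta>))) has_derivative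
      blinfun_apply (integral (cbox 0 1) (fx x))) (at x within UNIV)"
  proof (rule leibniz_rule)
    fix x \<theta>
    have "((\<lambda>x. ?y x \<theta>) has_derivative (\<lambda>h. h + (m \<theta> * h $ i - h $ i) *\<^sub>R axis i 1)) (at x)"
      unfolding setc_def by (auto intro!: derivative_eq_intros bounded_linear_imp_has_derivative bounded_linear_vec_nth)
    from has_derivative_compose[OF this has_derivative_partial[OF smooth_differentiable[OF g]]]
    have "((\<lambda>x. w \<theta> * g (?y x \<theta>)) has_derivative
       (\<lambda>h. w \<theta> * (\<Sum>j\<in>UNIV. (h + (m \<theta> * h $ i - h $ i) *\<^sub>R axis i 1) $ j * partial j g (?y x \<theta>)))) (at x)"
      by (rule has_derivative_mult_right)
    also have "(\<lambda>h. w \<theta> * (\<Sum>j\<in>UNIV. (h + (m \<theta> * h $ i - h $ i) *\<^sub>R axis i 1) $ j * partial j g (?y x \<theta>)))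
        = blinfun_apply (fx x \<theta>)"
      unfolding fx by (auto simp: fun_eq_iff sum_distrib_left axis_def algebra_simps intro!: sum.cong)
    finally show "((\<lambda>x. w \<theta> * g (?y x \<theta>)) has_derivative blinfun_apply (fx x \<theta>)) (at x within UNIV)"
      by simp
  next
    fix x show "(\<lambda>\<theta>. w \<theta> * g (?y x \<theta>)) integrable_on cbox 0 1"
      by (intro integrable_continuous continuous_intros wc cg g)
  next
    show "continuous_on (UNIV \<times> cbox 0 1) (\<lambda>(x, \<theta>). fx x \<theta>)"
      unfolding fx_def split_def by (intro continuous_on_sum continuous_on_scaleR cc continuous_intros)
  qed auto
  moreover have "blinfun_apply (integral (cbox 0 1) (fx x)) h =
      (\<Sum>j\<in>UNIV. h $ j * pint (\<lambda>\<theta>. if j = i then w \<theta> * m \<theta> else w \<theta>) l m i (partial j g) x)" for h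
  proof -
    have "fx x integrable_on cbox 0 1"
      unfolding fx_def by (intro integrable_continuous continuous_on_sum continuous_on_scaleR cc continuous_intros)
    then have "blinfun_apply (integral (cbox 0 1) (fx x)) h = integral (cbox 0 1) (\<lambda>\<theta>. \<Sum>j\<in>UNIV. h $ j * ?c j x \<theta>)"
      by (simp add: blinfun_apply_integral fx)
    also have "\<dots> = (\<Sum>j\<in>UNIV. integral (cbox 0 1) (\<lambda>\<theta>. h $ j * ?c j x \<theta>))"
      by (intro integral_sum integrable_continuous continuous_intros cc) auto
    finally show ?thesis by (simp add: pint_def cbox_interval)
  qed
  ultimately have "((\<lambda>x. integral (cbox 0 1) (\<lambda>\<theta>. w \<theta> * g (?y x \<theta>))) has_derivative
      (\<lambda>h. \<Sum>j\<in>UNIV. h $ j * pint (\<lambda>\<theta>. if j = i then w \<theta> * m \<theta> else w \<theta>) l m i (partial j g) x)) (at x)"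
    by (elim has_derivative_eq_rhs) auto
  then show ?thesis
    by (simp add: pint_def[abs_def] cbox_interval)
qed

lemma smooth_pint:
  assumes "continuous_on UNIV w" "continuous_on UNIV l" "continuous_on UNIV m" "smooth g"
  shows "smooth (pint w l m i g)"
proof (rule smooth_coinduct[of "\<lambda>f. \<exists>w g. continuous_on UNIV w \<and> smooth g \<and> f = pint w l m i g"])
  show "\<exists>w' g'. continuous_on UNIV w' \<and> smooth g' \<and> pint w l m i g = pint w' l m i g'" using assms by blast
next
  fix f x assume "\<exists>w g. continuous_on UNIV w \<and> smooth g \<and> f = pint w l m i g"
  then show "f differentiable at x"
    using pint_has_derivative[OF _ assms(2,3)] unfolding differentiable_def by blast
next
  fix f j assume "\<exists>w g. continuous_on UNIV w \<and> smooth g \<and> f = pint w l m i g"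
  then obtain w g where wg: "continuous_on UNIV w" "smooth g" and f: "f = pint w l m i g" by blast
  let ?w = "\<lambda>\<theta>. if j = i then w \<theta> * m \<theta> else w \<theta>"
  have "partial j f = pint ?w l m i (partial j g)"
    unfolding f
    by (rule ext, subst partial_eqI[OF pint_has_derivative[OF wg(1) assms(2,3) wg(2)]])
       (simp add: axis_def if_distrib[of "\<lambda>x. x * _"] cong: if_cong)
  moreover have "continuous_on UNIV ?w"
    using wg assms by (cases "j = i") (auto intro: continuous_intros)
  ultimately show "\<exists>w g. continuous_on UNIV w \<and> smooth g \<and> partial j f = pint w l m i g"
    using smooth_partial[OF wg(2)] by blast
qed


text \<open>The integral of \<psi> along coordinate \<open>i\<close> from \<open>- R\<close> to
  \<open>x $ i\<close>, after an affine substitution.\<close>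

definition slab :: "real \<Rightarrow> 3 \<Rightarrow> (real^3 \<Rightarrow> real) \<Rightarrow> real^3 \<Rightarrow> real" where
  "slab R i \<psi> x = (x $ i + R) * pint (\<lambda>_. 1) (\<lambda>\<theta>. (\<theta> - 1) * R) (\<lambda>\<theta>. \<theta>) i \<psi> x"

text \<open>The full integral of \<psi> over \<open>{- R..R}\<close> along coordinate
  \<open>i\<close>, likewise rescaled to the unit interval.\<close>

definition fiber :: "real \<Rightarrow> 3 \<Rightarrow> (real^3 \<Rightarrow> real) \<Rightarrow> real^3 \<Rightarrow> real" where
  "fiber R i \<psi> x = 2 * R * pint (\<lambda>_. 1) (\<lambda>\<theta>. 2 * R * \<theta> - R) (\<lambda>_. 0) i \<psi> x"

lemma smooth_slab: "smooth \<psi> \<Longrightarrow> smooth (slab R i \<psi>)"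
  unfolding slab_def
  by (intro smooth_mult smooth_add smooth_coord smooth_const smooth_pint continuous_intros)

lemma smooth_fiber: "smooth \<psi> \<Longrightarrow> smooth (fiber R i \<psi>)"
  unfolding fiber_def
  by (intro smooth_mult smooth_const smooth_pint continuous_intros)

lemma fiber_eq: "fiber R i \<psi> x = 2 * R * integral {0..1} (\<lambda>\<theta>. \<psi> (setc x i (2 * R * \<theta> - R)))"
  by (simp add: fiber_def pint_def)

lemma fiber_slab: "fiber R i \<psi> x = slab R i \<psi> (setc x i R)"
  by (simp add: fiber_eq slab_def pint_def setc_nth algebra_simps)

lemma slab_antiderivative:
  assumes "smooth \<psi>" "\<bar>R\<bar> \<le> K"
  obtains \<Gamma> where "\<And>u. \<bar>u\<bar> \<le> K \<Longrightarrow> (\<Gamma> has_field_derivative \<psi> (setc x i u)) (at u)"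
    "\<And>u. \<bar>u\<bar> \<le> K \<Longrightarrow> slab R i \<psi> (setc x i u) = \<Gamma> u - \<Gamma> (- R)"
proof -
  let ?g = "\<lambda>u. \<psi> (setc x i u)"
  \<comment> \<open>One unit of slack makes every point of absolute value at most \<open>K\<close>
    interior, so that derivatives within the interval become two-sided.\<close>
  have "continuous_on {- (K + 1)..K + 1} ?g"
    unfolding setc_def
    by (intro continuous_on_compose2[OF smooth_continuous_on[OF assms(1), of UNIV]] continuous_intros) auto
  from antiderivative_continuous[OF this]
  obtain \<Gamma> where \<Gamma>: "\<And>u. u \<in> {- (K + 1)..K + 1} \<Longrightarrow> (\<Gamma> has_vector_derivative ?g u) (at u within {- (K + 1)..K + 1})"
    by blast
  have D: "(\<Gamma> has_field_derivative ?g u) (at u)" if "\<bar>u\<bar> \<le> K" for u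
  proof -
    have "at u within {- (K + 1)..K + 1} = at u"
      using that by (intro at_within_Icc_at) auto
    then show ?thesis using \<Gamma>[of u] that by (simp add: has_real_derivative_iff_has_vector_derivative abs_le_iff)
  qed
  show thesis
  proof (rule that[OF D])
    fix u assume u: "\<bar>u\<bar> \<le> K"
    have "((\<lambda>\<theta>. ?g (- R + \<theta> * (u + R)) * (u + R)) has_integral \<Gamma> (- R + 1 * (u + R)) - \<Gamma> (- R + 0 * (u + R))) {0..1}"
    proof (rule fundamental_theorem_of_calculus)
      fix \<theta> :: real assume \<theta>: "\<theta> \<in> {0..1}"
      have "- R + \<theta> * (u + R) = (1 - \<theta>) * (- R) + \<theta> * u" by (simp add: algebra_simps)
      also have "\<bar>\<dots>\<bar> \<le> (1 - \<theta>) * K + \<theta> * K"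
        using \<theta> u assms(2)
        by (intro order.trans[OF abs_triangle_ineq] add_mono) (auto simp: abs_mult intro!: mult_left_mono)
      finally have "\<bar>- R + \<theta> * (u + R)\<bar> \<le> K" by (simp add: algebra_simps)
      have "((\<lambda>\<theta>. - R + \<theta> * (u + R)) has_field_derivative u + R) (at \<theta>)"
        by (auto intro!: derivative_eq_intros)
      from DERIV_chain'[OF this D[OF \<open>\<bar>- R + \<theta> * (u + R)\<bar> \<le> K\<close>]]
      have "((\<lambda>\<theta>. \<Gamma> (- R + \<theta> * (u + R))) has_field_derivative ?g (- R + \<theta> * (u + R)) * (u + R)) (at \<theta>)" .
      then show "((\<lambda>\<theta>. \<Gamma> (- R + \<theta> * (u + R))) has_vector_derivative ?g (- R + \<theta> * (u + R)) * (u + R)) (at \<theta> within {0..1})"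
        by (simp add: has_real_derivative_iff_has_vector_derivative has_vector_derivative_at_within)
    qed simp
    from integral_unique[OF this]
    have "integral {0..1} (\<lambda>\<theta>. ?g (- R + \<theta> * (u + R)) * (u + R)) = \<Gamma> u - \<Gamma> (- R)"
      by simp
    moreover have "- R + \<theta> * (u + R) = (\<theta> - 1) * R + \<theta> * u" for \<theta> by (simp add: algebra_simps)
    ultimately show "slab R i \<psi> (setc x i u) = \<Gamma> u - \<Gamma> (- R)"
      by (simp add: slab_def pint_def setc_nth mult.commute)
  qed
qed

lemma partial_slab:
  assumes "smooth \<psi>" shows "partial i (slab R i \<psi>) x = \<psi> x"
proof -
  obtain \<Gamma> where \<Gamma>: "\<And>u. \<bar>u\<bar> \<le> \<bar>R\<bar> + \<bar>x $ i\<bar> + 1 \<Longrightarrow> (\<Gamma> has_field_derivative \<psi> (setc x i u)) (at u)"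
    "\<And>u. \<bar>u\<bar> \<le> \<bar>R\<bar> + \<bar>x $ i\<bar> + 1 \<Longrightarrow> slab R i \<psi> (setc x i u) = \<Gamma> u - \<Gamma> (- R)"
    by (rule slab_antiderivative[OF assms, of R "\<bar>R\<bar> + \<bar>x $ i\<bar> + 1" x i]) auto
  have "((\<lambda>t. \<Gamma> (x $ i + t) - \<Gamma> (- R)) has_field_derivative \<psi> (setc x i (x $ i + 0)) * 1 - 0) (at 0)"
    by (intro DERIV_diff DERIV_const DERIV_chain'[OF _ \<Gamma>(1)]) (auto intro!: derivative_eq_intros)
  then have "((\<lambda>t. slab R i \<psi> (x + t *\<^sub>R axis i 1)) has_field_derivative \<psi> x) (at 0)"
  proof (rule has_field_derivative_transform_within_open[of _ _ _ "{-1<..<1}", THEN DERIV_cong])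
    fix t :: real assume t: "t \<in> {-1<..<1}"
    have "x + t *\<^sub>R axis i 1 = setc x i (x $ i + t)" by (simp add: setc_def)
    then show "\<Gamma> (x $ i + t) - \<Gamma> (- R) = slab R i \<psi> (x + t *\<^sub>R axis i 1)"
      using \<Gamma>(2)[of "x $ i + t"] t by auto
  qed auto
  then show ?thesis unfolding partial_def by (rule DERIV_imp_deriv)
qed

lemma vanish_fiber:
  assumes "vanish R \<psi>" "\<bar>x $ j\<bar> \<ge> R" "j \<noteq> i" shows "fiber R i \<psi> x = 0"
proof -
  have "\<psi> (setc x i s) = 0" for s
    using assms unfolding vanish_def by (metis setc_nth)
  then show ?thesis by (simp add: fiber_eq)
qed

text \<open>To the right of the support the antiderivative equals the full fiber integral. It is
  compactly supported exactly because these integrals are assumed to be 0.\<close>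

lemma vanish_slab:
  assumes "smooth \<psi>" "vanish R \<psi>" "R > 0" "\<And>x. fiber R i \<psi> x = 0"
  shows "vanish R (slab R i \<psi>)"
  unfolding vanish_def
proof (intro allI impI)
  fix x :: "real^3" and j assume x: "R \<le> \<bar>x $ j\<bar>"
  consider "j \<noteq> i" | "j = i" "x $ i \<le> - R" | "j = i" "x $ i \<ge> R" using x by (cases "j = i"; cases "x $ i \<ge> 0") auto
  then show "slab R i \<psi> x = 0"
  proof cases
    case 1
    then have "\<psi> (setc x i s) = 0" for s
      using assms(2) x unfolding vanish_def by (metis setc_nth)
    then show ?thesis by (simp add: slab_def pint_def)
  next
    case 2
    have z: "\<psi> (setc x i ((\<theta> - 1) * R + \<theta> * x $ i)) = 0" if "\<theta> \<in> {0..1}" for \<theta>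
    proof -
      have "\<theta> * (x $ i + R) \<le> 0" using that 2 by (simp add: mult_nonneg_nonpos)
      then have "(\<theta> - 1) * R + \<theta> * x $ i \<le> - R" by (simp add: algebra_simps)
      then have "R \<le> \<bar>setc x i ((\<theta> - 1) * R + \<theta> * x $ i) $ i\<bar>" using assms(3) by (simp add: setc_nth)
      then show ?thesis using assms(2) unfolding vanish_def by blast
    qed
    have "integral {0..1} (\<lambda>\<theta>. 1 * \<psi> (setc x i ((\<theta> - 1) * R + \<theta> * x $ i))) = integral {0..1} (\<lambda>\<theta>::real. 0)"
      by (rule Henstock_Kurzweil_Integration.integral_cong) (simp add: z)
    then show ?thesis by (simp add: slab_def pint_def)
  next
    case 3
    obtain \<Gamma> where \<Gamma>: "\<And>u. \<bar>u\<bar> \<le> \<bar>R\<bar> + \<bar>x $ i\<bar> \<Longrightarrow> (\<Gamma> has_field_derivative \<psi> (setc x i u)) (at u)"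
      "\<And>u. \<bar>u\<bar> \<le> \<bar>R\<bar> + \<bar>x $ i\<bar> \<Longrightarrow> slab R i \<psi> (setc x i u) = \<Gamma> u - \<Gamma> (- R)"
      by (rule slab_antiderivative[OF assms(1), of R "\<bar>R\<bar> + \<bar>x $ i\<bar>" x i]) auto
    have "((\<lambda>u. \<psi> (setc x i u)) has_integral \<Gamma> (x $ i) - \<Gamma> R) {R..x $ i}"
    proof (rule fundamental_theorem_of_calculus)
      fix u assume "u \<in> {R..x $ i}"
      then have "\<bar>u\<bar> \<le> \<bar>R\<bar> + \<bar>x $ i\<bar>" using assms(3) by auto
      from \<Gamma>(1)[OF this]
      show "(\<Gamma> has_vector_derivative \<psi> (setc x i u)) (at u within {R..x $ i})"
        by (simp add: has_real_derivative_iff_has_vector_derivative has_vector_derivative_at_within)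
    qed (use 3 in simp)
    moreover have z: "\<psi> (setc x i u) = 0" if "u \<in> {R..x $ i}" for u
    proof -
      have "R \<le> \<bar>setc x i u $ i\<bar>" using that by (auto simp: setc_nth)
      then show ?thesis using assms(2) unfolding vanish_def by blast
    qed
    ultimately have "((\<lambda>u. 0) has_integral \<Gamma> (x $ i) - \<Gamma> R) {R..x $ i}"
      by (rule has_integral_eq[rotated])
    then have "\<Gamma> (x $ i) = \<Gamma> R" by simp
    moreover have "fiber R i \<psi> x = \<Gamma> R - \<Gamma> (- R)"
      unfolding fiber_slab by (rule \<Gamma>(2)) simp
    moreover have "slab R i \<psi> (setc x i (x $ i)) = \<Gamma> (x $ i) - \<Gamma> (- R)"
      by (rule \<Gamma>(2)) simp
    ultimately show ?thesis using assms(4)[of x] by simp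
  qed
qed

definition chi :: "real \<Rightarrow> real" where "chi t = flat 1 (t + 1) * flat 1 (1 - t)"

text \<open>A product of one-variable bumps, so that integration along a fiber pulls out the other
  factors.\<close>

definition chi3 :: "real^3 \<Rightarrow> real" where "chi3 = box_bump (-1) 1"

text \<open>For \<open>R\<close> at least 1 this is the whole integral of \<open>chi\<close>; its
  positivity permits the normalisation in \<open>split_fiber\<close>.\<close>

definition chi_mass :: "real \<Rightarrow> real" where
  "chi_mass R = 2 * R * integral {0..1} (\<lambda>\<theta>. chi (2 * R * \<theta> - R))"

lemma prod_UNIV_3: "prod f (UNIV::3 set) = f 1 * f 2 * (f 3 :: 'a::comm_monoid_mult)"
  unfolding UNIV_3 by (simp add: ac_simps)

lemma chi3_eq: "chi3 x = chi (x $ 1) * chi (x $ 2) * chi (x $ 3)"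
  unfolding chi3_def box_bump_def chi_def prod_UNIV_3 by simp

lemma smooth_chi: "smooth (\<lambda>x. chi (x $ i))"
proof -
  have "smooth (\<lambda>x. flat 1 (1 * x $ i + 1) * flat 1 (-1 * x $ i + 1))"
    by (intro smooth_mult smooth_flat)
  then show ?thesis by (simp add: chi_def)
qed

lemma continuous_on_chi: "continuous_on S chi"
  unfolding chi_def
  by (intro continuous_intros continuous_on_compose2[OF continuous_on_flat[of UNIV]]) auto

lemma chi_mass_pos: assumes "R > 0" shows "chi_mass R > 0"
proof -
  let ?f = "\<lambda>\<theta>. chi (2 * R * \<theta> - R)"
  have c: "continuous_on {0..1} ?f"
    by (intro continuous_on_compose2[OF continuous_on_chi[of UNIV]] continuous_intros) auto
  have nn: "?f \<theta> \<ge> 0" for \<theta> by (simp add: chi_def flat_1_pos)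
  have "integral {0..1} ?f \<ge> 0"
    by (intro integral_nonneg integrable_continuous_real c nn)
  moreover have "integral {0..1} ?f \<noteq> 0"
  proof
    assume "integral {0..1} ?f = 0"
    then have "\<forall>\<theta>\<in>{0..1}. ?f \<theta> = 0"
      using integral_eq_0_iff[OF c] nn by auto
    then have "?f (1/2) = 0" by (rule bspec) simp
    then show False by (simp add: chi_def flat_1_pos)
  qed
  ultimately show ?thesis using assms by (simp add: chi_mass_def)
qed

lemma fiber_setc [simp]: "fiber R i \<psi> (setc x i s) = fiber R i \<psi> x"
  by (simp add: fiber_eq)

lemma fiber_indep:
  assumes "\<And>x s. \<phi> (setc x j s) = \<phi> x"
  shows "fiber R i \<phi> (setc x j s) = fiber R i \<phi> x"
proof (cases "i = j")
  case False
  then show ?thesis by (simp add: fiber_eq setc_commute[of j i] assms)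
qed simp

lemma fiber_mult_indep:
  assumes "\<And>s. \<phi> (setc x i s) = c" shows "fiber R i (\<lambda>x. \<phi> x * g x) x = c * fiber R i g x"
  by (simp add: fiber_eq assms)

lemma fiber_chi:
  assumes "\<And>x s. \<phi> (setc x i s) = \<phi> x"
  shows "fiber R i (\<lambda>x. chi (x $ i) * \<phi> x) x = chi_mass R * \<phi> x"
  by (simp add: fiber_eq assms setc_nth chi_mass_def)

lemma fiber_diff:
  assumes "smooth f" "smooth g"
  shows "fiber R i (\<lambda>x. f x - g x) x = fiber R i f x - fiber R i g x"
proof -
  have "(\<lambda>\<theta>. h (setc x i (2 * R * \<theta> - R))) integrable_on {0..1}" if "smooth h" for h
    unfolding setc_def
    by (intro integrable_continuous_real continuous_on_compose2[OF smooth_continuous_on[OF that, of UNIV]] continuous_intros) auto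
  then show ?thesis using assms by (simp add: fiber_eq integral_diff algebra_simps)
qed

text \<open>\<open>E\<close> is the multiple of \<open>chi\<close> with the same fiber integrals as
  \<psi>. The difference has fiber integrals 0, so its antiderivative along \<open>i\<close> is
  again a test function.\<close>

lemma split_fiber:
  fixes i :: 3
  assumes "smooth \<psi>" "vanish R \<psi>" "R \<ge> 1"
  defines "E \<equiv> (\<lambda>x. chi (x $ i) * (fiber R i \<psi> x / chi_mass R))"
  obtains \<theta> where "test_function \<theta>" "\<And>x. \<psi> x = E x + partial i \<theta> x" "smooth E" "vanish R E"
proof -
  let ?\<eta> = "\<lambda>x. \<psi> x - E x"
  have "smooth (\<lambda>x. chi (x $ i) * (1 / chi_mass R * fiber R i \<psi> x))"
    by (intro smooth_mult smooth_const smooth_chi smooth_fiber assms)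
  then have sE: "smooth E" by (simp add: E_def)
  then have s\<eta>: "smooth ?\<eta>" by (intro smooth_diff assms)
  have vE: "vanish R E"
    unfolding vanish_def
  proof (intro allI impI)
    fix x :: "real^3" and j assume x: "R \<le> \<bar>x $ j\<bar>"
    show "E x = 0"
    proof (cases "j = i")
      case True
      then have "chi (x $ i) = 0" using x assms(3) by (auto simp: chi_def flat_1_pos)
      then show ?thesis by (simp add: E_def)
    next
      case False
      then show ?thesis using vanish_fiber[OF assms(2) x] by (simp add: E_def)
    qed
  qed
  have v: "vanish R ?\<eta>"
    using vE assms(2) unfolding vanish_def by (metis diff_zero)
  have "fiber R i ?\<eta> x = 0" for x
  proof -
    have "fiber R i E x = chi_mass R * (fiber R i \<psi> x / chi_mass R)"
      unfolding E_def by (rule fiber_chi) simp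
    also have "\<dots> = fiber R i \<psi> x" using chi_mass_pos[of R] assms(3) by simp
    finally show ?thesis by (simp add: fiber_diff[OF assms(1) sE])
  qed
  then have "vanish R (slab R i ?\<eta>)"
    using assms(3) by (intro vanish_slab s\<eta> v) auto
  with smooth_slab[OF s\<eta>] have "test_function (slab R i ?\<eta>)" by (rule test_functionI)
  then show thesis
    using sE vE partial_slab[OF s\<eta>, of i R] by (intro that) auto
qed

lemma indep_all_const:
  assumes "\<And>x i s. f (setc x i s) = f x" shows "f x = f (0::real^3)"
proof -
  have "x = setc (setc (setc 0 1 (x $ 1)) 2 (x $ 2)) 3 (x $ 3)"
    by (simp add: vec_eq_iff setc_nth forall_3)
  then show ?thesis by (metis assms)
qed

text \<open>The three coordinates are integrated out in turn. The coefficient that remains depends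
  on no coordinate and is therefore a constant; a functional that kills all derivatives is thus
  fixed by its value on \<open>chi3\<close>.\<close>

theorem test_function_decomposition:
  assumes "test_function \<psi>"
  obtains c \<theta>\<^sub>1 \<theta>\<^sub>2 \<theta>\<^sub>3 where "test_function \<theta>\<^sub>1" "test_function \<theta>\<^sub>2" "test_function \<theta>\<^sub>3"
    "\<psi> = (\<lambda>x. c * chi3 x + (partial 1 \<theta>\<^sub>1 x + (partial 2 \<theta>\<^sub>2 x + partial 3 \<theta>\<^sub>3 x)))"
proof -
  obtain R where R: "R \<ge> 1" "vanish R \<psi>" using assms by (rule test_function_vanish)
  define m where "m = (\<lambda>x. fiber R 1 \<psi> x / chi_mass R)"
  obtain \<theta>1 where 1: "test_function \<theta>1" "\<And>x. \<psi> x = chi (x $ 1) * m x + partial 1 \<theta>1 x"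
      "smooth (\<lambda>x. chi (x $ 1) * m x)" "vanish R (\<lambda>x. chi (x $ 1) * m x)"
    unfolding m_def
    by (rule split_fiber[OF test_function_smooth[OF assms] R(2,1), where i = 1]) blast
  define m' where "m' = (\<lambda>x. fiber R 2 m x / chi_mass R)"
  have "fiber R 2 (\<lambda>x. chi (x $ 1) * m x) x = chi (x $ 1) * fiber R 2 m x" for x
    by (rule fiber_mult_indep) (simp add: setc_nth)
  then have e2: "fiber R 2 (\<lambda>x. chi (x $ 1) * m x) x / chi_mass R = chi (x $ 1) * m' x" for x
    by (simp add: m'_def)
  obtain \<theta>2 where 2: "test_function \<theta>2" "\<And>x. chi (x $ 1) * m x = chi (x $ 2) * (chi (x $ 1) * m' x) + partial 2 \<theta>2 x"
      "smooth (\<lambda>x. chi (x $ 2) * (chi (x $ 1) * m' x))" "vanish R (\<lambda>x. chi (x $ 2) * (chi (x $ 1) * m' x))"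
    by (rule split_fiber[OF 1(3,4) R(1), where i = 2, unfolded e2]) blast
  define m'' where "m'' = (\<lambda>x. fiber R 3 m' x / chi_mass R)"
  have "fiber R 3 (\<lambda>x. chi (x $ 2) * (chi (x $ 1) * m' x)) x = chi (x $ 2) * fiber R 3 (\<lambda>x. chi (x $ 1) * m' x) x" for x
    by (rule fiber_mult_indep) (simp add: setc_nth)
  moreover have "fiber R 3 (\<lambda>x. chi (x $ 1) * m' x) x = chi (x $ 1) * fiber R 3 m' x" for x
    by (rule fiber_mult_indep) (simp add: setc_nth)
  ultimately have e3: "fiber R 3 (\<lambda>x. chi (x $ 2) * (chi (x $ 1) * m' x)) x / chi_mass R = chi (x $ 2) * (chi (x $ 1) * m'' x)" for x
    by (simp add: m''_def)
  obtain \<theta>3 where 3: "test_function \<theta>3"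
      "\<And>x. chi (x $ 2) * (chi (x $ 1) * m' x) = chi (x $ 3) * (chi (x $ 2) * (chi (x $ 1) * m'' x)) + partial 3 \<theta>3 x"
    by (rule split_fiber[OF 2(3,4) R(1), where i = 3, unfolded e3]) blast
  \<comment> \<open>An integral along one coordinate does not depend on that coordinate, and it
    keeps any independence already gained in the others.\<close>
  have m1: "m (setc x 1 s) = m x" for x s by (simp add: m_def)
  have m2: "m' (setc x i s) = m' x" if "i = 1 \<or> i = 2" for x s i
    using that fiber_indep[where \<phi> = m and j = 1, OF m1] by (auto simp: m'_def)
  have m3: "m'' (setc x i s) = m'' x" for x s i
    using exhaust_3[of i] fiber_indep[where \<phi> = m' and j = i, OF m2] by (auto simp: m''_def)
  have "\<psi> = (\<lambda>x. m'' 0 * chi3 x + (partial 1 \<theta>1 x + (partial 2 \<theta>2 x + partial 3 \<theta>3 x)))"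
    using 1(2) 2(2) 3(2) indep_all_const[of m'', OF m3] by (auto simp: chi3_eq fun_eq_iff algebra_simps)
  then show thesis using that 1(1) 2(1) 3(1) by blast
qed

section \<open>Functionals determined by their values on derivatives of one bump\<close>

text \<open>Linearity on test functions passes from a functional to its distributional derivatives,
  which drives the induction in \<open>tlin_determined\<close>.\<close>

definition tlin :: "((real^3 \<Rightarrow> real) \<Rightarrow> real) \<Rightarrow> bool" where
  "tlin T \<longleftrightarrow> (\<forall>\<psi> \<eta>. test_function \<psi> \<longrightarrow> test_function \<eta> \<longrightarrow> T (\<lambda>x. \<psi> x + \<eta> x) = T \<psi> + T \<eta>) \<and>
     (\<forall>c \<psi>. test_function \<psi> \<longrightarrow> T (\<lambda>x. c * \<psi> x) = c * T \<psi>)"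

lemma test_function_chi3: "test_function chi3"
  by (simp add: chi3_def test_function_box_bump)

lemma tlin_partial: "tlin T \<Longrightarrow> tlin (\<lambda>\<psi>. T (partial i \<psi>))"
  unfolding tlin_def
  by (simp add: smooth_partial_add smooth_partial_cmult test_function_smooth test_function_partial)

text \<open>Induction on \<open>N\<close>: each functional \<open>T (partial i \<psi>)\<close>
  satisfies the hypotheses for one order less, hence is 0. The decomposition then reduces
  \<open>T\<close> to its value on \<open>chi3\<close>. This is the statement that vanishing
  derivatives of order \<open>N\<close> leave a polynomial, in a form that only mentions
  values.\<close>

theorem tlin_determined:
  assumes "tlin T" "\<And>a b c \<psi>. a + b + c = N \<Longrightarrow> test_function \<psi> \<Longrightarrow> T (D3 a b c \<psi>) = 0"
    and "\<And>a b c. T (D3 a b c chi3) = 0" "test_function \<psi>"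
  shows "T \<psi> = 0"
  using assms
proof (induction N arbitrary: T \<psi>)
  case 0
  then show ?case by (metis D3_0 add_0)
next
  case (Suc N)
  have *: "T (partial i \<theta>) = 0" if "test_function \<theta>" for i \<theta>
  proof (rule Suc.IH[of "\<lambda>\<psi>. T (partial i \<psi>)", OF tlin_partial[OF Suc.prems(1)]])
    show "T (partial i (D3 a b c \<eta>)) = 0" if "a + b + c = N" "test_function \<eta>" for a b c \<eta>
      using exhaust_3[of i] that by (auto simp: partial_D3 test_function_smooth intro!: Suc.prems(2))
    show "T (partial i (D3 a b c chi3)) = 0" for a b c
      using exhaust_3[of i] by (auto simp: partial_D3 test_function_smooth[OF test_function_chi3] intro!: Suc.prems(3))
  qed (rule that)
  obtain c \<theta>\<^sub>1 \<theta>\<^sub>2 \<theta>\<^sub>3 where t: "test_function \<theta>\<^sub>1" "test_function \<theta>\<^sub>2" "test_function \<theta>\<^sub>3"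
    and \<psi>: "\<psi> = (\<lambda>x. c * chi3 x + (partial 1 \<theta>\<^sub>1 x + (partial 2 \<theta>\<^sub>2 x + partial 3 \<theta>\<^sub>3 x)))"
    using Suc.prems(4) by (rule test_function_decomposition)
  have lin: "T (\<lambda>x. f x + g x) = T f + T g" "T (\<lambda>x. c * f x) = c * T f"
    if "test_function f" "test_function g" for f g
    using Suc.prems(1) that by (auto simp: tlin_def)
  have "T chi3 = 0" using Suc.prems(3)[of 0 0 0] by simp
  then show ?case
    unfolding \<psi> using t
    by (simp add: lin test_function_add test_function_partial test_function_chi3 test_function_cmult * lin(2)[OF test_function_chi3 test_function_chi3])
qed

section \<open>Integration by parts and regular distributions\<close>

lemma outside_cube:
  fixes x :: "real^3"
  assumes "x \<notin> cbox (\<chi> i. - R) (\<chi> i. R)" obtains i where "\<bar>x $ i\<bar> \<ge> R"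
proof -
  obtain i where "\<not> (- R \<le> x $ i \<and> x $ i \<le> R)"
    using assms by (auto simp: mem_box_cart)
  then show thesis by (intro that[of i]) linarith
qed

lemma vanish_bounded:
  assumes "continuous_on UNIV g" "vanish R g" obtains M where "M \<ge> 0" "\<And>x. \<bar>g x\<bar> \<le> M"
proof -
  let ?K = "cbox (\<chi> i. - R) (\<chi> i. R) :: (real^3) set"
  have "bounded (g ` ?K)"
    by (intro compact_imp_bounded compact_continuous_image continuous_on_subset[OF assms(1)]) auto
  then obtain M where M: "\<And>x. x \<in> ?K \<Longrightarrow> \<bar>g x\<bar> \<le> M" by (auto simp: bounded_iff)
  have "\<bar>g x\<bar> \<le> \<bar>M\<bar>" for x
  proof (cases "x \<in> ?K")
    case False
    then obtain i where "\<bar>x $ i\<bar> \<ge> R" by (rule outside_cube)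
    then have "g x = 0" using assms(2) unfolding vanish_def by blast
    then show ?thesis by simp
  qed (use M in fastforce)
  then show thesis by (intro that[of "\<bar>M\<bar>"]) auto
qed

lemma vanish_integrable:
  assumes "continuous_on UNIV g" "vanish R g" shows "integrable lborel g"
proof -
  let ?K = "cbox (\<chi> i. - R) (\<chi> i. R) :: (real^3) set"
  have "integrable lborel (\<lambda>x. indicator ?K x *\<^sub>R g x)"
    by (intro borel_integrable_compact continuous_on_subset[OF assms(1)]) auto
  also have "(\<lambda>x. indicator ?K x *\<^sub>R g x) = g"
  proof
    fix x show "indicator ?K x *\<^sub>R g x = g x"
    proof (cases "x \<in> ?K")
      case False
      then obtain i where "\<bar>x $ i\<bar> \<ge> R" by (rule outside_cube)
      then have "g x = 0" using assms(2) unfolding vanish_def by blast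
      then show ?thesis by simp
    qed simp
  qed
  finally show ?thesis .
qed

lemma test_mult_integrable:
  assumes "continuous_on UNIV f" "test_function \<psi>" shows "integrable lborel (\<lambda>x. f x * \<psi> x)"
proof -
  obtain R where R: "vanish R \<psi>" using assms(2) by (rule test_function_vanish)
  have "continuous_on UNIV (\<lambda>x. f x * \<psi> x)"
    by (intro continuous_intros assms(1) smooth_continuous_on test_function_smooth[OF assms(2)])
  moreover have "vanish R (\<lambda>x. f x * \<psi> x)" using R by (auto simp: vanish_def)
  ultimately show ?thesis by (rule vanish_integrable)
qed

lemma test_integrable: "test_function \<psi> \<Longrightarrow> integrable lborel \<psi>"
  using test_mult_integrable[of "\<lambda>_. 1" \<psi>] by simp

lemma lborel_integral_translate:
  fixes g :: "'a::euclidean_space \<Rightarrow> real"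
  assumes "g \<in> borel_measurable borel"
  shows "(LINT x|lborel. g (a + x)) = (LINT x|lborel. g x)"
  by (subst lborel_distr_plus[symmetric, of a], subst integral_distr) (use assms in auto)

lemma line_bound:
  assumes "smooth \<psi>" "\<And>x. \<bar>partial i \<psi> x\<bar> \<le> M" "h > 0"
  shows "\<bar>\<psi> (x + h *\<^sub>R axis i 1) - \<psi> x\<bar> \<le> M * h"
proof -
  have "\<exists>z. z > 0 \<and> z < h \<and> \<psi> (x + h *\<^sub>R axis i 1) - \<psi> (x + 0 *\<^sub>R axis i 1) = (h - 0) * partial i \<psi> (x + z *\<^sub>R axis i 1)"
    by (rule MVT2) (use assms in \<open>auto intro: DERIV_partial_line smooth_differentiable\<close>)
  then obtain z where "\<psi> (x + h *\<^sub>R axis i 1) - \<psi> x = h * partial i \<psi> (x + z *\<^sub>R axis i 1)" by auto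
  then show ?thesis using assms(2)[of "x + z *\<^sub>R axis i 1"] assms(3)
    by (simp add: abs_mult mult.commute mult_left_mono)
qed

text \<open>Difference quotients integrate to 0 by translation invariance. They converge to the
  derivative and are dominated through the mean value theorem.\<close>

lemma integral_partial_eq_0:
  assumes "test_function \<psi>" shows "(LINT x|lborel. partial i \<psi> x) = 0"
proof -
  note sm = test_function_smooth[OF assms]
  obtain R where R: "R \<ge> 1" "vanish R \<psi>" using assms by (rule test_function_vanish)
  obtain M where M: "M \<ge> 0" "\<And>x. \<bar>partial i \<psi> x\<bar> \<le> M"
    using vanish_bounded[OF smooth_continuous_on[OF smooth_partial[OF sm]] vanish_partial[OF R(2)]] by blast
  define q where "q n x = (\<psi> (x + (1 / real (Suc n)) *\<^sub>R axis i 1) - \<psi> x) * real (Suc n)" for n x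
  \<comment> \<open>The quotients use steps of length at most 1, so all of them vanish outside a
    cube that is one unit larger.\<close>
  let ?K = "cbox (\<chi> i. - (R + 1)) (\<chi> i. R + 1) :: (real^3) set"
  have mb: "\<psi> \<in> borel_measurable borel"
    by (intro borel_measurable_continuous_onI smooth_continuous_on sm)
  have mb': "partial i \<psi> \<in> borel_measurable borel"
    by (intro borel_measurable_continuous_onI smooth_continuous_on smooth_partial sm)
  have "(\<lambda>n. LINT x|lborel. q n x) \<longlonglongrightarrow> (LINT x|lborel. partial i \<psi> x)"
  proof (rule integral_dominated_convergence[where w = "\<lambda>x. indicator ?K x *\<^sub>R M"])
    show "integrable lborel (\<lambda>x. indicator ?K x *\<^sub>R M)"
      by (intro borel_integrable_compact) auto
    show "AE x in lborel. (\<lambda>n. q n x) \<longlonglongrightarrow> partial i \<psi> x"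
    proof (rule AE_I2)
      fix x
      have "((\<lambda>t. \<psi> (x + t *\<^sub>R axis i 1)) has_field_derivative partial i \<psi> (x + 0 *\<^sub>R axis i 1)) (at 0)"
        by (intro DERIV_partial_line smooth_differentiable sm)
      then have "((\<lambda>h. (\<psi> (x + h *\<^sub>R axis i 1) - \<psi> x) / h) \<longlongrightarrow> partial i \<psi> x) (at 0)"
        by (simp add: DERIV_def)
      moreover have "filterlim (\<lambda>n. 1 / real (Suc n)) (at 0) sequentially"
        unfolding filterlim_at using LIMSEQ_Suc[OF lim_1_over_n] by auto
      ultimately have "(\<lambda>n. (\<psi> (x + (1 / real (Suc n)) *\<^sub>R axis i 1) - \<psi> x) / (1 / real (Suc n))) \<longlonglongrightarrow> partial i \<psi> x"
        by (rule filterlim_compose)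
      then show "(\<lambda>n. q n x) \<longlonglongrightarrow> partial i \<psi> x"
        unfolding q_def by simp
    qed
    show "AE x in lborel. norm (q n x) \<le> indicator ?K x *\<^sub>R M" for n
    proof (rule AE_I2)
      fix x
      show "norm (q n x) \<le> indicator ?K x *\<^sub>R M"
      proof (cases "x \<in> ?K")
        case True
        have "\<bar>q n x\<bar> \<le> M * (1 / real (Suc n)) * real (Suc n)"
          unfolding q_def abs_mult
          by (intro mult_mono line_bound sm M(2)) (auto simp: M(1))
        then show ?thesis using True by simp
      next
        case False
        then obtain j where j: "\<bar>x $ j\<bar> \<ge> R + 1" by (rule outside_cube)
        have "\<bar>(x + (1 / real (Suc n)) *\<^sub>R axis i 1) $ j\<bar> \<ge> R"
        proof -
          define d where "d = ((1 / real (Suc n)) *\<^sub>R axis i (1::real)) $ j"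
          have "0 \<le> d" "d \<le> 1" by (auto simp: axis_def d_def)
          then show ?thesis using j unfolding vector_add_component d_def[symmetric] by linarith
        qed
        then have "\<psi> (x + (1 / real (Suc n)) *\<^sub>R axis i 1) = 0" using R(2) unfolding vanish_def by blast
        moreover have "\<psi> x = 0"
        proof -
          have "R \<le> \<bar>x $ j\<bar>" using j by linarith
          then show ?thesis using R(2) unfolding vanish_def by blast
        qed
        ultimately show ?thesis using M(1) by (simp add: q_def)
      qed
    qed
  qed (auto simp: q_def intro!: mb' borel_measurable_diff borel_measurable_times mb measurable_compose[OF _ mb])
  moreover have "(LINT x|lborel. q n x) = 0" for n
  proof -
    have i1: "integrable lborel \<psi>" by (rule test_integrable[OF assms])
    have "integrable lborel (\<lambda>x. \<psi> ((1 / real (Suc n)) *\<^sub>R axis i 1 + x))"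
      using i1 by (subst (asm) lborel_distr_plus[symmetric, of "(1 / real (Suc n)) *\<^sub>R axis i 1"], subst (asm) integrable_distr_eq)
        (auto simp: mb)
    then show ?thesis
      using i1 lborel_integral_translate[OF mb, of "(1 / real (Suc n)) *\<^sub>R axis i 1"]
      by (simp add: q_def add.commute)
  qed
  ultimately show ?thesis by (simp add: LIMSEQ_const_iff)
qed

lemma integral_by_parts:
  assumes "smooth f" "test_function \<psi>"
  shows "(LINT x|lborel. f x * partial i \<psi> x) = - (LINT x|lborel. partial i f x * \<psi> x)"
proof -
  have "partial i (\<lambda>x. f x * \<psi> x) = (\<lambda>x. partial i f x * \<psi> x + f x * partial i \<psi> x)"
    using assms by (auto simp: partial_mult smooth_differentiable test_function_smooth)
  with integral_partial_eq_0[OF test_function_mult[OF assms], of i]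
  have "(LINT x|lborel. partial i f x * \<psi> x + f x * partial i \<psi> x) = 0" by simp
  moreover have "integrable lborel (\<lambda>x. partial i f x * \<psi> x)" "integrable lborel (\<lambda>x. f x * partial i \<psi> x)"
    using assms by (auto intro!: test_mult_integrable smooth_continuous_on smooth_partial test_function_partial)
  ultimately show ?thesis by simp
qed

lemma integral_D3_by_parts:
  assumes "smooth f" "test_function \<psi>"
  shows "(LINT x|lborel. f x * D3 a b c \<psi> x) = (-1) ^ (a + b + c) * (LINT x|lborel. D3 a b c f x * \<psi> x)"
proof -
  have *: "(LINT x|lborel. f x * (partial i ^^ n) \<psi> x) = (-1) ^ n * (LINT x|lborel. (partial i ^^ n) f x * \<psi> x)"
    if "smooth f" "test_function \<psi>" for f \<psi> n i
    using that
  proof (induction n arbitrary: f)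
    case (Suc n)
    have t: "test_function ((partial i ^^ n) \<psi>)"
      using Suc.prems(2) by (induction n) (auto intro: test_function_partial)
    have "(LINT x|lborel. f x * (partial i ^^ Suc n) \<psi> x) = - (LINT x|lborel. partial i f x * (partial i ^^ n) \<psi> x)"
      using integral_by_parts[OF Suc.prems(1) t] by simp
    also have "\<dots> = (-1) ^ Suc n * (LINT x|lborel. (partial i ^^ n) (partial i f) x * \<psi> x)"
      using Suc.IH[OF smooth_partial[OF Suc.prems(1)] Suc.prems(2)] by simp
    finally show ?case using Suc.prems(1) by (simp add: partial_funpow_commute)
  qed simp
  have t: "test_function ((partial i ^^ n) \<psi>)" if "test_function \<psi>" for i n \<psi>
    using that by (induction n) (auto intro: test_function_partial)
  have "D3 a b c f = (partial 3 ^^ c) ((partial 2 ^^ b) ((partial 1 ^^ a) f))"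
  proof -
    have sw: "(partial i ^^ n) ((partial j ^^ m) g) = (partial j ^^ m) ((partial i ^^ n) g)" if "smooth g" for i j n m g
      using that by (induction n) (auto simp: partial_funpow_commute smooth_funpow)
    show ?thesis using assms(1) by (simp add: D3_def sw smooth_funpow)
  qed
  then show ?thesis
    using assms by (simp add: D3_def * t smooth_funpow power_add)
qed

lemma regular_D3:
  assumes "smooth f" "test_function \<psi>"
  shows "regular f (D3 a b c \<psi>) = (-1) ^ (a + b + c) * regular (D3 a b c f) \<psi>"
  using assms by (simp add: regular_def test_function_D3 integral_D3_by_parts)

lemma test_function_smooth_continuous: "test_function \<psi> \<Longrightarrow> continuous_on S \<psi>"
  by (simp add: smooth_continuous_on test_function_smooth)

text \<open>The fundamental lemma of the calculus of variations: where the difference is nonzero it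
  keeps its sign on a small box, and the bump of this box detects it.\<close>

lemma regular_inject:
  assumes "continuous_on UNIV f" "continuous_on UNIV g" "regular f = regular g" shows "f = g"
proof (rule ccontr)
  assume "f \<noteq> g"
  then obtain x0 where x0: "f x0 \<noteq> g x0" by auto
  define s where "s = sgn (f x0 - g x0)"
  define h where "h x = s * (f x - g x)" for x
  have s: "s \<noteq> 0" "h x0 > 0" using x0 by (auto simp: s_def h_def sgn_real_def)
  have ch: "continuous_on UNIV h" unfolding h_def by (intro continuous_intros assms)
  have "open {x. h x > 0}" using ch by (intro open_Collect_less) auto
  then obtain e where e: "e > 0" "ball x0 e \<subseteq> {x. h x > 0}"
    using s(2) by (auto simp: open_contains_ball)
  \<comment> \<open>Three coordinate deviations below e/6 add up to less than e/2 in the sum norm,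
    so the box lies in the ball of radius e.\<close>
  define l u where "l = (\<chi> i. x0 $ i - e / 6)" and "u = (\<chi> i. x0 $ i + e / 6)"
  let ?b = "box_bump l u"
  have sub: "h x > 0" if "?b x > 0" for x
  proof -
    have "\<bar>x $ i - x0 $ i\<bar> < e / 6" for i
      using that[unfolded box_bump_pos, rule_format, of i] unfolding l_def u_def abs_less_iff by simp
    then have "(\<Sum>i\<in>UNIV. \<bar>(x - x0) $ i\<bar>) < (\<Sum>i\<in>(UNIV::3 set). e / 6)"
      by (intro sum_strict_mono) auto
    with norm_le_l1_cart[of "x - x0"] e(1) have "dist x x0 < e" by (simp add: dist_norm sum_3)
    then show ?thesis using e(2) by (auto simp: dist_commute)
  qed
  have b0: "?b x0 > 0" using e(1) by (simp add: box_bump_pos l_def u_def)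
  have nn: "h x * ?b x \<ge> 0" for x
    using sub[of x] box_bump_nonneg[of l u x] by (cases "?b x > 0") auto
  have t: "test_function ?b" by (rule test_function_box_bump)
  have int: "integrable lborel (\<lambda>x. h x * ?b x)" by (rule test_mult_integrable[OF ch t])
  have "(LINT x|lborel. f x * ?b x) = (LINT x|lborel. g x * ?b x)"
    using fun_cong[OF assms(3), of ?b] t by (simp add: regular_def)
  then have z: "(LINT x|lborel. h x * ?b x) = 0"
    using test_mult_integrable[OF assms(1) t] test_mult_integrable[OF assms(2) t]
    by (simp add: h_def algebra_simps)
  have "((\<lambda>x. h x * ?b x) has_integral 0) UNIV"
    using has_integral_integral_lborel[OF int] z by simp
  then have "((\<lambda>x. h x * ?b x) has_integral 0) (cbox l u)"
  proof (subst has_integral_restrict_UNIV[symmetric], elim has_integral_cong[THEN iffD1, rotated])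
    fix x show "h x * ?b x = (if x \<in> cbox l u then h x * ?b x else 0)"
    proof (cases "x \<in> cbox l u")
      case False
      then have "\<not> ?b x > 0" unfolding box_bump_pos mem_box_cart by (meson less_imp_le)
      then show ?thesis using box_bump_nonneg[of l u x] False by simp
    qed simp
  qed
  moreover have "x0 \<in> box l u" using e(1) by (simp add: mem_box_cart l_def u_def)
  moreover have "continuous_on (cbox l u) (\<lambda>x. h x * ?b x)"
    by (intro continuous_on_mult continuous_on_subset[OF ch] test_function_smooth_continuous[OF t]) auto
  ultimately have "h x0 * ?b x0 = 0"
    using box_subset_cbox[of l u]
    by (intro has_integral_0_cbox_imp_0[of l u "\<lambda>x. h x * ?b x"])
       (auto intro!: nn)
  then show False using s b0 by simp
qed

lemma tlin_regular:
  assumes "continuous_on UNIV f" shows "tlin (regular f)"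
proof -
  have i: "integrable lborel (\<lambda>x. f x * \<psi> x)" if "test_function \<psi>" for \<psi>
    using test_mult_integrable[OF assms that] .
  show ?thesis
    unfolding tlin_def
  proof (intro conjI allI impI)
    fix \<psi> \<eta> assume "test_function \<psi>" "test_function \<eta>"
    then show "regular f (\<lambda>x. \<psi> x + \<eta> x) = regular f \<psi> + regular f \<eta>"
      using i by (simp add: regular_def test_function_add distrib_left)
  next
    fix c \<psi> assume "test_function \<psi>"
    then show "regular f (\<lambda>x. c * \<psi> x) = c * regular f \<psi>"
      by (simp add: regular_def test_function_cmult mult.left_commute)
  qed
qed

lemma distribution_tlin: "distribution T \<Longrightarrow> tlin T"
  by (auto simp: distribution_def tlin_def)

text \<open>The functional has order 0: the integral of the absolute value of \<open>f\<close> over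
  \<open>K\<close> times the supremum of \<psi> is a bound, and only the multi-index 0 enters the
  sum.\<close>

lemma distribution_regular:
  assumes "continuous_on UNIV f" shows "distribution (regular f)"
  unfolding distribution_def
proof (intro conjI)
  show "\<forall>\<psi>. \<not> test_function \<psi> \<longrightarrow> regular f \<psi> = 0" by (simp add: regular_def)
  show "\<forall>\<psi> \<eta>. test_function \<psi> \<longrightarrow> test_function \<eta> \<longrightarrow> regular f (\<lambda>x. \<psi> x + \<eta> x) = regular f \<psi> + regular f \<eta>"
    "\<forall>c \<psi>. test_function \<psi> \<longrightarrow> regular f (\<lambda>x. c * \<psi> x) = c * regular f \<psi>"
    using tlin_regular[OF assms] by (auto simp: tlin_def)
  show "\<forall>K. compact K \<longrightarrow> (\<exists>C N. \<forall>\<psi>. test_function \<psi> \<longrightarrow> support \<psi> \<subseteq> K \<longrightarrow>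
        \<bar>regular f \<psi>\<bar> \<le> C * (\<Sum>\<alpha> | (\<Sum>i\<in>UNIV. \<alpha> $ i) \<le> N. SUP x. \<bar>mpartial \<alpha> \<psi> x\<bar>))"
  proof (intro allI impI)
    fix K :: "(real^3) set" assume K: "compact K"
    define C where "C = (LINT x|lborel. indicator K x *\<^sub>R \<bar>f x\<bar>)"
    have iC: "integrable lborel (\<lambda>x. indicator K x *\<^sub>R \<bar>f x\<bar>)"
      by (intro borel_integrable_compact K continuous_intros continuous_on_subset[OF assms]) auto
    have z: "{\<alpha>::nat^3. (\<Sum>i\<in>UNIV. \<alpha> $ i) \<le> 0} = {0}"
      by (auto simp: vec_eq_iff)
    show "\<exists>C N. \<forall>\<psi>. test_function \<psi> \<longrightarrow> support \<psi> \<subseteq> K \<longrightarrow>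
        \<bar>regular f \<psi>\<bar> \<le> C * (\<Sum>\<alpha> | (\<Sum>i\<in>UNIV. \<alpha> $ i) \<le> N. SUP x. \<bar>mpartial \<alpha> \<psi> x\<bar>)"
    proof (intro exI[of _ C] exI[of _ 0] allI impI)
      fix \<psi> assume t: "test_function \<psi>" and sK: "support \<psi> \<subseteq> K"
      obtain R where R: "vanish R \<psi>" using t by (rule test_function_vanish)
      obtain M where M: "\<And>x. \<bar>\<psi> x\<bar> \<le> M"
        using vanish_bounded[OF test_function_smooth_continuous[OF t] R] by blast
      define S where "S = (SUP x. \<bar>\<psi> x\<bar>)"
      have S: "\<bar>\<psi> x\<bar> \<le> S" for x
        unfolding S_def by (rule cSUP_upper) (use M in \<open>auto simp: bdd_above_def\<close>)
      have "\<bar>LINT x|lborel. f x * \<psi> x\<bar> \<le> (LINT x|lborel. \<bar>f x * \<psi> x\<bar>)"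
        using integral_norm_bound[of lborel "\<lambda>x. f x * \<psi> x"] by simp
      also have "\<dots> \<le> (LINT x|lborel. (indicator K x *\<^sub>R \<bar>f x\<bar>) * S)"
      proof (rule integral_mono)
        show "integrable lborel (\<lambda>x. \<bar>f x * \<psi> x\<bar>)"
          using test_mult_integrable[OF assms t] by simp
        show "integrable lborel (\<lambda>x. (indicator K x *\<^sub>R \<bar>f x\<bar>) * S)"
          using iC by simp
        fix x
        show "\<bar>f x * \<psi> x\<bar> \<le> (indicator K x *\<^sub>R \<bar>f x\<bar>) * S"
        proof (cases "x \<in> K")
          case True then show ?thesis using S[of x] by (simp add: abs_mult mult_left_mono)
        next
          case False
          then have "\<psi> x = 0" using sK closure_subset[of "{x. \<psi> x \<noteq> 0}"] by (auto simp: support_def)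
          then show ?thesis using False by simp
        qed
      qed
      also have "\<dots> = C * S" by (simp add: C_def)
      finally show "\<bar>regular f \<psi>\<bar> \<le> C * (\<Sum>\<alpha> | (\<Sum>i\<in>UNIV. \<alpha> $ i) \<le> 0. SUP x. \<bar>mpartial \<alpha> \<psi> x\<bar>)"
        using t unfolding z by (simp add: regular_def mpartial_D3 S_def)
    qed
  qed
qed

lemma sum_UNIV_3_nat: "(\<Sum>i\<in>UNIV. \<alpha> $ i) = \<alpha> $ 1 + \<alpha> $ 2 + (\<alpha> $ 3 :: nat)" for \<alpha> :: "nat^3"
  by (simp add: sum_3)

lemma smooth_diff_op: "smooth f \<Longrightarrow> smooth (diff_op q f)"
  unfolding diff_op_def mpartial_D3
  by (intro smooth_sum smooth_mult smooth_const smooth_D3)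

text \<open>The signs built into \<open>dist_op\<close> cancel those of integration by parts, so the
  weak operator extends the classical one.\<close>

lemma dist_op_regular:
  assumes "smooth f" shows "dist_op q (regular f) = regular (diff_op q f)"
proof
  fix \<psi>
  show "dist_op q (regular f) \<psi> = regular (diff_op q f) \<psi>"
  proof (cases "test_function \<psi>")
    case True
    have "dist_op q (regular f) \<psi> = (\<Sum>\<alpha>\<in>Poly_Mapping.keys q. Poly_Mapping.lookup q \<alpha> * regular (mpartial \<alpha> f) \<psi>)"
      using True by (simp add: dist_op_def mpartial_D3 regular_D3 assms sum_3 mult.assoc flip: power_mult_distrib mult.assoc[of "_ ^ _"])
    also have "\<dots> = (LINT x|lborel. (\<Sum>\<alpha>\<in>Poly_Mapping.keys q. Poly_Mapping.lookup q \<alpha> * (mpartial \<alpha> f x * \<psi> x)))"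
      using True assms
      by (subst Bochner_Integration.integral_sum)
         (auto simp: regular_def mpartial_D3 intro!: test_mult_integrable smooth_continuous_on smooth_D3)
    also have "\<dots> = regular (diff_op q f) \<psi>"
      using True by (simp add: regular_def diff_op_def sum_distrib_right mult.assoc)
    finally show ?thesis .
  qed (simp add: dist_op_def regular_def)
qed

section \<open>Dimension counting in spaces of functions\<close>

interpretation fs: vector_space "\<lambda>(c::real) (f::'a \<Rightarrow> real) x. c * f x"
  by unfold_locales (auto simp: algebra_simps fun_eq_iff)

lemma fun_sum_apply: "(\<Sum>i\<in>A. f i) x = (\<Sum>i\<in>A. f i x :: real)"
  by (induction A rule: infinite_finite_induct) auto

text \<open>Independence of the indexed family also excludes repetitions, so that the index set
  itself counts the dimension.\<close>

lemma family_basis: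
  fixes e :: "'i \<Rightarrow> 'a \<Rightarrow> real"
  assumes "finite I"
    and ind: "\<And>c. (\<And>x. (\<Sum>i\<in>I. c i * e i x) = 0) \<Longrightarrow> \<forall>i\<in>I. c i = 0"
  shows "inj_on e I" "fs.independent (e ` I)"
    "fs.span (e ` I) = range (\<lambda>c x. \<Sum>i\<in>I. c i * e i x)"
proof -
  show inj: "inj_on e I"
  proof (rule inj_onI, rule ccontr)
    fix i j assume ij: "i \<in> I" "j \<in> I" "e i = e j" "i \<noteq> j"
    \<comment> \<open>If two members agreed, the difference of the two indicator coefficients would
      be a nontrivial relation.\<close>
    have "(\<Sum>k\<in>I. ((if k = i then 1 else 0) - (if k = j then 1 else 0)) * e k x) = 0" for x
      using ij assms(1) by (simp add: left_diff_distrib sum_subtractf if_distrib[of "\<lambda>u. u * _"] cong: if_cong)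
    from ind[OF this] ij show False by auto
  qed
  show "fs.independent (e ` I)"
  proof (rule fs.independent_if_scalars_zero)
    fix f x assume z: "(\<Sum>x\<in>e ` I. (\<lambda>y. f x * x y)) = 0" and x: "x \<in> e ` I"
    have "(\<Sum>i\<in>I. f (e i) * e i y) = 0" for y
      using fun_cong[OF z, of y] by (simp add: fun_sum_apply sum.reindex[OF inj])
    from ind[of "\<lambda>i. f (e i)", OF this] x show "f x = 0" by auto
  qed (simp add: assms)
  have "fs.span (e ` I) = range (\<lambda>u. \<Sum>v\<in>e ` I. (\<lambda>y. u v * v y))"
    using assms(1) by (simp add: fs.span_finite)
  also have "\<dots> = range (\<lambda>c x. \<Sum>i\<in>I. c i * e i x)"
  proof (intro equalityI subsetI; elim imageE)
    fix f u assume "f = (\<Sum>v\<in>e ` I. (\<lambda>y. u v * v y))"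
    then have "f = (\<lambda>x. \<Sum>i\<in>I. u (e i) * e i x)"
      by (auto simp: fun_eq_iff fun_sum_apply sum.reindex[OF inj])
    then show "f \<in> range (\<lambda>c x. \<Sum>i\<in>I. c i * e i x)" by (rule range_eqI[of _ _ "\<lambda>i. u (e i)"])
  next
    fix f c assume f: "f = (\<lambda>x. \<Sum>i\<in>I. c i * e i x)"
    have "f = (\<Sum>v\<in>e ` I. (\<lambda>y. c (inv_into I e v) * v y))"
      unfolding f by (auto simp: fun_eq_iff fun_sum_apply sum.reindex[OF inj] inv_into_f_f[OF inj] intro!: sum.cong)
    then show "f \<in> range (\<lambda>u. \<Sum>v\<in>e ` I. (\<lambda>y. u v * v y))" by (rule range_eqI[of _ _ "\<lambda>v. c (inv_into I e v)"])
  qed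
  finally show "fs.span (e ` I) = range (\<lambda>c x. \<Sum>i\<in>I. c i * e i x)" .
qed

lemma fdim_family:
  fixes e :: "'i \<Rightarrow> 'a \<Rightarrow> real"
  assumes "finite I" "\<And>c. (\<And>x. (\<Sum>i\<in>I. c i * e i x) = 0) \<Longrightarrow> \<forall>i\<in>I. c i = 0"
    and "K = range (\<lambda>c x. \<Sum>i\<in>I. c i * e i x)"
  shows "fdim K = card I"
proof -
  have "fdim K = fs.dim (fs.span (e ` I))"
    by (simp add: fdim_def family_basis(3)[OF assms(1,2)] assms(3))
  also have "\<dots> = card (e ` I)" by (rule fs.dim_span_eq_card_independent[OF family_basis(2)[OF assms(1,2)]])
  also have "\<dots> = card I" by (rule card_image[OF family_basis(1)[OF assms(1,2)]])
  finally show ?thesis .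
qed

text \<open>Evaluation at the points \<open>pt\<close> embeds \<open>K\<close> into a space of
  dimension \<open>card I\<close>, and \<open>card I\<close> independent members already fill such a
  space. Separation gives the upper bound and independence the lower one; no evaluation matrix has
  to be inverted.\<close>

lemma family_spans_by_evaluation:
  fixes e :: "'i \<Rightarrow> 'a \<Rightarrow> real" and pt :: "'i \<Rightarrow> 'a"
  assumes I: "finite I"
    and ind: "\<And>c. (\<And>x. (\<Sum>i\<in>I. c i * e i x) = 0) \<Longrightarrow> \<forall>i\<in>I. c i = 0"
    and K: "\<And>c T. T \<in> K \<Longrightarrow> (\<lambda>x. T x - (\<Sum>i\<in>I. c i * e i x)) \<in> K" "\<And>c. (\<lambda>x. \<Sum>i\<in>I. c i * e i x) \<in> K"
    and sep: "\<And>T. T \<in> K \<Longrightarrow> (\<And>i. i \<in> I \<Longrightarrow> T (pt i) = 0) \<Longrightarrow> T = (\<lambda>x. 0)"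
  shows "K = range (\<lambda>c x. \<Sum>i\<in>I. c i * e i x)"
proof
  show "range (\<lambda>c x. \<Sum>i\<in>I. c i * e i x) \<subseteq> K" using K(2) by auto
  show "K \<subseteq> range (\<lambda>c x. \<Sum>i\<in>I. c i * e i x)"
  proof
    fix T assume T: "T \<in> K"
    \<comment> \<open>Evaluation vectors are extended by 0 outside \<open>I\<close>, so that all of
      them lie in the span of the unit vectors \<open>d\<close>.\<close>
    define w where "w f j = (if j \<in> I then f (pt j) else (0::real))" for f :: "'a \<Rightarrow> real" and j
    define d where "d j k = (if k = j then 1 else (0::real))" for j k :: 'i
    have indw: "\<forall>i\<in>I. c i = 0" if z: "\<And>j. (\<Sum>i\<in>I. c i * w (e i) j) = 0" for c
    proof (rule ind)
      have "(\<lambda>x. \<Sum>i\<in>I. c i * e i x) = (\<lambda>x. 0)"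
      proof (rule sep[OF K(2)])
        fix j assume "j \<in> I"
        then show "(\<Sum>i\<in>I. c i * e i (pt j)) = 0" using z[of j] by (simp add: w_def)
      qed
      then show "(\<Sum>i\<in>I. c i * e i x) = 0" for x by (rule fun_cong)
    qed
    have indd: "\<forall>i\<in>I. c i = 0" if z: "\<And>j. (\<Sum>i\<in>I. c i * d i j) = 0" for c
    proof
      fix i assume "i \<in> I"
      then show "c i = 0" using z[of i] I by (simp add: d_def if_distrib[of "\<lambda>u. _ * u"] cong: if_cong)
    qed
    note bw = family_basis[of I "\<lambda>i. w (e i)", OF I indw]
    note bd = family_basis[of I d, OF I indd]
    have wd: "w f \<in> fs.span (d ` I)" for f
    proof -
      have *: "w f = (\<lambda>k. \<Sum>i\<in>I. w f i * d i k)"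
        using I by (auto simp: d_def w_def fun_eq_iff if_distrib[of "\<lambda>u. _ * u"] cong: if_cong)
      have sp: "fs.span (d ` I) = range (\<lambda>c x. \<Sum>i\<in>I. c i * d i x)" by (rule bd(3))
      have "w f \<in> range (\<lambda>c x. \<Sum>i\<in>I. c i * d i x)" by (rule range_eqI) (rule *)
      then show ?thesis unfolding sp .
    qed
    \<comment> \<open>Otherwise \<open>w T\<close> and the images of the family would be
      \<open>card I + 1\<close> independent vectors in a space spanned by \<open>card I\<close>
      vectors.\<close>
    have "w T \<in> fs.span ((\<lambda>i. w (e i)) ` I)"
    proof (rule ccontr)
      assume n: "w T \<notin> fs.span ((\<lambda>i. w (e i)) ` I)"
      then have "fs.independent (insert (w T) ((\<lambda>i. w (e i)) ` I))"
        using bw(2) by (simp add: fs.independent_insert)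
      moreover have "insert (w T) ((\<lambda>i. w (e i)) ` I) \<subseteq> fs.span (d ` I)" using wd by auto
      ultimately have "card (insert (w T) ((\<lambda>i. w (e i)) ` I)) \<le> card (d ` I)"
        by (rule fs.independent_span_bound[OF finite_imageI[OF I], THEN conjunct2])
      moreover have "w T \<notin> (\<lambda>i. w (e i)) ` I" using n
        by (rule contrapos_nn) (rule fs.span_base)
      ultimately show False using I by (simp add: card_image[OF bw(1)] card_image[OF bd(1)])
    qed
    moreover have "fs.span ((\<lambda>i. w (e i)) ` I) = range (\<lambda>c x. \<Sum>i\<in>I. c i * w (e i) x)" by (rule bw(3))
    ultimately have "w T \<in> range (\<lambda>c x. \<Sum>i\<in>I. c i * w (e i) x)" by simp
    then obtain c where c: "w T = (\<lambda>x. \<Sum>i\<in>I. c i * w (e i) x)" by (rule rangeE)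
    have "(\<lambda>x. T x - (\<Sum>i\<in>I. c i * e i x)) = (\<lambda>x. 0)"
    proof (rule sep[OF K(1)[OF T]])
      fix j assume "j \<in> I"
      then show "T (pt j) - (\<Sum>i\<in>I. c i * e i (pt j)) = 0" using fun_cong[OF c, of j] by (simp add: w_def)
    qed
    then have "T = (\<lambda>x. \<Sum>i\<in>I. c i * e i x)" by (auto simp: fun_eq_iff)
    then show "T \<in> range (\<lambda>c x. \<Sum>i\<in>I. c i * e i x)" by (rule range_eqI[of _ _ c])
  qed
qed

section \<open>Polynomials as divided-power arrays\<close>

text \<open>Polynomials are stored as arrays of divided-power coefficients, on which the partial
  derivatives act as index shifts.\<close>

definition mnm :: "nat \<Rightarrow> nat \<Rightarrow> nat \<Rightarrow> real^3 \<Rightarrow> real" where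
  "mnm a b c x = (x $ 1 ^ a / fact a) * (x $ 2 ^ b / fact b) * (x $ 3 ^ c / fact c)"

definition dp :: "nat \<Rightarrow> (nat \<Rightarrow> nat \<Rightarrow> nat \<Rightarrow> real) \<Rightarrow> real^3 \<Rightarrow> real" where
  "dp N s x = (\<Sum>a<N. \<Sum>b<N. \<Sum>c<N. s a b c * mnm a b c x)"

definition in_box :: "nat \<Rightarrow> (nat \<Rightarrow> nat \<Rightarrow> nat \<Rightarrow> real) \<Rightarrow> bool" where
  "in_box N s \<longleftrightarrow> (\<forall>a b c. N \<le> a \<or> N \<le> b \<or> N \<le> c \<longrightarrow> s a b c = 0)"

definition shift :: "nat \<Rightarrow> nat \<Rightarrow> nat \<Rightarrow> (nat \<Rightarrow> nat \<Rightarrow> nat \<Rightarrow> real) \<Rightarrow> nat \<Rightarrow> nat \<Rightarrow> nat \<Rightarrow> real" where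
  "shift i j k s a b c = s (i + a) (j + b) (k + c)"

lemma in_box_shift: "in_box N s \<Longrightarrow> in_box N (shift i j k s)"
  by (auto simp: in_box_def shift_def)

lemma smooth_power_coord: "smooth (\<lambda>x. x $ i ^ n)"
  by (induction n) (auto intro: smooth_mult smooth_coord smooth_const)

lemma smooth_mnm: "smooth (mnm a b c)"
proof -
  have "smooth (\<lambda>x. (x $ 1 ^ a * (1 / fact a)) * (x $ 2 ^ b * (1 / fact b)) * (x $ 3 ^ c * (1 / fact c)))"
    by (intro smooth_mult smooth_const smooth_power_coord)
  then show ?thesis by (simp add: mnm_def[abs_def])
qed

lemma smooth_dp: "smooth (dp N s)"
  unfolding dp_def by (intro smooth_sum smooth_mult smooth_const smooth_mnm)

lemma coord_line: "(x + t *\<^sub>R axis i (1::real)) $ j = x $ j + (if j = i then t else 0)"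
  by (simp add: axis_def)

lemma fact_div_Suc: "real n / fact n = (if n = 0 then 0 else 1 / fact (n - 1))"
  by (cases n) (simp_all del: of_nat_Suc)

lemma deriv_divided_power:
  "((\<lambda>t. (u + t) ^ n / fact n) has_field_derivative (if n = 0 then 0 else u ^ (n - 1) / fact (n - 1))) (at (0::real))"
proof (cases n)
  case (Suc m)
  have "((\<lambda>t. (u + t) ^ n / fact n) has_field_derivative real n * (u + 0) ^ (n - 1) * (0 + 1) / fact n) (at 0)"
    by (auto intro!: derivative_eq_intros)
  also have "real n * (u + 0) ^ (n - 1) * (0 + 1) / fact n = (real n / fact n) * u ^ (n - 1)" by simp
  finally show ?thesis unfolding fact_div_Suc by (simp add: Suc)
qed simp

lemma partial_mnm:
  "partial 1 (mnm a b c) x = (if a = 0 then 0 else mnm (a - 1) b c x)"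
  "partial 2 (mnm a b c) x = (if b = 0 then 0 else mnm a (b - 1) c x)"
  "partial 3 (mnm a b c) x = (if c = 0 then 0 else mnm a b (c - 1) x)"
proof -
  have "((\<lambda>t. (x $ 1 + t) ^ a / fact a * (x $ 2 ^ b / fact b) * (x $ 3 ^ c / fact c)) has_field_derivative
      (if a = 0 then 0 else x $ 1 ^ (a - 1) / fact (a - 1)) * (x $ 2 ^ b / fact b) * (x $ 3 ^ c / fact c)) (at 0)"
    by (intro DERIV_cmult_right deriv_divided_power)
  from DERIV_imp_deriv[OF this]
  have "deriv (\<lambda>t. mnm a b c (x + t *\<^sub>R axis 1 1)) 0 = (if a = 0 then 0 else x $ 1 ^ (a - 1) / fact (a - 1)) * (x $ 2 ^ b / fact b) * (x $ 3 ^ c / fact c)"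
    unfolding mnm_def coord_line by simp
  then show "partial 1 (mnm a b c) x = (if a = 0 then 0 else mnm (a - 1) b c x)"
    by (cases "a = 0") (simp_all add: partial_def mnm_def)
  have "((\<lambda>t. (x $ 1) ^ a / fact a * ((x $ 2 + t) ^ b / fact b) * (x $ 3 ^ c / fact c)) has_field_derivative
      (x $ 1 ^ a / fact a) * (if b = 0 then 0 else x $ 2 ^ (b - 1) / fact (b - 1)) * (x $ 3 ^ c / fact c)) (at 0)"
    by (intro DERIV_cmult_right DERIV_cmult deriv_divided_power)
  from DERIV_imp_deriv[OF this]
  have "deriv (\<lambda>t. mnm a b c (x + t *\<^sub>R axis 2 1)) 0 = (x $ 1 ^ a / fact a) * (if b = 0 then 0 else x $ 2 ^ (b - 1) / fact (b - 1)) * (x $ 3 ^ c / fact c)"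
    unfolding mnm_def coord_line by simp
  then show "partial 2 (mnm a b c) x = (if b = 0 then 0 else mnm a (b - 1) c x)"
    by (cases "b = 0") (simp_all add: partial_def mnm_def)
  have "((\<lambda>t. (x $ 1) ^ a / fact a * (x $ 2 ^ b / fact b) * ((x $ 3 + t) ^ c / fact c)) has_field_derivative
      (x $ 1 ^ a / fact a) * (x $ 2 ^ b / fact b) * (if c = 0 then 0 else x $ 3 ^ (c - 1) / fact (c - 1))) (at 0)"
    by (intro DERIV_cmult deriv_divided_power)
  from DERIV_imp_deriv[OF this]
  have "deriv (\<lambda>t. mnm a b c (x + t *\<^sub>R axis 3 1)) 0 = (x $ 1 ^ a / fact a) * (x $ 2 ^ b / fact b) * (if c = 0 then 0 else x $ 3 ^ (c - 1) / fact (c - 1))"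
    unfolding mnm_def coord_line by simp
  then show "partial 3 (mnm a b c) x = (if c = 0 then 0 else mnm a b (c - 1) x)"
    by (cases "c = 0") (simp_all add: partial_def mnm_def)
qed

lemma sum_shift_one:
  assumes "f 0 = 0" "f N = (0::real)" shows "(\<Sum>a<N. f a) = (\<Sum>a<N. f (Suc a))"
  using sum.lessThan_Suc_shift[of f N] assms by simp

lemma partial_dp_sum:
  "partial i (dp N s) x = (\<Sum>a<N. \<Sum>b<N. \<Sum>c<N. s a b c * partial i (mnm a b c) x)"
  unfolding dp_def
  by (simp add: partial_sum partial_cmult smooth_differentiable smooth_sum smooth_mult smooth_const smooth_mnm)

lemma partial_dp:
  assumes "in_box N s"
  shows "partial 1 (dp N s) = dp N (shift 1 0 0 s)" "partial 2 (dp N s) = dp N (shift 0 1 0 s)"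
    "partial 3 (dp N s) = dp N (shift 0 0 1 s)"
proof -
  have z: "s N b c = 0" "s a N c = 0" "s a b N = 0" for a b c using assms by (auto simp: in_box_def)
  show "partial 1 (dp N s) = dp N (shift 1 0 0 s)"
    by (rule ext, simp only: partial_dp_sum partial_mnm dp_def shift_def, subst sum_shift_one) (auto simp: z)
  show "partial 2 (dp N s) = dp N (shift 0 1 0 s)"
    by (rule ext, simp only: partial_dp_sum partial_mnm dp_def shift_def, rule sum.cong[OF refl], subst sum_shift_one) (auto simp: z)
  show "partial 3 (dp N s) = dp N (shift 0 0 1 s)"
    by (rule ext, simp only: partial_dp_sum partial_mnm dp_def shift_def, rule sum.cong[OF refl], rule sum.cong[OF refl], subst sum_shift_one) (auto simp: z)
qed

lemma shift_shift: "shift i j k (shift i' j' k' s) = shift (i + i') (j + j') (k + k') s"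
  by (auto simp: shift_def fun_eq_iff ac_simps)

lemma shift_0: "shift 0 0 0 s = s"
  by (auto simp: shift_def fun_eq_iff)

lemma D3_dp:
  assumes "in_box N s" shows "D3 a b c (dp N s) = dp N (shift a b c s)"
proof -
  have 1: "(partial 1 ^^ n) (dp N (shift a b c s)) = dp N (shift (n + a) b c s)" for n a b c
    by (induction n) (simp_all add: partial_dp in_box_shift assms shift_shift)
  have 2: "(partial 2 ^^ n) (dp N (shift a b c s)) = dp N (shift a (n + b) c s)" for n a b c
    by (induction n) (simp_all add: partial_dp in_box_shift assms shift_shift)
  have 3: "(partial 3 ^^ n) (dp N (shift a b c s)) = dp N (shift a b (n + c) s)" for n a b c
    by (induction n) (simp_all add: partial_dp in_box_shift assms shift_shift)
  show ?thesis
    using 1[of a 0 b c] 2[of b 0 0 c] 3[of c 0 0 0] by (simp add: D3_def shift_0)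
qed

lemma sum3_delta:
  fixes N :: nat
  assumes "i < N" "j < N" "k < N"
  shows "(\<Sum>a<N. \<Sum>b<N. \<Sum>c<N. if a = i \<and> b = j \<and> c = k then f a b c else 0) = (f i j k :: real)"
proof -
  have "(\<Sum>c<N. if a = i \<and> b = j \<and> c = k then f a b c else 0) = (if b = j then (if a = i then f a b k else 0) else 0)" for a b
    using assms by (cases "a = i \<and> b = j") auto
  then show ?thesis using assms by (simp add: sum.delta)
qed

lemma dp_at_0: assumes "N > 0" shows "dp N s 0 = s 0 0 0"
proof -
  have "s a b c * mnm a b c 0 = (if a = 0 \<and> b = 0 \<and> c = 0 then s a b c else 0)" for a b c
    by (auto simp: mnm_def power_0_left)
  then show ?thesis using assms by (simp add: dp_def sum3_delta)
qed

text \<open>The factorials in the divided powers make the entries equal to derivatives at the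
  origin, so an array can be read off its function.\<close>

lemma dp_coeff: "in_box N s \<Longrightarrow> N > 0 \<Longrightarrow> D3 a b c (dp N s) 0 = s a b c"
  by (simp add: D3_dp dp_at_0 shift_def)

lemma dp_inject:
  assumes "in_box N s" "in_box N s'" "N > 0" "dp N s = dp N s'" shows "s = s'"
  using dp_coeff[OF assms(1,3)] dp_coeff[OF assms(2,3)] assms(4) by (auto simp: fun_eq_iff)

lemma dp_zero: "dp N (\<lambda>a b c. 0) = (\<lambda>x. 0)"
  by (simp add: dp_def fun_eq_iff)

lemma dp_add: "dp N (\<lambda>a b c. s a b c + t a b c) x = dp N s x + dp N t x"
  by (simp add: dp_def algebra_simps sum.distrib)

lemma dp_cmult: "dp N (\<lambda>a b c. k * s a b c) x = k * dp N s x"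
  by (simp add: dp_def sum_distrib_left mult.assoc)

lemma dp_sum: "dp N (\<lambda>a b c. \<Sum>i\<in>A. f i a b c) x = (\<Sum>i\<in>A. dp N (f i) x)"
  by (induction A rule: infinite_finite_induct) (simp_all add: dp_zero dp_add)

definition dl :: "nat \<Rightarrow> nat \<Rightarrow> nat \<Rightarrow> nat \<Rightarrow> nat \<Rightarrow> nat \<Rightarrow> real" where
  "dl i j k a b c = (if a = i \<and> b = j \<and> c = k then 1 else 0)"

lemma dp_dl: assumes "i < N" "j < N" "k < N" shows "dp N (dl i j k) x = mnm i j k x"
proof -
  have "dl i j k a b c * mnm a b c x = (if a = i \<and> b = j \<and> c = k then mnm a b c x else 0)" for a b c
    by (simp add: dl_def)
  then show ?thesis using assms by (simp add: dp_def sum3_delta)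
qed

section \<open>Staircases of standard exponents and their recurrences\<close>

text \<open>The exponents of the monomials divisible by none of x1^2, x2^4, x3^6, the leading terms
  of the ideal generated by \<open>e1\<close>, \<open>e2\<close>, \<open>e3\<close>.\<close>

definition I48 :: "(nat \<times> nat \<times> nat) set" where
  "I48 = {..<2} \<times> {..<4} \<times> {..<6}"

text \<open>The exponents of the monomials divisible by none of x1^2, x2^4 x3^2, x2^8, x3^10, the
  leading terms of the ideal generated by \<open>e1\<close>, \<open>e3\<close>,
  \<open>e22\<close>.\<close>

definition I96 :: "(nat \<times> nat \<times> nat) set" where
  "I96 = {..<2} \<times> ({..<4} \<times> {..<10} \<union> {4..<8} \<times> {..<2})"

lemma I48_card: "finite I48" "card I48 = 48"
  by (simp_all add: I48_def)

lemma I96_card: "finite I96" "card I96 = 96"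
proof -
  have "{..<4} \<times> {..<10} \<inter> {4..<8} \<times> {..<2} = ({} :: (nat \<times> nat) set)" by auto
  then show "finite I96" "card I96 = 96" by (simp_all add: I96_def card_Un_disjoint)
qed

lemma array_step2:
  fixes t :: "nat \<Rightarrow> nat \<Rightarrow> nat \<Rightarrow> real"
  assumes r1: "\<And>a b c. t (a + 2) b c + t a (b + 2) c + t a b (c + 2) = 0"
    and z: "\<And>a b c. a < 2 \<Longrightarrow> t a b c = 0"
  shows "t a b c = 0"
proof (induction a arbitrary: b c rule: less_induct)
  case (less a)
  show ?case
  proof (cases "a < 2")
    case False
    then obtain a' where "a = a' + 2" by (metis add.commute le_Suc_ex not_less)
    with less r1[of a' b c] show ?thesis by simp
  qed (rule z)
qed

text \<open>The array \<open>t\<close> is a linear functional on monomials that vanishes on an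
  ideal. The relations derived below are members of this ideal whose leading terms rewrite every
  monomial to standard ones.\<close>

lemma I48_determines:
  fixes t :: "nat \<Rightarrow> nat \<Rightarrow> nat \<Rightarrow> real"
  assumes r1: "\<And>a b c. t (a + 2) b c + t a (b + 2) c + t a b (c + 2) = 0"
    and r2: "\<And>a b c. t (a + 2) (b + 2) c + t a (b + 2) (c + 2) + t (a + 2) b (c + 2) = 0"
    and r3: "\<And>a b c. t (a + 2) (b + 2) (c + 2) = 0"
    and z: "\<And>a b c. (a, b, c) \<in> I48 \<Longrightarrow> t a b c = 0"
  shows "t a b c = 0"
proof (rule array_step2[of t, OF r1])
  fix a b c :: nat assume a: "a < 2"
  \<comment> \<open>\<open>A\<close> and \<open>C\<close> are e3 and e2 after elimination of x1^2 by
    e1. \<open>V\<close> is x3^2 times \<open>C\<close> minus \<open>A\<close>.\<close>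
  have A: "t a (b + 4) (c + 2) + t a (b + 2) (c + 4) = 0" for b c
    using r1[of a "b + 2" "c + 2"] r3[of a b c] by (simp add: numeral_eq_Suc)
  have C: "t a (b + 4) c + t a (b + 2) (c + 2) + t a b (c + 4) = 0" for b c
    using r2[of a b c] r1[of a "b + 2" c] r1[of a b "c + 2"] by (simp add: numeral_eq_Suc)
  have V: "t a b (c + 6) = 0" for b c
    using C[of b "c + 2"] A[of b c] by (simp add: numeral_eq_Suc)
  show "t a b c = 0"
  proof (induction b arbitrary: c rule: less_induct)
    case (less b)
    show ?case
    proof (cases "b < 4")
      case True
      show ?thesis
      proof (cases "c < 6")
        case True
        then show ?thesis using a \<open>b < 4\<close> by (intro z) (simp add: I48_def)
      next
        case False
        then obtain c' where "c = c' + 6" by (metis add.commute le_Suc_ex not_less)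
        then show ?thesis using V by simp
      qed
    next
      case False
      then obtain b' where b': "b = b' + 4" by (metis add.commute le_Suc_ex not_less)
      with less[of "b' + 2" "c + 2"] less[of b' "c + 4"] C[of b' c] show ?thesis by simp
    qed
  qed
qed

text \<open>The same reduction with the square of e2 in place of e2. The staircase is no longer a
  box, because x2^4 is now reduced only in the company of x3^2.\<close>

lemma I96_determines:
  fixes t :: "nat \<Rightarrow> nat \<Rightarrow> nat \<Rightarrow> real"
  assumes r1: "\<And>a b c. t (a + 2) b c + t a (b + 2) c + t a b (c + 2) = 0"
    and r3: "\<And>a b c. t (a + 2) (b + 2) (c + 2) = 0"
    and r22: "\<And>a b c. t (a + 4) (b + 4) c + t a (b + 4) (c + 4) + t (a + 4) b (c + 4) = 0"
    and z: "\<And>a b c. (a, b, c) \<in> I96 \<Longrightarrow> t a b c = 0"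
  shows "t a b c = 0"
proof (rule array_step2[of t, OF r1])
  fix a b c :: nat assume a: "a < 2"
  have A: "t a (b + 4) (c + 2) + t a (b + 2) (c + 4) = 0" for b c
    using r1[of a "b + 2" "c + 2"] r3[of a b c] by (simp add: numeral_eq_Suc)
  \<comment> \<open>Modulo e1, x1^4 is the square of x2^2 + x3^2.\<close>
  have F: "t (a + 4) b c = t a (b + 4) c + 2 * t a (b + 2) (c + 2) + t a b (c + 4)" for b c
    using r1[of "a + 2" b c] r1[of a "b + 2" c] r1[of a b "c + 2"] by (simp add: numeral_eq_Suc)
  \<comment> \<open>Eliminating x1 from \<open>e22\<close> gives the coefficients 1, 2, 3, 2, 1. By
    \<open>A\<close> the three middle monomials agree up to alternating sign, so 2 - 3 + 2 = 1 of
    them survives.\<close>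
  have B: "t a (b + 8) c + t a (b + 2) (c + 6) + t a b (c + 8) = 0" for b c
    using r22[of a b c] F[of "b + 4" c] F[of b "c + 4"] A[of "b + 2" c] A[of b "c + 2"]
    by (simp add: numeral_eq_Suc)
  \<comment> \<open>After multiplication of \<open>B\<close> by x3^2, three uses of \<open>A\<close>
    carry x2^8 x3^2 to minus x2^2 x3^8, which cancels the second term.\<close>
  have V: "t a b (c + 10) = 0" for b c
    using B[of b "c + 2"] A[of "b + 4" c] A[of "b + 2" "c + 2"] A[of b "c + 4"] by (simp add: numeral_eq_Suc)
  show "t a b c = 0"
  proof (induction b arbitrary: c rule: less_induct)
    case (less b)
    \<comment> \<open>An exponent outside the staircase is divisible by one of the leading terms
      x3^10, x2^4 x3^2, x2^8.\<close>
    have "c \<ge> 10 \<or> (a, b, c) \<in> I96 \<or> b \<ge> 4 \<and> c \<ge> 2 \<or> b \<ge> 8 \<and> c < 2"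
      using a by (simp add: I96_def) arith
    then consider "c \<ge> 10" | "(a, b, c) \<in> I96" | "b \<ge> 4" "c \<ge> 2" | "b \<ge> 8" "c < 2"
      by blast
    then show ?case
    proof cases
      case 1
      then obtain c' where "c = c' + 10" by (metis add.commute le_Suc_ex)
      then show ?thesis using V by simp
    next
      \<comment> \<open>The rewriting trades powers of x2 for powers of x3. The exponent
        \<open>c\<close> grows, which is why the induction runs on \<open>b\<close> for all
        \<open>c\<close> at once.\<close>
      case 3
      then obtain b' c' where "b = b' + 4" "c = c' + 2" by (metis add.commute le_Suc_ex)
      with less[of "b' + 2" "c' + 4"] A[of b' c'] show ?thesis by simp
    next
      case 4
      then obtain b' where "b = b' + 8" by (metis add.commute le_Suc_ex)
      with less[of "b' + 2" "c + 6"] less[of b' "c + 8"] B[of b' c] show ?thesis by simp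
    qed (rule z)
  qed
qed

section \<open>The two kernels and their separation by finitely many values\<close>

text \<open>The set \<open>A\<close> encodes the symbol that is the sum of its monomials. The
  symbols used below have even degree, so the signs of the adjoint operator are all +1.\<close>

definition kills :: "(nat \<times> nat \<times> nat) set \<Rightarrow> functional3 \<Rightarrow> bool" where
  "kills A T \<longleftrightarrow> (\<forall>\<psi>. test_function \<psi> \<longrightarrow> (\<Sum>(a, b, c)\<in>A. T (D3 a b c \<psi>)) = 0)"

definition "e1 = {(2::nat, 0::nat, 0::nat), (0, 2, 0), (0, 0, 2)}"
definition "e2 = {(2::nat, 2::nat, 0::nat), (0, 2, 2), (2, 0, 2)}"
definition "e3 = {(2::nat, 2::nat, 2::nat)}"
definition "e22 = {(4::nat, 4::nat, 0::nat), (0, 4, 4), (4, 0, 4)}"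

text \<open>Modulo \<open>e1\<close> and \<open>e3\<close>, the square of the second elementary symmetric polynomial of the
  squares is the monomial symmetric polynomial \<open>e22\<close>.\<close>

definition K48 :: "functional3 set" where
  "K48 = {T. (\<forall>\<psi>. \<not> test_function \<psi> \<longrightarrow> T \<psi> = 0) \<and> tlin T \<and> kills e1 T \<and> kills e2 T \<and> kills e3 T}"

definition K96 :: "functional3 set" where
  "K96 = {T. (\<forall>\<psi>. \<not> test_function \<psi> \<longrightarrow> T \<psi> = 0) \<and> tlin T \<and> kills e1 T \<and> kills e3 T \<and> kills e22 T}"

lemma kills_shift:
  assumes "kills A T" "test_function \<psi>"
  shows "(\<Sum>(i, j, k)\<in>A. T (D3 (a + i) (b + j) (c + k) \<psi>)) = 0"
  using assms(1)[unfolded kills_def, rule_format, OF test_function_D3[OF assms(2), of a b c]]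
  by (simp add: D3_D3 test_function_smooth[OF assms(2)] ac_simps)

lemma kills_recurrences:
  assumes "test_function \<psi>"
  shows "kills e1 T \<Longrightarrow> T (D3 (a + 2) b c \<psi>) + T (D3 a (b + 2) c \<psi>) + T (D3 a b (c + 2) \<psi>) = 0"
    "kills e2 T \<Longrightarrow> T (D3 (a + 2) (b + 2) c \<psi>) + T (D3 a (b + 2) (c + 2) \<psi>) + T (D3 (a + 2) b (c + 2) \<psi>) = 0"
    "kills e3 T \<Longrightarrow> T (D3 (a + 2) (b + 2) (c + 2) \<psi>) = 0"
    "kills e22 T \<Longrightarrow> T (D3 (a + 4) (b + 4) c \<psi>) + T (D3 a (b + 4) (c + 4) \<psi>) + T (D3 (a + 4) b (c + 4) \<psi>) = 0"
  using kills_shift[OF _ assms(1), of e1 T a b c] kills_shift[OF _ assms(1), of e2 T a b c]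
    kills_shift[OF _ assms(1), of e3 T a b c] kills_shift[OF _ assms(1), of e22 T a b c]
  by (simp_all add: e1_def e2_def e3_def e22_def add.assoc)

text \<open>The staircase argument is used twice: on the values at derivatives of
  \<open>chi3\<close>, and on the derivatives of high order of an arbitrary test function. These are
  the two inputs of \<open>tlin_determined\<close>.\<close>

lemma K48_separated:
  assumes T: "T \<in> K48" and z: "\<And>a b c. (a, b, c) \<in> I48 \<Longrightarrow> T (D3 a b c chi3) = 0"
  shows "T = (\<lambda>x. 0)"
proof
  fix \<psi>
  have k: "kills e1 T" "kills e2 T" "kills e3 T" "tlin T" using T by (auto simp: K48_def)
  show "T \<psi> = 0"
  proof (cases "test_function \<psi>")
    case True
    show ?thesis
    \<comment> \<open>Total degrees are at most 9 in \<open>I48\<close> and at most 13 in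
      \<open>I96\<close>; the order 14 lies beyond both.\<close>
    proof (rule tlin_determined[OF k(4) _ _ True, where N = 14])
      show "T (D3 a b c chi3) = 0" for a b c
        by (rule I48_determines[of "\<lambda>a b c. T (D3 a b c chi3)",
              OF kills_recurrences(1)[OF test_function_chi3 k(1)] kills_recurrences(2)[OF test_function_chi3 k(2)] kills_recurrences(3)[OF test_function_chi3 k(3)] z])
      fix a b c \<eta> assume s: "a + b + c = (14::nat)" and \<eta>: "test_function \<eta>"
      \<comment> \<open>The recurrences are homogeneous, so they survive when all entries of total
        degree below 14 are replaced by 0. The truncated array is then 0 on the whole
        staircase.\<close>
      define t where "t a b c = (if a + b + c \<ge> 14 then T (D3 a b c \<eta>) else 0)" for a b c
      have "t a b c = 0"
      proof (rule I48_determines[of t])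
        show "t (a + 2) b c + t a (b + 2) c + t a b (c + 2) = 0" for a b c
          using kills_recurrences(1)[OF \<eta> k(1), of a b c] by (auto simp: t_def)
        show "t (a + 2) (b + 2) c + t a (b + 2) (c + 2) + t (a + 2) b (c + 2) = 0" for a b c
          using kills_recurrences(2)[OF \<eta> k(2), of a b c] by (auto simp: t_def)
        show "t (a + 2) (b + 2) (c + 2) = 0" for a b c
          using kills_recurrences(3)[OF \<eta> k(3), of a b c] by (auto simp: t_def)
        show "t a b c = 0" if "(a, b, c) \<in> I48" for a b c
          using that by (auto simp: t_def I48_def)
      qed
      then show "T (D3 a b c \<eta>) = 0" using s by (simp add: t_def)
    qed
  qed (use T in \<open>auto simp: K48_def\<close>)
qed

lemma K96_separated:
  assumes T: "T \<in> K96" and z: "\<And>a b c. (a, b, c) \<in> I96 \<Longrightarrow> T (D3 a b c chi3) = 0"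
  shows "T = (\<lambda>x. 0)"
proof
  fix \<psi>
  have k: "kills e1 T" "kills e3 T" "kills e22 T" "tlin T" using T by (auto simp: K96_def)
  show "T \<psi> = 0"
  proof (cases "test_function \<psi>")
    case True
    show ?thesis
    proof (rule tlin_determined[OF k(4) _ _ True, where N = 14])
      show "T (D3 a b c chi3) = 0" for a b c
        by (rule I96_determines[of "\<lambda>a b c. T (D3 a b c chi3)",
              OF kills_recurrences(1)[OF test_function_chi3 k(1)] kills_recurrences(3)[OF test_function_chi3 k(2)] kills_recurrences(4)[OF test_function_chi3 k(3)] z])
      fix a b c \<eta> assume s: "a + b + c = (14::nat)" and \<eta>: "test_function \<eta>"
      \<comment> \<open>The largest degree in \<open>I96\<close> is 1 + 3 + 9 = 13, so truncation at
        14 again clears the whole staircase.\<close>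
      define t where "t a b c = (if a + b + c \<ge> 14 then T (D3 a b c \<eta>) else 0)" for a b c
      have "t a b c = 0"
      proof (rule I96_determines[of t])
        show "t (a + 2) b c + t a (b + 2) c + t a b (c + 2) = 0" for a b c
          using kills_recurrences(1)[OF \<eta> k(1), of a b c] by (auto simp: t_def)
        show "t (a + 2) (b + 2) (c + 2) = 0" for a b c
          using kills_recurrences(3)[OF \<eta> k(2), of a b c] by (auto simp: t_def)
        show "t (a + 4) (b + 4) c + t a (b + 4) (c + 4) + t (a + 4) b (c + 4) = 0" for a b c
          using kills_recurrences(4)[OF \<eta> k(3), of a b c] by (auto simp: t_def)
        show "t a b c = 0" if "(a, b, c) \<in> I96" for a b c
          using that by (auto simp: t_def I96_def)
      qed
      then show "T (D3 a b c \<eta>) = 0" using s by (simp add: t_def)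
    qed
  qed (use T in \<open>auto simp: K96_def\<close>)
qed

section \<open>Alternating arrays and symmetric operators\<close>

text \<open>Antisymmetrisation: the arrays of \<open>Delta_B3\<close> and \<open>F_gen\<close> are, up to the factors
  \<open>5! 3! 1!\<close> and \<open>5 * 9! 3! 1! = 18 * 7! 5! 1!\<close>, alternating with entries in \<open>{-1, 0, 1}\<close>.\<close>

definition asym :: "(nat \<Rightarrow> nat \<Rightarrow> nat \<Rightarrow> real) \<Rightarrow> nat \<Rightarrow> nat \<Rightarrow> nat \<Rightarrow> real" where
  "asym h a b c = h a b c - h b a c + h b c a - h c b a + h c a b - h a c b"

definition sDelta :: "nat \<Rightarrow> nat \<Rightarrow> nat \<Rightarrow> real" where
  "sDelta = asym (\<lambda>a b c. - dl 5 3 1 a b c)"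

definition sF :: "nat \<Rightarrow> nat \<Rightarrow> nat \<Rightarrow> real" where
  "sF = asym (\<lambda>a b c. dl 7 5 1 a b c - dl 9 3 1 a b c)"

lemma dl_perm: "dl i j k b a c = dl j i k a b c" "dl i j k a c b = dl i k j a b c"
  "dl i j k b c a = dl k i j a b c" "dl i j k c b a = dl k j i a b c" "dl i j k c a b = dl j k i a b c"
  by (auto simp: dl_def)

lemma sDelta_eq: "sDelta a b c = - dl 5 3 1 a b c + dl 3 5 1 a b c - dl 1 5 3 a b c + dl 1 3 5 a b c
    - dl 3 1 5 a b c + dl 5 1 3 a b c"
  by (simp add: sDelta_def asym_def dl_perm)

lemma sF_eq: "sF a b c = (dl 7 5 1 a b c - dl 9 3 1 a b c) - (dl 5 7 1 a b c - dl 3 9 1 a b c)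
    + (dl 1 7 5 a b c - dl 1 9 3 a b c) - (dl 1 5 7 a b c - dl 1 3 9 a b c)
    + (dl 5 1 7 a b c - dl 3 1 9 a b c) - (dl 7 1 5 a b c - dl 9 1 3 a b c)"
  by (simp add: sF_def asym_def dl_perm)

lemma in_box_dl: "i < N \<Longrightarrow> j < N \<Longrightarrow> k < N \<Longrightarrow> in_box N (dl i j k)"
  by (auto simp: in_box_def dl_def)

lemma in_box_lin: "in_box N s \<Longrightarrow> in_box N t \<Longrightarrow> in_box N (\<lambda>a b c. s a b c + t a b c)"
  "in_box N s \<Longrightarrow> in_box N t \<Longrightarrow> in_box N (\<lambda>a b c. s a b c - t a b c)"
  "in_box N s \<Longrightarrow> in_box N (\<lambda>a b c. - s a b c)"
  by (auto simp: in_box_def)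

lemma in_box_sDelta: "in_box 10 sDelta" and in_box_sF: "in_box 10 sF"
  unfolding sDelta_eq[abs_def] sF_eq[abs_def] by (intro in_box_lin in_box_dl; simp)+

lemma dp_minus: "dp N (\<lambda>a b c. - s a b c) x = - dp N s x"
  using dp_cmult[of N "-1" s x] by simp

lemma dp_diff: "dp N (\<lambda>a b c. s a b c - t a b c) x = dp N s x - dp N t x"
  using dp_add[of N s "\<lambda>a b c. - t a b c" x] by (simp add: dp_minus)

lemma Delta_dp: "Delta_B3 x = 720 * dp 10 sDelta x"
  unfolding sDelta_eq[abs_def] dp_add dp_diff dp_minus Delta_B3_def
  by (simp add: dp_dl mnm_def fact_numeral) (simp add: field_simps; algebra)

lemma F_dp: "F_gen x = 10886400 * dp 10 sF x"
  unfolding sF_eq[abs_def] dp_add dp_diff dp_minus F_gen_def Delta_B3_def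
  by (simp add: dp_dl mnm_def fact_numeral) (simp add: field_simps; algebra)

text \<open>On divided-power arrays a differential operator acts by contraction with its coefficient
  array. All arrays it is applied to vanish once an exponent reaches 10.\<close>

definition act :: "(nat \<Rightarrow> nat \<Rightarrow> nat \<Rightarrow> real) \<Rightarrow> (nat \<Rightarrow> nat \<Rightarrow> nat \<Rightarrow> real) \<Rightarrow> nat \<Rightarrow> nat \<Rightarrow> nat \<Rightarrow> real" where
  "act co s a' b' c' = (\<Sum>a<10. \<Sum>b<10. \<Sum>c<10. co a b c * s (a + a') (b + b') (c + c'))"

lemma act_zeroI:
  assumes "\<And>i j k. co i j k * s (i + a) (j + b) (k + c) = 0" shows "act co s a b c = 0"
  unfolding act_def by (intro sum.neutral ballI assms)

text \<open>Invariance under signed permutations, read on coefficients: the two adjacent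
  transpositions generate the permutations, and the sign changes force even exponents.\<close>

definition symmetric_even :: "(nat \<Rightarrow> nat \<Rightarrow> nat \<Rightarrow> real) \<Rightarrow> bool" where
  "symmetric_even co \<longleftrightarrow> (\<forall>a b c. co b a c = co a b c \<and> co a c b = co a b c \<and>
     (co a b c \<noteq> 0 \<longrightarrow> even a \<and> even b \<and> even c))"

lemma act_swap:
  assumes "symmetric_even co" "\<And>a b c. s b a c = - s a b c" "\<And>a b c. s a c b = - s a b c"
  shows "act co s b' a' c' = - act co s a' b' c'" "act co s a' c' b' = - act co s a' b' c'"
proof -
  have co: "co b a c = co a b c" "co a c b = co a b c" for a b c
    using assms(1) by (simp_all add: symmetric_even_def)
  have "act co s b' a' c' = (\<Sum>b<10. \<Sum>a<10. \<Sum>c<10. co a b c * s (a + b') (b + a') (c + c'))"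
    unfolding act_def by (rule sum.swap)
  also have "\<dots> = (\<Sum>b<10. \<Sum>a<10. \<Sum>c<10. - (co b a c * s (b + a') (a + b') (c + c')))"
    by (intro sum.cong refl) (simp add: co(1)[of _ _] assms(2)[of "_ + b'" "_ + a'"])
  finally show "act co s b' a' c' = - act co s a' b' c'"
    by (simp add: act_def sum_negf)
  have "act co s a' c' b' = (\<Sum>a<10. \<Sum>c<10. \<Sum>b<10. co a b c * s (a + a') (b + c') (c + b'))"
    unfolding act_def by (intro sum.cong refl sum.swap)
  also have "\<dots> = (\<Sum>a<10. \<Sum>c<10. \<Sum>b<10. - (co a c b * s (a + a') (c + b') (b + c')))"
    by (intro sum.cong refl) (simp add: co(2)[of _ _] assms(3)[of _ "_ + c'" "_ + b'"])
  finally show "act co s a' c' b' = - act co s a' b' c'"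
    by (simp add: act_def sum_negf)
qed

text \<open>A symmetric even operator maps an alternating array with odd support to another one.
  Such an array vanishes as soon as it does on strictly decreasing odd exponents.\<close>

lemma act_eq_0I:
  assumes co: "symmetric_even co" and s: "\<And>a b c. s b a c = - s a b c" "\<And>a b c. s a c b = - s a b c"
    and odd: "\<And>a b c. s a b c \<noteq> 0 \<Longrightarrow> odd a \<and> odd b \<and> odd c"
    and sorted: "\<And>a b c. a > b \<Longrightarrow> b > c \<Longrightarrow> odd a \<Longrightarrow> odd b \<Longrightarrow> odd c \<Longrightarrow> act co s a b c = 0"
  shows "act co s a b c = 0"
proof (cases "odd a \<and> odd b \<and> odd c")
  case False
  have "co i j k * s (i + a) (j + b) (k + c) = 0" for i j k
    using odd[of "i + a" "j + b" "k + c"] co False by (auto simp: symmetric_even_def)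
  then show ?thesis by (rule act_zeroI)
next
  case True
  note sw = act_swap[OF co, of s, OF s]
  have "act co s a b c = 0" if "a = b \<or> b = c \<or> a = c"
    using that sw(1)[of a b c] sw(2)[of a c b] sw(1)[of b a c] sw(2)[of b c a] sw(1)[of c b a] by auto
  moreover have "act co s a b c = 0" if "a > b" "b > c" by (intro sorted that) (use True in auto)
  moreover have "act co s a b c = 0" if "a > c" "c > b"
    using sorted[OF that] True sw(2)[of a b c] by simp
  moreover have "act co s a b c = 0" if "b > a" "a > c"
    using sorted[OF that] True sw(1)[of a b c] by simp
  moreover have "act co s a b c = 0" if "b > c" "c > a"
    using sorted[OF that] True sw(1)[of a b c] sw(2)[of b a c] by simp
  moreover have "act co s a b c = 0" if "c > a" "a > b"
    using sorted[OF that] True sw(2)[of a b c] sw(1)[of a c b] by simp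
  moreover have "act co s a b c = 0" if "c > b" "b > a"
    using sorted[OF that] True sw(1)[of a b c] sw(2)[of b a c] sw(1)[of b c a] by simp
  ultimately show ?thesis by (metis linorder_neqE_nat)
qed

lemma act_dl:
  assumes "i < 10" "j < 10" "k < 10"
  shows "act co (dl i j k) a' b' c' = (if a' \<le> i \<and> b' \<le> j \<and> c' \<le> k then co (i - a') (j - b') (k - c') else 0)"
proof (cases "a' \<le> i \<and> b' \<le> j \<and> c' \<le> k")
  case True
  then have "co a b c * dl i j k (a + a') (b + b') (c + c') =
      (if a = i - a' \<and> b = j - b' \<and> c = k - c' then co a b c else 0)" for a b c
    by (auto simp: dl_def)
  then show ?thesis using True assms by (simp add: act_def sum3_delta)
next
  case False
  then have "dl i j k (a + a') (b + b') (c + c') = 0" for a b c by (auto simp: dl_def)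
  then show ?thesis using False by (auto simp: act_def)
qed

lemma act_lin:
  "act co (\<lambda>a b c. s a b c + t a b c) a' b' c' = act co s a' b' c' + act co t a' b' c'"
  "act co (\<lambda>a b c. s a b c - t a b c) a' b' c' = act co s a' b' c' - act co t a' b' c'"
  "act co (\<lambda>a b c. - s a b c) a' b' c' = - act co s a' b' c'"
  by (simp_all add: act_def algebra_simps sum.distrib sum_subtractf sum_negf)

lemma asym_swap: "asym h b a c = - asym h a b c" "asym h a c b = - asym h a b c"
  by (simp_all add: asym_def)

lemma sDelta_swap: "sDelta b a c = - sDelta a b c" "sDelta a c b = - sDelta a b c"
  unfolding sDelta_def by (rule asym_swap)+

lemma sF_swap: "sF b a c = - sF a b c" "sF a c b = - sF a b c"
  unfolding sF_def by (rule asym_swap)+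

lemma sDelta_support: "sDelta a b c \<noteq> 0 \<Longrightarrow> odd a \<and> odd b \<and> odd c \<and> a + b + c = 9"
  by (auto simp: sDelta_eq dl_def split: if_splits)

lemma sF_support: "sF a b c \<noteq> 0 \<Longrightarrow> odd a \<and> odd b \<and> odd c \<and> a + b + c = 13"
  by (auto simp: sF_eq dl_def split: if_splits)

lemma sorted_odd_ge:
  assumes "a > b" "b > c" "odd a" "odd b" "odd (c::nat)" shows "c \<ge> 1" "b \<ge> 3" "a \<ge> 5" "b \<ge> c + 2" "a \<ge> b + 2"
  using assms by presburger+

text \<open>An alternating array of odd exponents has total degree at least \<open>5 + 3 + 1\<close>, so a
  symmetric even operator of positive order annihilates \<open>sDelta\<close> and one of order greater than
  \<open>4\<close> annihilates \<open>sF\<close>.\<close>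

lemma act_sDelta:
  assumes co: "symmetric_even co" and z: "co 0 0 0 = 0"
  shows "act co sDelta a b c = 0"
proof (rule act_eq_0I[OF co sDelta_swap])
  fix a b c :: nat assume *: "a > b" "b > c" "odd a" "odd b" "odd c"
  have "co i j k * sDelta (i + a) (j + b) (k + c) = 0" for i j k
  proof (rule ccontr)
    assume "co i j k * sDelta (i + a) (j + b) (k + c) \<noteq> 0"
    then have "co i j k \<noteq> 0" "i + a + (j + b) + (k + c) = 9" using sDelta_support by auto
    then have "i = 0" "j = 0" "k = 0" using sorted_odd_ge[OF *] by linarith+
    with z \<open>co i j k \<noteq> 0\<close> show False by simp
  qed
  then show "act co sDelta a b c = 0" by (rule act_zeroI)
qed (use sDelta_support in blast)

lemma act_sF_expand: "act co sF a b c =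
    (act co (dl 7 5 1) a b c - act co (dl 9 3 1) a b c) - (act co (dl 5 7 1) a b c - act co (dl 3 9 1) a b c)
    + (act co (dl 1 7 5) a b c - act co (dl 1 9 3) a b c) - (act co (dl 1 5 7) a b c - act co (dl 1 3 9) a b c)
    + (act co (dl 5 1 7) a b c - act co (dl 3 1 9) a b c) - (act co (dl 7 1 5) a b c - act co (dl 9 1 3) a b c)"
  unfolding sF_eq[abs_def] act_lin by (rule refl)

lemma act_sDelta_expand: "act co sDelta a b c =
    - act co (dl 5 3 1) a b c + act co (dl 3 5 1) a b c - act co (dl 1 5 3) a b c + act co (dl 1 3 5) a b c
    - act co (dl 3 1 5) a b c + act co (dl 5 1 3) a b c"
  unfolding sDelta_eq[abs_def] act_lin by (rule refl)

text \<open>What remains are the orders 2 and 4, with the single sorted targets (7,3,1) and (5,3,1).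
  There the entries at (7,5,1) and (9,3,1) carry opposite signs: order 2 cancels by symmetry of
  \<open>co\<close>, order 4 under \<open>m4\<close>.\<close>

lemma act_sF:
  assumes co: "symmetric_even co" and hom: "\<And>a b c. co a b c \<noteq> 0 \<Longrightarrow> a + b + c = m" and m: "m \<ge> 1"
    and m4: "m = 4 \<Longrightarrow> co 2 2 0 = 2 * co 4 0 0"
  shows "act co sF a b c = 0"
proof (rule act_eq_0I[OF co sF_swap])
  fix a b c :: nat assume *: "a > b" "b > c" "odd a" "odd b" "odd c"
  show "act co sF a b c = 0"
  proof (rule ccontr)
    assume nz: "act co sF a b c \<noteq> 0"
    have "\<exists>i j k. co i j k * sF (i + a) (j + b) (k + c) \<noteq> 0"
    proof (rule ccontr)
      assume "\<not> ?thesis"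
      then have "act co sF a b c = 0" by (intro act_zeroI) blast
      with nz show False by simp
    qed
    then obtain i j k where ijk: "co i j k \<noteq> 0" "sF (i + a) (j + b) (k + c) \<noteq> 0" by auto
    have tot: "i + a + (j + b) + (k + c) = 13" using sF_support[OF ijk(2)] by simp
    have ev: "even i" "even j" "even k" using co ijk(1) by (auto simp: symmetric_even_def)
    have sum: "i + j + k = m" by (rule hom[OF ijk(1)])
    have coz: "co a b c = 0" if "a + b + c \<noteq> m" for a b c using hom[of a b c] that by blast
    have sy: "co b a c = co a b c" "co a c b = co a b c" for a b c
      using co by (simp_all add: symmetric_even_def)
    note ge = sorted_odd_ge[OF *]
    have "m \<le> 4" using tot sum ge by linarith
    moreover have "even m" using ev sum by auto
    ultimately have "m = 2 \<or> m = 4" using m by presburger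
    then consider "m = 2" | "m = 4" by blast
    then show False
    proof cases
      case 1
      then have s11: "a + b + c = 11" using tot sum by linarith
      then have "c < 3" using ge by linarith
      then have c: "c = 1" using \<open>odd c\<close> by presburger
      have "b < 5" using s11 ge by linarith
      then have b: "b = 3" using \<open>odd b\<close> ge(2) by presburger
      have a: "a = 7" using s11 b c by simp
      from a b c have "act co sF a b c = co 0 2 0 - co 2 0 0"
        by (simp add: act_sF_expand act_dl coz 1)
      then show False using nz sy(1)[of 2 0 0] by simp
    next
      case 2
      then have "a + b + c = 9" using tot sum by linarith
      then have "c = 1" "b = 3" "a = 5" using ge by linarith+
      then have "act co sF a b c = co 2 2 0 - co 4 0 0 - co 0 4 0"
        by (simp add: act_sF_expand act_dl coz 2)
      then show False using nz m4[OF 2] sy(1)[of 4 0 0] by simp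
    qed
  qed
qed (use sF_support in blast)

definition masked :: "(nat \<times> nat \<times> nat) set \<Rightarrow> (nat \<times> nat \<times> nat \<Rightarrow> real) \<Rightarrow> nat \<Rightarrow> nat \<Rightarrow> nat \<Rightarrow> real" where
  "masked I f a b c = (if (a, b, c) \<in> I then f (a, b, c) else 0)"

lemma act_masked:
  assumes "I \<subseteq> {..<10} \<times> {..<10} \<times> {..<10}"
  shows "act (masked I f) s a' b' c' = (\<Sum>(a, b, c)\<in>I. f (a, b, c) * s (a + a') (b + b') (c + c'))"
proof -
  have "act (masked I f) s a' b' c' = (\<Sum>(a, b, c)\<in>{..<10} \<times> {..<10} \<times> {..<10}. masked I f a b c * s (a + a') (b + b') (c + c'))"
    by (simp add: act_def sum.cartesian_product)
  also have "\<dots> = (\<Sum>(a, b, c)\<in>I. masked I f a b c * s (a + a') (b + b') (c + c'))"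
    using assms by (intro sum.mono_neutral_right) (auto simp: masked_def)
  also have "\<dots> = (\<Sum>(a, b, c)\<in>I. f (a, b, c) * s (a + a') (b + b') (c + c'))"
    by (intro sum.cong) (auto simp: masked_def)
  finally show ?thesis .
qed

lemma I48_box: "I48 \<subseteq> {..<10} \<times> {..<10} \<times> {..<10}" and I96_box: "I96 \<subseteq> {..<10} \<times> {..<10} \<times> {..<10}"
  by (auto simp: I48_def I96_def)

text \<open>The pairing of the standard monomials with themselves given by the top array is unitriangular
  up to sign within each parity class.\<close>

lemma sF_independent:
  assumes z: "\<And>a' b' c'. (\<Sum>(a, b, c)\<in>I96. f (a, b, c) * sF (a + a') (b + b') (c + c')) = 0"
    and i: "i \<in> I96"
  shows "f i = 0"
proof -
  define co where "co = masked I96 f"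
  have co0: "co a b c = 0" if "\<not> (a < 2 \<and> (b < 4 \<and> c < 10 \<or> b < 8 \<and> c < 2))" for a b c
    using that by (auto simp: co_def masked_def I96_def)
  have E: "act co sF a b c = 0" for a b c
    unfolding co_def act_masked[OF I96_box] by (rule z)
  \<comment> \<open>The support of \<open>sF\<close> is odd, so evaluation at \<open>1 - e\<close>,
    \<open>1 - p + 2 * i\<close>, \<open>1 - q + 2 * j\<close> sees one parity class only. Each of
    the eight classes has twelve unknowns and gets twelve equations, solved from high degree to
    low.\<close>
  have key: "co e (p + 2 * i) (q + 2 * j) = 0" if e: "e = 0 \<or> e = 1" and p: "p = 0 \<or> p = 1" and q: "q = 0 \<or> q = 1"
    and ij: "i < 2 \<and> j < 5 \<or> i < 4 \<and> j < 1" for e p q i j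
  proof -
    define C where "C i j = co e (p + 2 * i) (q + 2 * j)" for i j
    have E': "act co sF (1 - e) (1 - p + 2 * i) (1 - q + 2 * j) = 0" for i j by (rule E)
    have "C 1 4 = 0" using E'[of 0 0] e p q by (auto simp: C_def act_sF_expand act_dl co0 numeral_2_eq_2[symmetric] numeral_3_eq_3[symmetric])
    moreover have "C 0 4 = C 1 3" using E'[of 1 0] e p q by (auto simp: C_def act_sF_expand act_dl co0 numeral_2_eq_2[symmetric] numeral_3_eq_3[symmetric])
    moreover have "C 1 3 = 0" using E'[of 0 1] e p q by (auto simp: C_def act_sF_expand act_dl co0 numeral_2_eq_2[symmetric] numeral_3_eq_3[symmetric])
    moreover have "C 1 2 = C 0 3" using E'[of 2 0] e p q by (auto simp: C_def act_sF_expand act_dl co0 numeral_2_eq_2[symmetric] numeral_3_eq_3[symmetric])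
    moreover have "C 0 3 - C 1 2 - C 3 0 = 0" using E'[of 1 1] e p q by (auto simp: C_def act_sF_expand act_dl co0 numeral_2_eq_2[symmetric] numeral_3_eq_3[symmetric])
    moreover have "C 3 0 + C 1 2 = 0" using E'[of 0 2] e p q by (auto simp: C_def act_sF_expand act_dl co0 numeral_2_eq_2[symmetric] numeral_3_eq_3[symmetric])
    moreover have "C 0 2 = C 1 1" using E'[of 3 0] e p q by (auto simp: C_def act_sF_expand act_dl co0 numeral_2_eq_2[symmetric] numeral_3_eq_3[symmetric])
    moreover have "C 1 1 - C 0 2 - C 2 0 = 0" using E'[of 2 1] e p q by (auto simp: C_def act_sF_expand act_dl co0 numeral_2_eq_2[symmetric] numeral_3_eq_3[symmetric])
    moreover have "C 1 1 = C 2 0" using E'[of 0 3] e p q by (auto simp: C_def act_sF_expand act_dl co0 numeral_2_eq_2[symmetric] numeral_3_eq_3[symmetric])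
    moreover have "C 0 1 = 0" using E'[of 4 0] e p q by (auto simp: C_def act_sF_expand act_dl co0 numeral_2_eq_2[symmetric] numeral_3_eq_3[symmetric])
    moreover have "C 0 1 = C 1 0" using E'[of 3 1] e p q by (auto simp: C_def act_sF_expand act_dl co0 numeral_2_eq_2[symmetric] numeral_3_eq_3[symmetric])
    moreover have "C 0 0 = 0" using E'[of 4 1] e p q by (auto simp: C_def act_sF_expand act_dl co0 numeral_2_eq_2[symmetric] numeral_3_eq_3[symmetric])
    moreover have "(i = 0 \<or> i = 1) \<and> (j = 0 \<or> j = 1 \<or> j = 2 \<or> j = 3 \<or> j = 4) \<or> (i = 2 \<or> i = 3) \<and> j = 0" using ij by auto
    ultimately have "C i j = 0" by auto
    then show ?thesis by (simp add: C_def)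
  qed
  obtain a b c where abc: "i = (a, b, c)" by (cases i)
  have "co a (b mod 2 + 2 * (b div 2)) (c mod 2 + 2 * (c div 2)) = 0"
    using i by (intro key) (auto simp: abc I96_def)
  then show ?thesis using i by (simp add: abc co_def masked_def)
qed

lemma sDelta_independent:
  assumes z: "\<And>a' b' c'. (\<Sum>(a, b, c)\<in>I48. f (a, b, c) * sDelta (a + a') (b + b') (c + c')) = 0"
    and i: "i \<in> I48"
  shows "f i = 0"
proof -
  define co where "co = masked I48 f"
  have co0: "co a b c = 0" if "\<not> (a < 2 \<and> b < 4 \<and> c < 6)" for a b c
    using that by (auto simp: co_def masked_def I48_def)
  have E: "act co sDelta a b c = 0" for a b c
    unfolding co_def act_masked[OF I48_box] by (rule z)
  have key: "co e (p + 2 * i) (q + 2 * j) = 0" if e: "e = 0 \<or> e = 1" and p: "p = 0 \<or> p = 1" and q: "q = 0 \<or> q = 1"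
    and ij: "i < 2" "j < 3" for e p q i j
  proof -
    define C where "C i j = co e (p + 2 * i) (q + 2 * j)" for i j
    have E': "act co sDelta (1 - e) (1 - p + 2 * i) (1 - q + 2 * j) = 0" for i j by (rule E)
    have "C 1 2 = 0" using E'[of 0 0] e p q by (auto simp: C_def act_sDelta_expand act_dl co0 numeral_2_eq_2[symmetric] numeral_3_eq_3[symmetric])
    moreover have "C 0 2 = C 1 1" using E'[of 1 0] e p q by (auto simp: C_def act_sDelta_expand act_dl co0 numeral_2_eq_2[symmetric] numeral_3_eq_3[symmetric])
    moreover have "C 1 1 = 0" using E'[of 0 1] e p q by (auto simp: C_def act_sDelta_expand act_dl co0 numeral_2_eq_2[symmetric] numeral_3_eq_3[symmetric])
    moreover have "C 0 1 = 0" using E'[of 2 0] e p q by (auto simp: C_def act_sDelta_expand act_dl co0 numeral_2_eq_2[symmetric] numeral_3_eq_3[symmetric])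
    moreover have "C 0 1 = C 1 0" using E'[of 1 1] e p q by (auto simp: C_def act_sDelta_expand act_dl co0 numeral_2_eq_2[symmetric] numeral_3_eq_3[symmetric])
    moreover have "C 0 0 = 0" using E'[of 2 1] e p q by (auto simp: C_def act_sDelta_expand act_dl co0 numeral_2_eq_2[symmetric] numeral_3_eq_3[symmetric])
    moreover have "(i = 0 \<or> i = 1) \<and> (j = 0 \<or> j = 1 \<or> j = 2)" using ij by auto
    ultimately have "C i j = 0" by auto
    then show ?thesis by (simp add: C_def)
  qed
  obtain a b c where abc: "i = (a, b, c)" by (cases i)
  have "co a (b mod 2 + 2 * (b div 2)) (c mod 2 + 2 * (c div 2)) = 0"
    using i by (intro key) (auto simp: abc I48_def)
  then show ?thesis using i by (simp add: abc co_def masked_def)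
qed

section \<open>The kernel operators applied to the two generators\<close>

definition annih :: "(nat \<times> nat \<times> nat) set \<Rightarrow> (nat \<Rightarrow> nat \<Rightarrow> nat \<Rightarrow> real) \<Rightarrow> bool" where
  "annih A s \<longleftrightarrow> (\<forall>a' b' c'. (\<Sum>(a, b, c)\<in>A. s (a + a') (b + b') (c + c')) = 0)"

lemma annih_shift: "annih A s \<Longrightarrow> annih A (shift i j k s)"
  unfolding annih_def shift_def by (simp add: add.left_commute)

text \<open>Even total degree makes integration by parts free of signs, and the divided powers turn
  the remaining derivative into a sum of shifted arrays.\<close>

lemma kills_regular_dp:
  assumes s: "in_box N s" and A: "annih A s" and ev: "\<And>a b c. (a, b, c) \<in> A \<Longrightarrow> even (a + b + c)"
  shows "kills A (regular (dp N s))"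
  unfolding kills_def
proof (intro allI impI)
  fix \<psi> assume t: "test_function \<psi>"
  have "(\<Sum>(a, b, c)\<in>A. regular (dp N s) (D3 a b c \<psi>)) = (\<Sum>(a, b, c)\<in>A. regular (dp N (shift a b c s)) \<psi>)"
    by (intro sum.cong refl) (auto simp: regular_D3[OF smooth_dp t] D3_dp[OF s] dest: ev)
  also have "\<dots> = (\<Sum>p\<in>A. LINT x|lborel. (case p of (a, b, c) \<Rightarrow> dp N (shift a b c s) x) * \<psi> x)"
    using t by (intro sum.cong refl) (auto simp: regular_def)
  also have "\<dots> = (LINT x|lborel. (\<Sum>p\<in>A. (case p of (a, b, c) \<Rightarrow> dp N (shift a b c s) x) * \<psi> x))"
    by (subst Bochner_Integration.integral_sum)
       (auto intro!: test_mult_integrable t smooth_continuous_on smooth_dp split: prod.splits)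
  also have "(\<lambda>x. \<Sum>p\<in>A. (case p of (a, b, c) \<Rightarrow> dp N (shift a b c s) x) * \<psi> x) = (\<lambda>x. 0)"
  proof
    fix x
    have "(\<Sum>p\<in>A. case p of (a, b, c) \<Rightarrow> dp N (shift a b c s) x) = (\<Sum>p\<in>A. dp N (\<lambda>a' b' c'. case p of (a, b, c) \<Rightarrow> s (a + a') (b + b') (c + c')) x)"
      by (intro sum.cong refl) (auto simp: shift_def[abs_def])
    also have "\<dots> = dp N (\<lambda>a' b' c'. \<Sum>(a, b, c)\<in>A. s (a + a') (b + b') (c + c')) x"
      by (rule dp_sum[symmetric])
    also have "\<dots> = 0"
      using A by (simp add: annih_def dp_zero)
    finally show "(\<Sum>p\<in>A. (case p of (a, b, c) \<Rightarrow> dp N (shift a b c s) x) * \<psi> x) = 0"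
      by (simp add: sum_distrib_right[symmetric])
  qed
  finally show "(\<Sum>(a, b, c)\<in>A. regular (dp N s) (D3 a b c \<psi>)) = 0" by simp
qed

definition tDelta :: "nat \<Rightarrow> nat \<Rightarrow> nat \<Rightarrow> real" where "tDelta a b c = 720 * sDelta a b c"
definition tF :: "nat \<Rightarrow> nat \<Rightarrow> nat \<Rightarrow> real" where "tF a b c = 10886400 * sF a b c"

lemma Delta_eq_dp: "Delta_B3 = dp 10 tDelta"
  by (simp add: fun_eq_iff Delta_dp tDelta_def[abs_def] dp_cmult)

lemma F_eq_dp: "F_gen = dp 10 tF"
  by (simp add: fun_eq_iff F_dp tF_def[abs_def] dp_cmult)

lemma in_box_tDelta: "in_box 10 tDelta" and in_box_tF: "in_box 10 tF"
  using in_box_sDelta in_box_sF by (auto simp: in_box_def tDelta_def tF_def)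

lemma act_cmult: "act co (\<lambda>a b c. k * s a b c) a' b' c' = k * act co s a' b' c'"
  by (simp add: act_def sum_distrib_left mult.left_commute)

lemma annih_act:
  assumes "A \<subseteq> {..<10} \<times> {..<10} \<times> {..<10}" "\<And>a b c. act (masked A (\<lambda>_. 1)) s a b c = 0"
  shows "annih A s"
  using assms(2) act_masked[OF assms(1), of "\<lambda>_. 1" s] by (simp add: annih_def)

lemma e_symmetric: "symmetric_even (masked e1 (\<lambda>_. 1))" "symmetric_even (masked e2 (\<lambda>_. 1))"
  "symmetric_even (masked e3 (\<lambda>_. 1))" "symmetric_even (masked e22 (\<lambda>_. 1))"
  by (auto simp: symmetric_even_def masked_def e1_def e2_def e3_def e22_def)

lemma annih_tDelta: "annih e1 tDelta" "annih e2 tDelta" "annih e3 tDelta"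
proof -
  show "annih e1 tDelta"
  proof (rule annih_act)
    have "act (masked e1 (\<lambda>_. 1)) sDelta a b c = 0" for a b c
      by (rule act_sDelta[OF e_symmetric(1)]) (simp add: masked_def e1_def)
    then show "act (masked e1 (\<lambda>_. 1)) tDelta a b c = 0" for a b c
      by (simp add: tDelta_def[abs_def] act_cmult)
  qed (auto simp: e1_def)
  show "annih e2 tDelta"
  proof (rule annih_act)
    have "act (masked e2 (\<lambda>_. 1)) sDelta a b c = 0" for a b c
      by (rule act_sDelta[OF e_symmetric(2)]) (simp add: masked_def e2_def)
    then show "act (masked e2 (\<lambda>_. 1)) tDelta a b c = 0" for a b c
      by (simp add: tDelta_def[abs_def] act_cmult)
  qed (auto simp: e2_def)
  show "annih e3 tDelta"
  proof (rule annih_act)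
    have "act (masked e3 (\<lambda>_. 1)) sDelta a b c = 0" for a b c
      by (rule act_sDelta[OF e_symmetric(3)]) (simp add: masked_def e3_def)
    then show "act (masked e3 (\<lambda>_. 1)) tDelta a b c = 0" for a b c
      by (simp add: tDelta_def[abs_def] act_cmult)
  qed (auto simp: e3_def)
qed

lemma annih_tF: "annih e1 tF" "annih e3 tF" "annih e22 tF"
proof -
  \<comment> \<open>The degrees are 2, 6 and 8, so the condition of \<open>act_sF\<close> on order 4
    is vacuous for all three symbols.\<close>
  have "act (masked e1 (\<lambda>_. 1)) sF a b c = 0" for a b c
    by (rule act_sF[where m = 2, OF e_symmetric(1)]) (auto simp: masked_def e1_def split: if_splits)
  then show "annih e1 tF" by (intro annih_act) (auto simp: tF_def[abs_def] act_cmult e1_def)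
  have "act (masked e3 (\<lambda>_. 1)) sF a b c = 0" for a b c
    by (rule act_sF[where m = 6, OF e_symmetric(3)]) (auto simp: masked_def e3_def split: if_splits)
  then show "annih e3 tF" by (intro annih_act) (auto simp: tF_def[abs_def] act_cmult e3_def)
  have "act (masked e22 (\<lambda>_. 1)) sF a b c = 0" for a b c
    by (rule act_sF[where m = 8, OF e_symmetric(4)]) (auto simp: masked_def e22_def split: if_splits)
  then show "annih e22 tF" by (intro annih_act) (auto simp: tF_def[abs_def] act_cmult e22_def)
qed

lemma tDelta_independent:
  assumes "\<And>a' b' c'. (\<Sum>(a, b, c)\<in>I48. f (a, b, c) * tDelta (a + a') (b + b') (c + c')) = 0"
    and "i \<in> I48"
  shows "f i = 0"
proof -
  have "(\<lambda>p. 720 * f p) i = 0"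
    using assms by (intro sDelta_independent[of "\<lambda>p. 720 * f p"]) (auto simp: tDelta_def mult.commute mult.left_commute)
  then show ?thesis by simp
qed

lemma tF_independent:
  assumes "\<And>a' b' c'. (\<Sum>(a, b, c)\<in>I96. f (a, b, c) * tF (a + a') (b + b') (c + c')) = 0"
    and "i \<in> I96"
  shows "f i = 0"
proof -
  have "(\<lambda>p. 10886400 * f p) i = 0"
    using assms by (intro sF_independent[of "\<lambda>p. 10886400 * f p"]) (auto simp: tF_def mult.commute mult.left_commute)
  then show ?thesis by simp
qed

section \<open>Polynomial symbols, signed permutations and invariants\<close>

definition vec3 :: "nat \<times> nat \<times> nat \<Rightarrow> nat^3" where
  "vec3 = (\<lambda>(a, b, c). vector [a, b, c])"

lemma vec3_nth [simp]: "vec3 (a, b, c) $ 1 = a" "vec3 (a, b, c) $ 2 = b" "vec3 (a, b, c) $ 3 = c"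
  by (simp_all add: vec3_def vector_3)

lemma vec3_trip [simp]: "vec3 (\<alpha> $ 1, \<alpha> $ 2, \<alpha> $ 3) = \<alpha>"
  by (simp add: vec_eq_iff forall_3)

lemma inj_vec3: "inj vec3"
proof (rule injI)
  fix p q assume "vec3 p = vec3 q"
  then show "p = q" by (cases p, cases q) (metis vec3_nth)
qed

definition mkpoly :: "(nat \<times> nat \<times> nat) set \<Rightarrow> (nat \<times> nat \<times> nat \<Rightarrow> real) \<Rightarrow> poly3" where
  "mkpoly I f = Abs_poly_mapping (\<lambda>\<alpha>. masked I f (\<alpha> $ 1) (\<alpha> $ 2) (\<alpha> $ 3))"

lemma lookup_mkpoly:
  assumes "finite I" shows "Poly_Mapping.lookup (mkpoly I f) \<alpha> = masked I f (\<alpha> $ 1) (\<alpha> $ 2) (\<alpha> $ 3)"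
proof -
  have "{\<alpha> :: nat^3. masked I f (\<alpha> $ 1) (\<alpha> $ 2) (\<alpha> $ 3) \<noteq> 0} \<subseteq> vec3 ` I"
  proof
    fix \<alpha> :: "nat^3" assume "\<alpha> \<in> {\<alpha>. masked I f (\<alpha> $ 1) (\<alpha> $ 2) (\<alpha> $ 3) \<noteq> 0}"
    then have "(\<alpha> $ 1, \<alpha> $ 2, \<alpha> $ 3) \<in> I" by (auto simp: masked_def split: if_splits)
    then show "\<alpha> \<in> vec3 ` I" by (metis image_eqI vec3_trip)
  qed
  then have "finite {\<alpha> :: nat^3. masked I f (\<alpha> $ 1) (\<alpha> $ 2) (\<alpha> $ 3) \<noteq> 0}"
    using assms finite_subset by blast
  then show ?thesis by (simp add: mkpoly_def)
qed

lemma sum_keys_mkpoly: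
  assumes "finite I"
  shows "(\<Sum>\<alpha>\<in>Poly_Mapping.keys (mkpoly I f). Poly_Mapping.lookup (mkpoly I f) \<alpha> * (g \<alpha> :: real)) = (\<Sum>p\<in>I. f p * g (vec3 p))"
proof -
  have "Poly_Mapping.keys (mkpoly I f) \<subseteq> vec3 ` I"
  proof
    fix \<alpha> assume "\<alpha> \<in> Poly_Mapping.keys (mkpoly I f)"
    then have "(\<alpha> $ 1, \<alpha> $ 2, \<alpha> $ 3) \<in> I"
      by (auto simp: in_keys_iff lookup_mkpoly[OF assms] masked_def split: if_splits)
    then show "\<alpha> \<in> vec3 ` I" by (metis image_eqI vec3_trip)
  qed
  then have "(\<Sum>\<alpha>\<in>Poly_Mapping.keys (mkpoly I f). Poly_Mapping.lookup (mkpoly I f) \<alpha> * g \<alpha>) =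
      (\<Sum>\<alpha>\<in>vec3 ` I. Poly_Mapping.lookup (mkpoly I f) \<alpha> * g \<alpha>)"
    using assms by (intro sum.mono_neutral_left) (auto simp: in_keys_iff)
  also have "\<dots> = (\<Sum>p\<in>I. Poly_Mapping.lookup (mkpoly I f) (vec3 p) * g (vec3 p))"
    by (subst sum.reindex) (auto intro: inj_on_subset[OF inj_vec3])
  also have "\<dots> = (\<Sum>p\<in>I. f p * g (vec3 p))"
    by (intro sum.cong refl) (auto simp: lookup_mkpoly[OF assms] masked_def)
  finally show ?thesis .
qed

lemma mult_monomial_prod:
  fixes x :: "real^3"
  shows "(\<Prod>i\<in>UNIV. (x $ i) ^ (\<alpha> $ i)) = x $ 1 ^ (\<alpha> $ 1) * x $ 2 ^ (\<alpha> $ 2) * (x $ 3 ^ (\<alpha> $ 3) :: real)"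
  by (simp add: prod_UNIV_3)

lemma eval3_mkpoly:
  "finite I \<Longrightarrow> eval3 (mkpoly I f) x = (\<Sum>(a, b, c)\<in>I. f (a, b, c) * (x $ 1 ^ a * x $ 2 ^ b * x $ 3 ^ c))"
  unfolding eval3_def mult_monomial_prod by (subst sum_keys_mkpoly) (auto intro!: sum.cong)

lemma diff_op_mkpoly:
  "finite I \<Longrightarrow> diff_op (mkpoly I f) g x = (\<Sum>(a, b, c)\<in>I. f (a, b, c) * D3 a b c g x)"
  unfolding diff_op_def mpartial_D3 by (subst sum_keys_mkpoly) (auto intro!: sum.cong)

lemma dist_op_mkpoly:
  "finite I \<Longrightarrow> test_function \<psi> \<Longrightarrow>
    dist_op (mkpoly I f) T \<psi> = (\<Sum>(a, b, c)\<in>I. f (a, b, c) * ((-1) ^ (a + b + c) * T (D3 a b c \<psi>)))"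
  unfolding dist_op_def mpartial_D3 sum_UNIV_3_nat mult.assoc
  by (simp, subst sum_keys_mkpoly) (auto intro!: sum.cong)

definition Wmat :: "(3 \<Rightarrow> 3) \<Rightarrow> (3 \<Rightarrow> real) \<Rightarrow> real^3^3" where
  "Wmat \<sigma> \<epsilon> = (\<chi> i j. if j = \<sigma> i then \<epsilon> i else 0)"

lemma Wmat_mult: "(Wmat \<sigma> \<epsilon> *v x) $ i = \<epsilon> i * x $ \<sigma> i"
  by (simp add: Wmat_def matrix_vector_mult_def if_distrib[of "\<lambda>u. u * _"] cong: if_cong)

lemma W_B3_iff: "A \<in> W_B3 \<longleftrightarrow> (\<exists>\<sigma> \<epsilon>. bij \<sigma> \<and> (\<forall>i. \<epsilon> i \<in> signs) \<and> A = Wmat \<sigma> \<epsilon>)"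
  by (simp add: W_B3_def Wmat_def)

lemma signs_sq: "e \<in> signs \<Longrightarrow> e ^ 2 = 1"
  by (auto simp: signs_def)

lemma W_sum_powers:
  assumes "A \<in> W_B3" shows "(\<Sum>i\<in>UNIV. ((A *v x) $ i ^ 2) ^ n) = (\<Sum>i\<in>UNIV. (x $ i ^ 2) ^ n)"
    and "(\<Prod>i\<in>UNIV. (A *v x) $ i ^ 2) = (\<Prod>i\<in>UNIV. x $ i ^ 2)"
proof -
  obtain \<sigma> \<epsilon> where *: "bij \<sigma>" "\<And>i. \<epsilon> i \<in> signs" "A = Wmat \<sigma> \<epsilon>" using assms by (auto simp: W_B3_iff)
  have sq: "(A *v x) $ i ^ 2 = x $ \<sigma> i ^ 2" for i
    by (simp add: *(3) Wmat_mult power_mult_distrib signs_sq[OF *(2)])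
  show "(\<Sum>i\<in>UNIV. ((A *v x) $ i ^ 2) ^ n) = (\<Sum>i\<in>UNIV. (x $ i ^ 2) ^ n)"
    unfolding sq by (rule sum.reindex_bij_betw[of \<sigma> UNIV UNIV "\<lambda>i. (x $ i ^ 2) ^ n"]) (use *(1) in auto)
  show "(\<Prod>i\<in>UNIV. (A *v x) $ i ^ 2) = (\<Prod>i\<in>UNIV. x $ i ^ 2)"
    unfolding sq by (rule prod.reindex_bij_betw[of \<sigma> UNIV UNIV "\<lambda>i. x $ i ^ 2"]) (use *(1) in auto)
qed

text \<open>All three symbols are expressed through power sums and the product of the squares of the
  coordinates. Squares swallow the signs, and a permutation merely reindexes a sum or
  product.\<close>

lemma e_invariant: "invariant W_B3 (mkpoly e1 (\<lambda>_. 1))" "invariant W_B3 (mkpoly e2 (\<lambda>_. 1))"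
  "invariant W_B3 (mkpoly e3 (\<lambda>_. 1))"
proof -
  have f: "finite e1" "finite e2" "finite e3" by (auto simp: e1_def e2_def e3_def)
  have 1: "eval3 (mkpoly e1 (\<lambda>_. 1)) x = (\<Sum>i\<in>UNIV. (x $ i ^ 2) ^ 1)" for x
    by (simp add: eval3_mkpoly f) (simp add: e1_def sum_3)
  \<comment> \<open>Newton's identity for the second elementary symmetric polynomial in the
    squares.\<close>
  have 2: "eval3 (mkpoly e2 (\<lambda>_. 1)) x = ((\<Sum>i\<in>UNIV. (x $ i ^ 2) ^ 1) ^ 2 - (\<Sum>i\<in>UNIV. (x $ i ^ 2) ^ 2)) / 2" for x
    by (simp add: eval3_mkpoly f) (simp add: e2_def sum_3, simp add: power2_eq_square power4_eq_xxxx field_simps)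
  have 3: "eval3 (mkpoly e3 (\<lambda>_. 1)) x = (\<Prod>i\<in>UNIV. x $ i ^ 2)" for x
    unfolding prod_UNIV_3 by (simp add: eval3_mkpoly f) (simp add: e3_def)
  show "invariant W_B3 (mkpoly e1 (\<lambda>_. 1))"
    unfolding invariant_def 1 by (intro ballI allI W_sum_powers(1))
  show "invariant W_B3 (mkpoly e2 (\<lambda>_. 1))"
    unfolding invariant_def 2
  proof (intro ballI allI)
    fix A x assume A: "A \<in> W_B3"
    show "((\<Sum>i\<in>UNIV. ((A *v x) $ i ^ 2) ^ 1) ^ 2 - (\<Sum>i\<in>UNIV. ((A *v x) $ i ^ 2) ^ 2)) / 2 =
        ((\<Sum>i\<in>UNIV. (x $ i ^ 2) ^ 1) ^ 2 - (\<Sum>i\<in>UNIV. (x $ i ^ 2) ^ 2)) / 2"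
      by (simp only: W_sum_powers(1)[OF A, of x 1] W_sum_powers(1)[OF A, of x 2])
  qed
  show "invariant W_B3 (mkpoly e3 (\<lambda>_. 1))"
    unfolding invariant_def 3 by (intro ballI allI W_sum_powers(2))
qed

lemma G_harmonic_subset_K48: "G_harmonic W_B3 \<subseteq> K48"
proof
  fix T assume T: "T \<in> G_harmonic W_B3"
  have f: "finite e1" "finite e2" "finite e3" by (auto simp: e1_def e2_def e3_def)
  have d: "distribution T" using T by (simp add: G_harmonic_def)
  have z: "dist_op \<phi> T \<psi> = 0" if "invariant W_B3 \<phi>" "eval3 \<phi> 0 = 0" for \<phi> \<psi>
    using T that by (simp add: G_harmonic_def)
  have "kills e1 T"
    unfolding kills_def
  proof (intro allI impI)
    fix \<psi> assume t: "test_function \<psi>"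
    have "eval3 (mkpoly e1 (\<lambda>_. 1)) 0 = 0" unfolding eval3_mkpoly[OF f(1)] by (simp add: e1_def)
    from z[OF e_invariant(1) this, of \<psi>, unfolded dist_op_mkpoly[OF f(1) t]]
    show "(\<Sum>(a, b, c)\<in>e1. T (D3 a b c \<psi>)) = 0" by (simp add: e1_def)
  qed
  moreover have "kills e2 T"
    unfolding kills_def
  proof (intro allI impI)
    fix \<psi> assume t: "test_function \<psi>"
    have "eval3 (mkpoly e2 (\<lambda>_. 1)) 0 = 0" unfolding eval3_mkpoly[OF f(2)] by (simp add: e2_def)
    from z[OF e_invariant(2) this, of \<psi>, unfolded dist_op_mkpoly[OF f(2) t]]
    show "(\<Sum>(a, b, c)\<in>e2. T (D3 a b c \<psi>)) = 0" by (simp add: e2_def)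
  qed
  moreover have "kills e3 T"
    unfolding kills_def
  proof (intro allI impI)
    fix \<psi> assume t: "test_function \<psi>"
    have "eval3 (mkpoly e3 (\<lambda>_. 1)) 0 = 0" unfolding eval3_mkpoly[OF f(3)] by (simp add: e3_def)
    from z[OF e_invariant(3) this, of \<psi>, unfolded dist_op_mkpoly[OF f(3) t]]
    show "(\<Sum>(a, b, c)\<in>e3. T (D3 a b c \<psi>)) = 0" by (simp add: e3_def)
  qed
  ultimately show "T \<in> K48"
    using d distribution_tlin[OF d] by (simp add: K48_def distribution_def)
qed

section \<open>Bases of the kernels from derivatives of one generator\<close>

lemma kills_lin:
  assumes "kills A T" "kills A S" shows "kills A (\<lambda>x. T x - S x)" "kills A (\<lambda>x. T x + S x)" "kills A (\<lambda>x. c * T x)"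
  using assms by (simp_all add: kills_def split_def sum_subtractf sum.distrib flip: sum_distrib_left)

lemma kills_sum:
  assumes "finite I" "\<And>i. i \<in> I \<Longrightarrow> kills A (e i)" shows "kills A (\<lambda>x. \<Sum>i\<in>I. c i * e i x)"
  using assms
proof (induction I)
  case empty then show ?case by (simp add: kills_def)
next
  case (insert j I)
  then have "kills A (\<lambda>x. (c j * e j x) + (\<Sum>i\<in>I. c i * e i x))"
    by (intro kills_lin(2) kills_lin(3)) auto
  then show ?case using insert by simp
qed

lemma tlin_lin:
  assumes "tlin T" "tlin S" shows "tlin (\<lambda>x. T x - S x)" "tlin (\<lambda>x. T x + S x)" "tlin (\<lambda>x. c * T x)"
  using assms by (simp_all add: tlin_def algebra_simps)

lemma tlin_sum:
  assumes "finite I" "\<And>i. i \<in> I \<Longrightarrow> tlin (e i)" shows "tlin (\<lambda>x. \<Sum>i\<in>I. c i * e i x)"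
  using assms
proof (induction I)
  case empty then show ?case by (simp add: tlin_def)
next
  case (insert j I)
  then have "tlin (\<lambda>x. (c j * e j x) + (\<Sum>i\<in>I. c i * e i x))"
    by (intro tlin_lin(2) tlin_lin(3)) auto
  then show ?case using insert by simp
qed

definition Dt :: "(real^3 \<Rightarrow> real) \<Rightarrow> nat \<times> nat \<times> nat \<Rightarrow> real^3 \<Rightarrow> real" where
  "Dt f = (\<lambda>(a, b, c). D3 a b c f)"

lemma smooth_Dt: "smooth f \<Longrightarrow> smooth (Dt f p)"
  by (cases p) (simp add: Dt_def smooth_D3)

lemma regular_lin_comb:
  assumes "finite I" "\<And>i. i \<in> I \<Longrightarrow> continuous_on UNIV (f i)"
  shows "regular (\<lambda>x. \<Sum>i\<in>I. c i * f i x) \<psi> = (\<Sum>i\<in>I. c i * regular (f i) \<psi>)"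
proof (cases "test_function \<psi>")
  case True
  have "regular (\<lambda>x. \<Sum>i\<in>I. c i * f i x) \<psi> = (LINT x|lborel. (\<Sum>i\<in>I. c i * (f i x * \<psi> x)))"
    using True by (simp add: regular_def sum_distrib_right mult.assoc)
  also have "\<dots> = (\<Sum>i\<in>I. LINT x|lborel. c i * (f i x * \<psi> x))"
    by (intro Bochner_Integration.integral_sum integrable_mult_right test_mult_integrable assms True)
  finally show ?thesis using True by (simp add: regular_def)
qed (simp add: regular_def)

text \<open>In terms of polynomials: the derivatives with orders in \<open>I\<close> of the
  polynomial with array \<open>t\<close> are linearly independent.\<close>

definition indep_array :: "(nat \<times> nat \<times> nat) set \<Rightarrow> (nat \<Rightarrow> nat \<Rightarrow> nat \<Rightarrow> real) \<Rightarrow> bool" where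
  "indep_array I t \<longleftrightarrow> (\<forall>f. (\<forall>a' b' c'. (\<Sum>(a, b, c)\<in>I. f (a, b, c) * t (a + a') (b + b') (c + c')) = 0) \<longrightarrow> (\<forall>i\<in>I. f i = 0))"

lemma indep_tDelta: "indep_array I48 tDelta"
  unfolding indep_array_def
proof (intro allI impI ballI)
  fix f i assume z: "\<forall>a' b' c'. (\<Sum>(a, b, c)\<in>I48. f (a, b, c) * tDelta (a + a') (b + b') (c + c')) = 0" and i: "i \<in> I48"
  show "f i = 0" by (rule tDelta_independent[of f i, OF z[rule_format] i])
qed

lemma indep_tF: "indep_array I96 tF"
  unfolding indep_array_def
proof (intro allI impI ballI)
  fix f i assume z: "\<forall>a' b' c'. (\<Sum>(a, b, c)\<in>I96. f (a, b, c) * tF (a + a') (b + b') (c + c')) = 0" and i: "i \<in> I96"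
  show "f i = 0" by (rule tF_independent[of f i, OF z[rule_format] i])
qed

lemma Dt_independent:
  assumes t: "in_box 10 t" and I: "finite I"
    and ind: "indep_array I t"
    and z: "\<And>x. (\<Sum>i\<in>I. c i * Dt (dp 10 t) i x) = 0"
  shows "\<forall>i\<in>I. c i = 0"
proof
  fix i assume i: "i \<in> I"
  have "dp 10 (\<lambda>a' b' c'. \<Sum>p\<in>I. c p * (case p of (a, b, c) \<Rightarrow> shift a b c t a' b' c')) x = dp 10 (\<lambda>_ _ _. 0) x" for x
  proof -
    have "dp 10 (\<lambda>a' b' c'. \<Sum>p\<in>I. c p * (case p of (a, b, c) \<Rightarrow> shift a b c t a' b' c')) x
       = (\<Sum>p\<in>I. c p * Dt (dp 10 t) p x)"
      unfolding dp_sum dp_cmult by (intro sum.cong refl) (auto simp: Dt_def D3_dp[OF t] split: prod.splits)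
    then show ?thesis using z by (simp add: dp_zero)
  qed
  then have eq: "dp 10 (\<lambda>a' b' c'. \<Sum>p\<in>I. c p * (case p of (a, b, c) \<Rightarrow> shift a b c t a' b' c')) = dp 10 (\<lambda>_ _ _. 0)" by auto
  have "in_box 10 (\<lambda>a' b' c'. \<Sum>p\<in>I. c p * (case p of (a, b, c) \<Rightarrow> shift a b c t a' b' c'))"
    using in_box_shift[OF t] unfolding in_box_def by (auto intro!: sum.neutral split: prod.splits)
  from dp_inject[OF this _ _ eq]
  have "(\<Sum>p\<in>I. c p * (case p of (a, b, c) \<Rightarrow> shift a b c t a' b' c')) = 0" for a' b' c'
    by (auto simp: in_box_def fun_eq_iff)
  then have "(\<Sum>(a, b, k)\<in>I. c (a, b, k) * t (a + a') (b + b') (k + c')) = 0" for a' b' c'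
    by (simp add: shift_def split_def)
  then show "c i = 0" using ind[unfolded indep_array_def, rule_format, of c i] i by blast
qed

lemma regular_Dt_independent:
  assumes t: "in_box 10 t" and I: "finite I"
    and ind: "indep_array I t"
    and z: "\<And>x. (\<Sum>i\<in>I. c i * regular (Dt (dp 10 t) i) x) = 0"
  shows "\<forall>i\<in>I. c i = 0"
proof (rule Dt_independent[OF t I ind])
  have c: "continuous_on UNIV (Dt (dp 10 t) i)" for i
    by (intro smooth_continuous_on smooth_Dt smooth_dp)
  have c': "continuous_on UNIV (\<lambda>x. \<Sum>i\<in>I. c i * Dt (dp 10 t) i x)"
    by (intro continuous_intros c)
  have "regular (\<lambda>x. \<Sum>i\<in>I. c i * Dt (dp 10 t) i x) = regular (\<lambda>x. 0)"
    by (rule ext) (simp add: regular_lin_comb[OF I c] z, simp add: regular_def)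
  from regular_inject[OF c' _ this] show "(\<Sum>i\<in>I. c i * Dt (dp 10 t) i x) = 0" for x
    by (auto simp: fun_eq_iff)
qed

text \<open>Both kernels are handled at once. The derivatives of the generator lie in the kernel and
  \<open>card I\<close> of them are independent; the values at \<open>Dt chi3\<close> separate the
  kernel. The two counts agree, so these derivatives form a basis and the cyclic module is the whole
  kernel.\<close>

lemma kernel_basis:
  assumes t: "in_box 10 t" and I: "finite I"
    and ind: "indep_array I t"
    and K: "K = {T. (\<forall>\<psi>. \<not> test_function \<psi> \<longrightarrow> T \<psi> = 0) \<and> tlin T \<and> (\<forall>A\<in>\<A>. kills A T)}"
    and an: "\<And>A. A \<in> \<A> \<Longrightarrow> annih A t" "\<And>A a b c. A \<in> \<A> \<Longrightarrow> (a, b, c) \<in> A \<Longrightarrow> even (a + b + c)"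
    and sep: "\<And>T. T \<in> K \<Longrightarrow> (\<And>a b c. (a, b, c) \<in> I \<Longrightarrow> T (D3 a b c chi3) = 0) \<Longrightarrow> T = (\<lambda>x. 0)"
  shows "K = range (\<lambda>c x. \<Sum>i\<in>I. c i * regular (Dt (dp 10 t) i) x)"
    and "K = regular ` range (\<lambda>q. diff_op q (dp 10 t))"
    and "fdim K = card I"
    and "fdim (range (\<lambda>q. diff_op q (dp 10 t))) = card I"
proof -
  note s = smooth_dp[of 10 t]
  have c: "continuous_on UNIV (Dt (dp 10 t) i)" for i
    by (intro smooth_continuous_on smooth_Dt s)
  have e: "regular (Dt (dp 10 t) i) \<in> K" for i
  proof -
    have "kills A (regular (Dt (dp 10 t) i))" if "A \<in> \<A>" for A
    proof (cases i)
      case (fields a b c)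
      show ?thesis unfolding fields Dt_def prod.case D3_dp[OF t]
        by (intro kills_regular_dp in_box_shift t annih_shift an that) (use that in auto)
    qed
    then show ?thesis unfolding K using tlin_regular[OF c] by (auto simp: regular_def)
  qed
  have comb: "(\<lambda>x. \<Sum>i\<in>J. c i * regular (Dt (dp 10 t) i) x) \<in> K" if "finite J" for c J
    using e that unfolding K by (auto intro!: tlin_sum kills_sum sum.neutral)
  show K1: "K = range (\<lambda>c x. \<Sum>i\<in>I. c i * regular (Dt (dp 10 t) i) x)"
  proof (rule family_spans_by_evaluation[where pt = "Dt chi3"])
    show "\<forall>i\<in>I. c i = 0" if "\<And>x. (\<Sum>i\<in>I. c i * regular (Dt (dp 10 t) i) x) = 0" for c
      by (rule regular_Dt_independent[OF t I ind that])
    show "(\<lambda>x. \<Sum>i\<in>I. c i * regular (Dt (dp 10 t) i) x) \<in> K" for c by (rule comb[OF I])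
    then show "(\<lambda>x. T x - (\<Sum>i\<in>I. c i * regular (Dt (dp 10 t) i) x)) \<in> K" if "T \<in> K" for c T
      using that unfolding K by (auto intro!: tlin_lin(1) kills_lin(1))
    show "T = (\<lambda>x. 0)" if "T \<in> K" "\<And>i. i \<in> I \<Longrightarrow> T (Dt chi3 i) = 0" for T
      by (rule sep[OF that(1)]) (use that(2) in \<open>force simp: Dt_def\<close>)
  qed (rule I)
  have dop: "diff_op (mkpoly J f) (dp 10 t) = (\<lambda>x. \<Sum>i\<in>J. f i * Dt (dp 10 t) i x)" if "finite J" for J f
    using that by (auto simp: diff_op_mkpoly Dt_def fun_eq_iff intro!: sum.cong)
  have dop': "diff_op q (dp 10 t) = (\<lambda>x. \<Sum>\<alpha>\<in>Poly_Mapping.keys q. Poly_Mapping.lookup q \<alpha> * Dt (dp 10 t) (\<alpha> $ 1, \<alpha> $ 2, \<alpha> $ 3) x)" for q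
    by (simp add: diff_op_def[abs_def] mpartial_D3 Dt_def)
  show K2: "K = regular ` range (\<lambda>q. diff_op q (dp 10 t))"
  proof (intro equalityI subsetI)
    fix T assume "T \<in> K"
    then obtain f where "T = (\<lambda>x. \<Sum>i\<in>I. f i * regular (Dt (dp 10 t) i) x)" unfolding K1 by (rule rangeE)
    also have "\<dots> = regular (diff_op (mkpoly I f) (dp 10 t))"
      unfolding dop[OF I] by (rule ext) (simp add: regular_lin_comb[OF I c])
    finally show "T \<in> regular ` range (\<lambda>q. diff_op q (dp 10 t))" by blast
  next
    fix T assume "T \<in> regular ` range (\<lambda>q. diff_op q (dp 10 t))"
    then obtain q where "T = regular (diff_op q (dp 10 t))" by blast
    then have "T = (\<lambda>x. \<Sum>\<alpha>\<in>Poly_Mapping.keys q. Poly_Mapping.lookup q \<alpha> * regular (Dt (dp 10 t) (\<alpha> $ 1, \<alpha> $ 2, \<alpha> $ 3)) x)"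
      unfolding dop' by (auto simp: regular_lin_comb[OF finite_keys c])
    also have "\<dots> = (\<lambda>x. \<Sum>p\<in>(\<lambda>\<alpha>. (\<alpha> $ 1, \<alpha> $ 2, \<alpha> $ 3)) ` Poly_Mapping.keys q. Poly_Mapping.lookup q (vec3 p) * regular (Dt (dp 10 t) p) x)"
      by (subst sum.reindex) (auto intro!: inj_onI simp: vec_eq_iff forall_3)
    also have "\<dots> \<in> K" by (intro comb finite_imageI finite_keys)
    finally show "T \<in> K" .
  qed
  show "fdim K = card I"
    by (rule fdim_family[OF I _ K1]) (rule regular_Dt_independent[OF t I ind])
  \<comment> \<open>The span of the functions is compared through the functionals,
    \<open>regular\<close> being injective on continuous functions.\<close>
  have "range (\<lambda>q. diff_op q (dp 10 t)) = range (\<lambda>c x. \<Sum>i\<in>I. c i * Dt (dp 10 t) i x)"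
  proof (intro equalityI subsetI)
    fix f assume "f \<in> range (\<lambda>q. diff_op q (dp 10 t))"
    then obtain q where q: "f = diff_op q (dp 10 t)" by blast
    then have "regular f \<in> K" unfolding K2 by blast
    then obtain h where "regular f = (\<lambda>x. \<Sum>i\<in>I. h i * regular (Dt (dp 10 t) i) x)" unfolding K1 by (rule rangeE)
    then have "regular f = regular (\<lambda>x. \<Sum>i\<in>I. h i * Dt (dp 10 t) i x)"
      by (auto simp: regular_lin_comb[OF I c])
    then have "f = (\<lambda>x. \<Sum>i\<in>I. h i * Dt (dp 10 t) i x)"
      by (rule regular_inject[rotated 2])
         (unfold q, intro smooth_continuous_on smooth_diff_op s, intro continuous_on_sum continuous_on_mult continuous_on_const c)
    then show "f \<in> range (\<lambda>c x. \<Sum>i\<in>I. c i * Dt (dp 10 t) i x)" by (rule range_eqI[of _ _ h])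
  next
    fix f assume "f \<in> range (\<lambda>c x. \<Sum>i\<in>I. c i * Dt (dp 10 t) i x)"
    then obtain h where "f = (\<lambda>x. \<Sum>i\<in>I. h i * Dt (dp 10 t) i x)" by (rule rangeE)
    then have "f = diff_op (mkpoly I h) (dp 10 t)" by (simp add: dop[OF I])
    then show "f \<in> range (\<lambda>q. diff_op q (dp 10 t))" by blast
  qed
  then show "fdim (range (\<lambda>q. diff_op q (dp 10 t))) = card I"
    by (intro fdim_family[OF I]) (rule Dt_independent[OF t I ind])
qed

lemma K48_basis:
  "K48 = regular ` range (\<lambda>q. diff_op q Delta_B3)" "fdim K48 = 48"
proof -
  have K: "K48 = {T. (\<forall>\<psi>. \<not> test_function \<psi> \<longrightarrow> T \<psi> = 0) \<and> tlin T \<and> (\<forall>A\<in>{e1, e2, e3}. kills A T)}"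
    by (auto simp: K48_def)
  have ev: "even (a + b + c)" if "A \<in> {e1, e2, e3}" "(a, b, c) \<in> A" for A a b c
    using that by (auto simp: e1_def e2_def e3_def)
  note * = kernel_basis[OF in_box_tDelta I48_card(1) indep_tDelta K _ ev K48_separated]
  show "K48 = regular ` range (\<lambda>q. diff_op q Delta_B3)"
    unfolding Delta_eq_dp by (rule *(2)) (auto simp: annih_tDelta)
  show "fdim K48 = 48"
    unfolding I48_card(2)[symmetric] by (rule *(3)) (auto simp: annih_tDelta)
qed

lemma K96_basis:
  "K96 = regular ` range (\<lambda>q. diff_op q F_gen)" "fdim K96 = 96" "fdim (range (\<lambda>q. diff_op q F_gen)) = 96"
proof -
  have K: "K96 = {T. (\<forall>\<psi>. \<not> test_function \<psi> \<longrightarrow> T \<psi> = 0) \<and> tlin T \<and> (\<forall>A\<in>{e1, e3, e22}. kills A T)}"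
    by (auto simp: K96_def)
  have ev: "even (a + b + c)" if "A \<in> {e1, e3, e22}" "(a, b, c) \<in> A" for A a b c
    using that by (auto simp: e1_def e22_def e3_def)
  note * = kernel_basis[OF in_box_tF I96_card(1) indep_tF K _ ev K96_separated]
  show "K96 = regular ` range (\<lambda>q. diff_op q F_gen)"
    unfolding F_eq_dp by (rule *(2)) (auto simp: annih_tF)
  show "fdim K96 = 96"
    unfolding I96_card(2)[symmetric] by (rule *(3)) (auto simp: annih_tF)
  show "fdim (range (\<lambda>q. diff_op q F_gen)) = 96"
    unfolding F_eq_dp I96_card(2)[symmetric] by (rule *(4)) (auto simp: annih_tF)
qed

section \<open>Invariant operators and the G-harmonic distributions\<close>

text \<open>The array of a polynomial operator applied to \<open>t\<close>; in contrast to
  \<open>act\<close> the sum runs over all exponents of \<open>q\<close>.\<close>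

definition qarr :: "poly3 \<Rightarrow> (nat \<Rightarrow> nat \<Rightarrow> nat \<Rightarrow> real) \<Rightarrow> nat \<Rightarrow> nat \<Rightarrow> nat \<Rightarrow> real" where
  "qarr q t a b c = (\<Sum>\<alpha>\<in>Poly_Mapping.keys q. Poly_Mapping.lookup q \<alpha> * t (\<alpha> $ 1 + a) (\<alpha> $ 2 + b) (\<alpha> $ 3 + c))"

lemma in_box_qarr: "in_box N t \<Longrightarrow> in_box N (qarr q t)"
  by (auto simp: in_box_def qarr_def intro!: sum.neutral)

lemma diff_op_dp: assumes "in_box N t" shows "diff_op q (dp N t) = dp N (qarr q t)"
proof
  fix x
  have "dp N (qarr q t) x = (\<Sum>\<alpha>\<in>Poly_Mapping.keys q. Poly_Mapping.lookup q \<alpha> * dp N (\<lambda>a b c. t (\<alpha> $ 1 + a) (\<alpha> $ 2 + b) (\<alpha> $ 3 + c)) x)"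
    unfolding qarr_def[abs_def] dp_sum dp_cmult by (rule refl)
  then show "diff_op q (dp N t) x = dp N (qarr q t) x"
    by (simp add: diff_op_def mpartial_D3 D3_dp[OF assms] shift_def[abs_def])
qed

lemma act_sum: "act co (\<lambda>a b c. \<Sum>i\<in>A. f i a b c) a' b' c' = (\<Sum>i\<in>A. act co (f i) a' b' c')"
proof (induction A rule: infinite_finite_induct)
  case (insert i A)
  then show ?case by (simp add: act_lin(1)[of co "f i" "\<lambda>a b c. \<Sum>i\<in>A. f i a b c"])
qed (simp_all add: act_def)

lemma act_qarr:
  assumes "\<And>a b c. act co t a b c = 0" shows "act co (qarr q t) a b c = 0"
proof -
  have "act co (\<lambda>a b c. t (i + a) (j + b) (k + c)) a b c = act co t (i + a) (j + b) (k + c)" for i j k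
    by (simp add: act_def ac_simps)
  then show ?thesis
    unfolding qarr_def[abs_def] act_sum act_cmult using assms by simp
qed

text \<open>A finitely supported polynomial fits into some box, and factorials convert its
  coefficients to divided powers, so that \<open>dp_inject\<close> can compare coefficients.\<close>

lemma eval3_dp:
  fixes q :: poly3
  obtains M where "M > 0" "in_box M (\<lambda>a b c. fact a * fact b * fact c * Poly_Mapping.lookup q (vec3 (a, b, c)))"
    "\<And>x. eval3 q x = dp M (\<lambda>a b c. fact a * fact b * fact c * Poly_Mapping.lookup q (vec3 (a, b, c))) x"
proof -
  let ?K = "Poly_Mapping.keys q"
  define M where "M = Suc (\<Sum>\<alpha>\<in>?K. \<alpha> $ 1 + \<alpha> $ 2 + \<alpha> $ 3)"
  let ?B = "{..<M} \<times> {..<M} \<times> {..<M}"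
  have bd: "\<alpha> $ 1 < M" "\<alpha> $ 2 < M" "\<alpha> $ 3 < M" if "\<alpha> \<in> ?K" for \<alpha>
    using member_le_sum[of \<alpha> ?K "\<lambda>\<alpha>. \<alpha> $ 1 + \<alpha> $ 2 + \<alpha> $ 3"] that by (auto simp: M_def less_Suc_eq_le)
  have z: "Poly_Mapping.lookup q (vec3 (a, b, c)) = 0" if "M \<le> a \<or> M \<le> b \<or> M \<le> c" for a b c
    using bd[of "vec3 (a, b, c)"] that unfolding vec3_nth in_keys_iff by (metis not_less)
  have sub: "?K \<subseteq> vec3 ` ?B"
  proof
    fix \<alpha> assume "\<alpha> \<in> ?K"
    with bd have "(\<alpha> $ 1, \<alpha> $ 2, \<alpha> $ 3) \<in> ?B" by auto
    then show "\<alpha> \<in> vec3 ` ?B" by (metis image_eqI vec3_trip)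
  qed
  have "eval3 q x = dp M (\<lambda>a b c. fact a * fact b * fact c * Poly_Mapping.lookup q (vec3 (a, b, c))) x" for x
  proof -
    have "eval3 q x = (\<Sum>\<alpha>\<in>vec3 ` ?B. Poly_Mapping.lookup q \<alpha> * (x $ 1 ^ (\<alpha> $ 1) * x $ 2 ^ (\<alpha> $ 2) * x $ 3 ^ (\<alpha> $ 3)))"
      unfolding eval3_def mult_monomial_prod
      by (rule sum.mono_neutral_left) (use sub in \<open>auto simp: in_keys_iff\<close>)
    also have "\<dots> = (\<Sum>(a, b, c)\<in>?B. Poly_Mapping.lookup q (vec3 (a, b, c)) * (x $ 1 ^ a * x $ 2 ^ b * x $ 3 ^ c))"
      by (subst sum.reindex) (auto intro: inj_on_subset[OF inj_vec3] intro!: sum.cong)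
    also have "\<dots> = (\<Sum>(a, b, c)\<in>?B. fact a * fact b * fact c * Poly_Mapping.lookup q (vec3 (a, b, c)) * mnm a b c x)"
      by (intro sum.cong refl) (auto simp: mnm_def)
    also have "\<dots> = dp M (\<lambda>a b c. fact a * fact b * fact c * Poly_Mapping.lookup q (vec3 (a, b, c))) x"
      unfolding dp_def sum.cartesian_product by (rule refl)
    finally show ?thesis .
  qed
  then show thesis using z by (intro that[of M]) (auto simp: M_def in_box_def)
qed

lemma Wmat_in_W_B3: "bij \<sigma> \<Longrightarrow> (\<And>i. \<epsilon> i \<in> signs) \<Longrightarrow> Wmat \<sigma> \<epsilon> \<in> W_B3"
  by (auto simp: W_B3_iff)

text \<open>Invariance is tested on two transpositions and one sign change; comparison of
  coefficients yields the symmetry and the parity in the first exponent. The parity of the other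
  exponents follows from the symmetry.\<close>

lemma invariant_symmetric_even:
  assumes inv: "invariant W_B3 q"
  shows "symmetric_even (\<lambda>a b c. Poly_Mapping.lookup q (vec3 (a, b, c)))"
proof -
  define co where "co a b c = Poly_Mapping.lookup q (vec3 (a, b, c))" for a b c
  obtain M where M: "M > 0" and box: "in_box M (\<lambda>a b c. fact a * fact b * fact c * co a b c)"
    and ev: "\<And>x. eval3 q x = dp M (\<lambda>a b c. fact a * fact b * fact c * co a b c) x"
    unfolding co_def by (rule eval3_dp[of q]) blast
  define s where "s a b c = fact a * fact b * fact c * co a b c" for a b c
  have box: "in_box M s" and ev: "eval3 q x = dp M s x" for x using box ev by (simp_all add: s_def[abs_def])
  have eq: "dp M s (Wmat \<sigma> \<epsilon> *v x) = dp M s x" if "bij \<sigma>" "\<And>i. \<epsilon> i \<in> signs" for \<sigma> \<epsilon> x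
  proof -
    have "eval3 q (Wmat \<sigma> \<epsilon> *v x) = eval3 q x"
      using inv Wmat_in_W_B3[of \<sigma> \<epsilon>, OF that] unfolding invariant_def by blast
    then show ?thesis by (simp only: ev)
  qed
  have s1: "1 \<in> signs" "-1 \<in> signs" by (auto simp: signs_def)
  have sw12: "s b a c = s a b c" for a b c
  proof -
    have "dp M s = dp M (\<lambda>a b c. s b a c)"
    proof
      fix x
      let ?A = "Wmat (Transposition.transpose 1 2) (\<lambda>_. 1)"
      have "mnm a b c (?A *v x) = mnm b a c x" for a b c
        unfolding mnm_def Wmat_mult by (simp add: transpose_def mult.commute mult.left_commute)
      then have "dp M s (?A *v x) = (\<Sum>a<M. \<Sum>b<M. \<Sum>c<M. s a b c * mnm b a c x)" by (simp add: dp_def)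
      also have "\<dots> = dp M (\<lambda>a b c. s b a c) x" unfolding dp_def by (rule sum.swap)
      finally show "dp M s x = dp M (\<lambda>a b c. s b a c) x" using eq[of "Transposition.transpose 1 2" "\<lambda>_. 1" x] s1 by simp
    qed
    from dp_inject[OF box _ M this] have "s = (\<lambda>a b c. s b a c)" using box by (auto simp: in_box_def)
    then show ?thesis by (metis (no_types))
  qed
  have sw23: "s a c b = s a b c" for a b c
  proof -
    have "dp M s = dp M (\<lambda>a b c. s a c b)"
    proof
      fix x
      let ?A = "Wmat (Transposition.transpose 2 3) (\<lambda>_. 1)"
      have "mnm a b c (?A *v x) = mnm a c b x" for a b c
        unfolding mnm_def Wmat_mult by (simp add: transpose_def mult.commute mult.left_commute)
      then have "dp M s (?A *v x) = (\<Sum>a<M. \<Sum>b<M. \<Sum>c<M. s a b c * mnm a c b x)" by (simp add: dp_def)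
      also have "\<dots> = dp M (\<lambda>a b c. s a c b) x" unfolding dp_def by (intro sum.cong refl sum.swap)
      finally show "dp M s x = dp M (\<lambda>a b c. s a c b) x" using eq[of "Transposition.transpose 2 3" "\<lambda>_. 1" x] s1 by simp
    qed
    from dp_inject[OF box _ M this] have "s = (\<lambda>a b c. s a c b)" using box by (auto simp: in_box_def)
    then show ?thesis by (metis (no_types))
  qed
  have par: "s a b c = 0" if "odd a" for a b c
  proof -
    have "dp M s = dp M (\<lambda>a b c. (-1) ^ a * s a b c)"
    proof
      fix x
      let ?e = "\<lambda>i::3. if i = 1 then -1 else (1::real)"
      have "mnm a b c (Wmat id ?e *v x) = (-1) ^ a * mnm a b c x" for a b c
        unfolding mnm_def Wmat_mult by (simp add: power_minus[of "x $ 1"])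
      then have "dp M s (Wmat id ?e *v x) = dp M (\<lambda>a b c. (-1) ^ a * s a b c) x"
        by (simp add: dp_def mult_ac)
      then show "dp M s x = dp M (\<lambda>a b c. (-1) ^ a * s a b c) x" using eq[of id ?e x] s1 by simp
    qed
    from dp_inject[OF box _ M this] have "s = (\<lambda>a b c. (-1) ^ a * s a b c)" using box by (auto simp: in_box_def)
    from fun_cong[OF fun_cong[OF fun_cong[OF this, of a], of b], of c] show ?thesis using that by simp
  qed
  have co: "co b a c = co a b c" "co a c b = co a b c" for a b c
    using sw12[of b a c] sw23[of a c b] by (auto simp: s_def)
  have pa: "even a" if "co a b c \<noteq> 0" for a b c using par[of a b c] that by (auto simp: s_def)
  have "symmetric_even co"
    unfolding symmetric_even_def using co pa by metis
  then show ?thesis by (simp add: co_def[abs_def])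
qed

text \<open>Derivatives of order 10 or more in one variable kill an array in the box of size 10, so
  the sum over the symbol may be cut off there.\<close>

lemma diff_op_act:
  assumes t: "in_box 10 t"
  shows "diff_op q (dp 10 t) = dp 10 (act (\<lambda>a b c. Poly_Mapping.lookup q (vec3 (a, b, c))) t)"
proof -
  have "qarr q t = act (\<lambda>a b c. Poly_Mapping.lookup q (vec3 (a, b, c))) t"
  proof (intro ext)
    fix a' b' c'
    let ?B = "{..<10::nat} \<times> {..<10::nat} \<times> {..<10::nat}"
    have "act (\<lambda>a b c. Poly_Mapping.lookup q (vec3 (a, b, c))) t a' b' c'
        = (\<Sum>(a, b, c)\<in>?B. Poly_Mapping.lookup q (vec3 (a, b, c)) * t (a + a') (b + b') (c + c'))"
      by (simp add: act_def sum.cartesian_product)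
    also have "\<dots> = (\<Sum>\<alpha>\<in>vec3 ` ?B. Poly_Mapping.lookup q \<alpha> * t (\<alpha> $ 1 + a') (\<alpha> $ 2 + b') (\<alpha> $ 3 + c'))"
      by (subst sum.reindex) (auto intro: inj_on_subset[OF inj_vec3] intro!: sum.cong)
    also have "\<dots> = (\<Sum>\<alpha>\<in>vec3 ` ?B \<union> Poly_Mapping.keys q. Poly_Mapping.lookup q \<alpha> * t (\<alpha> $ 1 + a') (\<alpha> $ 2 + b') (\<alpha> $ 3 + c'))"
    proof (rule sum.mono_neutral_left)
      show "\<forall>\<alpha>\<in>vec3 ` ?B \<union> Poly_Mapping.keys q - vec3 ` ?B. Poly_Mapping.lookup q \<alpha> * t (\<alpha> $ 1 + a') (\<alpha> $ 2 + b') (\<alpha> $ 3 + c') = 0"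
      proof
        fix \<alpha> assume "\<alpha> \<in> vec3 ` ?B \<union> Poly_Mapping.keys q - vec3 ` ?B"
        then have "(\<alpha> $ 1, \<alpha> $ 2, \<alpha> $ 3) \<notin> ?B" by (metis DiffD2 image_eqI vec3_trip)
        then have "10 \<le> \<alpha> $ 1 + a' \<or> 10 \<le> \<alpha> $ 2 + b' \<or> 10 \<le> \<alpha> $ 3 + c'" by auto
        then show "Poly_Mapping.lookup q \<alpha> * t (\<alpha> $ 1 + a') (\<alpha> $ 2 + b') (\<alpha> $ 3 + c') = 0"
          using t unfolding in_box_def by (metis mult_zero_right)
      qed
    qed auto
    also have "\<dots> = qarr q t a' b' c'"
      unfolding qarr_def by (rule sum.mono_neutral_right) (auto simp: in_keys_iff)
    finally show "qarr q t a' b' c' = act (\<lambda>a b c. Poly_Mapping.lookup q (vec3 (a, b, c))) t a' b' c'" by simp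
  qed
  then show ?thesis by (simp add: diff_op_dp[OF t])
qed

lemma eval3_at_0: "eval3 q 0 = Poly_Mapping.lookup q (vec3 (0, 0, 0))"
proof -
  obtain M where M: "M > 0"
    and ev: "\<And>x. eval3 q x = dp M (\<lambda>a b c. fact a * fact b * fact c * Poly_Mapping.lookup q (vec3 (a, b, c))) x"
    by (rule eval3_dp[of q]) blast
  show ?thesis unfolding ev by (simp add: dp_at_0[OF M])
qed

text \<open>All invariant symbols without constant term are treated together: their coefficient
  arrays are symmetric and even, hence annihilate the alternating array of \<open>Delta_B3\<close>
  and all its derivatives, which exhaust \<open>K48\<close>.\<close>

theorem G_harmonic_eq_K48: "G_harmonic W_B3 = K48"
proof
  show "G_harmonic W_B3 \<subseteq> K48" by (rule G_harmonic_subset_K48)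
  show "K48 \<subseteq> G_harmonic W_B3"
  proof
    fix T assume "T \<in> K48"
    then obtain q where T: "T = regular (diff_op q Delta_B3)" unfolding K48_basis(1) by blast
    have T': "T = regular (dp 10 (qarr q tDelta))"
      unfolding T Delta_eq_dp diff_op_dp[OF in_box_tDelta] ..
    note box = in_box_qarr[OF in_box_tDelta, of q]
    have "dist_op \<phi> T = (\<lambda>_. 0)" if "invariant W_B3 \<phi>" "eval3 \<phi> 0 = 0" for \<phi>
    proof -
      let ?co = "\<lambda>a b c. Poly_Mapping.lookup \<phi> (vec3 (a, b, c))"
      have "act ?co sDelta a b c = 0" for a b c
        using that(2) by (intro act_sDelta invariant_symmetric_even that(1)) (simp add: eval3_at_0)
      then have "act ?co tDelta a b c = 0" for a b c
        by (simp add: tDelta_def[abs_def] act_cmult)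
      then have "act ?co (qarr q tDelta) a b c = 0" for a b c by (rule act_qarr)
      then have "act ?co (qarr q tDelta) = (\<lambda>_ _ _. 0)" by (intro ext)
      then have "diff_op \<phi> (dp 10 (qarr q tDelta)) = (\<lambda>x. 0)"
        by (simp add: diff_op_act[OF box] dp_zero)
      then show ?thesis
        unfolding T' dist_op_regular[OF smooth_dp] by (simp add: regular_def fun_eq_iff)
    qed
    moreover have "distribution T"
      unfolding T' by (intro distribution_regular smooth_continuous_on smooth_dp)
    ultimately show "T \<in> G_harmonic W_B3" by (simp add: G_harmonic_def)
  qed
qed

section \<open>Exact Taylor expansion and mean values of polynomials\<close>

lemma divided_power_sum_shift:
  fixes g :: "nat \<Rightarrow> real"
  assumes "\<And>a. a \<ge> N \<Longrightarrow> g a = 0"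
  shows "(\<Sum>a<N. g a * ((u + v) ^ a / fact a)) = (\<Sum>i<N. v ^ i / fact i * (\<Sum>a<N. g (i + a) * (u ^ a / fact a)))"
proof -
  have bin: "(u + v) ^ n / fact n = (\<Sum>i\<le>n. (v ^ i / fact i) * (u ^ (n - i) / fact (n - i)))" for n
  proof -
    have "(u + v) ^ n = (v + u) ^ n" by (simp add: add.commute)
    also have "\<dots> = (\<Sum>i\<le>n. of_nat (n choose i) * v ^ i * u ^ (n - i))" by (rule binomial_ring)
    also have "\<dots> / fact n = (\<Sum>i\<le>n. (v ^ i / fact i) * (u ^ (n - i) / fact (n - i)))"
      unfolding sum_divide_distrib
      by (intro sum.cong refl) (simp add: binomial_fact)
    finally show ?thesis by simp
  qed
  have "(\<Sum>a<N. g a * ((u + v) ^ a / fact a)) = (\<Sum>a<N. \<Sum>i\<le>a. g (i + (a - i)) * ((v ^ i / fact i) * (u ^ (a - i) / fact (a - i))))"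
    unfolding bin sum_distrib_left by (intro sum.cong refl) auto
  also have "\<dots> = (\<Sum>(i, j)\<in>{(i, j). i + j < N}. g (i + j) * ((v ^ i / fact i) * (u ^ j / fact j)))"
    by (rule sum.triangle_reindex[symmetric])
  also have "\<dots> = (\<Sum>(i, j)\<in>{..<N} \<times> {..<N}. g (i + j) * ((v ^ i / fact i) * (u ^ j / fact j)))"
    by (rule sum.mono_neutral_left) (auto, metis assms not_less)
  also have "\<dots> = (\<Sum>i<N. v ^ i / fact i * (\<Sum>a<N. g (i + a) * (u ^ a / fact a)))"
    by (simp add: sum.cartesian_product[symmetric] sum_distrib_left mult_ac)
  finally show ?thesis .
qed

text \<open>The binomial theorem in divided powers has no coefficients, so a translation becomes a
  contraction of the array with the monomials of \<open>y\<close>. It is applied to one coordinate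
  at a time.\<close>

lemma dp_translate:
  assumes s: "in_box N s"
  shows "dp N s (x + y) = (\<Sum>i<N. \<Sum>j<N. \<Sum>k<N. mnm i j k y * dp N (shift i j k s) x)"
proof -
  \<comment> \<open>A one-variable evaluation; \<open>dp\<close> is its threefold nesting.\<close>
  define S where "S u g = (\<Sum>a<N. g a * (u ^ a / fact a))" for u and g :: "nat \<Rightarrow> real"
  have S: "S (u + v) g = (\<Sum>i<N. v ^ i / fact i * S u (\<lambda>a. g (i + a)))" if "\<And>a. a \<ge> N \<Longrightarrow> g a = 0" for u v g
    unfolding S_def by (rule divided_power_sum_shift[OF that])
  have Ssum: "S u (\<lambda>a. \<Sum>i<N. w i * h i a) = (\<Sum>i<N. w i * S u (h i))" for u w h
    unfolding S_def sum_distrib_left sum_distrib_right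
    by (subst sum.swap) (simp add: mult.assoc)
  have dpS: "dp N s x = S (x $ 1) (\<lambda>a. S (x $ 2) (\<lambda>b. S (x $ 3) (s a b)))" for s x
    unfolding dp_def S_def mnm_def sum_distrib_right by (intro sum.cong refl) (simp add: mult_ac)
  have z: "s a b c = 0" if "N \<le> a \<or> N \<le> b \<or> N \<le> c" for a b c using s that by (auto simp: in_box_def)
  have S0: "S u g = 0" if "\<And>a. a < N \<Longrightarrow> g a = 0" for u g using that by (simp add: S_def)
  have "dp N s (x + y) = S (x $ 1 + y $ 1) (\<lambda>a. S (x $ 2 + y $ 2) (\<lambda>b. S (x $ 3 + y $ 3) (s a b)))"
    by (simp add: dpS)
  also have "\<dots> = (\<Sum>k<N. y $ 3 ^ k / fact k * (\<Sum>j<N. y $ 2 ^ j / fact j * (\<Sum>i<N. y $ 1 ^ i / fact i *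
      S (x $ 1) (\<lambda>a. S (x $ 2) (\<lambda>b. S (x $ 3) (\<lambda>c. s (i + a) (j + b) (k + c)))))))"
  proof -
    have 3: "S (x $ 3 + y $ 3) (s a b) = (\<Sum>k<N. y $ 3 ^ k / fact k * S (x $ 3) (\<lambda>c. s a b (k + c)))" for a b
      by (rule S) (simp add: z)
    have 2: "S (x $ 2 + y $ 2) (\<lambda>b. S (x $ 3) (\<lambda>c. s a b (k + c)))
        = (\<Sum>j<N. y $ 2 ^ j / fact j * S (x $ 2) (\<lambda>b. S (x $ 3) (\<lambda>c. s a (j + b) (k + c))))" for a k
      by (rule S) (simp add: z S0)
    have 1: "S (x $ 1 + y $ 1) (\<lambda>a. S (x $ 2) (\<lambda>b. S (x $ 3) (\<lambda>c. s a (j + b) (k + c))))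
        = (\<Sum>i<N. y $ 1 ^ i / fact i * S (x $ 1) (\<lambda>a. S (x $ 2) (\<lambda>b. S (x $ 3) (\<lambda>c. s (i + a) (j + b) (k + c)))))" for j k
      by (rule S) (simp add: z S0)
    show ?thesis unfolding 3 Ssum 2 1 ..
  qed
  also have "\<dots> = (\<Sum>k<N. \<Sum>j<N. \<Sum>i<N. mnm i j k y * dp N (shift i j k s) x)"
    unfolding dpS shift_def mnm_def sum_distrib_left by (simp add: mult_ac)
  also have "\<dots> = (\<Sum>j<N. \<Sum>k<N. \<Sum>i<N. mnm i j k y * dp N (shift i j k s) x)" by (rule sum.swap)
  also have "\<dots> = (\<Sum>j<N. \<Sum>i<N. \<Sum>k<N. mnm i j k y * dp N (shift i j k s) x)" by (intro sum.cong refl sum.swap)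
  also have "\<dots> = (\<Sum>i<N. \<Sum>j<N. \<Sum>k<N. mnm i j k y * dp N (shift i j k s) x)" by (rule sum.swap)
  finally show ?thesis .
qed

definition homog :: "nat \<Rightarrow> (nat \<Rightarrow> nat \<Rightarrow> nat \<Rightarrow> real) \<Rightarrow> nat \<Rightarrow> nat \<Rightarrow> nat \<Rightarrow> real" where
  "homog m w a b c = (if a + b + c = m then w a b c else 0)"

text \<open>The terms are grouped by powers of \<rho>. The coefficient of \<rho>^m is the
  homogeneous part of degree m of the moment array acting on \<open>s\<close>, so only m = 0
  survives.\<close>

lemma mean_value_dp:
  assumes z: "\<And>m a b c. m \<ge> 1 \<Longrightarrow> act (homog m w) s a b c = 0"
  shows "(\<Sum>i<10. \<Sum>j<10. \<Sum>k<10. w i j k * \<rho> ^ (i + j + k) * dp 10 (shift i j k s) x) = w 0 0 0 * dp 10 s x"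
proof -
  \<comment> \<open>Three exponents below 10 have sum at most 27, hence below 30.\<close>
  have pick: "w i j k * \<rho> ^ (i + j + k) = (\<Sum>m<30. \<rho> ^ m * homog m w i j k)" if "i < 10" "j < 10" "k < 10" for i j k
    using that by (simp add: homog_def if_distrib[of "\<lambda>u. _ * u"] sum.delta cong: if_cong)
  have "(\<Sum>i<10. \<Sum>j<10. \<Sum>k<10. w i j k * \<rho> ^ (i + j + k) * dp 10 (shift i j k s) x) =
     (\<Sum>i<10. \<Sum>j<10. \<Sum>k<10. \<Sum>m<30. \<rho> ^ m * (homog m w i j k * dp 10 (shift i j k s) x))"
    by (intro sum.cong refl) (simp add: pick sum_distrib_right mult.assoc)
  also have "\<dots> = (\<Sum>m<30. \<Sum>i<10. \<Sum>j<10. \<Sum>k<10. \<rho> ^ m * (homog m w i j k * dp 10 (shift i j k s) x))"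
    by (simp only: sum.swap[of _ "{..<30}"])
  also have "\<dots> = (\<Sum>m<30. \<rho> ^ m * dp 10 (act (homog m w) s) x)"
    unfolding act_def[abs_def] dp_sum dp_cmult
    by (simp add: sum_distrib_left shift_def[abs_def])
  also have "\<dots> = (\<Sum>m<30::nat. if m = 0 then dp 10 (act (homog 0 w) s) x else 0)"
  proof (intro sum.cong refl)
    fix m
    show "\<rho> ^ m * dp 10 (act (homog m w) s) x = (if m = 0 then dp 10 (act (homog 0 w) s) x else 0)"
    proof (cases "m = 0")
      case False
      then have "act (homog m w) s = (\<lambda>_ _ _. 0)" using z[of m] by (intro ext) simp
      then show ?thesis using False by (simp add: dp_zero)
    qed simp
  qed
  also have "\<dots> = dp 10 (act (homog 0 w) s) x" by (simp add: sum.delta)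
  also have "act (homog 0 w) s = (\<lambda>a b c. w 0 0 0 * s a b c)"
  proof (intro ext)
    fix a b c
    have "homog 0 w i j k * s (i + a) (j + b) (k + c) = (if i = 0 \<and> j = 0 \<and> k = 0 then w i j k * s (i + a) (j + b) (k + c) else 0)" for i j k
      by (auto simp: homog_def)
    then show "act (homog 0 w) s a b c = w 0 0 0 * s a b c"
      unfolding act_def by (simp add: sum3_delta)
  qed
  finally show ?thesis by (simp add: dp_cmult)
qed

section \<open>Averaging functionals\<close>

text \<open>What the argument uses of integration over a compact skeleton: linearity on continuous
  functions, a bound by the supremum over a cube, and Fubini for kernels compactly supported in
  \<open>x\<close>. It allows one treatment of points, segments, triangles and the solid.\<close>

definition nice :: "((real^3 \<Rightarrow> real) \<Rightarrow> real) \<Rightarrow> bool" where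
  "nice L \<longleftrightarrow>
     (\<forall>f g. continuous_on UNIV f \<longrightarrow> continuous_on UNIV g \<longrightarrow> L (\<lambda>y. f y + g y) = L f + L g) \<and>
     (\<forall>c f. continuous_on UNIV f \<longrightarrow> L (\<lambda>y. c * f y) = c * L f) \<and>
     (\<exists>R C. R > 0 \<and> C \<ge> 0 \<and> (\<forall>f M. continuous_on UNIV f \<longrightarrow> M \<ge> 0 \<longrightarrow>
        (\<forall>y. (\<forall>i. \<bar>y $ i\<bar> \<le> R) \<longrightarrow> \<bar>f y\<bar> \<le> M) \<longrightarrow> \<bar>L f\<bar> \<le> C * M)) \<and>
     (\<forall>(h :: (real^3) \<times> (real^3) \<Rightarrow> real) R. continuous_on UNIV h \<longrightarrow> (\<forall>x y i. \<bar>x $ i\<bar> \<ge> R \<longrightarrow> h (x, y) = 0) \<longrightarrow>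
        integrable lborel (\<lambda>x. L (\<lambda>y. h (x, y))) \<and>
        (LINT x|lborel. L (\<lambda>y. h (x, y))) = L (\<lambda>y. LINT x|lborel. h (x, y)))"

lemma nice_cmult:
  assumes "nice L" shows "nice (\<lambda>f. c * L f)"
  unfolding nice_def
proof (intro conjI allI impI)
  show "c * L (\<lambda>y. f y + g y) = c * L f + c * L g" if "continuous_on UNIV f" "continuous_on UNIV g" for f g
    using assms that by (simp add: nice_def algebra_simps)
  show "c * L (\<lambda>y. d * f y) = d * (c * L f)" if "continuous_on UNIV f" for d f
    using assms that by (simp add: nice_def)
  obtain R C where RC: "R > 0" "C \<ge> 0" and b: "\<And>f M. continuous_on UNIV f \<Longrightarrow> M \<ge> 0 \<Longrightarrow> (\<And>y. (\<And>i. \<bar>y $ i\<bar> \<le> R) \<Longrightarrow> \<bar>f y\<bar> \<le> M) \<Longrightarrow> \<bar>L f\<bar> \<le> C * M"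
    using assms unfolding nice_def by blast
  show "\<exists>R C. R > 0 \<and> C \<ge> 0 \<and> (\<forall>f M. continuous_on UNIV f \<longrightarrow> M \<ge> 0 \<longrightarrow>
        (\<forall>y. (\<forall>i. \<bar>y $ i\<bar> \<le> R) \<longrightarrow> \<bar>f y\<bar> \<le> M) \<longrightarrow> \<bar>c * L f\<bar> \<le> C * M)"
  proof (rule exI[of _ R], rule exI[of _ "\<bar>c\<bar> * C"], intro conjI allI impI)
    fix f :: "real^3 \<Rightarrow> real" and M :: real assume "continuous_on UNIV f" "M \<ge> 0" "\<forall>y. (\<forall>i. \<bar>y $ i\<bar> \<le> R) \<longrightarrow> \<bar>f y\<bar> \<le> M"
    then have "\<bar>L f\<bar> \<le> C * M" using b by blast
    then show "\<bar>c * L f\<bar> \<le> \<bar>c\<bar> * C * M" by (simp add: abs_mult mult.assoc mult_left_mono)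
  qed (use RC in auto)
  fix h :: "(real^3) \<times> (real^3) \<Rightarrow> real" and R :: real assume "continuous_on UNIV h" "\<forall>x y i. \<bar>x $ i\<bar> \<ge> R \<longrightarrow> h (x, y) = 0"
  then have "integrable lborel (\<lambda>x. L (\<lambda>y. h (x, y)))" "(LINT x|lborel. L (\<lambda>y. h (x, y))) = L (\<lambda>y. LINT x|lborel. h (x, y))"
    using assms unfolding nice_def by blast+
  then show "integrable lborel (\<lambda>x. c * L (\<lambda>y. h (x, y)))" "(LINT x|lborel. c * L (\<lambda>y. h (x, y))) = c * L (\<lambda>y. LINT x|lborel. h (x, y))"
    by simp_all
qed

lemma nice_add:
  assumes "nice L" "nice L'" shows "nice (\<lambda>f. L f + L' f)"
  unfolding nice_def
proof (intro conjI allI impI)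
  show "L (\<lambda>y. f y + g y) + L' (\<lambda>y. f y + g y) = L f + L' f + (L g + L' g)" if "continuous_on UNIV f" "continuous_on UNIV g" for f g
    using assms that by (simp add: nice_def algebra_simps)
  show "L (\<lambda>y. d * f y) + L' (\<lambda>y. d * f y) = d * (L f + L' f)" if "continuous_on UNIV f" for d f
    using assms that by (simp add: nice_def algebra_simps)
  obtain R C where RC: "R > 0" "C \<ge> 0" and b: "\<And>f M. continuous_on UNIV f \<Longrightarrow> M \<ge> 0 \<Longrightarrow> (\<And>y. (\<And>i. \<bar>y $ i\<bar> \<le> R) \<Longrightarrow> \<bar>f y\<bar> \<le> M) \<Longrightarrow> \<bar>L f\<bar> \<le> C * M"
    using assms(1) unfolding nice_def by blast
  obtain R' C' where RC': "R' > 0" "C' \<ge> 0" and b': "\<And>f M. continuous_on UNIV f \<Longrightarrow> M \<ge> 0 \<Longrightarrow> (\<And>y. (\<And>i. \<bar>y $ i\<bar> \<le> R') \<Longrightarrow> \<bar>f y\<bar> \<le> M) \<Longrightarrow> \<bar>L' f\<bar> \<le> C' * M"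
    using assms(2) unfolding nice_def by blast
  show "\<exists>R C. R > 0 \<and> C \<ge> 0 \<and> (\<forall>f M. continuous_on UNIV f \<longrightarrow> M \<ge> 0 \<longrightarrow>
        (\<forall>y. (\<forall>i. \<bar>y $ i\<bar> \<le> R) \<longrightarrow> \<bar>f y\<bar> \<le> M) \<longrightarrow> \<bar>L f + L' f\<bar> \<le> C * M)"
  proof (rule exI[of _ "max R R'"], rule exI[of _ "C + C'"], intro conjI allI impI)
    fix f :: "real^3 \<Rightarrow> real" and M assume f: "continuous_on UNIV f" "M \<ge> 0" and *: "\<forall>y. (\<forall>i. \<bar>y $ i\<bar> \<le> max R R') \<longrightarrow> \<bar>f y\<bar> \<le> M"
    have "\<bar>L f\<bar> \<le> C * M"
    proof (rule b[OF f])
      fix y :: "real^3" assume "\<And>i. \<bar>y $ i\<bar> \<le> R"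
      then have "\<forall>i. \<bar>y $ i\<bar> \<le> max R R'" by (meson max.coboundedI1)
      then show "\<bar>f y\<bar> \<le> M" using * by blast
    qed
    moreover have "\<bar>L' f\<bar> \<le> C' * M"
    proof (rule b'[OF f])
      fix y :: "real^3" assume "\<And>i. \<bar>y $ i\<bar> \<le> R'"
      then have "\<forall>i. \<bar>y $ i\<bar> \<le> max R R'" by (meson max.coboundedI2)
      then show "\<bar>f y\<bar> \<le> M" using * by blast
    qed
    ultimately show "\<bar>L f + L' f\<bar> \<le> (C + C') * M" by (simp add: distrib_right)
  qed (use RC RC' in auto)
  fix h :: "(real^3) \<times> (real^3) \<Rightarrow> real" and R :: real assume "continuous_on UNIV h" "\<forall>x y i. \<bar>x $ i\<bar> \<ge> R \<longrightarrow> h (x, y) = 0"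
  then have "integrable lborel (\<lambda>x. L (\<lambda>y. h (x, y)))" "(LINT x|lborel. L (\<lambda>y. h (x, y))) = L (\<lambda>y. LINT x|lborel. h (x, y))"
    "integrable lborel (\<lambda>x. L' (\<lambda>y. h (x, y)))" "(LINT x|lborel. L' (\<lambda>y. h (x, y))) = L' (\<lambda>y. LINT x|lborel. h (x, y))"
    using assms unfolding nice_def by blast+
  then show "integrable lborel (\<lambda>x. L (\<lambda>y. h (x, y)) + L' (\<lambda>y. h (x, y)))"
     "(LINT x|lborel. L (\<lambda>y. h (x, y)) + L' (\<lambda>y. h (x, y))) = L (\<lambda>y. LINT x|lborel. h (x, y)) + L' (\<lambda>y. LINT x|lborel. h (x, y))"
    by simp_all
qed

lemma nice_zero: "nice (\<lambda>f. 0)"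
  unfolding nice_def by (auto intro!: exI[of _ 1])

lemma nice_sum:
  assumes "\<And>i. i \<in> A \<Longrightarrow> nice (L i)" shows "nice (\<lambda>f. \<Sum>i\<in>A. L i f)"
  using assms by (induction A rule: infinite_finite_induct) (auto intro: nice_zero nice_add)

text \<open>Every piece of a skeleton is a continuous image of a compact parameter set with Lebesgue
  measure.\<close>

lemma nice_base:
  fixes S :: "'a::euclidean_space set" and \<phi> :: "'a \<Rightarrow> real^3"
  assumes S: "compact S" and \<phi>: "continuous_on UNIV \<phi>"
  shows "nice (\<lambda>f. LINT t:S|lborel. f (\<phi> t))"
  unfolding nice_def
proof (intro conjI allI impI)
  have cf: "continuous_on X (\<lambda>t. f (\<phi> t))" if "continuous_on UNIV f" for f :: "real^3 \<Rightarrow> real" and X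
    by (intro continuous_on_compose2[OF that] continuous_on_subset[OF \<phi>]) auto
  have int: "set_integrable lborel S (\<lambda>t. f (\<phi> t))" if "continuous_on UNIV f" for f :: "real^3 \<Rightarrow> real"
    unfolding set_integrable_def by (intro borel_integrable_compact S cf that)
  show "(LINT t:S|lborel. f (\<phi> t) + g (\<phi> t)) = (LINT t:S|lborel. f (\<phi> t)) + (LINT t:S|lborel. g (\<phi> t))"
    if "continuous_on UNIV f" "continuous_on UNIV g" for f g :: "real^3 \<Rightarrow> real"
    by (rule set_integral_add(2)[OF int[OF that(1)] int[OF that(2)]])
  show "(LINT t:S|lborel. c * f (\<phi> t)) = c * (LINT t:S|lborel. f (\<phi> t))" for c and f :: "real^3 \<Rightarrow> real"
    by (simp add: set_lebesgue_integral_def mult.left_commute)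
  have "bounded (\<phi> ` S)"
    by (intro compact_imp_bounded compact_continuous_image S continuous_on_subset[OF \<phi>]) auto
  then obtain B where B: "\<And>t. t \<in> S \<Longrightarrow> norm (\<phi> t) \<le> B" by (auto simp: bounded_iff)
  show "\<exists>R C. R > 0 \<and> C \<ge> 0 \<and> (\<forall>(f :: real^3 \<Rightarrow> real) M. continuous_on UNIV f \<longrightarrow> M \<ge> 0 \<longrightarrow>
        (\<forall>y. (\<forall>i. \<bar>y $ i\<bar> \<le> R) \<longrightarrow> \<bar>f y\<bar> \<le> M) \<longrightarrow> \<bar>LINT t:S|lborel. f (\<phi> t)\<bar> \<le> C * M)"
  proof (rule exI[of _ "\<bar>B\<bar> + 1"], rule exI[of _ "measure lborel S"], intro conjI allI impI)
    fix f :: "real^3 \<Rightarrow> real" and M assume f: "continuous_on UNIV f" and M: "M \<ge> 0" and *: "\<forall>y. (\<forall>i. \<bar>y $ i\<bar> \<le> \<bar>B\<bar> + 1) \<longrightarrow> \<bar>f y\<bar> \<le> M"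
    have bd: "\<bar>f (\<phi> t)\<bar> \<le> M" if "t \<in> S" for t
    proof -
      have "\<bar>\<phi> t $ i\<bar> \<le> \<bar>B\<bar> + 1" for i
        using component_le_norm_cart[of "\<phi> t" i] B[OF that] by linarith
      then show ?thesis using * by blast
    qed
    have "\<bar>LINT t:S|lborel. f (\<phi> t)\<bar> \<le> (LINT t|lborel. indicator S t * M)"
      unfolding set_lebesgue_integral_def real_norm_def[symmetric]
    proof (rule Bochner_Integration.integral_norm_bound_integral)
      show "integrable lborel (\<lambda>t. indicat_real S t *\<^sub>R f (\<phi> t))" using int[OF f] by (simp add: set_integrable_def)
      show "integrable lborel (\<lambda>t. indicator S t * M)"
        using borel_integrable_compact[OF S, of "\<lambda>_. M"] by simp
    qed (auto simp: indicator_def bd)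
    also have "\<dots> = measure lborel S * M"
      using S by (simp add: borel_compact)
    finally show "\<bar>LINT t:S|lborel. f (\<phi> t)\<bar> \<le> measure lborel S * M" .
  qed auto
  fix h :: "(real^3) \<times> (real^3) \<Rightarrow> real" and R :: real
  assume h: "continuous_on UNIV h" and v: "\<forall>x y i. \<bar>x $ i\<bar> \<ge> R \<longrightarrow> h (x, y) = 0"
  let ?K = "cbox (\<chi> i. - R) (\<chi> i. R) :: (real^3) set"
  let ?H = "\<lambda>t x. indicator S t * h (x, \<phi> t)"
  \<comment> \<open>The kernel vanishes for \<open>x\<close> outside the cube \<open>?K\<close>, so
    the integrand lives on the compact product of \<open>S\<close> and \<open>?K\<close>.\<close>
  have "integrable lborel (\<lambda>p. indicator (S \<times> ?K) p *\<^sub>R h (snd p, \<phi> (fst p)))"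
    by (intro borel_integrable_compact compact_Times S compact_cbox continuous_on_compose2[OF h] continuous_intros
        continuous_on_compose2[OF \<phi>]) auto
  also have "(\<lambda>p. indicator (S \<times> ?K) p *\<^sub>R h (snd p, \<phi> (fst p))) = (\<lambda>p. ?H (fst p) (snd p))"
  proof
    fix p :: "'a \<times> (real^3)"
    show "indicator (S \<times> ?K) p *\<^sub>R h (snd p, \<phi> (fst p)) = ?H (fst p) (snd p)"
    proof (cases "snd p \<in> ?K")
      case False
      then obtain i where "\<bar>snd p $ i\<bar> \<ge> R" by (rule outside_cube)
      then have "h (snd p, \<phi> (fst p)) = 0" using v by blast
      then show ?thesis by simp
    qed (cases p, auto simp: indicator_def)
  qed
  finally have I: "integrable (lborel \<Otimes>\<^sub>M lborel) (\<lambda>(t, x). ?H t x)"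
    by (simp add: lborel_prod split_def)
  have e: "(LINT t:S|lborel. h (x, \<phi> t)) = (LINT t|lborel. ?H t x)" for x
    by (simp add: set_lebesgue_integral_def)
  show "integrable lborel (\<lambda>x. LINT t:S|lborel. h (x, \<phi> t))"
    unfolding e by (rule lborel_pair.integrable_snd[OF I])
  have "(LINT x|lborel. (LINT t:S|lborel. h (x, \<phi> t))) = (LINT t|lborel. LINT x|lborel. ?H t x)"
    unfolding e by (rule lborel_pair.Fubini_integral[OF I])
  also have "\<dots> = (LINT t:S|lborel. (LINT x|lborel. h (x, \<phi> t)))"
    by (simp add: set_lebesgue_integral_def)
  finally show "(LINT x|lborel. (LINT t:S|lborel. h (x, \<phi> t))) = (LINT t:S|lborel. (LINT x|lborel. h (x, \<phi> t)))" .
qed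

section \<open>Moment relations for continuous functions with a mean value property\<close>

lemma taylor_line:
  assumes "smooth \<psi>" "\<And>x. \<bar>(partial i ^^ N) \<psi> x\<bar> \<le> M"
  shows "\<bar>\<psi> (x + t *\<^sub>R axis i 1) - (\<Sum>m<N. t ^ m / fact m * (partial i ^^ m) \<psi> x)\<bar> \<le> M * \<bar>t\<bar> ^ N"
proof -
  define df where "df m t = (partial i ^^ m) \<psi> (x + t *\<^sub>R axis i 1)" for m t
  have D: "\<forall>m t. (df m has_field_derivative df (Suc m) t) (at t)"
    unfolding df_def
    using DERIV_partial_line[OF smooth_differentiable[OF smooth_funpow[OF assms(1)]]] by simp
  obtain s where s: "df 0 t = (\<Sum>m<N. df m 0 / fact m * t ^ m) + df N s / fact N * t ^ N"
    using Maclaurin_all_le[of df "df 0" t N] D by auto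
  have "\<psi> (x + t *\<^sub>R axis i 1) - (\<Sum>m<N. t ^ m / fact m * (partial i ^^ m) \<psi> x) = df N s / fact N * t ^ N"
    using s by (simp add: df_def mult.commute)
  also have "\<bar>\<dots>\<bar> \<le> M / 1 * \<bar>t\<bar> ^ N"
    unfolding abs_mult abs_divide power_abs
    using assms(2)[of "x + s *\<^sub>R axis i 1"]
    by (intro mult_right_mono frac_le) (auto simp: df_def)
  finally show ?thesis by simp
qed

text \<open>A Taylor polynomial with every single exponent below \<open>N\<close> results from three
  one-variable expansions carried out in turn; the remainder then needs one-variable estimates
  only.\<close>

lemma taylor_box:
  assumes t: "test_function \<psi>"
  obtains C where "C \<ge> 0" "\<And>x z \<delta>. (\<And>i. \<bar>z $ i\<bar> \<le> \<delta>) \<Longrightarrow> \<delta> \<le> 1 \<Longrightarrow>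
    \<bar>\<psi> (x + z) - (\<Sum>a<N. \<Sum>b<N. \<Sum>c<N. mnm a b c z * D3 a b c \<psi> x)\<bar> \<le> C * \<delta> ^ N"
proof -
  note sm = test_function_smooth[OF t]
  have "\<exists>M\<ge>0. \<forall>x. \<bar>D3 a b c \<psi> x\<bar> \<le> M" for a b c
  proof -
    obtain R where R: "vanish R (D3 a b c \<psi>)" using test_function_D3[OF t] by (rule test_function_vanish)
    show ?thesis using vanish_bounded[OF smooth_continuous_on[OF smooth_D3[OF sm]] R] by metis
  qed
  then obtain m where m: "\<And>a b c. m a b c \<ge> 0" "\<And>a b c x. \<bar>D3 a b c \<psi> x\<bar> \<le> m a b c" by metis
  \<comment> \<open>One bound for exactly the derivatives that occur in the three remainders: order
    \<open>N\<close> in the direction being expanded, below \<open>N\<close> in those already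
    expanded.\<close>
  define M where "M = m N 0 0 + (\<Sum>a<N. m a N 0 + (\<Sum>b<N. m a b N))"
  have M0: "m N 0 0 \<le> M" unfolding M_def by (simp add: sum_nonneg m)
  have M1: "m a N 0 \<le> M" if "a < N" for a
  proof -
    have "m a N 0 \<le> m a N 0 + (\<Sum>b<N. m a b N)" by (simp add: sum_nonneg m)
    also have "\<dots> \<le> (\<Sum>a<N. m a N 0 + (\<Sum>b<N. m a b N))"
      using that by (intro member_le_sum) (auto intro!: add_nonneg_nonneg sum_nonneg m)
    finally show ?thesis using m(1)[of N 0 0] by (simp add: M_def)
  qed
  have M2: "m a b N \<le> M" if "a < N" "b < N" for a b
  proof -
    have "m a b N \<le> (\<Sum>b<N. m a b N)" using that by (intro member_le_sum) (auto intro!: m)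
    also have "\<dots> \<le> m a N 0 + (\<Sum>b<N. m a b N)" by (simp add: m)
    also have "\<dots> \<le> (\<Sum>a<N. m a N 0 + (\<Sum>b<N. m a b N))"
      using that by (intro member_le_sum) (auto intro!: add_nonneg_nonneg sum_nonneg m)
    finally show ?thesis using m(1)[of N 0 0] by (simp add: M_def)
  qed
  have Mnn: "M \<ge> 0" using M0 m(1)[of N 0 0] by linarith
  have D1: "(partial 1 ^^ n) \<psi> = D3 n 0 0 \<psi>" for n by (simp add: D3_def)
  have D2: "(partial 2 ^^ n) (D3 a 0 0 \<psi>) = D3 a n 0 \<psi>" for n a
    by (induction n) (auto simp: partial_D3 sm)
  have D3': "(partial 3 ^^ n) (D3 a b 0 \<psi>) = D3 a b n \<psi>" for n a b
    by (induction n) (auto simp: partial_D3 sm)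
  show thesis
  \<comment> \<open>The three expansions contribute 1, N and N * N remainders, each at most M
    \<delta>^N.\<close>
  proof (rule that[of "M * (1 + N + N * N)"])
    show "0 \<le> M * real (1 + N + N * N)" using Mnn by simp
    fix x z :: "real^3" and \<delta> :: real assume z: "\<And>i. \<bar>z $ i\<bar> \<le> \<delta>" and \<delta>: "\<delta> \<le> 1"
    have \<delta>0: "\<delta> \<ge> 0" using z[of 1] by linarith
    let ?x3 = "x + z $ 3 *\<^sub>R axis 3 1"
    let ?x2 = "?x3 + z $ 2 *\<^sub>R axis 2 1"
    have xz: "x + z = ?x2 + z $ 1 *\<^sub>R axis 1 1"
      by (subst vec3_axis_sum[of z]) (simp add: sum_3 algebra_simps)
    have p: "\<bar>z $ i\<bar> ^ N \<le> \<delta> ^ N" for i using z by (intro power_mono) auto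
    have w: "\<bar>z $ i ^ a / fact a\<bar> \<le> 1" for i a
    proof -
      have "\<bar>z $ i\<bar> ^ a \<le> 1" using z[of i] \<delta> by (intro power_le_one) auto
      then have "\<bar>z $ i\<bar> ^ a / fact a \<le> 1 / 1" by (intro frac_le) auto
      then show ?thesis by (simp add: power_abs abs_divide)
    qed
    have E1: "\<bar>\<psi> (x + z) - (\<Sum>a<N. z $ 1 ^ a / fact a * D3 a 0 0 \<psi> ?x2)\<bar> \<le> M * \<delta> ^ N"
    proof -
      have "\<bar>\<psi> (x + z) - (\<Sum>a<N. z $ 1 ^ a / fact a * D3 a 0 0 \<psi> ?x2)\<bar> \<le> M * \<bar>z $ 1\<bar> ^ N"
      proof -
        have "\<bar>(partial 1 ^^ N) \<psi> y\<bar> \<le> M" for y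
          using m(2)[of N 0 0 y] M0 unfolding D1 by linarith
        from taylor_line[OF sm this, of ?x2 "z $ 1"] show ?thesis unfolding D1 xz[symmetric] .
      qed
      also have "\<dots> \<le> M * \<delta> ^ N" by (intro mult_left_mono p Mnn)
      finally show ?thesis .
    qed
    have E2: "\<bar>D3 a 0 0 \<psi> ?x2 - (\<Sum>b<N. z $ 2 ^ b / fact b * D3 a b 0 \<psi> ?x3)\<bar> \<le> M * \<delta> ^ N" if "a < N" for a
    proof -
      have "\<bar>D3 a 0 0 \<psi> ?x2 - (\<Sum>b<N. z $ 2 ^ b / fact b * D3 a b 0 \<psi> ?x3)\<bar> \<le> M * \<bar>z $ 2\<bar> ^ N"
      proof -
        have "\<bar>(partial 2 ^^ N) (D3 a 0 0 \<psi>) y\<bar> \<le> M" for y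
          using m(2)[of a N 0 y] M1[OF that] unfolding D2 by linarith
        from taylor_line[OF smooth_D3[OF sm] this] show ?thesis unfolding D2 .
      qed
      also have "\<dots> \<le> M * \<delta> ^ N" by (intro mult_left_mono p Mnn)
      finally show ?thesis .
    qed
    have E3: "\<bar>D3 a b 0 \<psi> ?x3 - (\<Sum>c<N. z $ 3 ^ c / fact c * D3 a b c \<psi> x)\<bar> \<le> M * \<delta> ^ N" if "a < N" "b < N" for a b
    proof -
      have "\<bar>D3 a b 0 \<psi> ?x3 - (\<Sum>c<N. z $ 3 ^ c / fact c * D3 a b c \<psi> x)\<bar> \<le> M * \<bar>z $ 3\<bar> ^ N"
      proof -
        have "\<bar>(partial 3 ^^ N) (D3 a b 0 \<psi>) y\<bar> \<le> M" for y
          using m(2)[of a b N y] M2[OF that] unfolding D3' by linarith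
        from taylor_line[OF smooth_D3[OF sm] this] show ?thesis unfolding D3' .
      qed
      also have "\<dots> \<le> M * \<delta> ^ N" by (intro mult_left_mono p Mnn)
      finally show ?thesis .
    qed
    have wsum: "\<bar>\<Sum>a<N. z $ i ^ a / fact a * u a\<bar> \<le> real N * B" if "\<And>a. a < N \<Longrightarrow> \<bar>u a\<bar> \<le> B" for u :: "nat \<Rightarrow> real" and B i
    proof -
      have "\<bar>\<Sum>a<N. z $ i ^ a / fact a * u a\<bar> \<le> (\<Sum>a<N. \<bar>z $ i ^ a / fact a\<bar> * \<bar>u a\<bar>)"
        unfolding abs_mult[symmetric] by (rule sum_abs)
      also have "\<dots> \<le> (\<Sum>a<N. 1 * B)"
        by (intro sum_mono mult_mono w that) (auto)
      finally show ?thesis by simp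
    qed
    let ?e = "M * \<delta> ^ N"
    have A2: "\<bar>\<Sum>a<N. z $ 1 ^ a / fact a * (D3 a 0 0 \<psi> ?x2 - (\<Sum>b<N. z $ 2 ^ b / fact b * D3 a b 0 \<psi> ?x3))\<bar> \<le> real N * ?e"
      by (rule wsum) (rule E2)
    have A3: "\<bar>\<Sum>a<N. z $ 1 ^ a / fact a * (\<Sum>b<N. z $ 2 ^ b / fact b * (D3 a b 0 \<psi> ?x3 - (\<Sum>c<N. z $ 3 ^ c / fact c * D3 a b c \<psi> x)))\<bar>
        \<le> real N * (real N * ?e)"
      by (intro wsum E3)
    have "\<psi> (x + z) - (\<Sum>a<N. \<Sum>b<N. \<Sum>c<N. mnm a b c z * D3 a b c \<psi> x) =
       (\<psi> (x + z) - (\<Sum>a<N. z $ 1 ^ a / fact a * D3 a 0 0 \<psi> ?x2))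
       + (\<Sum>a<N. z $ 1 ^ a / fact a * (D3 a 0 0 \<psi> ?x2 - (\<Sum>b<N. z $ 2 ^ b / fact b * D3 a b 0 \<psi> ?x3)))
       + (\<Sum>a<N. z $ 1 ^ a / fact a * (\<Sum>b<N. z $ 2 ^ b / fact b * (D3 a b 0 \<psi> ?x3 - (\<Sum>c<N. z $ 3 ^ c / fact c * D3 a b c \<psi> x))))"
      unfolding mnm_def right_diff_distrib sum_subtractf sum_distrib_left mult.assoc by simp
    then have "\<bar>\<psi> (x + z) - (\<Sum>a<N. \<Sum>b<N. \<Sum>c<N. mnm a b c z * D3 a b c \<psi> x)\<bar> \<le> ?e + real N * ?e + real N * (real N * ?e)"
      using E1 A2 A3 by linarith
    then show "\<bar>\<psi> (x + z) - (\<Sum>a<N. \<Sum>b<N. \<Sum>c<N. mnm a b c z * D3 a b c \<psi> x)\<bar> \<le> M * real (1 + N + N * N) * \<delta> ^ N"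
      by (simp add: algebra_simps)
  qed
qed

text \<open>If all lower coefficients are 0, division by \<rho>^m leaves c m in the limit at 0,
  while the bound still tends to 0 since m < N.\<close>

lemma poly_small_o:
  fixes c :: "nat \<Rightarrow> real"
  assumes d: "d > 0" and b: "\<And>\<rho>. 0 < \<rho> \<Longrightarrow> \<rho> \<le> d \<Longrightarrow> \<bar>\<Sum>m<K. c m * \<rho> ^ m\<bar> \<le> C * \<rho> ^ N"
    and m: "m < N" "m < K"
  shows "c m = 0"
  using m
proof (induction m rule: less_induct)
  case (less m)
  have z: "c j = 0" if "j < m" for j using less that by auto
  let ?p = "\<lambda>\<rho>::real. \<Sum>j<K. if j < m then 0 else c j * \<rho> ^ (j - m)"
  have pm: "?p \<rho> * \<rho> ^ m = (\<Sum>j<K. c j * \<rho> ^ j)" for \<rho>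
    unfolding sum_distrib_right by (intro sum.cong refl) (auto simp: z mult.assoc simp flip: power_add)
  have "(?p \<longlongrightarrow> ?p 0) (at_right 0)"
  proof (rule tendsto_sum)
    fix j
    show "((\<lambda>\<rho>. if j < m then 0 else c j * \<rho> ^ (j - m)) \<longlongrightarrow> (if j < m then 0 else c j * 0 ^ (j - m))) (at_right 0)"
      by (cases "j < m") (auto intro!: tendsto_intros)
  qed
  moreover have "?p 0 = c m"
  proof -
    have "?p 0 = (\<Sum>j<K. if j = m then c j else 0)"
      by (intro sum.cong refl) (auto simp: power_0_left)
    then show ?thesis using less.prems by (simp add: sum.delta)
  qed
  moreover have "(?p \<longlongrightarrow> 0) (at_right 0)"
  proof (rule Lim_null_comparison)
    show "((\<lambda>\<rho>::real. C * \<rho> ^ (N - m)) \<longlongrightarrow> 0) (at_right 0)"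
      using less.prems by (auto intro!: tendsto_eq_intros)
    have "norm (?p \<rho>) \<le> C * \<rho> ^ (N - m)" if \<rho>: "0 < \<rho>" "\<rho> < d" for \<rho>
    proof -
      have "\<bar>?p \<rho>\<bar> * \<rho> ^ m = \<bar>?p \<rho> * \<rho> ^ m\<bar>" using \<rho> by (simp add: abs_mult)
      also have "\<dots> \<le> C * \<rho> ^ N" unfolding pm using b[of \<rho>] \<rho> by simp
      also have "\<dots> = C * \<rho> ^ (N - m) * \<rho> ^ m" using less.prems by (simp flip: power_add)
      finally show ?thesis using \<rho> by simp
    qed
    then show "\<forall>\<^sub>F \<rho> in at_right 0. norm (?p \<rho>) \<le> C * \<rho> ^ (N - m)"
      using eventually_at_right_less[of 0] by (intro eventually_at_rightI[of 0 d]) (use d in auto)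
  qed
  ultimately show ?case using tendsto_unique[of "at_right (0::real)" ?p "c m" 0] by simp
qed

lemma nice_addD: "nice L \<Longrightarrow> continuous_on UNIV f \<Longrightarrow> continuous_on UNIV g \<Longrightarrow> L (\<lambda>y. f y + g y) = L f + L g"
  unfolding nice_def by blast

lemma nice_cmultD: "nice L \<Longrightarrow> continuous_on UNIV f \<Longrightarrow> L (\<lambda>y. c * f y) = c * L f"
  unfolding nice_def by blast

lemma nice_sumD:
  assumes L: "nice L" and "finite A" "\<And>i. i \<in> A \<Longrightarrow> continuous_on UNIV (f i)"
  shows "L (\<lambda>y. \<Sum>i\<in>A. c i * f i y) = (\<Sum>i\<in>A. c i * L (f i))"
  using assms(2,3)
proof (induction A)
  case empty
  show ?case using nice_cmultD[OF L, of "\<lambda>_. 0" 0] by simp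
next
  case (insert i A)
  have "L (\<lambda>y. c i * f i y + (\<Sum>i\<in>A. c i * f i y)) = L (\<lambda>y. c i * f i y) + L (\<lambda>y. \<Sum>i\<in>A. c i * f i y)"
    using insert by (intro nice_addD[OF L] continuous_intros) auto
  then show ?case using insert nice_cmultD[OF L] by simp
qed

lemma vanish_D3:
  assumes "vanish R \<psi>" shows "vanish (R + real (a + b + c)) (D3 a b c \<psi>)"
proof -
  have *: "vanish (R + real n) ((partial i ^^ n) \<psi>)" if "vanish R \<psi>" for R \<psi> n i
  proof (induction n)
    case (Suc n)
    from vanish_partial[OF this, of i] show ?case by (simp add: add_ac)
  qed (simp add: that)
  have "vanish (R + real c + real b + real a) (D3 a b c \<psi>)"
    unfolding D3_def by (intro * assms)
  then show ?thesis by (simp add: algebra_simps)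
qed

definition mnt :: "nat \<times> nat \<times> nat \<Rightarrow> real^3 \<Rightarrow> real" where
  "mnt = (\<lambda>(a, b, c). mnm a b c)"

definition tdeg :: "nat \<times> nat \<times> nat \<Rightarrow> nat" where
  "tdeg = (\<lambda>(a, b, c). a + b + c)"

definition cube3 :: "nat \<Rightarrow> (nat \<times> nat \<times> nat) set" where
  "cube3 N = {..<N} \<times> {..<N} \<times> {..<N}"

lemma sum_cube3: "(\<Sum>p\<in>cube3 N. f p) = (\<Sum>a<N. \<Sum>b<N. \<Sum>c<N. f (a, b, c))"
  unfolding cube3_def by (simp add: sum.cartesian_product split_def)

lemma finite_cube3 [simp]: "finite (cube3 N)" by (simp add: cube3_def)

lemma continuous_mnt: "continuous_on S (mnt p)"
  by (cases p) (simp add: mnt_def smooth_continuous_on[OF smooth_mnm])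

lemma mnt_scale: "mnt p (\<rho> *\<^sub>R y) = \<rho> ^ tdeg p * mnt p y"
  by (cases p) (simp add: mnt_def tdeg_def mnm_def power_mult_distrib power_add)

lemma mnt_minus: "mnt p (- y) = (-1) ^ tdeg p * mnt p y"
  using mnt_scale[of p "-1" y] by simp

text \<open>Pairing with \<psi> moves the shift from the continuous \<open>f\<close> to the smooth
  \<psi>. Averaging g(\<rho> y), where g is the correlation of \<open>f\<close> with \<psi>, then
  gives a value independent of \<rho>. Expanding g at 0 yields a polynomial in \<rho> that is
  constant up to an error of order \<rho>^N, and its coefficient at \<rho>^m is the
  relation.\<close>

theorem moment_relations:
  assumes L: "nice L" and f: "continuous_on UNIV f"
    and harm: "\<And>x \<rho>. \<rho> > 0 \<Longrightarrow> f x * L (\<lambda>_. 1) = L (\<lambda>y. f (x + \<rho> *\<^sub>R y))"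
    and t: "test_function \<psi>" and m: "1 \<le> m" "m < N"
  shows "(\<Sum>p\<in>cube3 N. if tdeg p = m then L (mnt p) * regular f (Dt \<psi> p) else 0) = 0"
proof -
  note sm = test_function_smooth[OF t]
  obtain R where R: "R \<ge> 1" "vanish R \<psi>" using t by (rule test_function_vanish)
  have c\<psi>: "continuous_on S \<psi>" for S by (rule smooth_continuous_on[OF sm])
  define g where "g z = (LINT x|lborel. f x * \<psi> (x - z))" for z
  \<comment> \<open>Fubini exchanges the pairing with the averaging, and translation invariance of
    the integral moves the shift to the other factor.\<close>
  have main: "L (\<lambda>y. g (\<rho> *\<^sub>R y)) = L (\<lambda>_. 1) * regular f \<psi>" if \<rho>: "\<rho> > 0" for \<rho>
  proof -
    let ?h = "\<lambda>(x, y). \<psi> x * f (x + \<rho> *\<^sub>R y)"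
    have h: "continuous_on UNIV ?h"
      unfolding split_def
      by (intro continuous_intros continuous_on_compose2[OF c\<psi>[of UNIV]] continuous_on_compose2[OF f]) auto
    have hv: "\<forall>x y i. \<bar>x $ i\<bar> \<ge> R \<longrightarrow> ?h (x, y) = 0"
      using R(2) by (auto simp: vanish_def)
    have F: "(LINT x|lborel. L (\<lambda>y. ?h (x, y))) = L (\<lambda>y. LINT x|lborel. ?h (x, y))"
      using L h hv unfolding nice_def by blast
    have "L (\<lambda>y. ?h (x, y)) = L (\<lambda>_. 1) * (f x * \<psi> x)" for x
    proof -
      have "L (\<lambda>y. \<psi> x * f (x + \<rho> *\<^sub>R y)) = \<psi> x * L (\<lambda>y. f (x + \<rho> *\<^sub>R y))"
        by (intro nice_cmultD[OF L] continuous_on_compose2[OF f] continuous_intros) auto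
      then show ?thesis using harm[OF \<rho>, of x] by (simp add: mult_ac)
    qed
    moreover have "(LINT x|lborel. ?h (x, y)) = g (\<rho> *\<^sub>R y)" for y
    proof -
      have "(\<lambda>x. f x * \<psi> (x - \<rho> *\<^sub>R y)) \<in> borel_measurable borel"
        by (intro borel_measurable_continuous_onI continuous_intros f continuous_on_compose2[OF c\<psi>[of UNIV]]) auto
      from lborel_integral_translate[OF this, of "\<rho> *\<^sub>R y"]
      show ?thesis by (simp add: g_def mult.commute add.commute)
    qed
    ultimately show ?thesis using F t by (simp add: regular_def)
  qed
  \<comment> \<open>The cube has to contain the support of \<psi> shifted by at most 1 per
    coordinate, and of derivatives up to total order 3N, each order costing one unit in
    \<open>vanish_D3\<close>.\<close>
  define R' where "R' = R + 3 * real N + 1"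
  let ?K = "cbox (\<chi> i. - R') (\<chi> i. R') :: (real^3) set"
  have iK: "integrable lborel (\<lambda>x. indicator ?K x * \<bar>f x\<bar>)"
    using borel_integrable_compact[of ?K "\<lambda>x. \<bar>f x\<bar>"] continuous_on_subset[OF f] by (auto intro: continuous_intros)
  define F1 where "F1 = (LINT x|lborel. indicator ?K x * \<bar>f x\<bar>)"
  have F1: "F1 \<ge> 0" unfolding F1_def by (intro integral_nonneg_AE) auto
  have v1: "\<psi> (x - z) = 0" if xK: "x \<notin> ?K" and z1: "\<And>i. \<bar>z $ i\<bar> \<le> 1" for x z
  proof -
    obtain i where "\<bar>x $ i\<bar> \<ge> R'" using xK by (rule outside_cube)
    with z1[of i] have "\<bar>(x - z) $ i\<bar> \<ge> R" by (simp add: R'_def)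
    then show ?thesis using R(2) unfolding vanish_def by blast
  qed
  have v2: "Dt \<psi> p x = 0" if xK: "x \<notin> ?K" and pN: "p \<in> cube3 N" for p x
  proof -
    obtain a b c where p: "p = (a, b, c)" by (cases p)
    obtain i where "\<bar>x $ i\<bar> \<ge> R'" using xK by (rule outside_cube)
    moreover have "real (a + b + c) \<le> 3 * real N" using pN by (simp add: p cube3_def)
    ultimately have "R + real (a + b + c) \<le> \<bar>x $ i\<bar>" by (simp add: R'_def)
    then show ?thesis using vanish_D3[OF R(2), of a b c] unfolding vanish_def p Dt_def by auto
  qed
  have ci: "continuous_on S (\<lambda>x. f x * \<psi> (x - z))" for z S
    by (intro continuous_intros continuous_on_subset[OF f] continuous_on_compose2[OF c\<psi>[of UNIV]]) auto
  have gi: "integrable lborel (\<lambda>x. f x * \<psi> (x - z))" if "\<And>i. \<bar>z $ i\<bar> \<le> B" for z B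
  proof (rule vanish_integrable[of _ "R + B"])
    show "vanish (R + B) (\<lambda>x. f x * \<psi> (x - z))"
      unfolding vanish_def
    proof (intro allI impI)
      fix x :: "real^3" and i assume "R + B \<le> \<bar>x $ i\<bar>"
      with that[of i] have "\<bar>(x - z) $ i\<bar> \<ge> R" by simp
      then show "f x * \<psi> (x - z) = 0" using R(2) unfolding vanish_def by (metis mult_zero_right)
    qed
  qed (rule ci)
  have gi: "integrable lborel (\<lambda>x. f x * \<psi> (x - z))" for z
    by (rule gi[of z "norm z"]) (rule component_le_norm_cart)
  \<comment> \<open>The functional \<open>L\<close> is controlled on continuous functions, so g has
    to be continuous before \<open>L\<close> is applied to it.\<close>
  have cg: "continuous_on UNIV g"
  proof (rule continuous_at_imp_continuous_on, rule ballI, unfold continuous_at_sequentially, intro allI impI)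
    fix z :: "real^3" and u :: "nat \<Rightarrow> real^3" assume u: "u \<longlonglongrightarrow> z"
    then have "bounded (range u)" by (rule convergent_imp_bounded)
    then obtain B where B: "\<And>n. norm (u n) \<le> B" by (auto simp: bounded_iff)
    obtain M where M: "M \<ge> 0" "\<And>x. \<bar>\<psi> x\<bar> \<le> M" using vanish_bounded[OF c\<psi> R(2)] by blast
    let ?B = "cbox (\<chi> i. - (R + B)) (\<chi> i. R + B) :: (real^3) set"
    have "(\<lambda>n. LINT x|lborel. f x * \<psi> (x - u n)) \<longlonglongrightarrow> (LINT x|lborel. f x * \<psi> (x - z))"
    proof (rule integral_dominated_convergence[where w = "\<lambda>x. indicator ?B x *\<^sub>R (\<bar>f x\<bar> * M)"])
      show "(\<lambda>x. f x * \<psi> (x - z)) \<in> borel_measurable lborel" using gi by blast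
      show "(\<lambda>x. f x * \<psi> (x - u n)) \<in> borel_measurable lborel" for n using gi by blast
      show "integrable lborel (\<lambda>x. indicator ?B x *\<^sub>R (\<bar>f x\<bar> * M))"
        by (intro borel_integrable_compact continuous_intros continuous_on_subset[OF f]) auto
      show "AE x in lborel. (\<lambda>n. f x * \<psi> (x - u n)) \<longlonglongrightarrow> f x * \<psi> (x - z)"
      proof (rule AE_I2)
        fix x
        have "(\<lambda>n. \<psi> (x - u n)) \<longlonglongrightarrow> \<psi> (x - z)"
          by (rule isCont_tendsto_compose[OF smooth_isCont[OF sm]]) (intro tendsto_intros u)
        then show "(\<lambda>n. f x * \<psi> (x - u n)) \<longlonglongrightarrow> f x * \<psi> (x - z)" by (intro tendsto_intros)
      qed
      show "AE x in lborel. norm (f x * \<psi> (x - u n)) \<le> indicator ?B x *\<^sub>R (\<bar>f x\<bar> * M)" for n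
      proof (rule AE_I2)
        fix x
        show "norm (f x * \<psi> (x - u n)) \<le> indicator ?B x *\<^sub>R (\<bar>f x\<bar> * M)"
        proof (cases "x \<in> ?B")
          case True
          then show ?thesis using M by (simp add: abs_mult mult_left_mono)
        next
          case False
          then obtain i where "\<bar>x $ i\<bar> \<ge> R + B" by (rule outside_cube)
          moreover have "\<bar>u n $ i\<bar> \<le> B" using component_le_norm_cart[of "u n" i] B[of n] by linarith
          ultimately have "\<bar>(x - u n) $ i\<bar> \<ge> R" by simp
          then have "\<psi> (x - u n) = 0" using R(2) unfolding vanish_def by blast
          then show ?thesis using M by simp
        qed
      qed
    qed
    then show "(g \<circ> u) \<longlonglongrightarrow> g z" by (simp add: g_def[abs_def] o_def)
  qed
  define tp where "tp p = regular f (Dt \<psi> p)" for p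
  have tDt: "test_function (Dt \<psi> p)" for p by (cases p) (simp add: Dt_def test_function_D3 t)
  have tp: "tp p = (LINT x|lborel. f x * Dt \<psi> p x)" for p by (simp add: tp_def regular_def tDt)
  have iD: "integrable lborel (\<lambda>x. f x * Dt \<psi> p x)" for p by (rule test_mult_integrable[OF f tDt])
  obtain C where C: "C \<ge> 0" and tay: "\<And>x z \<delta>. (\<And>i. \<bar>z $ i\<bar> \<le> \<delta>) \<Longrightarrow> \<delta> \<le> 1 \<Longrightarrow>
      \<bar>\<psi> (x + z) - (\<Sum>a<N. \<Sum>b<N. \<Sum>c<N. mnm a b c z * D3 a b c \<psi> x)\<bar> \<le> C * \<delta> ^ N"
    by (rule taylor_box[OF t, of N]) blast
  \<comment> \<open>The Taylor error of \<psi> is uniform in x, so integrating it against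
    \<open>f\<close> over the cube costs the factor \<open>F1\<close>.\<close>
  have gt: "\<bar>g z - (\<Sum>p\<in>cube3 N. ((-1) ^ tdeg p * tp p) * mnt p z)\<bar> \<le> C * F1 * \<delta> ^ N"
    if z: "\<And>i. \<bar>z $ i\<bar> \<le> \<delta>" and \<delta>: "\<delta> \<le> 1" for z \<delta>
  proof -
    have \<delta>0: "\<delta> \<ge> 0" using z[of 1] by linarith
    let ?q = "\<lambda>x. \<Sum>p\<in>cube3 N. mnt p (- z) * Dt \<psi> p x"
    have b: "\<bar>\<psi> (x - z) - ?q x\<bar> \<le> C * \<delta> ^ N" for x
      using tay[of "- z" \<delta> x] z \<delta> by (simp add: sum_cube3 mnt_def Dt_def)
    have iq: "integrable lborel (\<lambda>x. \<Sum>p\<in>cube3 N. mnt p (- z) * (f x * Dt \<psi> p x))"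
      by (intro Bochner_Integration.integrable_sum integrable_mult_right iD)
    have eq: "f x * (\<psi> (x - z) - ?q x) = f x * \<psi> (x - z) - (\<Sum>p\<in>cube3 N. mnt p (- z) * (f x * Dt \<psi> p x))" for x
      by (simp add: algebra_simps sum_distrib_left)
    have "g z - (\<Sum>p\<in>cube3 N. ((-1) ^ tdeg p * tp p) * mnt p z) = g z - (\<Sum>p\<in>cube3 N. mnt p (- z) * tp p)"
      by (simp add: mnt_minus mult_ac)
    also have "\<dots> = (LINT x|lborel. f x * (\<psi> (x - z) - ?q x))"
      unfolding eq using gi iq iD by (simp add: g_def tp)
    finally have e: "g z - (\<Sum>p\<in>cube3 N. ((-1) ^ tdeg p * tp p) * mnt p z) = (LINT x|lborel. f x * (\<psi> (x - z) - ?q x))" .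
    have "\<bar>LINT x|lborel. f x * (\<psi> (x - z) - ?q x)\<bar> \<le> (LINT x|lborel. (indicator ?K x * \<bar>f x\<bar>) * (C * \<delta> ^ N))"
      unfolding real_norm_def[symmetric]
    proof (rule Bochner_Integration.integral_norm_bound_integral)
      show "integrable lborel (\<lambda>x. f x * (\<psi> (x - z) - ?q x))"
        unfolding eq using gi iq by simp
      show "integrable lborel (\<lambda>x. (indicator ?K x * norm (f x)) * (C * \<delta> ^ N))" using iK by simp
      fix x
      show "norm (f x * (\<psi> (x - z) - ?q x)) \<le> (indicator ?K x * norm (f x)) * (C * \<delta> ^ N)"
      proof (cases "x \<in> ?K")
        case True
        then show ?thesis using b[of x] by (simp add: abs_mult mult_left_mono)
      next
        case False
        have "\<bar>z $ i\<bar> \<le> 1" for i using z[of i] \<delta> by linarith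
        then have "\<psi> (x - z) = 0" by (rule v1[OF False])
        moreover have "?q x = 0" using v2[OF False] by simp
        ultimately show ?thesis using False by simp
      qed
    qed
    also have "(LINT x|lborel. (indicator ?K x * \<bar>f x\<bar>) * (C * \<delta> ^ N)) = F1 * (C * \<delta> ^ N)"
      unfolding F1_def by (rule integral_mult_left_zero)
    also have "\<dots> = C * F1 * \<delta> ^ N" by simp
    finally show ?thesis unfolding e .
  qed
  obtain RI CI where RI: "RI > 0" "CI \<ge> 0" and bd: "\<And>u M. continuous_on UNIV u \<Longrightarrow> M \<ge> 0 \<Longrightarrow>
      (\<And>y. (\<And>i. \<bar>y $ i\<bar> \<le> RI) \<Longrightarrow> \<bar>u y\<bar> \<le> M) \<Longrightarrow> \<bar>L u\<bar> \<le> CI * M"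
    using L unfolding nice_def by blast
  \<comment> \<open>The coefficient of \<rho>^k in the difference of the constant and the averaged
    expansion; the sign stems from the argument x - z of \<psi>.\<close>
  define c where "c k = (if k = 0 then L (\<lambda>_. 1) * regular f \<psi> else 0)
      - (\<Sum>p\<in>cube3 N. if tdeg p = k then (-1) ^ k * tp p * L (mnt p) else 0)" for k
  have N0: "N > 0" using m by simp
  have small: "\<bar>\<Sum>k<3 * N. c k * \<rho> ^ k\<bar> \<le> (CI * (C * F1 * RI ^ N)) * \<rho> ^ N" if \<rho>: "0 < \<rho>" "\<rho> \<le> 1 / RI" for \<rho>
  proof -
    let ?s = "\<lambda>y. \<Sum>p\<in>cube3 N. ((-1) ^ tdeg p * tp p * \<rho> ^ tdeg p) * mnt p y"
    have cs: "continuous_on UNIV ?s" by (intro continuous_intros continuous_mnt)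
    have cgr: "continuous_on UNIV (\<lambda>y. g (\<rho> *\<^sub>R y))"
      by (intro continuous_on_compose2[OF cg] continuous_intros) auto
    have "L (\<lambda>y. g (\<rho> *\<^sub>R y) + (- 1) * ?s y) = L (\<lambda>y. g (\<rho> *\<^sub>R y)) + L (\<lambda>y. (-1) * ?s y)"
      by (intro nice_addD[OF L] cgr continuous_intros cs)
    also have "L (\<lambda>y. (-1) * ?s y) = (-1) * L ?s" by (rule nice_cmultD[OF L cs])
    also have "L ?s = (\<Sum>p\<in>cube3 N. ((-1) ^ tdeg p * tp p * \<rho> ^ tdeg p) * L (mnt p))"
      by (rule nice_sumD[OF L]) (auto intro: continuous_mnt)
    finally have Lu: "L (\<lambda>y. g (\<rho> *\<^sub>R y) + (- 1) * ?s y) = L (\<lambda>_. 1) * regular f \<psi>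
        - (\<Sum>p\<in>cube3 N. ((-1) ^ tdeg p * tp p * \<rho> ^ tdeg p) * L (mnt p))"
      using main[OF \<rho>(1)] by simp
    have "\<bar>L (\<lambda>y. g (\<rho> *\<^sub>R y) + (- 1) * ?s y)\<bar> \<le> CI * (C * F1 * (\<rho> * RI) ^ N)"
    proof (rule bd)
      show "continuous_on UNIV (\<lambda>y. g (\<rho> *\<^sub>R y) + (- 1) * ?s y)" by (intro continuous_intros cgr cs)
      show "0 \<le> C * F1 * (\<rho> * RI) ^ N" using C F1 \<rho> RI by simp
      fix y :: "real^3" assume y: "\<And>i. \<bar>y $ i\<bar> \<le> RI"
      have "\<bar>(\<rho> *\<^sub>R y) $ i\<bar> \<le> \<rho> * RI" for i using y[of i] \<rho> by (simp add: abs_mult)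
      moreover have "\<rho> * RI \<le> 1" using \<rho> RI by (simp add: field_simps)
      ultimately have "\<bar>g (\<rho> *\<^sub>R y) - (\<Sum>p\<in>cube3 N. ((-1) ^ tdeg p * tp p) * mnt p (\<rho> *\<^sub>R y))\<bar> \<le> C * F1 * (\<rho> * RI) ^ N"
        by (rule gt)
      then show "\<bar>g (\<rho> *\<^sub>R y) + (- 1) * ?s y\<bar> \<le> C * F1 * (\<rho> * RI) ^ N"
        by (simp add: mnt_scale mult.assoc)
    qed
    moreover have "(\<Sum>k<3 * N. c k * \<rho> ^ k) = L (\<lambda>_. 1) * regular f \<psi>
        - (\<Sum>p\<in>cube3 N. ((-1) ^ tdeg p * tp p * \<rho> ^ tdeg p) * L (mnt p))"
    proof -
      \<comment> \<open>The exponents are bounded by \<open>N\<close> one by one, so total degrees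
        up to 3N - 3 occur; only the coefficients below \<open>N\<close> are extracted.\<close>
      have dl: "tdeg p < 3 * N" if "p \<in> cube3 N" for p using that by (cases p) (auto simp: cube3_def tdeg_def)
      have "(\<Sum>k<3 * N. (\<Sum>p\<in>cube3 N. if tdeg p = k then (-1) ^ k * tp p * L (mnt p) else 0) * \<rho> ^ k)
          = (\<Sum>p\<in>cube3 N. \<Sum>k<3 * N. if k = tdeg p then (-1) ^ k * tp p * L (mnt p) * \<rho> ^ k else 0)"
        unfolding sum_distrib_right by (subst sum.swap) (intro sum.cong refl, auto)
      also have "\<dots> = (\<Sum>p\<in>cube3 N. (-1) ^ tdeg p * tp p * L (mnt p) * \<rho> ^ tdeg p)"
        by (intro sum.cong refl) (simp add: sum.delta dl)
      moreover have "(\<Sum>k<3 * N. (if k = 0 then L (\<lambda>_. 1) * regular f \<psi> else 0) * \<rho> ^ k) = L (\<lambda>_. 1) * regular f \<psi>"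
      proof -
        have "(\<Sum>k<3 * N. (if k = 0 then L (\<lambda>_. 1) * regular f \<psi> else 0) * \<rho> ^ k) = (\<Sum>k<3 * N. if k = 0 then L (\<lambda>_. 1) * regular f \<psi> else 0)"
          by (intro sum.cong refl) auto
        then show ?thesis using N0 by (simp add: sum.delta)
      qed
      ultimately show ?thesis unfolding c_def left_diff_distrib sum_subtractf
        by (simp add: mult_ac)
    qed
    ultimately show ?thesis unfolding Lu by (simp add: power_mult_distrib mult_ac)
  qed
  have "c m = 0"
    by (rule poly_small_o[where d = "1 / RI" and K = "3 * N" and c = c, OF _ small m(2)]) (use RI m in auto)
  then have "(\<Sum>p\<in>cube3 N. if tdeg p = m then (-1) ^ m * tp p * L (mnt p) else 0) = 0"
    using m by (simp add: c_def)
  also have "(\<Sum>p\<in>cube3 N. if tdeg p = m then (-1) ^ m * tp p * L (mnt p) else 0)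
      = (-1) ^ m * (\<Sum>p\<in>cube3 N. if tdeg p = m then L (mnt p) * tp p else 0)"
    unfolding sum_distrib_left by (intro sum.cong refl) auto
  finally show ?thesis unfolding tp_def by simp
qed

section \<open>From moments to the generating invariants\<close>

lemma even_le_8: "even (a::nat) \<Longrightarrow> a \<le> 8 \<Longrightarrow> a = 0 \<or> a = 2 \<or> a = 4 \<or> a = 6 \<or> a = 8"
  by presburger

text \<open>Moments with an odd exponent are 0, which leaves the short explicit lists of even
  triples in degrees 2, 4, 6 and 8.\<close>

lemma sum_even_triples:
  fixes w :: "nat \<Rightarrow> nat \<Rightarrow> nat \<Rightarrow> real"
  assumes w: "symmetric_even w" and S: "S \<subseteq> cube3 9" "\<And>p. p \<in> S \<Longrightarrow> tdeg p = m"
    and all: "\<And>a b c. even a \<Longrightarrow> even b \<Longrightarrow> even c \<Longrightarrow> a + b + c = m \<Longrightarrow> (a, b, c) \<in> S"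
  shows "(\<Sum>p\<in>cube3 9. if tdeg p = m then (case p of (a, b, c) \<Rightarrow> w a b c) * t p else 0) = (\<Sum>(a, b, c)\<in>S. w a b c * t (a, b, c))"
proof -
  have "(\<Sum>p\<in>cube3 9. if tdeg p = m then (case p of (a, b, c) \<Rightarrow> w a b c) * t p else 0)
      = (\<Sum>p\<in>S. if tdeg p = m then (case p of (a, b, c) \<Rightarrow> w a b c) * t p else 0)"
  proof (rule sum.mono_neutral_right)
    show "\<forall>p\<in>cube3 9 - S. (if tdeg p = m then (case p of (a, b, c) \<Rightarrow> w a b c) * t p else 0) = 0"
    proof
      fix p assume p: "p \<in> cube3 9 - S"
      obtain a b c where abc: "p = (a, b, c)" by (cases p)
      have "w a b c = 0" if "a + b + c = m"
        using all[of a b c] that p w unfolding abc symmetric_even_def by blast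
      then show "(if tdeg p = m then (case p of (a, b, c) \<Rightarrow> w a b c) * t p else 0) = 0"
        by (simp add: abc tdeg_def)
    qed
  qed (use S in auto)
  also have "\<dots> = (\<Sum>(a, b, c)\<in>S. w a b c * t (a, b, c))"
    using S(2) by (intro sum.cong refl) auto
  finally show ?thesis .
qed

lemma sum_even_triples_2:
  assumes "symmetric_even w"
  shows "(\<Sum>p\<in>cube3 9. if tdeg p = 2 then (case p of (a, b, c) \<Rightarrow> w a b c) * t p else 0) =
    w 0 0 2 * t (0, 0, 2) + w 0 2 0 * t (0, 2, 0) + w 2 0 0 * t (2, 0, 0)"
proof -
  have "(\<Sum>p\<in>cube3 9. if tdeg p = 2 then (case p of (a, b, c) \<Rightarrow> w a b c) * t p else 0) =
      (\<Sum>(a, b, c)\<in>{(0::nat, 0::nat, 2::nat), (0, 2, 0), (2, 0, 0)}. w a b c * t (a, b, c))"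
  proof (rule sum_even_triples[OF assms])
    fix a b c :: nat assume *: "even a" "even b" "even c" "a + b + c = 2"
    have "a \<le> 8" "b \<le> 8" using *(4) by linarith+
    then have ab: "a \<in> {0, 2, 4, 6, 8}" "b \<in> {0, 2, 4, 6, 8}" using even_le_8[OF *(1)] even_le_8[OF *(2)] by simp_all
    have c: "c = 2 - a - b" using *(4) by simp
    show "(a, b, c) \<in> {(0::nat, 0::nat, 2::nat), (0, 2, 0), (2, 0, 0)}" using ab *(4) unfolding c by (elim insertE emptyE; simp)
  qed (auto simp: cube3_def tdeg_def)
  then show ?thesis by (simp add: add.assoc)
qed

lemma sum_even_triples_4:
  assumes "symmetric_even w"
  shows "(\<Sum>p\<in>cube3 9. if tdeg p = 4 then (case p of (a, b, c) \<Rightarrow> w a b c) * t p else 0) =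
    w 0 0 4 * t (0, 0, 4) + w 0 2 2 * t (0, 2, 2) + w 0 4 0 * t (0, 4, 0) + w 2 0 2 * t (2, 0, 2) + w 2 2 0 * t (2, 2, 0) + w 4 0 0 * t (4, 0, 0)"
proof -
  have "(\<Sum>p\<in>cube3 9. if tdeg p = 4 then (case p of (a, b, c) \<Rightarrow> w a b c) * t p else 0) =
      (\<Sum>(a, b, c)\<in>{(0::nat, 0::nat, 4::nat), (0, 2, 2), (0, 4, 0), (2, 0, 2), (2, 2, 0), (4, 0, 0)}. w a b c * t (a, b, c))"
  proof (rule sum_even_triples[OF assms])
    fix a b c :: nat assume *: "even a" "even b" "even c" "a + b + c = 4"
    have "a \<le> 8" "b \<le> 8" using *(4) by linarith+
    then have ab: "a \<in> {0, 2, 4, 6, 8}" "b \<in> {0, 2, 4, 6, 8}" using even_le_8[OF *(1)] even_le_8[OF *(2)] by simp_all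
    have c: "c = 4 - a - b" using *(4) by simp
    show "(a, b, c) \<in> {(0::nat, 0::nat, 4::nat), (0, 2, 2), (0, 4, 0), (2, 0, 2), (2, 2, 0), (4, 0, 0)}" using ab *(4) unfolding c by (elim insertE emptyE; simp)
  qed (auto simp: cube3_def tdeg_def)
  then show ?thesis by (simp add: add.assoc)
qed

lemma sum_even_triples_6:
  assumes "symmetric_even w"
  shows "(\<Sum>p\<in>cube3 9. if tdeg p = 6 then (case p of (a, b, c) \<Rightarrow> w a b c) * t p else 0) =
    w 0 0 6 * t (0, 0, 6) + w 0 2 4 * t (0, 2, 4) + w 0 4 2 * t (0, 4, 2) + w 0 6 0 * t (0, 6, 0) + w 2 0 4 * t (2, 0, 4) + w 2 2 2 * t (2, 2, 2) + w 2 4 0 * t (2, 4, 0) + w 4 0 2 * t (4, 0, 2) + w 4 2 0 * t (4, 2, 0) + w 6 0 0 * t (6, 0, 0)"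
proof -
  have "(\<Sum>p\<in>cube3 9. if tdeg p = 6 then (case p of (a, b, c) \<Rightarrow> w a b c) * t p else 0) =
      (\<Sum>(a, b, c)\<in>{(0::nat, 0::nat, 6::nat), (0, 2, 4), (0, 4, 2), (0, 6, 0), (2, 0, 4), (2, 2, 2), (2, 4, 0), (4, 0, 2), (4, 2, 0), (6, 0, 0)}. w a b c * t (a, b, c))"
  proof (rule sum_even_triples[OF assms])
    fix a b c :: nat assume *: "even a" "even b" "even c" "a + b + c = 6"
    have "a \<le> 8" "b \<le> 8" using *(4) by linarith+
    then have ab: "a \<in> {0, 2, 4, 6, 8}" "b \<in> {0, 2, 4, 6, 8}" using even_le_8[OF *(1)] even_le_8[OF *(2)] by simp_all
    have c: "c = 6 - a - b" using *(4) by simp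
    show "(a, b, c) \<in> {(0::nat, 0::nat, 6::nat), (0, 2, 4), (0, 4, 2), (0, 6, 0), (2, 0, 4), (2, 2, 2), (2, 4, 0), (4, 0, 2), (4, 2, 0), (6, 0, 0)}" using ab *(4) unfolding c by (elim insertE emptyE; simp)
  qed (auto simp: cube3_def tdeg_def)
  then show ?thesis by (simp add: add.assoc)
qed

lemma sum_even_triples_8:
  assumes "symmetric_even w"
  shows "(\<Sum>p\<in>cube3 9. if tdeg p = 8 then (case p of (a, b, c) \<Rightarrow> w a b c) * t p else 0) =
    w 0 0 8 * t (0, 0, 8) + w 0 2 6 * t (0, 2, 6) + w 0 4 4 * t (0, 4, 4) + w 0 6 2 * t (0, 6, 2) + w 0 8 0 * t (0, 8, 0) + w 2 0 6 * t (2, 0, 6) + w 2 2 4 * t (2, 2, 4) + w 2 4 2 * t (2, 4, 2) + w 2 6 0 * t (2, 6, 0) + w 4 0 4 * t (4, 0, 4) + w 4 2 2 * t (4, 2, 2) + w 4 4 0 * t (4, 4, 0) + w 6 0 2 * t (6, 0, 2) + w 6 2 0 * t (6, 2, 0) + w 8 0 0 * t (8, 0, 0)"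
proof -
  have "(\<Sum>p\<in>cube3 9. if tdeg p = 8 then (case p of (a, b, c) \<Rightarrow> w a b c) * t p else 0) =
      (\<Sum>(a, b, c)\<in>{(0::nat, 0::nat, 8::nat), (0, 2, 6), (0, 4, 4), (0, 6, 2), (0, 8, 0), (2, 0, 6), (2, 2, 4), (2, 4, 2), (2, 6, 0), (4, 0, 4), (4, 2, 2), (4, 4, 0), (6, 0, 2), (6, 2, 0), (8, 0, 0)}. w a b c * t (a, b, c))"
  proof (rule sum_even_triples[OF assms])
    fix a b c :: nat assume *: "even a" "even b" "even c" "a + b + c = 8"
    have "a \<le> 8" "b \<le> 8" using *(4) by linarith+
    then have ab: "a \<in> {0, 2, 4, 6, 8}" "b \<in> {0, 2, 4, 6, 8}" using even_le_8[OF *(1)] even_le_8[OF *(2)] by simp_all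
    have c: "c = 8 - a - b" using *(4) by simp
    show "(a, b, c) \<in> {(0::nat, 0::nat, 8::nat), (0, 2, 6), (0, 4, 4), (0, 6, 2), (0, 8, 0), (2, 0, 6), (2, 2, 4), (2, 4, 2), (2, 6, 0), (4, 0, 4), (4, 2, 2), (4, 4, 0), (6, 0, 2), (6, 2, 0), (8, 0, 0)}" using ab *(4) unfolding c by (elim insertE emptyE; simp)
  qed (auto simp: cube3_def tdeg_def)
  then show ?thesis by (simp add: add.assoc)
qed

text \<open>The moments are taken of the divided monomials \<open>mnm\<close>; in this normalisation
  they are exactly the coefficients of the operators in \<open>moment_relations\<close>.\<close>

locale harmonic_moments =
  fixes L :: "(real^3 \<Rightarrow> real) \<Rightarrow> real" and f :: "real^3 \<Rightarrow> real" and w :: "nat \<Rightarrow> nat \<Rightarrow> nat \<Rightarrow> real"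
  assumes L: "nice L" and f: "continuous_on UNIV f"
    and harm: "\<And>x \<rho>. \<rho> > 0 \<Longrightarrow> f x * L (\<lambda>_. 1) = L (\<lambda>y. f (x + \<rho> *\<^sub>R y))"
    and w_def: "\<And>a b c. w a b c = L (mnm a b c)" and w: "symmetric_even w"
begin

abbreviation "T \<equiv> regular f"

lemma rel:
  assumes "test_function \<psi>" "1 \<le> m" "m < 9"
  shows "(\<Sum>p\<in>cube3 9. if tdeg p = m then (case p of (a, b, c) \<Rightarrow> w a b c) * T (Dt \<psi> p) else 0) = 0"
proof -
  have "L (mnt p) = (case p of (a, b, c) \<Rightarrow> w a b c)" for p by (cases p) (simp add: mnt_def w_def)
  from moment_relations[OF L f harm assms, unfolded this] show ?thesis .
qed

lemma w_sym: "w b a c = w a b c" "w a c b = w a b c"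
  using w by (simp_all add: symmetric_even_def)

lemma w_perm: "w 0 2 0 = w 2 0 0" "w 0 0 2 = w 2 0 0" "w 0 4 0 = w 4 0 0" "w 0 0 4 = w 4 0 0"
  "w 0 2 2 = w 2 2 0" "w 2 0 2 = w 2 2 0" "w 0 6 0 = w 6 0 0" "w 0 0 6 = w 6 0 0"
  "w 0 4 2 = w 4 2 0" "w 0 2 4 = w 4 2 0" "w 2 0 4 = w 4 2 0" "w 4 0 2 = w 4 2 0" "w 2 4 0 = w 4 2 0"
  "w 0 8 0 = w 8 0 0" "w 0 0 8 = w 8 0 0" "w 0 4 4 = w 4 4 0" "w 4 0 4 = w 4 4 0"
  "w 0 6 2 = w 6 2 0" "w 0 2 6 = w 6 2 0" "w 2 0 6 = w 6 2 0" "w 6 0 2 = w 6 2 0" "w 2 6 0 = w 6 2 0"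
  by (metis w_sym)+

lemma kills_e1: assumes "w 2 0 0 \<noteq> 0" shows "kills e1 T"
  unfolding kills_def
proof (intro allI impI)
  fix \<psi> assume t: "test_function \<psi>"
  have "w 2 0 0 * (T (D3 2 0 0 \<psi>) + T (D3 0 2 0 \<psi>) + T (D3 0 0 2 \<psi>)) = 0"
    using rel[OF t, of 2] unfolding sum_even_triples_2[OF w] by (simp add: Dt_def w_perm algebra_simps)
  then show "(\<Sum>(a, b, c)\<in>e1. T (D3 a b c \<psi>)) = 0" using assms by (simp add: e1_def add.assoc)
qed

text \<open>Modulo e1 the sum of the fourth powers is -2 e2, so the relation of degree 4 is a
  multiple of e2 with factor w(2,2,0) - 2 w(4,0,0).\<close>

lemma kills_e2: assumes k: "kills e1 T" and n: "w 2 2 0 \<noteq> 2 * w 4 0 0" shows "kills e2 T"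
  unfolding kills_def
proof (intro allI impI)
  fix \<psi> assume t: "test_function \<psi>"
  define S4 where "S4 = T (D3 4 0 0 \<psi>) + T (D3 0 4 0 \<psi>) + T (D3 0 0 4 \<psi>)"
  define S22 where "S22 = T (D3 2 2 0 \<psi>) + T (D3 0 2 2 \<psi>) + T (D3 2 0 2 \<psi>)"
  note r = kills_recurrences(1)[OF t k]
  have "S4 = - 2 * S22"
    using r[of 2 0 0] r[of 0 2 0] r[of 0 0 2] by (simp add: S4_def S22_def numeral_2_eq_2[symmetric])
  moreover have "w 4 0 0 * S4 + w 2 2 0 * S22 = 0"
    using rel[OF t, of 4] unfolding sum_even_triples_4[OF w] by (simp add: Dt_def w_perm S4_def S22_def algebra_simps)
  ultimately have "(w 2 2 0 - 2 * w 4 0 0) * S22 = 0" by (simp add: algebra_simps)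
  then show "(\<Sum>(a, b, c)\<in>e2. T (D3 a b c \<psi>)) = 0" using n by (simp add: e2_def S22_def add.assoc)
qed

text \<open>Modulo e1 every invariant of degree 6 is a multiple of e3: the orbit sum of (4,2,0) is
  -3 e3 and that of (6,0,0) is 3 e3.\<close>

lemma kills_e3: assumes k: "kills e1 T" and n: "3 * w 6 0 0 - 3 * w 4 2 0 + w 2 2 2 \<noteq> 0" shows "kills e3 T"
  unfolding kills_def
proof (intro allI impI)
  fix \<psi> assume t: "test_function \<psi>"
  define S6 where "S6 = T (D3 6 0 0 \<psi>) + T (D3 0 6 0 \<psi>) + T (D3 0 0 6 \<psi>)"
  define S42 where "S42 = T (D3 4 2 0 \<psi>) + T (D3 4 0 2 \<psi>) + T (D3 2 4 0 \<psi>) + T (D3 0 4 2 \<psi>) + T (D3 2 0 4 \<psi>) + T (D3 0 2 4 \<psi>)"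
  note r = kills_recurrences(1)[OF t k]
  have "S6 = - S42" using r[of 4 0 0] r[of 0 4 0] r[of 0 0 4] by (simp add: S6_def S42_def numeral_2_eq_2[symmetric])
  moreover have "S42 = - 3 * T (D3 2 2 2 \<psi>)" using r[of 2 2 0] r[of 0 2 2] r[of 2 0 2] by (simp add: S42_def numeral_2_eq_2[symmetric])
  moreover have "w 6 0 0 * S6 + w 4 2 0 * S42 + w 2 2 2 * T (D3 2 2 2 \<psi>) = 0"
    using rel[OF t, of 6] unfolding sum_even_triples_6[OF w] by (simp add: Dt_def w_perm S6_def S42_def algebra_simps)
  ultimately have "(3 * w 6 0 0 - 3 * w 4 2 0 + w 2 2 2) * T (D3 2 2 2 \<psi>) = 0" by (simp add: algebra_simps)
  then show "(\<Sum>(a, b, c)\<in>e3. T (D3 a b c \<psi>)) = 0" using n by (simp add: e3_def)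
qed

text \<open>Modulo e1 and e3 the orbit sums of (6,2,0) and (8,0,0) are -2 and 2 times that of
  (4,4,0), and every monomial containing all three variables is 0.\<close>

lemma kills_e22:
  assumes k: "kills e1 T" "kills e3 T" and n: "2 * w 8 0 0 - 2 * w 6 2 0 + w 4 4 0 \<noteq> 0" shows "kills e22 T"
  unfolding kills_def
proof (intro allI impI)
  fix \<psi> assume t: "test_function \<psi>"
  define S8 where "S8 = T (D3 8 0 0 \<psi>) + T (D3 0 8 0 \<psi>) + T (D3 0 0 8 \<psi>)"
  define S62 where "S62 = T (D3 6 2 0 \<psi>) + T (D3 6 0 2 \<psi>) + T (D3 2 6 0 \<psi>) + T (D3 0 6 2 \<psi>) + T (D3 2 0 6 \<psi>) + T (D3 0 2 6 \<psi>)"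
  define S44 where "S44 = T (D3 4 4 0 \<psi>) + T (D3 0 4 4 \<psi>) + T (D3 4 0 4 \<psi>)"
  note r = kills_recurrences(1)[OF t k(1)]
  have z: "T (D3 4 2 2 \<psi>) = 0" "T (D3 2 4 2 \<psi>) = 0" "T (D3 2 2 4 \<psi>) = 0"
    using kills_recurrences(3)[OF t k(2), of 2 0 0] kills_recurrences(3)[OF t k(2), of 0 2 0] kills_recurrences(3)[OF t k(2), of 0 0 2]
    by (simp_all add: numeral_2_eq_2[symmetric])
  have "S8 = - S62" using r[of 6 0 0] r[of 0 6 0] r[of 0 0 6] by (simp add: S8_def S62_def numeral_2_eq_2[symmetric])
  moreover have "S62 = - 2 * S44"
    using r[of 4 2 0] r[of 4 0 2] r[of 2 4 0] r[of 0 4 2] r[of 2 0 4] r[of 0 2 4] by (simp add: S62_def S44_def z numeral_2_eq_2[symmetric])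
  moreover have "w 8 0 0 * S8 + w 6 2 0 * S62 + w 4 4 0 * S44 = 0"
    using rel[OF t, of 8] unfolding sum_even_triples_8[OF w]
    by (simp add: Dt_def w_perm S8_def S62_def S44_def z algebra_simps)
  ultimately have "(2 * w 8 0 0 - 2 * w 6 2 0 + w 4 4 0) * S44 = 0" by (simp add: algebra_simps)
  then show "(\<Sum>(a, b, c)\<in>e22. T (D3 a b c \<psi>)) = 0" using n by (simp add: e22_def S44_def add.assoc)
qed

lemma regular_in_K48:
  assumes "w 2 0 0 \<noteq> 0" "w 2 2 0 \<noteq> 2 * w 4 0 0" "3 * w 6 0 0 - 3 * w 4 2 0 + w 2 2 2 \<noteq> 0"
  shows "T \<in> K48"
proof -
  note 1 = kills_e1[OF assms(1)]
  show ?thesis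
    using 1 kills_e2[OF 1 assms(2)] kills_e3[OF 1 assms(3)] tlin_regular[OF f] by (simp add: K48_def regular_def)
qed

lemma regular_in_K96:
  assumes "w 2 0 0 \<noteq> 0" "3 * w 6 0 0 - 3 * w 4 2 0 + w 2 2 2 \<noteq> 0" "2 * w 8 0 0 - 2 * w 6 2 0 + w 4 4 0 \<noteq> 0"
  shows "T \<in> K96"
proof -
  note 1 = kills_e1[OF assms(1)] and 3 = kills_e3[OF kills_e1[OF assms(1)] assms(2)]
  show ?thesis
    using 1 3 kills_e22[OF 1 3 assms(3)] tlin_regular[OF f] by (simp add: K96_def regular_def)
qed

end

text \<open>The symbol \<open>e22\<close> equals e2^2 - 2 e1 e3.\<close>

lemma K48_subset_K96: "K48 \<subseteq> K96"
proof
  fix T assume "T \<in> K48"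
  then have T: "\<forall>\<psi>. \<not> test_function \<psi> \<longrightarrow> T \<psi> = 0" "tlin T" "kills e1 T" "kills e2 T" "kills e3 T" by (auto simp: K48_def)
  have "kills e22 T"
    unfolding kills_def
  proof (intro allI impI)
    fix \<psi> assume t: "test_function \<psi>"
    note r1 = kills_recurrences(1)[OF t T(3)] and r2 = kills_recurrences(2)[OF t T(4)] and r3 = kills_recurrences(3)[OF t T(5)]
    show "(\<Sum>(a, b, c)\<in>e22. T (D3 a b c \<psi>)) = 0"
      using r2[of 2 2 0] r2[of 0 2 2] r2[of 2 0 2] r3[of 2 0 0] r3[of 0 2 0] r3[of 0 0 2]
      by (simp add: e22_def numeral_2_eq_2[symmetric])
  qed
  then show "T \<in> K96" using T by (simp add: K96_def)
qed

text \<open>Polynomials in the kernel satisfy the mean value property exactly: their Taylor expansion is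
  finite, and the homogeneous parts of the moment operator annihilate them.\<close>

lemma mean_value_F:
  assumes L: "nice L" and w_def: "\<And>a b c. w a b c = L (mnm a b c)" and w: "symmetric_even w"
    and m4: "w 2 2 0 = 2 * w 4 0 0"
  shows "L (\<lambda>y. diff_op q F_gen (x + \<rho> *\<^sub>R y)) = L (\<lambda>_. 1) * diff_op q F_gen x"
proof -
  define s where "s = qarr q tF"
  have box: "in_box 10 s" unfolding s_def by (rule in_box_qarr[OF in_box_tF])
  have F: "diff_op q F_gen = dp 10 s" unfolding F_eq_dp s_def by (rule diff_op_dp[OF in_box_tF])
  have "diff_op q F_gen (x + \<rho> *\<^sub>R y) = (\<Sum>p\<in>cube3 10. (\<rho> ^ tdeg p * (case p of (i, j, k) \<Rightarrow> dp 10 (shift i j k s) x)) * mnt p y)" for y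
    unfolding F dp_translate[OF box] sum_cube3
    by (intro sum.cong refl) (use mnt_scale[of "(_, _, _)" \<rho> y] in \<open>simp add: mnt_def\<close>)
  then have "L (\<lambda>y. diff_op q F_gen (x + \<rho> *\<^sub>R y)) = (\<Sum>p\<in>cube3 10. (\<rho> ^ tdeg p * (case p of (i, j, k) \<Rightarrow> dp 10 (shift i j k s) x)) * L (mnt p))"
    by (simp add: nice_sumD[OF L] continuous_mnt)
  also have "\<dots> = (\<Sum>i<10. \<Sum>j<10. \<Sum>k<10. w i j k * \<rho> ^ (i + j + k) * dp 10 (shift i j k s) x)"
    unfolding sum_cube3 by (intro sum.cong refl) (simp add: mnt_def tdeg_def w_def mult_ac)
  also have "\<dots> = w 0 0 0 * dp 10 s x"
  proof (rule mean_value_dp)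
    fix m a b c :: nat assume m: "m \<ge> 1"
    have "symmetric_even (homog m w)"
      using w by (auto simp: symmetric_even_def homog_def ac_simps)
    then have "act (homog m w) sF a b c = 0" for a b c
      by (rule act_sF[where m = m]) (use m m4 in \<open>auto simp: homog_def split: if_splits\<close>)
    then have "act (homog m w) tF a b c = 0" for a b c by (simp add: tF_def[abs_def] act_cmult)
    then show "act (homog m w) s a b c = 0" unfolding s_def by (rule act_qarr)
  qed
  also have "w 0 0 0 = L (\<lambda>_. 1)" by (simp add: w_def mnm_def[abs_def])
  finally show ?thesis unfolding F .
qed

section \<open>Enumerating vertices, edges and faces\<close>

lemma sum_signs: "(\<Sum>a\<in>signs. g a) = g 1 + (g (-1) :: real)"
  by (simp add: signs_def)

lemma finite_signs [simp]: "finite signs" by (simp add: signs_def)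

text \<open>The average over the sign changes of one coordinate: it filters even exponents, and sums
  over octants factor into three of these.\<close>

definition sg :: "nat \<Rightarrow> real" where "sg i = (\<Sum>a\<in>signs. a ^ i)"

lemma sg_eq: "sg i = (if even i then 2 else 0)"
  by (simp add: sg_def sum_signs)

lemma v_nth: "vA a $ 1 = a" "vA a $ 2 = 0" "vA a $ 3 = 0" "vB b $ 1 = 0" "vB b $ 2 = b" "vB b $ 3 = 0"
  "vC c $ 1 = 0" "vC c $ 2 = 0" "vC c $ 3 = c"
  "vD r a b c $ 1 = r / 3 * a" "vD r a b c $ 2 = r / 3 * b" "vD r a b c $ 3 = r / 3 * c"
  by (simp_all add: vA_def vB_def vC_def vD_def vector_3)

lemma signs_nz: "a \<in> signs \<Longrightarrow> a \<noteq> 0" by (auto simp: signs_def)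

lemma vec3_eq_iff: "x = y \<longleftrightarrow> x $ 1 = y $ 1 \<and> x $ 2 = y $ 2 \<and> x $ 3 = y $ 3" for x y :: "'a^3"
  by (simp add: vec_eq_iff forall_3)

lemma v_inj [simp]: "vA a = vA a' \<longleftrightarrow> a = a'" "vB a = vB a' \<longleftrightarrow> a = a'" "vC a = vC a' \<longleftrightarrow> a = a'"
  by (auto simp: vec3_eq_iff v_nth)

lemma vD_inj: "r > 0 \<Longrightarrow> vD r a b c = vD r a' b' c' \<longleftrightarrow> a = a' \<and> b = b' \<and> c = c'"
  by (auto simp: vec3_eq_iff v_nth)

lemma v_neq:
  assumes "a \<in> signs" "b \<in> signs" "c \<in> signs"
  shows "vA a \<noteq> vB b'" "vA a \<noteq> vC b'" "vB a \<noteq> vA b'" "vB a \<noteq> vC b'" "vC a \<noteq> vA b'" "vC a \<noteq> vB b'"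
    "r > 0 \<Longrightarrow> vD r a b c \<noteq> vA a'" "r > 0 \<Longrightarrow> vD r a b c \<noteq> vB a'" "r > 0 \<Longrightarrow> vD r a b c \<noteq> vC a'"
    "r > 0 \<Longrightarrow> vA a' \<noteq> vD r a b c" "r > 0 \<Longrightarrow> vB a' \<noteq> vD r a b c" "r > 0 \<Longrightarrow> vC a' \<noteq> vD r a b c"
  using assms signs_nz by (auto simp: vec3_eq_iff v_nth)

lemma image_prod3: "(\<lambda>(a, b, c). g a b c) ` (S \<times> S' \<times> S'') = (\<Union>a\<in>S. \<Union>b\<in>S'. \<Union>c\<in>S''. {g a b c})"
  by (auto simp: image_iff) blast

text \<open>A union becomes a sum only if nothing is listed twice. For positive \<open>r\<close> the
  apices have three nonzero coordinates, so they are distinct from the octahedral vertices and from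
  each other.\<close>

lemma sum_vertices:
  assumes "r > 0"
  shows "(\<Sum>v\<in>vertices r. f v) = (\<Sum>a\<in>signs. f (vA a)) + (\<Sum>b\<in>signs. f (vB b)) + (\<Sum>c\<in>signs. f (vC c))
    + (\<Sum>a\<in>signs. \<Sum>b\<in>signs. \<Sum>c\<in>signs. f (vD r a b c) :: real)"
proof -
  let ?S3 = "signs \<times> signs \<times> signs"
  let ?d = "\<lambda>(a, b, c). vD r a b c"
  have "vertices r = vA ` signs \<union> vB ` signs \<union> vC ` signs \<union> ?d ` ?S3"
    unfolding vertices_def image_prod3 by (rule refl)
  also have "(\<Sum>v\<in>\<dots>. f v) = (\<Sum>v\<in>vA ` signs. f v) + (\<Sum>v\<in>vB ` signs. f v) + (\<Sum>v\<in>vC ` signs. f v) + (\<Sum>v\<in>?d ` ?S3. f v)"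
    by (subst sum.union_disjoint; (subst sum.union_disjoint)?; (subst sum.union_disjoint)?) (auto simp: v_neq assms)
  also have "(\<Sum>v\<in>?d ` ?S3. f v) = (\<Sum>(a, b, c)\<in>?S3. f (vD r a b c))"
    by (subst sum.reindex) (auto simp: inj_on_def vD_inj[OF assms] split_def)
  also have "(\<Sum>v\<in>vA ` signs. f v) = (\<Sum>a\<in>signs. f (vA a))" by (subst sum.reindex) (auto simp: inj_on_def)
  also have "(\<Sum>v\<in>vB ` signs. f v) = (\<Sum>a\<in>signs. f (vB a))" by (subst sum.reindex) (auto simp: inj_on_def)
  also have "(\<Sum>v\<in>vC ` signs. f v) = (\<Sum>a\<in>signs. f (vC a))" by (subst sum.reindex) (auto simp: inj_on_def)
  finally show ?thesis by (simp add: sum.cartesian_product)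
qed

text \<open>An edge of the octahedron belongs to two octants, yet it is a single element of
  \<open>edges\<close>. Hence the first three sums run over two signs and the last over
  three.\<close>

lemma sum_edges:
  assumes "r > 0"
  shows "(\<Sum>(u, v)\<in>edges r. h u v) = (\<Sum>a\<in>signs. \<Sum>b\<in>signs. h (vA a) (vB b)) + (\<Sum>a\<in>signs. \<Sum>c\<in>signs. h (vA a) (vC c))
    + (\<Sum>b\<in>signs. \<Sum>c\<in>signs. h (vB b) (vC c))
    + (\<Sum>a\<in>signs. \<Sum>b\<in>signs. \<Sum>c\<in>signs. h (vA a) (vD r a b c) + h (vB b) (vD r a b c) + h (vC c) (vD r a b c) :: real)"
proof -
  let ?S2 = "signs \<times> signs" and ?S3 = "signs \<times> signs \<times> signs" and ?f = "\<lambda>(u, v). h u v"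
  define E1 where "E1 = (\<lambda>(a, b). (vA a, vB b)) ` ?S2"
  define E2 where "E2 = (\<lambda>(a, b). (vA a, vC b)) ` ?S2"
  define E3 where "E3 = (\<lambda>(a, b). (vB a, vC b)) ` ?S2"
  define E4 where "E4 = (\<lambda>(a, b, c). (vA a, vD r a b c)) ` ?S3"
  define E5 where "E5 = (\<lambda>(a, b, c). (vB b, vD r a b c)) ` ?S3"
  define E6 where "E6 = (\<lambda>(a, b, c). (vC c, vD r a b c)) ` ?S3"
  note E = E1_def E2_def E3_def E4_def E5_def E6_def
  have fin: "finite E1" "finite E2" "finite E3" "finite E4" "finite E5" "finite E6" by (auto simp: E)
  have "edges r = E1 \<union> (E2 \<union> (E3 \<union> (E4 \<union> (E5 \<union> E6))))"
  proof -
    have ne: "\<exists>x. x \<in> signs" by (auto simp: signs_def)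
    have U: "E1 = (\<Union>a\<in>signs. \<Union>b\<in>signs. {(vA a, vB b)})" "E2 = (\<Union>a\<in>signs. \<Union>b\<in>signs. {(vA a, vC b)})"
      "E3 = (\<Union>a\<in>signs. \<Union>b\<in>signs. {(vB a, vC b)})" "E4 = (\<Union>a\<in>signs. \<Union>b\<in>signs. \<Union>c\<in>signs. {(vA a, vD r a b c)})"
      "E5 = (\<Union>a\<in>signs. \<Union>b\<in>signs. \<Union>c\<in>signs. {(vB b, vD r a b c)})" "E6 = (\<Union>a\<in>signs. \<Union>b\<in>signs. \<Union>c\<in>signs. {(vC c, vD r a b c)})"
      unfolding E image_prod3 by (auto simp: image_iff)
    show ?thesis unfolding edges_def U by (rule set_eqI) (simp add: bex_disj_distrib ne)
  qed
  also have "sum ?f \<dots> = sum ?f E1 + (sum ?f E2 + (sum ?f E3 + (sum ?f E4 + (sum ?f E5 + sum ?f E6))))"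
  proof -
    have d: "E5 \<inter> E6 = {}" "E4 \<inter> (E5 \<union> E6) = {}" "E3 \<inter> (E4 \<union> (E5 \<union> E6)) = {}" "E2 \<inter> (E3 \<union> (E4 \<union> (E5 \<union> E6))) = {}"
      "E1 \<inter> (E2 \<union> (E3 \<union> (E4 \<union> (E5 \<union> E6)))) = {}"
      unfolding E by (auto simp: v_neq assms)
    show ?thesis by (simp add: sum.union_disjoint fin d)
  qed
  also have "sum ?f E1 = (\<Sum>a\<in>signs. \<Sum>b\<in>signs. h (vA a) (vB b))"
    unfolding E by (subst sum.reindex) (auto simp: inj_on_def sum.cartesian_product split_def)
  also have "sum ?f E2 = (\<Sum>a\<in>signs. \<Sum>b\<in>signs. h (vA a) (vC b))"
    unfolding E by (subst sum.reindex) (auto simp: inj_on_def sum.cartesian_product split_def)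
  also have "sum ?f E3 = (\<Sum>a\<in>signs. \<Sum>b\<in>signs. h (vB a) (vC b))"
    unfolding E by (subst sum.reindex) (auto simp: inj_on_def sum.cartesian_product split_def)
  also have "sum ?f E4 = (\<Sum>a\<in>signs. \<Sum>b\<in>signs. \<Sum>c\<in>signs. h (vA a) (vD r a b c))"
    unfolding E by (subst sum.reindex) (auto simp: inj_on_def vD_inj[OF assms] sum.cartesian_product split_def)
  also have "sum ?f E5 = (\<Sum>a\<in>signs. \<Sum>b\<in>signs. \<Sum>c\<in>signs. h (vB b) (vD r a b c))"
    unfolding E by (subst sum.reindex) (auto simp: inj_on_def vD_inj[OF assms] sum.cartesian_product split_def)
  also have "sum ?f E6 = (\<Sum>a\<in>signs. \<Sum>b\<in>signs. \<Sum>c\<in>signs. h (vC c) (vD r a b c))"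
    unfolding E by (subst sum.reindex) (auto simp: inj_on_def vD_inj[OF assms] sum.cartesian_product split_def)
  finally show ?thesis by (simp add: sum.distrib)
qed

lemma sum_faces:
  assumes "r > 0"
  shows "(\<Sum>(u, v, w)\<in>faces r. h u v w) = (\<Sum>a\<in>signs. \<Sum>b\<in>signs. \<Sum>c\<in>signs.
      h (vA a) (vB b) (vD r a b c) + h (vA a) (vC c) (vD r a b c) + h (vB b) (vC c) (vD r a b c) :: real)"
proof -
  let ?S3 = "signs \<times> signs \<times> signs" and ?f = "\<lambda>(u, v, w). h u v w"
  define E4 where "E4 = (\<lambda>(a, b, c). (vA a, vB b, vD r a b c)) ` ?S3"
  define E5 where "E5 = (\<lambda>(a, b, c). (vA a, vC c, vD r a b c)) ` ?S3"
  define E6 where "E6 = (\<lambda>(a, b, c). (vB b, vC c, vD r a b c)) ` ?S3"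
  note E = E4_def E5_def E6_def
  have fin: "finite E4" "finite E5" "finite E6" by (auto simp: E)
  have "faces r = E4 \<union> (E5 \<union> E6)"
  proof -
    have U: "E4 = (\<Union>a\<in>signs. \<Union>b\<in>signs. \<Union>c\<in>signs. {(vA a, vB b, vD r a b c)})"
      "E5 = (\<Union>a\<in>signs. \<Union>b\<in>signs. \<Union>c\<in>signs. {(vA a, vC c, vD r a b c)})" "E6 = (\<Union>a\<in>signs. \<Union>b\<in>signs. \<Union>c\<in>signs. {(vB b, vC c, vD r a b c)})"
      unfolding E image_prod3 by (rule refl)+
    show ?thesis unfolding faces_def U by (rule set_eqI) (simp add: bex_disj_distrib)
  qed
  also have "sum ?f \<dots> = sum ?f E4 + (sum ?f E5 + sum ?f E6)"
  proof -
    have d: "E5 \<inter> E6 = {}" "E4 \<inter> (E5 \<union> E6) = {}"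
      unfolding E by (auto simp: v_neq assms)
    show ?thesis by (simp add: sum.union_disjoint fin d)
  qed
  also have "sum ?f E4 = (\<Sum>a\<in>signs. \<Sum>b\<in>signs. \<Sum>c\<in>signs. h (vA a) (vB b) (vD r a b c))"
    unfolding E by (subst sum.reindex) (auto simp: inj_on_def vD_inj[OF assms] sum.cartesian_product split_def)
  also have "sum ?f E5 = (\<Sum>a\<in>signs. \<Sum>b\<in>signs. \<Sum>c\<in>signs. h (vA a) (vC c) (vD r a b c))"
    unfolding E by (subst sum.reindex) (auto simp: inj_on_def vD_inj[OF assms] sum.cartesian_product split_def)
  also have "sum ?f E6 = (\<Sum>a\<in>signs. \<Sum>b\<in>signs. \<Sum>c\<in>signs. h (vB b) (vC c) (vD r a b c))"
    unfolding E by (subst sum.reindex) (auto simp: inj_on_def vD_inj[OF assms] sum.cartesian_product split_def)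
  finally show ?thesis by (simp add: sum.distrib)
qed

section \<open>Moments of the vertices, edges and faces\<close>

text \<open>The Beta function at (m + 1, n + 1).\<close>

definition bt :: "nat \<Rightarrow> nat \<Rightarrow> real" where "bt m n = fact m * fact n / fact (m + n + 1)"

text \<open>Integration by parts lowers \<open>m\<close> and raises \<open>n\<close>. The general
  upper limit \<open>u\<close> serves the inner integrals over triangles and simplices.\<close>

lemma beta_has_integral:
  assumes "u \<ge> (0::real)"
  shows "((\<lambda>s. (u - s) ^ m * s ^ n) has_integral bt m n * u ^ (m + n + 1)) {0..u}"
proof (induction m arbitrary: n)
  case 0
  have "((\<lambda>s. s ^ n) has_integral u ^ Suc n / real (Suc n) - 0 ^ Suc n / real (Suc n)) {0..u}"
  proof (rule fundamental_theorem_of_calculus[OF assms])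
    fix s
    have "((\<lambda>s. s ^ Suc n / real (Suc n)) has_field_derivative s ^ n) (at s)"
      using DERIV_cdivide[OF DERIV_pow[of "Suc n" s], of "real (Suc n)"] by (simp del: of_nat_Suc power_Suc)
    then show "((\<lambda>s. s ^ Suc n / real (Suc n)) has_vector_derivative s ^ n) (at s within {0..u})"
      by (simp add: has_real_derivative_iff_has_vector_derivative has_vector_derivative_at_within del: of_nat_Suc power_Suc)
  qed
  moreover have "u ^ Suc n / real (Suc n) - 0 ^ Suc n / real (Suc n) = bt 0 n * u ^ (0 + n + 1)"
    by (simp add: bt_def del: of_nat_Suc)
  ultimately show ?case by simp
next
  case (Suc m)
  have "((\<lambda>s. (u - s) ^ Suc m * s ^ n - (real (Suc m) / real (Suc n)) * ((u - s) ^ m * s ^ Suc n)) has_integral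
      (u - u) ^ Suc m * u ^ Suc n / real (Suc n) - (u - 0) ^ Suc m * 0 ^ Suc n / real (Suc n)) {0..u}"
  proof (rule fundamental_theorem_of_calculus[OF assms])
    fix s
    have "((\<lambda>s. (u - s) ^ Suc m * s ^ Suc n / real (Suc n)) has_field_derivative
        (real (Suc m) * (u - s) ^ m * (0 - 1) * s ^ Suc n + (u - s) ^ Suc m * (real (Suc n) * s ^ n)) / real (Suc n)) (at s)"
      by (auto intro!: derivative_eq_intros simp del: of_nat_Suc power_Suc)
    moreover have "(real (Suc m) * (u - s) ^ m * (0 - 1) * s ^ Suc n + (u - s) ^ Suc m * (real (Suc n) * s ^ n)) / real (Suc n)
        = (u - s) ^ Suc m * s ^ n - (real (Suc m) / real (Suc n)) * ((u - s) ^ m * s ^ Suc n)"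
      by (simp add: add_divide_distrib diff_divide_distrib del: of_nat_Suc power_Suc)
    ultimately show "((\<lambda>s. (u - s) ^ Suc m * s ^ Suc n / real (Suc n)) has_vector_derivative
        (u - s) ^ Suc m * s ^ n - (real (Suc m) / real (Suc n)) * ((u - s) ^ m * s ^ Suc n)) (at s within {0..u})"
      by (simp add: has_real_derivative_iff_has_vector_derivative has_vector_derivative_at_within del: of_nat_Suc power_Suc)
  qed
  then have "((\<lambda>s. (u - s) ^ Suc m * s ^ n - (real (Suc m) / real (Suc n)) * ((u - s) ^ m * s ^ Suc n)) has_integral 0) {0..u}"
    by (simp del: of_nat_Suc)
  from has_integral_add[OF this has_integral_mult_right[OF Suc[of "Suc n"], of "real (Suc m) / real (Suc n)"]]
  have "((\<lambda>s. (u - s) ^ Suc m * s ^ n) has_integral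
      (real (Suc m) / real (Suc n)) * (bt m (Suc n) * u ^ (m + Suc n + 1))) {0..u}"
    by (simp del: of_nat_Suc power_Suc)
  moreover have ratio: "(real (Suc m) / real (Suc n)) * bt m (Suc n) = bt (Suc m) n"
  proof -
    have "fact (Suc m) = real (Suc m) * fact m" "fact (Suc n) = real (Suc n) * fact n" by (simp_all del: of_nat_Suc)
    then show ?thesis unfolding bt_def by (simp del: fact_Suc of_nat_Suc)
  qed
  ultimately have "((\<lambda>s. (u - s) ^ Suc m * s ^ n) has_integral bt (Suc m) n * u ^ (m + Suc n + 1)) {0..u}"
    unfolding mult.assoc[symmetric] by (simp only:)
  then show ?case by simp
qed

lemma set_lint_eq_has_integral:
  fixes f :: "real \<Rightarrow> real"
  assumes "continuous_on {a..b} f" "(f has_integral I) {a..b}"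
  shows "(LINT t:{a..b}|lborel. f t) = I"
proof -
  have "set_integrable lborel {a..b} f"
    unfolding set_integrable_def by (intro borel_integrable_compact assms(1)) auto
  then show ?thesis using set_borel_integral_eq_integral(2) assms(2) integral_unique by metis
qed

lemma set_lint_lin_comb:
  fixes h :: "'i \<Rightarrow> 'a::euclidean_space \<Rightarrow> real"
  assumes "compact S" "finite A" "\<And>i. i \<in> A \<Longrightarrow> continuous_on S (h i)"
  shows "(LINT x:S|lborel. (\<Sum>i\<in>A. c i * h i x)) = (\<Sum>i\<in>A. c i * (LINT x:S|lborel. h i x))"
proof -
  have i: "integrable lborel (\<lambda>x. indicat_real S x *\<^sub>R h i x)" if "i \<in> A" for i
    by (intro borel_integrable_compact assms that)
  have "(LINT x:S|lborel. (\<Sum>i\<in>A. c i * h i x)) = (LINT x|lborel. (\<Sum>i\<in>A. c i * (indicat_real S x *\<^sub>R h i x)))"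
    by (simp add: set_lebesgue_integral_def sum_distrib_left mult_ac)
  also have "\<dots> = (\<Sum>i\<in>A. LINT x|lborel. c i * (indicat_real S x *\<^sub>R h i x))"
    by (intro Bochner_Integration.integral_sum integrable_mult_right i)
  finally show ?thesis by (simp add: set_lebesgue_integral_def)
qed

definition Tri :: "(real \<times> real) set" where "Tri = {(s, t). 0 \<le> s \<and> 0 \<le> t \<and> s + t \<le> 1}"

lemma compact_Tri: "compact Tri"
proof -
  have "Tri = {x. 0 \<le> fst x} \<inter> {x. 0 \<le> snd x} \<inter> {x. fst x + snd x \<le> 1}" by (auto simp: Tri_def)
  also have "closed \<dots>" by (intro closed_Int closed_Collect_le continuous_intros)
  finally have "closed Tri" .
  moreover have "Tri \<subseteq> {0..1} \<times> {0..1}" by (auto simp: Tri_def)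
  then have "bounded Tri" by (rule bounded_subset[rotated]) (intro bounded_Times bounded_closed_interval)
  ultimately show ?thesis by (simp add: compact_eq_bounded_closed)
qed

lemma lint_Tri:
  assumes "continuous_on UNIV (\<lambda>x. f (fst x) (snd x))"
  shows "(LINT x:Tri|lborel. f (fst x) (snd x)) = (LINT t:{0..1}|lborel. (LINT s:{0..1 - t}|lborel. f s t :: real))"
proof -
  have "integrable lborel (\<lambda>x. indicat_real Tri x *\<^sub>R f (fst x) (snd x))"
    by (intro borel_integrable_compact compact_Tri continuous_on_subset[OF assms]) auto
  then have I: "integrable (lborel \<Otimes>\<^sub>M lborel) (\<lambda>(s, t). indicat_real Tri (s, t) * f s t)"
    by (simp add: lborel_prod split_def)
  have "(LINT x:Tri|lborel. f (fst x) (snd x)) = (LINT x|(lborel \<Otimes>\<^sub>M lborel). (case x of (s, t) \<Rightarrow> indicat_real Tri (s, t) * f s t))"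
    by (simp add: set_lebesgue_integral_def lborel_prod split_def)
  also have "\<dots> = (LINT t|lborel. LINT s|lborel. indicat_real Tri (s, t) * f s t)"
    by (rule lborel_pair.integral_snd[OF I, symmetric])
  also have "\<dots> = (LINT t|lborel. indicat_real {0..1} t * (LINT s|lborel. indicat_real {0..1 - t} s * f s t))"
  proof (rule Bochner_Integration.integral_cong[OF refl])
    fix t :: real
    have "(LINT s|lborel. indicat_real Tri (s, t) * f s t) = (LINT s|lborel. indicat_real {0..1} t * (indicat_real {0..1 - t} s * f s t))"
      by (rule Bochner_Integration.integral_cong[OF refl]) (auto simp: Tri_def indicator_def)
    then show "(LINT s|lborel. indicat_real Tri (s, t) * f s t) = indicat_real {0..1} t * (LINT s|lborel. indicat_real {0..1 - t} s * f s t)"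
      by simp
  qed
  finally show ?thesis by (simp add: set_lebesgue_integral_def)
qed

text \<open>Dirichlet's integral as two nested Beta integrals: the inner one over s up to 1 - t
  raises the exponent of 1 - t by n + 1.\<close>

lemma dirichlet_Tri:
  "(LINT x:Tri|lborel. (1 - fst x - snd x) ^ m * fst x ^ n * snd x ^ l) = fact m * fact n * fact l / fact (m + n + l + 2)"
proof -
  have "(LINT x:Tri|lborel. (1 - fst x - snd x) ^ m * fst x ^ n * snd x ^ l)
      = (LINT t:{0..1}|lborel. (LINT s:{0..1 - t}|lborel. (1 - s - t) ^ m * s ^ n * t ^ l))"
    by (rule lint_Tri) (intro continuous_intros)
  also have "\<dots> = (LINT t:{0..1}|lborel. bt m n * ((1 - t) ^ (m + n + 1) * t ^ l))"
  proof (rule set_lebesgue_integral_cong)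
    show "\<forall>t. t \<in> {0..1} \<longrightarrow> (LINT s:{0..1 - t}|lborel. (1 - s - t) ^ m * s ^ n * t ^ l) = bt m n * ((1 - t) ^ (m + n + 1) * t ^ l)"
    proof (intro allI impI)
      fix t :: real assume t: "t \<in> {0..1}"
      have "((\<lambda>s. t ^ l * ((1 - t - s) ^ m * s ^ n)) has_integral t ^ l * (bt m n * (1 - t) ^ (m + n + 1))) {0..1 - t}"
        using t by (intro has_integral_mult_right beta_has_integral) auto
      moreover have "(\<lambda>s. t ^ l * ((1 - t - s) ^ m * s ^ n)) = (\<lambda>s. (1 - s - t) ^ m * s ^ n * t ^ l)"
        by (auto simp: diff_diff_add add.commute)
      ultimately show "(LINT s:{0..1 - t}|lborel. (1 - s - t) ^ m * s ^ n * t ^ l) = bt m n * ((1 - t) ^ (m + n + 1) * t ^ l)"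
        by (intro set_lint_eq_has_integral) (auto intro!: continuous_intros simp: mult_ac)
    qed
  qed simp
  also have "\<dots> = bt m n * (bt (m + n + 1) l * 1 ^ (m + n + 1 + l + 1))"
    by (intro set_lint_eq_has_integral has_integral_mult_right beta_has_integral continuous_intros) auto
  also have "\<dots> = fact m * fact n * fact l / fact (m + n + l + 2)"
  proof -
    have "m + n + 1 + l + 1 = m + n + l + 2" by simp
    then show ?thesis unfolding bt_def by (simp only: power_one) (simp del: fact_Suc)
  qed
  finally show ?thesis .
qed

text \<open>Moment of the monomial with exponents \<open>i, j, k\<close> over the triangle (\<open>e = 2\<close>) with vertices
  \<open>(1,0,0)\<close>, \<open>(0,1,0)\<close>, \<open>(q,q,q)\<close> or over its cone from the origin (\<open>e = 3\<close>), with respect to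
  barycentric coordinates.\<close>

definition Dm :: "nat \<Rightarrow> real \<Rightarrow> nat \<Rightarrow> nat \<Rightarrow> nat \<Rightarrow> real" where
  "Dm e q i j k = fact i * fact j / fact (i + j + k + e) *
     (\<Sum>m\<le>i. \<Sum>n\<le>j. q ^ (m + n + k) * fact (m + n + k) / (fact m * fact n))"

lemma Dm_swap: "Dm e q j i k = Dm e q i j k"
  unfolding Dm_def by (subst sum.swap) (simp add: add.commute add.left_commute mult.commute)

text \<open>The moment over the segment from (1,0,0) to (q,q,q). Both other coordinates equal q t
  there, so only the sum \<open>n\<close> of their exponents matters.\<close>

definition gm :: "real \<Rightarrow> nat \<Rightarrow> nat \<Rightarrow> real" where
  "gm q i n = fact i / fact (i + n + 1) * (\<Sum>m\<le>i. q ^ (m + n) * fact (m + n) / fact m)"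

lemma binomial_fact_real: "m \<le> i \<Longrightarrow> real (i choose m) * fact (i - m) = fact i / fact m"
  by (simp add: binomial_fact field_simps)

lemma segment_moment:
  "(LINT t:{0..1}|lborel. (1 - t + q * t) ^ i * (q * t) ^ n) = gm q i n"
proof -
  have "(1 - t + q * t) ^ i * (q * t) ^ n = (\<Sum>m\<le>i. (real (i choose m) * q ^ (m + n)) * ((1 - t) ^ (i - m) * t ^ (m + n)))" for t
    unfolding add.commute[of "1 - t"] binomial_ring sum_distrib_right
    by (intro sum.cong refl) (simp add: power_mult_distrib power_add mult_ac)
  then have "(LINT t:{0..1}|lborel. (1 - t + q * t) ^ i * (q * t) ^ n)
      = (\<Sum>m\<le>i. (real (i choose m) * q ^ (m + n)) * (LINT t:{0..1}|lborel. (1 - t) ^ (i - m) * t ^ (m + n)))"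
    by (simp only:) (intro set_lint_lin_comb, auto intro!: continuous_intros)
  also have "\<dots> = (\<Sum>m\<le>i. (real (i choose m) * q ^ (m + n)) * bt (i - m) (m + n))"
  proof (intro sum.cong refl arg_cong2[where f = "(*)"])
    fix m
    show "(LINT t:{0..1}|lborel. (1 - t) ^ (i - m) * t ^ (m + n)) = bt (i - m) (m + n)"
      using beta_has_integral[of 1 "i - m" "m + n"] by (intro set_lint_eq_has_integral continuous_intros) auto
  qed
  also have "\<dots> = (\<Sum>m\<le>i. fact i / fact (i + n + 1) * (q ^ (m + n) * fact (m + n) / fact m))"
  proof (intro sum.cong refl)
    fix m assume "m \<in> {..i}"
    then have m: "m \<le> i" by simp
    then have e: "i - m + (m + n) + 1 = i + n + 1" by simp
    have "(real (i choose m) * q ^ (m + n)) * bt (i - m) (m + n) = (real (i choose m) * fact (i - m)) * (q ^ (m + n) * fact (m + n)) / fact (i + n + 1)"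
      unfolding bt_def e by simp
    then show "(real (i choose m) * q ^ (m + n)) * bt (i - m) (m + n) = fact i / fact (i + n + 1) * (q ^ (m + n) * fact (m + n) / fact m)"
      unfolding binomial_fact_real[OF m] by simp
  qed
  finally show ?thesis by (simp add: gm_def sum_distrib_left)
qed

text \<open>With \<open>p\<close> and \<open>s\<close> free the same expansion serves the triangle,
  where they are barycentric weights, and the simplex, where they are coordinates.\<close>

lemma triangle_expansion:
  fixes q p s t :: real
  shows "(p + q * t) ^ i * (s + q * t) ^ j * (q * t) ^ k =
    (\<Sum>x\<in>{..i} \<times> {..j}. (real (i choose fst x) * real (j choose snd x) * q ^ (fst x + snd x + k)) *
       (p ^ (i - fst x) * s ^ (j - snd x) * t ^ (fst x + snd x + k)))"
proof -
  have "(p + q * t) ^ i * (s + q * t) ^ j * (q * t) ^ k = (q * t + p) ^ i * (q * t + s) ^ j * (q * t) ^ k" by (simp add: add.commute)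
  also have "\<dots> = (\<Sum>m\<le>i. \<Sum>n\<le>j. (real (i choose m) * (q * t) ^ m * p ^ (i - m)) * (real (j choose n) * (q * t) ^ n * s ^ (j - n))) * (q * t) ^ k"
    unfolding binomial_ring sum_product by (rule refl)
  also have "\<dots> = (\<Sum>m\<le>i. \<Sum>n\<le>j. (real (i choose m) * real (j choose n) * q ^ (m + n + k)) * (p ^ (i - m) * s ^ (j - n) * t ^ (m + n + k)))"
    unfolding sum_distrib_right by (intro sum.cong refl) (simp add: power_mult_distrib power_add mult_ac)
  finally show ?thesis by (simp add: sum.cartesian_product split_def)
qed

text \<open>The dimension \<open>e\<close> enters only through the denominator of Dirichlet's
  formula, so faces and cones share this computation.\<close>

lemma Dm_alt:
  "(\<Sum>x\<in>{..i} \<times> {..j}. (real (i choose fst x) * real (j choose snd x) * q ^ (fst x + snd x + k)) *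
     (fact (i - fst x) * fact (j - snd x) * fact (fst x + snd x + k) / fact (i + j + k + e))) = Dm e q i j k"
proof -
  have "(\<Sum>x\<in>{..i} \<times> {..j}. (real (i choose fst x) * real (j choose snd x) * q ^ (fst x + snd x + k)) *
     (fact (i - fst x) * fact (j - snd x) * fact (fst x + snd x + k) / fact (i + j + k + e)))
    = (\<Sum>m\<le>i. \<Sum>n\<le>j. (real (i choose m) * real (j choose n) * q ^ (m + n + k)) *
     (fact (i - m) * fact (j - n) * fact (m + n + k) / fact (i + j + k + e)))"
    by (simp add: sum.cartesian_product split_def)
  also have "\<dots> = (\<Sum>m\<le>i. \<Sum>n\<le>j. fact i * fact j / fact (i + j + k + e) * (q ^ (m + n + k) * fact (m + n + k) / (fact m * fact n)))"
  proof (intro sum.cong refl)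
    fix m n assume "m \<in> {..i}" "n \<in> {..j}"
    then have "m \<le> i" "n \<le> j" by auto
    note b = binomial_fact_real[OF this(1)] binomial_fact_real[OF this(2)]
    have "(real (i choose m) * real (j choose n) * q ^ (m + n + k)) * (fact (i - m) * fact (j - n) * fact (m + n + k) / fact (i + j + k + e))
       = (real (i choose m) * fact (i - m)) * (real (j choose n) * fact (j - n)) * (q ^ (m + n + k) * fact (m + n + k)) / fact (i + j + k + e)"
      by simp
    then show "(real (i choose m) * real (j choose n) * q ^ (m + n + k)) * (fact (i - m) * fact (j - n) * fact (m + n + k) / fact (i + j + k + e))
       = fact i * fact j / fact (i + j + k + e) * (q ^ (m + n + k) * fact (m + n + k) / (fact m * fact n))"
      unfolding b by simp
  qed
  finally show ?thesis by (simp add: Dm_def sum_distrib_left)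
qed

lemma triangle_moment:
  "(LINT x:Tri|lborel. (1 - fst x - snd x + q * snd x) ^ i * (fst x + q * snd x) ^ j * (q * snd x) ^ k) = Dm 2 q i j k"
proof -
  have "(LINT x:Tri|lborel. (1 - fst x - snd x + q * snd x) ^ i * (fst x + q * snd x) ^ j * (q * snd x) ^ k)
     = (\<Sum>y\<in>{..i} \<times> {..j}. (real (i choose fst y) * real (j choose snd y) * q ^ (fst y + snd y + k)) *
       (LINT x:Tri|lborel. (1 - fst x - snd x) ^ (i - fst y) * fst x ^ (j - snd y) * snd x ^ (fst y + snd y + k)))"
    unfolding triangle_expansion by (rule set_lint_lin_comb) (auto intro!: compact_Tri continuous_intros)
  also have "\<dots> = (\<Sum>x\<in>{..i} \<times> {..j}. (real (i choose fst x) * real (j choose snd x) * q ^ (fst x + snd x + k)) *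
     (fact (i - fst x) * fact (j - snd x) * fact (fst x + snd x + k) / fact (i + j + k + 2)))"
  proof (intro sum.cong refl arg_cong2[where f = "(*)"])
    fix y assume "y \<in> {..i} \<times> {..j}"
    then have "i - fst y + (j - snd y) + (fst y + snd y + k) + 2 = i + j + k + 2" by auto
    then show "(LINT x:Tri|lborel. (1 - fst x - snd x) ^ (i - fst y) * fst x ^ (j - snd y) * snd x ^ (fst y + snd y + k))
      = fact (i - fst y) * fact (j - snd y) * fact (fst y + snd y + k) / fact (i + j + k + 2)"
      by (simp only: dirichlet_Tri)
  qed
  also have "\<dots> = Dm 2 q i j k" by (rule Dm_alt)
  finally show ?thesis .
qed

lemma sum_signs_monomial:
  "(\<Sum>a\<in>signs. \<Sum>b\<in>signs. \<Sum>c\<in>signs. a ^ i * b ^ j * c ^ k * K) = sg i * sg j * sg k * K"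
  "(\<Sum>a\<in>signs. \<Sum>b\<in>signs. a ^ i * b ^ j * K) = sg i * sg j * K"
  by (simp_all add: sum_signs sg_def algebra_simps)

lemma skeleton_0_moment:
  assumes "r > 0"
  shows "skeleton_integral r 0 (\<lambda>y. y $ 1 ^ i * y $ 2 ^ j * y $ 3 ^ k) =
    sg i * 0 ^ j * 0 ^ k + 0 ^ i * sg j * 0 ^ k + 0 ^ i * 0 ^ j * sg k + sg i * sg j * sg k * (r / 3) ^ (i + j + k)"
proof -
  have "vD r a b c $ 1 ^ i * vD r a b c $ 2 ^ j * vD r a b c $ 3 ^ k = a ^ i * b ^ j * c ^ k * (r / 3) ^ (i + j + k)" for a b c
    unfolding v_nth power_mult_distrib power_add by (simp add: mult_ac)
  then show ?thesis
    unfolding skeleton_integral_def sum_vertices[OF assms]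
    by (simp add: sum_signs_monomial(1)) (simp add: v_nth sg_def sum_signs algebra_simps)
qed

lemma line_comb_nth: "(u + t *\<^sub>R (v - u)) $ i = u $ i + t * (v $ i - u $ i)" for u v :: "real^3"
  by simp

lemma segment_lint:
  assumes "\<And>t. g t = K * h t" "(LINT t:{0..1}|lborel. h t) = (I::real)"
  shows "(LINT t:{0..1::real}|lborel. g t) = K * I"
  unfolding assms(1) using assms(2) by (simp add: set_lebesgue_integral_def mult.left_commute)

lemma beta_lint: "(LINT t:{0..1}|lborel. (1 - t) ^ i * t ^ j) = bt i j"
  using beta_has_integral[of 1 i j] by (intro set_lint_eq_has_integral continuous_intros) auto

lemma signs_mult_self: "a \<in> signs \<Longrightarrow> a * a = 1"
  by (auto simp: signs_def)

lemma norm_vec3: "norm (x :: real^3) = sqrt (x $ 1 ^ 2 + x $ 2 ^ 2 + x $ 3 ^ 2)"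
  by (simp add: norm_eq_sqrt_inner inner_vec_def sum_3 power2_eq_square)

lemma signs_scaled_sq: "a \<in> signs \<Longrightarrow> (u * a) ^ 2 = u ^ 2"
  by (simp add: power_mult_distrib signs_sq)

lemma edge_norms:
  assumes "a \<in> signs" "b \<in> signs" "c \<in> signs"
  shows "norm (vB b - vA a) = sqrt 2" "norm (vC c - vA a) = sqrt 2" "norm (vC c - vB b) = sqrt 2"
    "norm (vD r a b c - vA a) = sqrt (1 - 2 * (r / 3) + 3 * (r / 3) ^ 2)"
    "norm (vD r a b c - vB b) = sqrt (1 - 2 * (r / 3) + 3 * (r / 3) ^ 2)"
    "norm (vD r a b c - vC c) = sqrt (1 - 2 * (r / 3) + 3 * (r / 3) ^ 2)"
proof -
  have d: "(q * e - e) ^ 2 = (q - 1) ^ 2" if "e \<in> signs" for e q :: real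
    using signs_scaled_sq[OF that, of "q - 1"] by (simp add: left_diff_distrib)
  have e: "(q - 1) ^ 2 = 1 - 2 * q + q ^ 2" for q :: real by (simp add: power2_eq_square algebra_simps)
  show "norm (vB b - vA a) = sqrt 2" "norm (vC c - vA a) = sqrt 2" "norm (vC c - vB b) = sqrt 2"
    by (simp_all add: norm_vec3 v_nth assms signs_sq)
  show "norm (vD r a b c - vA a) = sqrt (1 - 2 * (r / 3) + 3 * (r / 3) ^ 2)"
    "norm (vD r a b c - vB b) = sqrt (1 - 2 * (r / 3) + 3 * (r / 3) ^ 2)"
    "norm (vD r a b c - vC c) = sqrt (1 - 2 * (r / 3) + 3 * (r / 3) ^ 2)"
    unfolding norm_vec3 vector_minus_component v_nth diff_0_right d[OF assms(1)] d[OF assms(2)] d[OF assms(3)]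
      signs_scaled_sq[OF assms(1)] signs_scaled_sq[OF assms(2)] signs_scaled_sq[OF assms(3)] e
    by simp_all
qed

lemma face_norms:
  assumes "a \<in> signs" "b \<in> signs" "c \<in> signs"
  shows "norm (cross3 (vB b - vA a) (vD r a b c - vA a)) = sqrt (2 * (r / 3) ^ 2 + (2 * (r / 3) - 1) ^ 2)"
    "norm (cross3 (vC c - vA a) (vD r a b c - vA a)) = sqrt (2 * (r / 3) ^ 2 + (2 * (r / 3) - 1) ^ 2)"
    "norm (cross3 (vC c - vB b) (vD r a b c - vB b)) = sqrt (2 * (r / 3) ^ 2 + (2 * (r / 3) - 1) ^ 2)"
proof -
  have h: "a = 1 \<or> a = -1" "b = 1 \<or> b = -1" "c = 1 \<or> c = -1" using assms by (auto simp: signs_def)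
  show "norm (cross3 (vB b - vA a) (vD r a b c - vA a)) = sqrt (2 * (r / 3) ^ 2 + (2 * (r / 3) - 1) ^ 2)"
    unfolding norm_vec3 cross3_def vector_3 vector_minus_component v_nth
    using h by (elim disjE) (simp_all add: power2_eq_square field_simps)
  show "norm (cross3 (vC c - vA a) (vD r a b c - vA a)) = sqrt (2 * (r / 3) ^ 2 + (2 * (r / 3) - 1) ^ 2)"
    unfolding norm_vec3 cross3_def vector_3 vector_minus_component v_nth
    using h by (elim disjE) (simp_all add: power2_eq_square field_simps)
  show "norm (cross3 (vC c - vB b) (vD r a b c - vB b)) = sqrt (2 * (r / 3) ^ 2 + (2 * (r / 3) - 1) ^ 2)"
    unfolding norm_vec3 cross3_def vector_3 vector_minus_component v_nth
    using h by (elim disjE) (simp_all add: power2_eq_square field_simps)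
qed

definition edge_len :: "real \<Rightarrow> real" where "edge_len r = sqrt (1 - 2 * (r / 3) + 3 * (r / 3) ^ 2)"
text \<open>Twice the area of a face: the Jacobian of its affine parametrisation.\<close>

definition face_area2 :: "real \<Rightarrow> real" where "face_area2 r = sqrt (2 * (r / 3) ^ 2 + (2 * (r / 3) - 1) ^ 2)"

lemma sum_signs2_cong: "(\<And>a b. a \<in> signs \<Longrightarrow> b \<in> signs \<Longrightarrow> f a b = g a b) \<Longrightarrow>
   (\<Sum>a\<in>signs. \<Sum>b\<in>signs. f a b) = (\<Sum>a\<in>signs. \<Sum>b\<in>signs. g a b :: real)"
  by (intro sum.cong refl) auto

lemma sum_signs3_cong: "(\<And>a b c. a \<in> signs \<Longrightarrow> b \<in> signs \<Longrightarrow> c \<in> signs \<Longrightarrow> f a b c = g a b c) \<Longrightarrow>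
   (\<Sum>a\<in>signs. \<Sum>b\<in>signs. \<Sum>c\<in>signs. f a b c) = (\<Sum>a\<in>signs. \<Sum>b\<in>signs. \<Sum>c\<in>signs. g a b c :: real)"
  by (intro sum.cong refl) auto

lemma skeleton_1_moment:
  assumes "r > 0"
  shows "skeleton_integral r 1 (\<lambda>y. y $ 1 ^ i * y $ 2 ^ j * y $ 3 ^ k) =
    sqrt 2 * (sg i * sg j * 0 ^ k * bt i j + sg i * 0 ^ j * sg k * bt i k + 0 ^ i * sg j * sg k * bt j k)
    + edge_len r * (sg i * sg j * sg k * (gm (r / 3) i (j + k) + gm (r / 3) j (i + k) + gm (r / 3) k (i + j)))"
proof -
  define q where "q = r / 3"
  let ?Y = "\<lambda>y::real^3. y $ 1 ^ i * y $ 2 ^ j * y $ 3 ^ k"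
  let ?I = "\<lambda>u v. norm (v - u) * (LINT t:{0..1}|lborel. ?Y (u + t *\<^sub>R (v - u)))"
  \<comment> \<open>Along an edge each coordinate is a sign, or 0, times a function of the parameter
    alone; the signs can then be pulled out of the integral.\<close>
  have l: "a + t * (0 - a) = a * (1 - t)" "0 + t * (b - 0) = b * t" "0 + t * (0 - 0) = (0::real)"
    "a + t * (q * a - a) = a * (1 - t + q * t)" "0 + t * (q * b - 0) = b * (q * t)" for a b t :: real
    by (simp_all add: algebra_simps)
  have AB: "(LINT t:{0..1}|lborel. ?Y (vA a + t *\<^sub>R (vB b - vA a))) = (a ^ i * b ^ j * 0 ^ k) * bt i j" for a b
    unfolding line_comb_nth v_nth l by (rule segment_lint[OF _ beta_lint]) (simp add: power_mult_distrib mult_ac)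
  have AC: "(LINT t:{0..1}|lborel. ?Y (vA a + t *\<^sub>R (vC c - vA a))) = (a ^ i * 0 ^ j * c ^ k) * bt i k" for a c
    unfolding line_comb_nth v_nth l by (rule segment_lint[OF _ beta_lint]) (simp add: power_mult_distrib mult_ac)
  have BC: "(LINT t:{0..1}|lborel. ?Y (vB b + t *\<^sub>R (vC c - vB b))) = (0 ^ i * b ^ j * c ^ k) * bt j k" for b c
    unfolding line_comb_nth v_nth l by (rule segment_lint[OF _ beta_lint]) (simp add: power_mult_distrib mult_ac)
  have AD: "(LINT t:{0..1}|lborel. ?Y (vA a + t *\<^sub>R (vD r a b c - vA a))) = (a ^ i * b ^ j * c ^ k) * gm q i (j + k)" for a b c
    unfolding line_comb_nth v_nth q_def[symmetric] l
    by (rule segment_lint[OF _ segment_moment]) (simp add: power_mult_distrib power_add mult_ac)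
  have BD: "(LINT t:{0..1}|lborel. ?Y (vB b + t *\<^sub>R (vD r a b c - vB b))) = (a ^ i * b ^ j * c ^ k) * gm q j (i + k)" for a b c
    unfolding line_comb_nth v_nth q_def[symmetric] l
    by (rule segment_lint[OF _ segment_moment]) (simp add: power_mult_distrib power_add mult_ac)
  have CD: "(LINT t:{0..1}|lborel. ?Y (vC c + t *\<^sub>R (vD r a b c - vC c))) = (a ^ i * b ^ j * c ^ k) * gm q k (i + j)" for a b c
    unfolding line_comb_nth v_nth q_def[symmetric] l
    by (rule segment_lint[OF _ segment_moment]) (simp add: power_mult_distrib power_add mult_ac)
  have 1: "(\<Sum>a\<in>signs. \<Sum>b\<in>signs. ?I (vA a) (vB b)) = (\<Sum>a\<in>signs. \<Sum>b\<in>signs. a ^ i * b ^ j * (sqrt 2 * 0 ^ k * bt i j))"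
    by (rule sum_signs2_cong) (simp only: AB edge_norms, simp add: mult_ac)
  have 2: "(\<Sum>a\<in>signs. \<Sum>b\<in>signs. ?I (vA a) (vC b)) = (\<Sum>a\<in>signs. \<Sum>b\<in>signs. a ^ i * b ^ k * (sqrt 2 * 0 ^ j * bt i k))"
    by (rule sum_signs2_cong) (simp only: AC edge_norms, simp add: mult_ac)
  have 3: "(\<Sum>a\<in>signs. \<Sum>b\<in>signs. ?I (vB a) (vC b)) = (\<Sum>a\<in>signs. \<Sum>b\<in>signs. a ^ j * b ^ k * (sqrt 2 * 0 ^ i * bt j k))"
    by (rule sum_signs2_cong) (simp only: BC edge_norms, simp add: mult_ac)
  have 4: "(\<Sum>a\<in>signs. \<Sum>b\<in>signs. \<Sum>c\<in>signs. ?I (vA a) (vD r a b c) + ?I (vB b) (vD r a b c) + ?I (vC c) (vD r a b c))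
     = (\<Sum>a\<in>signs. \<Sum>b\<in>signs. \<Sum>c\<in>signs. a ^ i * b ^ j * c ^ k * (edge_len r * (gm q i (j + k) + gm q j (i + k) + gm q k (i + j))))"
    by (rule sum_signs3_cong) (simp only: AD BD CD edge_norms edge_len_def, simp add: algebra_simps)
  have "skeleton_integral r 1 ?Y = (\<Sum>a\<in>signs. \<Sum>b\<in>signs. ?I (vA a) (vB b)) + (\<Sum>a\<in>signs. \<Sum>b\<in>signs. ?I (vA a) (vC b))
     + (\<Sum>a\<in>signs. \<Sum>b\<in>signs. ?I (vB a) (vC b)) + (\<Sum>a\<in>signs. \<Sum>b\<in>signs. \<Sum>c\<in>signs. ?I (vA a) (vD r a b c) + ?I (vB b) (vD r a b c) + ?I (vC c) (vD r a b c))"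
    unfolding skeleton_integral_def by (simp only: sum_edges[OF assms] if_True if_False one_neq_zero refl)
  then show ?thesis
    unfolding 1 2 3 4 sum_signs_monomial by (simp add: q_def algebra_simps)
qed

text \<open>The three faces around an apex, or the cones over them, differ in which coordinate
  vanishes along the octahedral edge; it takes the last place in \<open>Dm\<close>.\<close>

definition Sg :: "nat \<Rightarrow> real \<Rightarrow> nat \<Rightarrow> nat \<Rightarrow> nat \<Rightarrow> real" where
  "Sg e q i j k = Dm e q i j k + Dm e q i k j + Dm e q j k i"

lemma face_lint:
  assumes "\<And>x. g x = K * ((1 - fst x - snd x + q * snd x) ^ i * (fst x + q * snd x) ^ j * (q * snd x) ^ k)"
  shows "(LINT x:{(s, t). 0 \<le> s \<and> 0 \<le> t \<and> s + t \<le> 1}|lborel. g x) = K * Dm 2 q i j k"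
  unfolding assms(1) using triangle_moment[of q i j k]
  by (simp add: set_lebesgue_integral_def mult.left_commute Tri_def[symmetric])

lemma skeleton_2_moment:
  assumes "r > 0"
  shows "skeleton_integral r 2 (\<lambda>y. y $ 1 ^ i * y $ 2 ^ j * y $ 3 ^ k) =
    face_area2 r * (sg i * sg j * sg k * Sg 2 (r / 3) i j k)"
proof -
  define q where "q = r / 3"
  let ?Y = "\<lambda>y::real^3. y $ 1 ^ i * y $ 2 ^ j * y $ 3 ^ k"
  let ?I = "\<lambda>u v w. norm (cross3 (v - u) (w - u)) * (LINT p:{(s, t). 0 \<le> s \<and> 0 \<le> t \<and> s + t \<le> 1}|lborel.
     ?Y (u + fst p *\<^sub>R (v - u) + snd p *\<^sub>R (w - u)))"
  have n: "(u + s *\<^sub>R (v - u) + t *\<^sub>R (w - u)) $ l = u $ l + s * (v $ l - u $ l) + t * (w $ l - u $ l)" for u v w :: "real^3" and s t l by simp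
  have l: "a + s * (0 - a) + t * (q * a - a) = a * (1 - s - t + q * t)" "0 + s * (b - 0) + t * (q * b - 0) = b * (s + q * t)"
    "0 + s * (0 - 0) + t * (q * c - 0) = c * (q * t)" for a b c s t :: real
    by (simp_all add: algebra_simps)
  have ABD: "(LINT p:{(s, t). 0 \<le> s \<and> 0 \<le> t \<and> s + t \<le> 1}|lborel. ?Y (vA a + fst p *\<^sub>R (vB b - vA a) + snd p *\<^sub>R (vD r a b c - vA a)))
     = (a ^ i * b ^ j * c ^ k) * Dm 2 q i j k" for a b c
    unfolding n v_nth q_def[symmetric] l by (rule face_lint) (simp only: power_mult_distrib mult_ac)
  have ACD: "(LINT p:{(s, t). 0 \<le> s \<and> 0 \<le> t \<and> s + t \<le> 1}|lborel. ?Y (vA a + fst p *\<^sub>R (vC c - vA a) + snd p *\<^sub>R (vD r a b c - vA a)))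
     = (a ^ i * b ^ j * c ^ k) * Dm 2 q i k j" for a b c
    unfolding n v_nth q_def[symmetric] l by (rule face_lint) (simp only: power_mult_distrib mult_ac)
  have BCD: "(LINT p:{(s, t). 0 \<le> s \<and> 0 \<le> t \<and> s + t \<le> 1}|lborel. ?Y (vB b + fst p *\<^sub>R (vC c - vB b) + snd p *\<^sub>R (vD r a b c - vB b)))
     = (a ^ i * b ^ j * c ^ k) * Dm 2 q j k i" for a b c
    unfolding n v_nth q_def[symmetric] l by (rule face_lint) (simp only: power_mult_distrib mult_ac)
  have 4: "(\<Sum>a\<in>signs. \<Sum>b\<in>signs. \<Sum>c\<in>signs. ?I (vA a) (vB b) (vD r a b c) + ?I (vA a) (vC c) (vD r a b c) + ?I (vB b) (vC c) (vD r a b c))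
     = (\<Sum>a\<in>signs. \<Sum>b\<in>signs. \<Sum>c\<in>signs. a ^ i * b ^ j * c ^ k * (face_area2 r * Sg 2 q i j k))"
    by (rule sum_signs3_cong) (simp only: ABD ACD BCD face_norms face_area2_def[symmetric] Sg_def, simp add: algebra_simps)
  have k2: "(2::nat) \<noteq> 0" "(2::nat) \<noteq> 1" by simp_all
  have "skeleton_integral r 2 ?Y = (\<Sum>a\<in>signs. \<Sum>b\<in>signs. \<Sum>c\<in>signs. ?I (vA a) (vB b) (vD r a b c) + ?I (vA a) (vC c) (vD r a b c) + ?I (vB b) (vC c) (vD r a b c))"
    unfolding skeleton_integral_def by (simp only: sum_faces[OF assms] if_True if_False k2 refl)
  then show ?thesis
    unfolding 4 sum_signs_monomial by (simp add: q_def)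
qed

section \<open>The decisive moment combinations\<close>

lemma Sg_swap: "Sg e q j i k = Sg e q i j k" "Sg e q i k j = Sg e q i j k"
  unfolding Sg_def using Dm_swap[of e q] by (simp_all add: algebra_simps)

lemma bt_swap: "bt j i = bt i j" by (simp add: bt_def add.commute mult.commute)

text \<open>Clearing the factorial that depends on the dimension shows that the surface and the
  solid have proportional moments in each degree. Therefore k = 2 and k = 3 share one critical
  radius.\<close>

definition Pn :: "real \<Rightarrow> nat \<Rightarrow> nat \<Rightarrow> nat \<Rightarrow> real" where
  "Pn q i j k = Sg 0 q i j k * fact (i + j + k)"

lemma Dm_scale: "Dm e q i j k * fact (i + j + k + e) = Dm 0 q i j k * fact (i + j + k)"
  by (simp add: Dm_def)

lemma Sg_Pn: "Sg e q i j k = Pn q i j k / fact (i + j + k + e)"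
proof -
  have "Sg e q i j k * fact (i + j + k + e) = Pn q i j k"
  proof -
    have e: "i + k + j = i + j + k" "j + k + i = i + j + k" by simp_all
    show ?thesis
      using Dm_scale[of e q i j k] Dm_scale[of e q i k j] Dm_scale[of e q j k i]
      unfolding e Pn_def Sg_def distrib_right by (simp only:)
  qed
  then show ?thesis by (metis fact_nonzero nonzero_mult_div_cancel_right)
qed

lemma atMost_num: "{..8::nat} = {0,1,2,3,4,5,6,7,8}" "{..6::nat} = {0,1,2,3,4,5,6}" "{..4::nat} = {0,1,2,3,4}" "{..2::nat} = {0,1,2}"
  by auto

lemma Dn_eval: "Dm 0 q i j k * fact (i + j + k) = fact i * fact j * (\<Sum>m\<le>i. \<Sum>n\<le>j. q ^ (m + n + k) * fact (m + n + k) / (fact m * fact n))"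
  by (simp add: Dm_def)

lemma Pn_eval: "Pn q i j k = fact i * fact j * (\<Sum>m\<le>i. \<Sum>n\<le>j. q ^ (m + n + k) * fact (m + n + k) / (fact m * fact n))
   + fact i * fact k * (\<Sum>m\<le>i. \<Sum>n\<le>k. q ^ (m + n + j) * fact (m + n + j) / (fact m * fact n))
   + fact j * fact k * (\<Sum>m\<le>j. \<Sum>n\<le>k. q ^ (m + n + i) * fact (m + n + i) / (fact m * fact n))"
proof -
  have e: "i + k + j = i + j + k" "j + k + i = i + j + k" by simp_all
  show ?thesis
    using Dn_eval[of q i j k] Dn_eval[of q i k j] Dn_eval[of q j k i]
    unfolding e Pn_def Sg_def distrib_right by (simp only:)
qed

text \<open>The coefficients 1, -3, then 1, -15, 30 and 1, -28, 35 are those of the locale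
  \<open>harmonic_moments\<close> after the factorials of the divided monomials have been
  cleared.\<close>

lemma Pn_400: "Pn q 4 0 0 - 3 * Pn q 2 2 0 = 12 * (3 + 2 * q - 2 * q ^ 2 - 8 * q ^ 3 - 12 * q ^ 4)"
  unfolding Pn_eval atMost_num by (simp add: fact_numeral) (simp add: field_simps eval_nat_numeral)

lemma Pn_600: "Pn q 6 0 0 - 15 * Pn q 4 2 0 + 30 * Pn q 2 2 2 = 720 * (1 - 2 * q ^ 2 - 2 * q ^ 3 + 8 * q ^ 4 + 32 * q ^ 5 + 48 * q ^ 6)"
  unfolding Pn_eval atMost_num by (simp add: fact_numeral) (simp add: field_simps eval_nat_numeral)

lemma Pn_800: "Pn q 8 0 0 - 28 * Pn q 6 2 0 + 35 * Pn q 4 4 0 =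
   20160 * (3 + 2 * q - 2 * q ^ 2 - 8 * q ^ 3 - 12 * q ^ 4 - 8 * q ^ 5 + 8 * q ^ 6 + 32 * q ^ 7 + 48 * q ^ 8)"
  unfolding Pn_eval atMost_num by (simp add: fact_numeral) (simp add: field_simps eval_nat_numeral)

lemma Pn_pos: "q > 0 \<Longrightarrow> Pn q i j k > 0"
  unfolding Pn_eval
  by (intro add_pos_pos mult_pos_pos sum_pos divide_pos_pos) auto

definition Gg :: "real \<Rightarrow> nat \<Rightarrow> nat \<Rightarrow> nat \<Rightarrow> real" where
  "Gg q i j k = gm q i (j + k) + gm q j (i + k) + gm q k (i + j)"

lemma Gg_400: "Gg q 4 0 0 - 3 * Gg q 2 2 0 = (1 + q - 2 * q ^ 3 - 6 * q ^ 4) / 5"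
  unfolding Gg_def gm_def by (simp add: atMost_num fact_numeral) (simp add: field_simps eval_nat_numeral)

lemma Gg_600: "Gg q 6 0 0 - 15 * Gg q 4 2 0 + 30 * Gg q 2 2 2 = (1 + q - 2 * q ^ 3 + 16 * q ^ 5 + 48 * q ^ 6) / 7"
  unfolding Gg_def gm_def by (simp add: atMost_num fact_numeral) (simp add: field_simps eval_nat_numeral)

lemma Gg_800: "Gg q 8 0 0 - 28 * Gg q 6 2 0 + 35 * Gg q 4 4 0 =
   (1 + q - 2 * q ^ 3 - 4 * q ^ 4 - 4 * q ^ 5 + 8 * q ^ 7 + 24 * q ^ 8) / 9"
  unfolding Gg_def gm_def by (simp add: atMost_num fact_numeral) (simp add: field_simps eval_nat_numeral)

lemma Gg_pos: "q > 0 \<Longrightarrow> Gg q i j k > 0"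
  unfolding Gg_def gm_def
  by (intro add_pos_pos mult_pos_pos sum_pos divide_pos_pos) auto

section \<open>The solid as a sublevel set\<close>

text \<open>The gauge of the solid. On the cone over a face the coordinate of smallest absolute
  value is fixed, so \<open>NN\<close> is linear there; the slope 3/r - 3 makes it 1 at the apex, as
  it is at the octahedral vertices.\<close>

definition NN :: "real \<Rightarrow> real^3 \<Rightarrow> real" where
  "NN r x = \<bar>x $ 1\<bar> + \<bar>x $ 2\<bar> + \<bar>x $ 3\<bar> + (3 / r - 3) * min \<bar>x $ 1\<bar> (min \<bar>x $ 2\<bar> \<bar>x $ 3\<bar>)"

lemma continuous_on_NN: "continuous_on S (NN r)"
  unfolding NN_def by (intro continuous_intros)

lemma convex_linear_le: "convex {x::real^3. \<alpha> * x $ 1 + \<beta> * x $ 2 + \<gamma> * x $ 3 \<le> d}"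
proof -
  have "{x::real^3. \<alpha> * x $ 1 + \<beta> * x $ 2 + \<gamma> * x $ 3 \<le> d} = {x. vector [\<alpha>, \<beta>, \<gamma>] \<bullet> x \<le> d}"
    by (simp add: inner_vec_def sum_3 vector_3)
  then show ?thesis by (simp add: convex_halfspace_le)
qed

lemma convex_comb4:
  assumes "convex C" "p1 \<in> C" "p2 \<in> C" "p3 \<in> C" "p4 \<in> C" "u1 \<ge> 0" "u2 \<ge> 0" "u3 \<ge> 0" "u4 \<ge> (0::real)" "u1 + u2 + u3 + u4 = 1"
  shows "u1 *\<^sub>R p1 + u2 *\<^sub>R p2 + u3 *\<^sub>R p3 + u4 *\<^sub>R p4 \<in> C"
proof -
  have "(\<Sum>i\<in>{0, 1, 2, 3::nat}. ([u1, u2, u3, u4] ! i) *\<^sub>R ([p1, p2, p3, p4] ! i)) \<in> C"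
    by (rule convex_sum) (use assms in \<open>auto simp: add.assoc\<close>)
  then show ?thesis by (simp add: add.assoc)
qed

lemma one_signs [simp]: "1 \<in> signs" "-1 \<in> signs" by (auto simp: signs_def)

text \<open>The value at 0 is 1, so that every point gets an octant, also on the coordinate
  planes.\<close>

definition sn :: "real \<Rightarrow> real" where "sn t = (if t \<ge> 0 then 1 else -1)"

lemma sn_signs [simp]: "sn t \<in> signs" by (simp add: sn_def)

lemma sn_abs: "sn t * \<bar>t\<bar> = t" by (simp add: sn_def)

lemma octahedron_eq: "octahedron = {x. \<bar>x $ 1\<bar> + \<bar>x $ 2\<bar> + \<bar>x $ 3\<bar> \<le> 1}"
proof
  let ?Q = "{x::real^3. \<bar>x $ 1\<bar> + \<bar>x $ 2\<bar> + \<bar>x $ 3\<bar> \<le> 1}"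
  have "?Q = (\<Inter>a\<in>signs. \<Inter>b\<in>signs. \<Inter>c\<in>signs. {x. a * x $ 1 + b * x $ 2 + c * x $ 3 \<le> 1})"
  proof (intro equalityI subsetI)
    have le: "a * t \<le> \<bar>t\<bar>" if "a \<in> signs" for a t using that by (auto simp: signs_def)
    fix x assume "x \<in> ?Q"
    then show "x \<in> (\<Inter>a\<in>signs. \<Inter>b\<in>signs. \<Inter>c\<in>signs. {x. a * x $ 1 + b * x $ 2 + c * x $ 3 \<le> 1})"
      using le by (auto intro: order_trans[OF add_mono[OF add_mono]])
  next
    have e: "sn t * t = \<bar>t\<bar>" for t by (simp add: sn_def)
    fix x :: "real^3" assume "x \<in> (\<Inter>a\<in>signs. \<Inter>b\<in>signs. \<Inter>c\<in>signs. {x. a * x $ 1 + b * x $ 2 + c * x $ 3 \<le> 1})"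
    then have "sn (x $ 1) * x $ 1 + sn (x $ 2) * x $ 2 + sn (x $ 3) * x $ 3 \<le> 1" using sn_signs by blast
    then show "x \<in> ?Q" by (simp add: e)
  qed
  also have "convex \<dots>" by (intro convex_INT convex_linear_le)
  finally have "convex ?Q" .
  then show "octahedron \<subseteq> ?Q"
    unfolding octahedron_def by (intro hull_minimal) (auto simp: v_nth signs_def)
  show "?Q \<subseteq> octahedron"
  proof
    fix x assume x: "x \<in> ?Q"
    have c: "convex octahedron" by (simp add: octahedron_def convex_convex_hull)
    have v: "vA a \<in> octahedron" "vB a \<in> octahedron" "vC a \<in> octahedron" if "a \<in> signs" for a
      unfolding octahedron_def using that by (auto intro!: hull_inc)
    \<comment> \<open>The origin, as midpoint of two opposite vertices, later absorbs the weight
      that the coordinates leave over.\<close>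
    have "(1/2) *\<^sub>R vA 1 + (1/2) *\<^sub>R vA (-1) + 0 *\<^sub>R vA 1 + 0 *\<^sub>R vA 1 \<in> octahedron"
      by (intro convex_comb4[OF c] v) auto
    moreover have "(1/2) *\<^sub>R vA 1 + (1/2) *\<^sub>R vA (-1) + 0 *\<^sub>R vA 1 + 0 *\<^sub>R vA 1 = 0"
      by (simp add: vec3_eq_iff v_nth)
    ultimately have z: "0 \<in> octahedron" by simp
    have "\<bar>x $ 1\<bar> *\<^sub>R vA (sn (x $ 1)) + \<bar>x $ 2\<bar> *\<^sub>R vB (sn (x $ 2)) + \<bar>x $ 3\<bar> *\<^sub>R vC (sn (x $ 3))
        + (1 - \<bar>x $ 1\<bar> - \<bar>x $ 2\<bar> - \<bar>x $ 3\<bar>) *\<^sub>R 0 \<in> octahedron"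
      using x by (intro convex_comb4[OF c] v z) auto
    moreover have "\<bar>x $ 1\<bar> *\<^sub>R vA (sn (x $ 1)) + \<bar>x $ 2\<bar> *\<^sub>R vB (sn (x $ 2)) + \<bar>x $ 3\<bar> *\<^sub>R vC (sn (x $ 3))
        + (1 - \<bar>x $ 1\<bar> - \<bar>x $ 2\<bar> - \<bar>x $ 3\<bar>) *\<^sub>R 0 = x"
      using sn_abs by (simp add: vec3_eq_iff v_nth mult.commute)
    ultimately show "x \<in> octahedron" by simp
  qed
qed

text \<open>Linear inequalities need to be checked at the four vertices only. The factor
  \<open>s\<close> fixes the direction: -1 for attached pyramids and +1 for excavated ones, where
  the face planes bound from the other side.\<close>

lemma pyramid_halfspaces:
  assumes "a \<in> signs" "b \<in> signs" "c \<in> signs" "r > 0"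
    and x: "x \<in> convex hull {vA a, vB b, vC c, vD r a b c}"
  shows "0 \<le> a * x $ 1 \<and> 0 \<le> b * x $ 2 \<and> 0 \<le> c * x $ 3"
    and "s * (3 / r - 3) \<ge> 0 \<Longrightarrow> s * (a * x $ 1 + b * x $ 2 + c * x $ 3 + (3 / r - 3) * (a * x $ 1)) \<ge> s \<and>
      s * (a * x $ 1 + b * x $ 2 + c * x $ 3 + (3 / r - 3) * (b * x $ 2)) \<ge> s \<and>
      s * (a * x $ 1 + b * x $ 2 + c * x $ 3 + (3 / r - 3) * (c * x $ 3)) \<ge> s"
proof -
  have sq: "a * a = 1" "b * b = 1" "c * c = 1" using assms by (auto intro: signs_mult_self)
  let ?V = "{vA a, vB b, vC c, vD r a b c}"
  have key: "\<alpha> * x $ 1 + \<beta> * x $ 2 + \<gamma> * x $ 3 \<le> d"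
    if "\<And>v. v \<in> ?V \<Longrightarrow> \<alpha> * v $ 1 + \<beta> * v $ 2 + \<gamma> * v $ 3 \<le> d" for \<alpha> \<beta> \<gamma> d
  proof -
    have "convex hull ?V \<subseteq> {x. \<alpha> * x $ 1 + \<beta> * x $ 2 + \<gamma> * x $ 3 \<le> d}"
      by (rule hull_minimal) (use that convex_linear_le in auto)
    then show ?thesis using x by auto
  qed
  have q: "e * (r / 3 * e) = r / 3" if "e * e = 1" for e :: real
    using that by (metis mult.left_commute mult.right_neutral)
  have q': "e * (r * e) = r" if "e * e = 1" for e :: real
    using that by (metis mult.left_commute mult.right_neutral)
  have "- a * x $ 1 + 0 * x $ 2 + 0 * x $ 3 \<le> 0" by (rule key) (use assms(4) in \<open>auto simp: v_nth sq q'\<close>)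
  moreover have "0 * x $ 1 + - b * x $ 2 + 0 * x $ 3 \<le> 0" by (rule key) (use assms(4) in \<open>auto simp: v_nth sq q'\<close>)
  moreover have "0 * x $ 1 + 0 * x $ 2 + - c * x $ 3 \<le> 0" by (rule key) (use assms(4) in \<open>auto simp: v_nth sq q'\<close>)
  ultimately show "0 \<le> a * x $ 1 \<and> 0 \<le> b * x $ 2 \<and> 0 \<le> c * x $ 3" by simp
  assume s: "s * (3 / r - 3) \<ge> 0"
  \<comment> \<open>At the apex each of the three linear forms takes the value 1.\<close>
  have t: "r / 3 + r / 3 + r / 3 + (3 / r - 3) * (r / 3) = 1" using assms(4) by (simp add: field_simps)
  \<comment> \<open>Weights (1,0,0), (0,1,0) and (0,0,1) give the three face planes; one computation
    covers them.\<close>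
  have main: "- s * (1 + (3 / r - 3) * k1) * a * x $ 1 + - s * (1 + (3 / r - 3) * k2) * b * x $ 2 + - s * (1 + (3 / r - 3) * k3) * c * x $ 3 \<le> - s"
    if k: "k1 \<ge> 0" "k2 \<ge> 0" "k3 \<ge> 0" "k1 + k2 + k3 = 1" for k1 k2 k3
  proof (rule key)
    fix v assume "v \<in> ?V"
    then consider "v = vA a" | "v = vB b" | "v = vC c" | "v = vD r a b c" by auto
    then show "- s * (1 + (3 / r - 3) * k1) * a * v $ 1 + - s * (1 + (3 / r - 3) * k2) * b * v $ 2 + - s * (1 + (3 / r - 3) * k3) * c * v $ 3 \<le> - s"
    proof cases
      case 1
      have "- s * (1 + (3 / r - 3) * k1) * a * a = - s * (1 + (3 / r - 3) * k1)" using sq by simp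
      then show ?thesis using 1 mult_nonneg_nonneg[OF s k(1)] by (simp add: v_nth algebra_simps)
    next
      case 2
      have "- s * (1 + (3 / r - 3) * k2) * b * b = - s * (1 + (3 / r - 3) * k2)" using sq by simp
      then show ?thesis using 2 mult_nonneg_nonneg[OF s k(2)] by (simp add: v_nth algebra_simps)
    next
      case 3
      have "- s * (1 + (3 / r - 3) * k3) * c * c = - s * (1 + (3 / r - 3) * k3)" using sq by simp
      then show ?thesis using 3 mult_nonneg_nonneg[OF s k(3)] by (simp add: v_nth algebra_simps)
    next
      case 4
      have "- s * (1 + (3 / r - 3) * k1) * a * (r / 3 * a) + - s * (1 + (3 / r - 3) * k2) * b * (r / 3 * b) + - s * (1 + (3 / r - 3) * k3) * c * (r / 3 * c)
         = - s * (1 + (3 / r - 3) * k1) * (a * (r / 3 * a)) + - s * (1 + (3 / r - 3) * k2) * (b * (r / 3 * b)) + - s * (1 + (3 / r - 3) * k3) * (c * (r / 3 * c))"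
        by (simp only: mult.assoc)
      also have "\<dots> = - s * (r / 3 + r / 3 + r / 3 + (3 / r - 3) * (r / 3) * (k1 + k2 + k3))"
        unfolding q[OF sq(1)] q[OF sq(2)] q[OF sq(3)] by (simp only: distrib_left distrib_right mult_1_right mult_1_left mult_ac add_ac)
      also have "\<dots> = - s" using t k(4) by simp
      finally show ?thesis using 4 by (simp only: v_nth order_refl)
    qed
  qed
  have "- s * (1 + (3 / r - 3) * 1) * a * x $ 1 + - s * (1 + (3 / r - 3) * 0) * b * x $ 2 + - s * (1 + (3 / r - 3) * 0) * c * x $ 3 \<le> - s"
    by (rule main) auto
  moreover have "- s * (1 + (3 / r - 3) * 0) * a * x $ 1 + - s * (1 + (3 / r - 3) * 1) * b * x $ 2 + - s * (1 + (3 / r - 3) * 0) * c * x $ 3 \<le> - s"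
    by (rule main) auto
  moreover have "- s * (1 + (3 / r - 3) * 0) * a * x $ 1 + - s * (1 + (3 / r - 3) * 0) * b * x $ 2 + - s * (1 + (3 / r - 3) * 1) * c * x $ 3 \<le> - s"
    by (rule main) auto
  ultimately show "s * (a * x $ 1 + b * x $ 2 + c * x $ 3 + (3 / r - 3) * (a * x $ 1)) \<ge> s \<and>
      s * (a * x $ 1 + b * x $ 2 + c * x $ 3 + (3 / r - 3) * (b * x $ 2)) \<ge> s \<and>
      s * (a * x $ 1 + b * x $ 2 + c * x $ 3 + (3 / r - 3) * (c * x $ 3)) \<ge> s"
    by (simp add: algebra_simps)
qed

lemma sign_abs: "a \<in> signs \<Longrightarrow> 0 \<le> a * t \<Longrightarrow> a * t = \<bar>t\<bar>"
  by (auto simp: signs_def)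

lemma min3_cases: "min u (min v w) = u \<or> min u (min v w) = v \<or> min u (min v w) = (w::real)"
  by (auto simp: min_def)

lemma NN_pyramid:
  assumes "r > 0" "x \<in> pyramids r"
  shows "r \<ge> 1 \<Longrightarrow> NN r x \<le> 1" "r < 1 \<Longrightarrow> NN r x \<ge> 1"
proof -
  obtain a b c where abc: "a \<in> signs" "b \<in> signs" "c \<in> signs" "x \<in> convex hull {vA a, vB b, vC c, vD r a b c}"
    using assms(2) by (auto simp: pyramids_def)
  note p = pyramid_halfspaces[OF abc(1-3) assms(1) abc(4)]
  have ab: "a * x $ 1 = \<bar>x $ 1\<bar>" "b * x $ 2 = \<bar>x $ 2\<bar>" "c * x $ 3 = \<bar>x $ 3\<bar>"
    using p(1) abc by (auto intro: sign_abs)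
  show "NN r x \<le> 1" if "r \<ge> 1"
  proof -
    have "(-1) * (3 / r - 3) \<ge> 0" using that by (simp add: field_simps)
    from p(2)[OF this] show ?thesis
      using min3_cases[of "\<bar>x $ 1\<bar>" "\<bar>x $ 2\<bar>" "\<bar>x $ 3\<bar>"] unfolding ab NN_def by auto
  qed
  show "NN r x \<ge> 1" if "r < 1"
  proof -
    have "1 * (3 / r - 3) \<ge> 0" using that assms(1) by (simp add: field_simps)
    from p(2)[OF this] show ?thesis
      using min3_cases[of "\<bar>x $ 1\<bar>" "\<bar>x $ 2\<bar>" "\<bar>x $ 3\<bar>"] unfolding ab NN_def by auto
  qed
qed

text \<open>\<open>u\<close> is the barycentric weight of the apex and the other weights are the
  differences in the hypotheses; the last hypothesis says that the four weights have sum 1.\<close>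

lemma pyramidI:
  assumes u: "u \<ge> 0" "\<bar>x $ 1\<bar> - r / 3 * u \<ge> 0" "\<bar>x $ 2\<bar> - r / 3 * u \<ge> 0" "\<bar>x $ 3\<bar> - r / 3 * u \<ge> 0"
    and s: "\<bar>x $ 1\<bar> + \<bar>x $ 2\<bar> + \<bar>x $ 3\<bar> + (1 - r) * u = 1"
  shows "x \<in> pyramids r"
proof -
  let ?a = "sn (x $ 1)" and ?b = "sn (x $ 2)" and ?c = "sn (x $ 3)"
  let ?H = "convex hull {vA ?a, vB ?b, vC ?c, vD r ?a ?b ?c}"
  have "(\<bar>x $ 1\<bar> - r / 3 * u) *\<^sub>R vA ?a + (\<bar>x $ 2\<bar> - r / 3 * u) *\<^sub>R vB ?b + (\<bar>x $ 3\<bar> - r / 3 * u) *\<^sub>R vC ?c + u *\<^sub>R vD r ?a ?b ?c \<in> ?H"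
    using u s by (intro convex_comb4 convex_convex_hull hull_inc) (auto simp: algebra_simps)
  moreover have "(\<bar>x $ 1\<bar> - r / 3 * u) *\<^sub>R vA ?a + (\<bar>x $ 2\<bar> - r / 3 * u) *\<^sub>R vB ?b + (\<bar>x $ 3\<bar> - r / 3 * u) *\<^sub>R vC ?c + u *\<^sub>R vD r ?a ?b ?c = x"
    using sn_abs[of "x $ 1"] sn_abs[of "x $ 2"] sn_abs[of "x $ 3"] by (simp add: vec3_eq_iff v_nth algebra_simps)
  ultimately have "x \<in> ?H" by simp
  then show ?thesis unfolding pyramids_def by (blast intro: sn_signs)
qed

lemma NN_scale: "c \<ge> 0 \<Longrightarrow> NN r (c *\<^sub>R x) = c * NN r x"
proof -
  assume c: "c \<ge> 0"
  have m: "min (c * u) (min (c * v) (c * w)) = c * min u (min v w)" for u v w :: real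
    using c by (simp add: min_mult_distrib_left)
  have "\<bar>(c *\<^sub>R x) $ i\<bar> = c * \<bar>x $ i\<bar>" for i using c by (simp add: abs_mult)
  then show ?thesis unfolding NN_def by (simp only: m distrib_left mult.left_commute)
qed

lemma min3_leD: "t \<le> min u (min v w) \<Longrightarrow> t \<le> u" "t \<le> min u (min v w) \<Longrightarrow> t \<le> v" "t \<le> min u (min v w) \<Longrightarrow> t \<le> (w::real)"
  by auto

lemma divide_leI: "a \<le> d * m \<Longrightarrow> 0 < d \<Longrightarrow> a / d \<le> (m::real)"
  by (simp add: pos_divide_le_eq mult.commute)

text \<open>\<open>NN\<close> compares with 1 in the same way for attached and excavated pyramids.
  For \<open>r < 1\<close> removing the closed pyramids leaves the strict sublevel set, and the
  closure restores equality.\<close>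

theorem solid_eq: assumes "r > 0" shows "solid r = {x. NN r x \<le> 1}"
proof (cases "r < 1")
  case False
  have k: "3 / r - 3 \<le> 0" using False assms by (simp add: field_simps)
  have "octahedron \<union> pyramids r = {x. NN r x \<le> 1}"
  proof (intro equalityI subsetI)
    fix x assume "x \<in> octahedron \<union> pyramids r"
    then show "x \<in> {x. NN r x \<le> 1}"
    proof
      assume x: "x \<in> octahedron"
      have "(3 / r - 3) * min \<bar>x $ 1\<bar> (min \<bar>x $ 2\<bar> \<bar>x $ 3\<bar>) \<le> 0" using k by (intro mult_nonpos_nonneg) auto
      then show ?thesis using x by (simp add: octahedron_eq NN_def)
    next
      assume "x \<in> pyramids r" then show ?thesis using NN_pyramid(1)[OF assms] False by simp
    qed
  next
    fix x assume "x \<in> {x. NN r x \<le> 1}"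
    then have N: "NN r x \<le> 1" by simp
    show "x \<in> octahedron \<union> pyramids r"
    proof (cases "\<bar>x $ 1\<bar> + \<bar>x $ 2\<bar> + \<bar>x $ 3\<bar> \<le> 1")
      case out: False
      have r1: "r > 1"
      proof (rule ccontr)
        assume "\<not> r > 1" then have "r = 1" using False by simp
        then show False using N out by (simp add: NN_def)
      qed
      let ?S = "\<bar>x $ 1\<bar> + \<bar>x $ 2\<bar> + \<bar>x $ 3\<bar>" and ?m = "min \<bar>x $ 1\<bar> (min \<bar>x $ 2\<bar> \<bar>x $ 3\<bar>)"
      \<comment> \<open>The apex weight forced by the condition that the barycentric weights have
        sum 1.\<close>
      let ?u = "(?S - 1) / (r - 1)"
      have "r / 3 * ?u \<le> ?m"
      proof -
        have "?S - 1 \<le> (3 - 3 / r) * ?m" using N by (simp add: NN_def algebra_simps)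
        then have "r / 3 * (?S - 1) \<le> r / 3 * ((3 - 3 / r) * ?m)" using assms by (intro mult_left_mono) auto
        also have "\<dots> = (r - 1) * ?m" using assms by (simp add: field_simps)
        finally have "r / 3 * (?S - 1) / (r - 1) \<le> ?m" using r1 by (intro divide_leI) simp_all
        then show ?thesis by (simp only: times_divide_eq_right)
      qed
      from min3_leD[OF this] have p: "\<bar>x $ 1\<bar> - r / 3 * ?u \<ge> 0" "\<bar>x $ 2\<bar> - r / 3 * ?u \<ge> 0" "\<bar>x $ 3\<bar> - r / 3 * ?u \<ge> 0"
        by (simp_all only: diff_ge_0_iff_ge)
      have "(1 - r) * ?u = - ((r - 1) * ?u)" by (simp only: minus_mult_left minus_diff_eq)
      also have "(r - 1) * ?u = ?S - 1" using r1 by simp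
      finally have s: "?S + (1 - r) * ?u = 1" by simp
      have u: "?u \<ge> 0" using r1 out by simp
      from pyramidI[OF u p s] have "x \<in> pyramids r" .
      then show ?thesis by simp
    qed (simp add: octahedron_eq)
  qed
  then show ?thesis using False by (simp add: solid_def)
next
  case True
  have k: "3 / r - 3 > 0" using True assms by (simp add: field_simps)
  have mnn: "(3 / r - 3) * min \<bar>x $ 1\<bar> (min \<bar>x $ 2\<bar> \<bar>x $ 3\<bar>) \<ge> 0" for x :: "real^3"
    using k by (intro mult_nonneg_nonneg) auto
  have "octahedron - pyramids r = {x. NN r x < 1}"
  proof (intro equalityI subsetI)
    fix x assume x: "x \<in> octahedron - pyramids r"
    show "x \<in> {x. NN r x < 1}"
    proof (rule ccontr)
      assume "x \<notin> {x. NN r x < 1}"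
      then have N: "NN r x \<ge> 1" by simp
      let ?S = "\<bar>x $ 1\<bar> + \<bar>x $ 2\<bar> + \<bar>x $ 3\<bar>" and ?m = "min \<bar>x $ 1\<bar> (min \<bar>x $ 2\<bar> \<bar>x $ 3\<bar>)"
      have S: "?S \<le> 1" using x by (simp add: octahedron_eq)
      let ?u = "(1 - ?S) / (1 - r)"
      have "r / 3 * ?u \<le> ?m"
      proof -
        have "1 - ?S \<le> (3 / r - 3) * ?m" using N by (simp add: NN_def algebra_simps)
        then have "r / 3 * (1 - ?S) \<le> r / 3 * ((3 / r - 3) * ?m)" using assms by (intro mult_left_mono) auto
        also have "\<dots> = (1 - r) * ?m" using assms by (simp add: field_simps)
        finally have "r / 3 * (1 - ?S) / (1 - r) \<le> ?m" using True by (intro divide_leI) simp_all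
        then show ?thesis by (simp only: times_divide_eq_right)
      qed
      from min3_leD[OF this] have p: "\<bar>x $ 1\<bar> - r / 3 * ?u \<ge> 0" "\<bar>x $ 2\<bar> - r / 3 * ?u \<ge> 0" "\<bar>x $ 3\<bar> - r / 3 * ?u \<ge> 0"
        by (simp_all only: diff_ge_0_iff_ge)
      have "(1 - r) * ?u = 1 - ?S" using True by simp
      then have s: "?S + (1 - r) * ?u = 1" by simp
      have u: "?u \<ge> 0" using True S by simp
      from pyramidI[OF u p s] have "x \<in> pyramids r" .
      then show False using x by simp
    qed
  next
    fix x assume "x \<in> {x. NN r x < 1}"
    then have N: "NN r x < 1" by simp
    then show "x \<in> octahedron - pyramids r"
      using mnn[of x] NN_pyramid(2)[OF assms, of x] True by (auto simp: octahedron_eq NN_def)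
  qed
  moreover have "closure {x. NN r x < 1} = {x. NN r x \<le> 1}"
  proof
    have "closed {x. NN r x \<le> 1}" using continuous_on_NN by (intro closed_Collect_le) auto
    then show "closure {x. NN r x < 1} \<subseteq> {x. NN r x \<le> 1}" by (intro closure_minimal) auto
    show "{x. NN r x \<le> 1} \<subseteq> closure {x. NN r x < 1}"
    proof
      fix x assume x: "x \<in> {x. NN r x \<le> 1}"
      \<comment> \<open>A point with \<open>NN\<close> at most 1 is approached along its ray:
        \<open>NN\<close> is positively homogeneous and, here, nonnegative.\<close>
      have "(\<lambda>n. (1 - 1 / real (Suc n)) *\<^sub>R x) \<longlonglongrightarrow> (1 - 0) *\<^sub>R x"
        by (intro tendsto_intros LIMSEQ_Suc[OF lim_1_over_n])
      moreover have "(1 - 1 / real (Suc n)) *\<^sub>R x \<in> {x. NN r x < 1}" for n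
      proof -
        have "NN r x \<ge> 0" using mnn[of x] by (simp add: NN_def)
        then have "(1 - 1 / real (Suc n)) * NN r x \<le> (1 - 1 / real (Suc n)) * 1" using x by (intro mult_left_mono) auto
        also have "\<dots> < 1" by simp
        finally show ?thesis by (simp add: NN_scale)
      qed
      ultimately show "x \<in> closure {x. NN r x < 1}" unfolding closure_sequential by (intro exI conjI) auto
    qed
  qed
  ultimately show ?thesis using True by (simp add: solid_def)
qed

lemma compact_solid: assumes "r > 0" shows "compact (solid r)"
proof -
  have "closed (solid r)" unfolding solid_eq[OF assms] using continuous_on_NN by (intro closed_Collect_le) auto
  moreover have "bounded (solid r)"
  proof (rule bounded_of_coords[of _ "max 1 r"])
    fix x i assume "x \<in> solid r"
    then have N: "NN r x \<le> 1" by (simp add: solid_eq[OF assms])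
    define S where "S = \<bar>x $ 1\<bar> + \<bar>x $ 2\<bar> + \<bar>x $ 3\<bar>"
    define m where "m = min \<bar>x $ 1\<bar> (min \<bar>x $ 2\<bar> \<bar>x $ 3\<bar>)"
    \<comment> \<open>The minimum of three numbers is at most their mean, which bounds the negative
      term of \<open>NN\<close> for \<open>r\<close> at least 1.\<close>
    have m: "0 \<le> m" "m \<le> S / 3" unfolding m_def S_def by auto
    have N': "S + (3 / r - 3) * m \<le> 1" using N by (simp add: NN_def S_def m_def)
    have "S \<le> max 1 r"
    proof (cases "r \<ge> 1")
      case True
      then have "(3 / r - 3) * (S / 3) \<le> (3 / r - 3) * m" using assms m by (intro mult_left_mono_neg) (auto simp: field_simps)
      moreover have "(3 / r - 3) * (S / 3) = S / r - S" by (simp add: algebra_simps)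
      ultimately have "S / r \<le> 1" using N' by linarith
      then show ?thesis using assms by (simp add: field_simps)
    next
      case False
      then have "(3 / r - 3) * m \<ge> 0" using assms m by (intro mult_nonneg_nonneg) (auto simp: field_simps)
      then show ?thesis using N' by simp
    qed
    then show "\<bar>x $ i\<bar> \<le> max 1 r" using exhaust_3[of i] unfolding S_def by auto
  qed
  ultimately show ?thesis by (simp add: compact_eq_bounded_closed)
qed

section \<open>Moments of the solid\<close>

definition triple_vec :: "real \<times> real \<times> real \<Rightarrow> real^3" where
  "triple_vec p = fst p *\<^sub>R axis 1 1 + fst (snd p) *\<^sub>R axis 2 1 + snd (snd p) *\<^sub>R axis 3 1"

lemma triple_vec_nth [simp]: "triple_vec p $ 1 = fst p" "triple_vec p $ 2 = fst (snd p)" "triple_vec p $ 3 = snd (snd p)"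
  by (simp_all add: triple_vec_def axis_def)

lemma measurable_triple_vec: "triple_vec \<in> borel_measurable lborel"
proof -
  have "continuous_on UNIV triple_vec" unfolding triple_vec_def by (intro continuous_intros)
  then show ?thesis by (simp add: borel_measurable_continuous_onI)
qed

lemma Basis_real3: "(Basis :: (real^3) set) = range (\<lambda>i. axis i 1)"
  by (auto simp: Basis_vec_def)

lemma lborel_Times:
  fixes A :: "'a::euclidean_space set" and B :: "'b::euclidean_space set"
  assumes "A \<in> sets borel" "B \<in> sets borel"
  shows "emeasure lborel (A \<times> B) = emeasure lborel A * emeasure lborel B"
  unfolding lborel_prod[symmetric] using assms by (intro lborel.emeasure_pair_measure_Times) auto

text \<open>Lebesgue measure is characterised by its values on boxes. The identification with a
  product of lines makes Fubini available in space.\<close>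

lemma lborel_triple_vec: "lborel = distr lborel borel triple_vec"
proof (rule lborel_eqI)
  fix l u :: "real^3" assume lu: "\<And>b. b \<in> Basis \<Longrightarrow> l \<bullet> b \<le> u \<bullet> b"
  have le: "l $ i \<le> u $ i" for i using lu[of "axis i 1"] by (simp add: Basis_real3 inner_axis)
  have "triple_vec -` box l u = {l $ 1<..<u $ 1} \<times> {l $ 2<..<u $ 2} \<times> {l $ 3<..<u $ 3}"
    by (auto simp: mem_box_cart forall_3)
  then have "emeasure (distr lborel borel triple_vec) (box l u) = emeasure lborel ({l $ 1<..<u $ 1} \<times> {l $ 2<..<u $ 2} \<times> {l $ 3<..<u $ 3})"
    using measurable_triple_vec by (simp add: emeasure_distr)
  also have "\<dots> = ennreal (u $ 1 - l $ 1) * (ennreal (u $ 2 - l $ 2) * ennreal (u $ 3 - l $ 3))"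
    by (simp add: lborel_Times borel_open open_Times le)
  also have "\<dots> = ennreal ((u $ 1 - l $ 1) * ((u $ 2 - l $ 2) * (u $ 3 - l $ 3)))"
    using le by (simp add: ennreal_mult)
  also have "(u $ 1 - l $ 1) * ((u $ 2 - l $ 2) * (u $ 3 - l $ 3)) = (\<Prod>i\<in>UNIV. u $ i - l $ i)"
    by (simp add: prod_UNIV_3 mult_ac)
  also have "\<dots> = (\<Prod>b\<in>Basis. (u - l) \<bullet> b)"
    unfolding Basis_real3 by (subst prod.reindex) (auto simp: inj_on_def axis_eq_axis inner_axis)
  finally show "emeasure (distr lborel borel triple_vec) (box l u) = ennreal (\<Prod>b\<in>Basis. (u - l) \<bullet> b)" .
qed simp

definition T3 :: "(real^3) set" where
  "T3 = {y. 0 \<le> y $ 1 \<and> 0 \<le> y $ 2 \<and> 0 \<le> y $ 3 \<and> y $ 1 + y $ 2 + y $ 3 \<le> 1}"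

lemma compact_T3: "compact T3"
proof -
  have "closed T3" unfolding T3_def by (intro closed_Collect_conj closed_Collect_le continuous_intros)
  moreover have "bounded T3"
  proof (rule bounded_of_coords[of _ 1])
    fix x i assume "x \<in> T3" then show "\<bar>x $ i\<bar> \<le> 1" using exhaust_3[of i] by (auto simp: T3_def)
  qed
  ultimately show ?thesis by (simp add: compact_eq_bounded_closed)
qed

text \<open>Integrating out the first coordinate leaves the triangle integral with exponent
  \<open>Suc m\<close>; the factor 1/(m + 1) cancels against its factorial.\<close>

lemma dirichlet_T3:
  "(LINT y:T3|lborel. y $ 1 ^ m * y $ 2 ^ n * y $ 3 ^ l) = fact m * fact n * fact l / fact (m + n + l + 3)"
proof -
  define f where "f y = indicat_real T3 y *\<^sub>R (y $ 1 ^ m * y $ 2 ^ n * y $ 3 ^ l)" for y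
  have f: "integrable lborel f"
    unfolding f_def by (intro borel_integrable_compact compact_T3 continuous_intros)
  have fm: "f \<in> borel_measurable borel" using borel_measurable_integrable[OF f] by simp
  have "integrable (distr lborel borel triple_vec) f" using f by (simp add: lborel_triple_vec[symmetric])
  then have "integrable lborel (\<lambda>p. f (triple_vec p))"
    using integrable_distr_eq[of triple_vec lborel borel f] measurable_triple_vec fm by simp
  then have I: "integrable (lborel \<Otimes>\<^sub>M lborel) (\<lambda>(p, st). f (triple_vec (p, st)))"
    by (simp add: lborel_prod split_def)
  have "(LINT y:T3|lborel. y $ 1 ^ m * y $ 2 ^ n * y $ 3 ^ l) = integral\<^sup>L lborel f"
    by (simp add: set_lebesgue_integral_def f_def[abs_def])
  also have "\<dots> = integral\<^sup>L (distr lborel borel triple_vec) f" by (simp add: lborel_triple_vec[symmetric])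
  also have "\<dots> = (LINT p|lborel. f (triple_vec p))"
    using measurable_triple_vec fm by (intro integral_distr) auto
  also have "\<dots> = (LINT x|(lborel \<Otimes>\<^sub>M lborel). (case x of (p, st) \<Rightarrow> f (triple_vec (p, st))))"
    by (simp add: lborel_prod split_def)
  also have "\<dots> = (LINT st|lborel. (LINT p|lborel. f (triple_vec (p, st))))"
    by (rule lborel_pair.integral_snd[OF I, symmetric])
  also have "\<dots> = (LINT st|lborel. bt 0 m * (indicat_real Tri st *\<^sub>R ((1 - fst st - snd st) ^ Suc m * fst st ^ n * snd st ^ l)))"
  proof (rule Bochner_Integration.integral_cong[OF refl])
    fix st :: "real \<times> real"
    let ?u = "1 - fst st - snd st"
    show "(LINT p|lborel. f (triple_vec (p, st))) = bt 0 m * (indicat_real Tri st *\<^sub>R (?u ^ Suc m * fst st ^ n * snd st ^ l))"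
    proof (cases "st \<in> Tri")
      case True
      then have u: "?u \<ge> 0" "0 \<le> fst st" "0 \<le> snd st" by (auto simp: Tri_def)
      have "(LINT p|lborel. f (triple_vec (p, st))) = (LINT p|lborel. (fst st ^ n * snd st ^ l) * (indicat_real {0..?u} p *\<^sub>R p ^ m))"
        using u by (intro Bochner_Integration.integral_cong refl) (auto simp: f_def T3_def indicator_def)
      also have "\<dots> = (fst st ^ n * snd st ^ l) * (LINT p:{0..?u}|lborel. p ^ m)"
        by (simp add: set_lebesgue_integral_def)
      also have "(LINT p:{0..?u}|lborel. p ^ m) = bt 0 m * ?u ^ Suc m"
        using beta_has_integral[OF u(1), of 0 m] by (intro set_lint_eq_has_integral continuous_intros) auto
      finally show ?thesis using True by simp
    next
      case False
      then have "f (triple_vec (p, st)) = 0" for p by (auto simp: f_def T3_def indicator_def Tri_def split_def)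
      then show ?thesis using False by simp
    qed
  qed
  also have "\<dots> = bt 0 m * (LINT x:Tri|lborel. (1 - fst x - snd x) ^ Suc m * fst x ^ n * snd x ^ l)"
    by (simp add: set_lebesgue_integral_def)
  also have "\<dots> = fact m / fact (Suc m) * (fact (Suc m) * fact n * fact l / fact (Suc m + n + l + 2))"
    unfolding dirichlet_Tri by (simp add: bt_def)
  also have "\<dots> = fact m * fact n * fact l / fact (Suc m + n + l + 2)"
  proof -
    have "a / c * (c * x * y / d) = a * x * y / d" if "c \<noteq> 0" for a c x y d :: real using that by simp
    then show ?thesis using fact_nonzero by blast
  qed
  also have "Suc m + n + l + 2 = m + n + l + 3" by simp
  finally show ?thesis .
qed

lemma simplex_moment:
  "(LINT y:T3|lborel. (y $ 1 + q * y $ 3) ^ i * (y $ 2 + q * y $ 3) ^ j * (q * y $ 3) ^ k) = Dm 3 q i j k"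
proof -
  have "(LINT x:T3|lborel. (x $ 1 + q * x $ 3) ^ i * (x $ 2 + q * x $ 3) ^ j * (q * x $ 3) ^ k)
     = (\<Sum>y\<in>{..i} \<times> {..j}. (real (i choose fst y) * real (j choose snd y) * q ^ (fst y + snd y + k)) *
       (LINT x:T3|lborel. x $ 1 ^ (i - fst y) * x $ 2 ^ (j - snd y) * x $ 3 ^ (fst y + snd y + k)))"
    unfolding triangle_expansion by (rule set_lint_lin_comb) (auto intro!: compact_T3 continuous_intros)
  also have "\<dots> = (\<Sum>x\<in>{..i} \<times> {..j}. (real (i choose fst x) * real (j choose snd x) * q ^ (fst x + snd x + k)) *
     (fact (i - fst x) * fact (j - snd x) * fact (fst x + snd x + k) / fact (i + j + k + 3)))"
  proof (intro sum.cong refl arg_cong2[where f = "(*)"])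
    fix y assume "y \<in> {..i} \<times> {..j}"
    then have "i - fst y + (j - snd y) + (fst y + snd y + k) + 3 = i + j + k + 3" by auto
    then show "(LINT x:T3|lborel. x $ 1 ^ (i - fst y) * x $ 2 ^ (j - snd y) * x $ 3 ^ (fst y + snd y + k))
      = fact (i - fst y) * fact (j - snd y) * fact (fst y + snd y + k) / fact (i + j + k + 3)"
      by (simp only: dirichlet_T3)
  qed
  also have "\<dots> = Dm 3 q i j k" by (rule Dm_alt)
  finally show ?thesis .
qed

lemma integral_linear_image:
  fixes M :: "real^3^3" and f :: "real^3 \<Rightarrow> real"
  assumes S: "compact S" and f: "continuous_on UNIV f"
  shows "integral ((\<lambda>y. M *v y) ` S) f = \<bar>det M\<bar> * (LINT y:S|lborel. f (M *v y))"
proof -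
  let ?g = "\<lambda>y. M *v y"
  \<comment> \<open>The change of variables rule is applied to integrands with vector values, so
    \<open>f\<close> is viewed as a map to \<open>real^1\<close>.\<close>
  define F where "F x = (\<chi> i. f x :: real^1)" for x
  have F: "continuous_on UNIV F" unfolding F_def by (intro continuous_on_vec_lambda f)
  have g: "continuous_on UNIV ?g" by (intro linear_continuous_on matrix_vector_mul_bounded_linear)
  have cF: "continuous_on S (F \<circ> ?g)" by (intro continuous_on_compose continuous_on_subset[OF F] continuous_on_subset[OF g]) auto
  have cf: "continuous_on S (f \<circ> ?g)" by (intro continuous_on_compose continuous_on_subset[OF f] continuous_on_subset[OF g]) auto
  have cFi: "continuous_on (?g ` S) F" by (intro continuous_on_subset[OF F]) auto
  have gS: "compact (?g ` S)" by (intro compact_continuous_image S continuous_on_subset[OF g]) auto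
  have int: "set_integrable lborel A h" if "compact A" "continuous_on A h" for A and h :: "real^3 \<Rightarrow> 'b::euclidean_space"
    unfolding set_integrable_def by (intro borel_integrable_compact that)
  have "integrable lborel (\<lambda>x. indicat_real S x *\<^sub>R (F \<circ> ?g) x)" using int[OF S cF] by (simp add: set_integrable_def)
  then have "(F \<circ> ?g) absolutely_integrable_on S"
    unfolding set_integrable_def by (subst integrable_completion) (auto intro: borel_measurable_integrable)
  then have "integral (?g ` S) F = \<bar>det (matrix ?g)\<bar> *\<^sub>R integral S (F \<circ> ?g)"
    by (intro integral_change_of_variables_linear) auto
  then have "integral (?g ` S) F $ 1 = \<bar>det M\<bar> * integral S (F \<circ> ?g) $ 1" by simp
  moreover have "integral (?g ` S) F $ 1 = integral (?g ` S) f"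
    using integral_component_eq_cart[OF set_borel_integral_eq_integral(1)[OF int[OF gS cFi]], of 1] by (simp add: F_def)
  moreover have "integral S (F \<circ> ?g) $ 1 = integral S (f \<circ> ?g)"
    using integral_component_eq_cart[OF set_borel_integral_eq_integral(1)[OF int[OF S cF]], of 1] by (simp add: F_def o_def)
  moreover have "(LINT y:S|lborel. (f \<circ> ?g) y) = integral S (f \<circ> ?g)"
    by (rule set_borel_integral_eq_integral(2)[OF int[OF S cf]])
  ultimately show ?thesis by (simp add: o_def)
qed

definition sgnvecs :: "(real^3) set" where "sgnvecs = {e. \<forall>i. e $ i \<in> signs}"

text \<open>The cone from the origin over one face: \<open>e\<close> is the octant and
  \<open>m\<close> the coordinate that is smallest in absolute value there, so the octahedral edge
  of the face joins the other two axes.\<close>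

definition tet :: "real \<Rightarrow> real^3 \<Rightarrow> 3 \<Rightarrow> (real^3) set" where
  "tet q e m = {x. 0 \<le> e $ m * x $ m \<and> (\<forall>j. e $ m * x $ m \<le> e $ j * x $ j) \<and>
     e $ 1 * x $ 1 + e $ 2 * x $ 2 + e $ 3 * x $ 3 - 3 * (e $ m * x $ m) + e $ m * x $ m / q \<le> 1}"

text \<open>The columns are the two octahedral vertices of the face and its apex, hence the image of
  \<open>T3\<close> is the cone \<open>tet\<close>.\<close>

definition tmat :: "real \<Rightarrow> real^3 \<Rightarrow> 3 \<Rightarrow> real^3^3" where
  "tmat q e m = (if m = 1 then vector [vector [0, 0, q * e $ 1], vector [e $ 2, 0, q * e $ 2], vector [0, e $ 3, q * e $ 3]]
     else if m = 2 then vector [vector [e $ 1, 0, q * e $ 1], vector [0, 0, q * e $ 2], vector [0, e $ 3, q * e $ 3]]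
     else vector [vector [e $ 1, 0, q * e $ 1], vector [0, e $ 2, q * e $ 2], vector [0, 0, q * e $ 3]])"

lemma tmat_mult:
  "(tmat q e 1 *v y) $ 1 = e $ 1 * (q * y $ 3)" "(tmat q e 1 *v y) $ 2 = e $ 2 * (y $ 1 + q * y $ 3)" "(tmat q e 1 *v y) $ 3 = e $ 3 * (y $ 2 + q * y $ 3)"
  "(tmat q e 2 *v y) $ 1 = e $ 1 * (y $ 1 + q * y $ 3)" "(tmat q e 2 *v y) $ 2 = e $ 2 * (q * y $ 3)" "(tmat q e 2 *v y) $ 3 = e $ 3 * (y $ 2 + q * y $ 3)"
  "(tmat q e 3 *v y) $ 1 = e $ 1 * (y $ 1 + q * y $ 3)" "(tmat q e 3 *v y) $ 2 = e $ 2 * (y $ 2 + q * y $ 3)" "(tmat q e 3 *v y) $ 3 = e $ 3 * (q * y $ 3)"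
  by (simp_all add: tmat_def matrix_vector_mult_def sum_3 vector_3 algebra_simps)

lemma sgnvecs_sq:
  assumes "e \<in> sgnvecs" shows "e $ i * (e $ i * z) = z" "e $ i * z * e $ i = z"
proof -
  have "e $ i * e $ i = 1" using assms by (intro signs_mult_self) (simp add: sgnvecs_def)
  moreover have "e $ i * (e $ i * z) = (e $ i * e $ i) * z" "e $ i * z * e $ i = (e $ i * e $ i) * z" by (simp_all only: mult_ac)
  ultimately show "e $ i * (e $ i * z) = z" "e $ i * z * e $ i = z" by simp_all
qed

lemma det_tmat:
  assumes "e \<in> sgnvecs" "q > 0" shows "\<bar>det (tmat q e m)\<bar> = q"
proof -
  have a: "\<bar>e $ i\<bar> = 1" for i using assms(1) by (auto simp: sgnvecs_def signs_def dest!: spec[of _ i])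
  show ?thesis using exhaust_3[of m] assms(2)
    by (elim disjE) (simp_all add: det_3 tmat_def vector_3 abs_mult a)
qed

lemma image_eqI2:
  assumes "\<And>y. y \<in> T \<Longrightarrow> g y \<in> A" "\<And>x. x \<in> A \<Longrightarrow> h x \<in> T" "\<And>x. x \<in> A \<Longrightarrow> g (h x) = x"
  shows "A = g ` T"
  using assms by force

lemma tet_image:
  assumes e: "e \<in> sgnvecs" and q: "q > 0"
  shows "tet q e m = (\<lambda>y. tmat q e m *v y) ` T3"
proof (rule image_eqI2)
  note sq = sgnvecs_sq[OF e]
  show "tmat q e m *v y \<in> tet q e m" if y: "y \<in> T3" for y
  proof -
    have "q * y $ 3 \<ge> 0" "q * y $ 3 / q = y $ 3" using y q by (auto simp: T3_def)
    then show ?thesis using y exhaust_3[of m]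
      by (elim disjE) (auto simp: tet_def T3_def forall_3 tmat_mult sq)
  qed
  let ?z = "\<lambda>x. e $ m * x $ m"
  \<comment> \<open>The inverse map: the smallest coordinate over q is the weight of the apex, and
    subtracting it from the other two leaves their weights.\<close>
  let ?h = "\<lambda>x. if m = 1 then triple_vec (e $ 2 * x $ 2 - ?z x, e $ 3 * x $ 3 - ?z x, ?z x / q)
     else if m = 2 then triple_vec (e $ 1 * x $ 1 - ?z x, e $ 3 * x $ 3 - ?z x, ?z x / q)
     else triple_vec (e $ 1 * x $ 1 - ?z x, e $ 2 * x $ 2 - ?z x, ?z x / q)"
  show "?h x \<in> T3" if x: "x \<in> tet q e m" for x
  proof -
    have "?z x / q \<ge> 0" using x q by (simp add: tet_def)
    then show ?thesis using x exhaust_3[of m]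
      by (elim disjE) (auto simp: tet_def T3_def forall_3 mult.commute)
  qed
  show "tmat q e m *v ?h x = x" if "x \<in> tet q e m" for x
  proof -
    have c: "q * (z / q) = z" for z using q by simp
    show ?thesis using exhaust_3[of m]
      by (elim disjE) (simp_all add: vec3_eq_iff tmat_mult c sq del: times_divide_eq_right)
  qed
qed

lemma tet_moment:
  assumes e: "e \<in> sgnvecs" and q: "q > 0"
  shows "((\<lambda>y. y $ 1 ^ i * y $ 2 ^ j * y $ 3 ^ k) has_integral e $ 1 ^ i * e $ 2 ^ j * e $ 3 ^ k *
    (q * (if m = 1 then Dm 3 q j k i else if m = 2 then Dm 3 q i k j else Dm 3 q i j k))) (tet q e m)"
proof -
  let ?Y = "\<lambda>y::real^3. y $ 1 ^ i * y $ 2 ^ j * y $ 3 ^ k"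
  have Y: "continuous_on X ?Y" for X by (intro continuous_intros)
  let ?g = "\<lambda>y. tmat q e m *v y"
  have g: "continuous_on UNIV ?g" by (intro linear_continuous_on matrix_vector_mul_bounded_linear)
  have "compact (?g ` T3)" by (intro compact_continuous_image compact_T3 continuous_on_subset[OF g]) auto
  then have "compact (tet q e m)" by (simp add: tet_image[OF assms])
  then have "set_integrable lborel (tet q e m) ?Y"
    unfolding set_integrable_def by (intro borel_integrable_compact Y)
  then have int: "?Y integrable_on tet q e m" by (rule set_borel_integral_eq_integral(1))
  let ?K = "e $ 1 ^ i * e $ 2 ^ j * e $ 3 ^ k"
  have "(LINT y:T3|lborel. ?Y (?g y)) = ?K * (if m = 1 then Dm 3 q j k i else if m = 2 then Dm 3 q i k j else Dm 3 q i j k)"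
  proof -
    consider "m = 1" | "m = 2" | "m = 3" using exhaust_3 by blast
    then show ?thesis
    proof cases
      case 1
      have "?Y (?g y) = ?K * ((y $ 1 + q * y $ 3) ^ j * (y $ 2 + q * y $ 3) ^ k * (q * y $ 3) ^ i)" for y
        unfolding 1 tmat_mult power_mult_distrib by (simp add: mult_ac)
      then show ?thesis using 1 simplex_moment[of q j k i] by (simp add: set_lebesgue_integral_def mult.left_commute[of _ ?K])
    next
      case 2
      have "?Y (?g y) = ?K * ((y $ 1 + q * y $ 3) ^ i * (y $ 2 + q * y $ 3) ^ k * (q * y $ 3) ^ j)" for y
        unfolding 2 tmat_mult power_mult_distrib by (simp add: mult_ac)
      then show ?thesis using 2 simplex_moment[of q i k j] by (simp add: set_lebesgue_integral_def mult.left_commute[of _ ?K])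
    next
      case 3
      have "?Y (?g y) = ?K * ((y $ 1 + q * y $ 3) ^ i * (y $ 2 + q * y $ 3) ^ j * (q * y $ 3) ^ k)" for y
        unfolding 3 tmat_mult power_mult_distrib by (simp add: mult_ac)
      then show ?thesis using 3 simplex_moment[of q i j k] by (simp add: set_lebesgue_integral_def mult.left_commute[of _ ?K])
    qed
  qed
  then have "integral (tet q e m) ?Y = ?K * (q * (if m = 1 then Dm 3 q j k i else if m = 2 then Dm 3 q i k j else Dm 3 q i j k))"
    using integral_linear_image[OF compact_T3 Y, of "tmat q e m"] by (simp add: tet_image[OF assms, symmetric] det_tmat[OF assms] mult_ac)
  then show ?thesis using integrable_integral[OF int] by simp
qed

text \<open>Cones in different octants meet in a coordinate plane. Cones in one octant meet where
  two signed coordinates agree.\<close>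

lemma tet_negligible:
  assumes "e \<in> sgnvecs" "e' \<in> sgnvecs" "(e, m) \<noteq> (e', m')"
  shows "negligible (tet q e m \<inter> tet q e' m')"
proof (cases "e = e'")
  case False
  then obtain l where l: "e $ l \<noteq> e' $ l" by (auto simp: vec_eq_iff)
  have s: "e $ l \<in> signs" "e' $ l \<in> signs" using assms by (auto simp: sgnvecs_def)
  have "tet q e m \<inter> tet q e' m' \<subseteq> {x. axis l 1 \<bullet> x = 0}"
  proof
    fix x assume "x \<in> tet q e m \<inter> tet q e' m'"
    then have "0 \<le> e $ l * x $ l" "0 \<le> e' $ l * x $ l" unfolding tet_def by (auto intro: order_trans)
    then have "x $ l = 0" using s l by (auto simp: signs_def)
    then show "x \<in> {x. axis l 1 \<bullet> x = 0}" by (simp add: inner_axis')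
  qed
  moreover have "negligible {x::real^3. axis l 1 \<bullet> x = 0}" by (rule negligible_hyperplane) (simp add: axis_eq_0_iff)
  ultimately show ?thesis by (rule negligible_subset[rotated])
next
  case True
  then have m: "m \<noteq> m'" using assms by simp
  let ?v = "axis m (e $ m) - axis m' (e $ m') :: real^3"
  have "e $ m \<noteq> 0" using assms(1) by (auto simp: sgnvecs_def signs_nz)
  then have "?v $ m \<noteq> 0" using m by (simp add: axis_def)
  then have "?v \<noteq> 0" by (metis zero_index)
  moreover have "tet q e m \<inter> tet q e' m' \<subseteq> {x. ?v \<bullet> x = 0}"
    using True by (auto simp: tet_def inner_diff_left inner_axis' intro: order_antisym)
  ultimately show ?thesis using negligible_hyperplane[of ?v 0] negligible_subset by blast
qed

text \<open>Cones from the origin over the 24 faces decompose the solid in the same way for attached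
  and excavated pyramids.\<close>

lemma solid_tets:
  assumes "r > 0"
  shows "solid r = (\<Union>p\<in>sgnvecs \<times> UNIV. tet (r / 3) (fst p) (snd p))"
proof (intro equalityI subsetI)
  fix x assume "x \<in> solid r"
  then have N: "NN r x \<le> 1" by (simp add: solid_eq[OF assms])
  define e where "e = (\<chi> i. sn (x $ i))"
  have e: "e \<in> sgnvecs" by (simp add: e_def sgnvecs_def)
  have ab: "e $ i * x $ i = \<bar>x $ i\<bar>" for i by (simp add: e_def sn_def)
  let ?m = "min \<bar>x $ 1\<bar> (min \<bar>x $ 2\<bar> \<bar>x $ 3\<bar>)"
  obtain m where m: "\<bar>x $ m\<bar> = ?m" using min3_cases[of "\<bar>x $ 1\<bar>" "\<bar>x $ 2\<bar>" "\<bar>x $ 3\<bar>"] by metis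
  have "x \<in> tet (r / 3) e m"
    unfolding tet_def ab mem_Collect_eq m
  proof (intro conjI allI)
    show "?m \<le> \<bar>x $ j\<bar>" for j using exhaust_3[of j] by (auto simp: min.coboundedI2)
  qed (use N in \<open>auto simp: NN_def algebra_simps\<close>)
  then show "x \<in> (\<Union>p\<in>sgnvecs \<times> UNIV. tet (r / 3) (fst p) (snd p))" using e by force
next
  fix x assume "x \<in> (\<Union>p\<in>sgnvecs \<times> UNIV. tet (r / 3) (fst p) (snd p))"
  then obtain e m where e: "e \<in> sgnvecs" and x: "x \<in> tet (r / 3) e m" by auto
  have ab: "e $ i * x $ i = \<bar>x $ i\<bar>" for i
    using e x by (intro sign_abs) (auto simp: sgnvecs_def tet_def intro: order_trans)
  have le: "\<bar>x $ m\<bar> \<le> \<bar>x $ j\<bar>" for j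
  proof -
    have "e $ m * x $ m \<le> e $ j * x $ j" using x by (simp add: tet_def)
    then show ?thesis by (simp only: ab)
  qed
  have "min \<bar>x $ 1\<bar> (min \<bar>x $ 2\<bar> \<bar>x $ 3\<bar>) = \<bar>x $ m\<bar>"
    using le[of 1] le[of 2] le[of 3] exhaust_3[of m] by (auto simp: min_def)
  moreover have "e $ 1 * x $ 1 + e $ 2 * x $ 2 + e $ 3 * x $ 3 - 3 * (e $ m * x $ m) + e $ m * x $ m / (r / 3) \<le> 1"
    using x unfolding tet_def by blast
  ultimately have "NN r x \<le> 1" unfolding ab NN_def by (simp add: algebra_simps)
  then show "x \<in> solid r" by (simp add: solid_eq[OF assms])
qed

lemma sgnvecs_image: "sgnvecs = (\<lambda>(a, b, c). vector [a, b, c]) ` (signs \<times> signs \<times> signs)"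
proof (intro equalityI subsetI)
  fix e assume "e \<in> sgnvecs"
  then have "(e $ 1, e $ 2, e $ 3) \<in> signs \<times> signs \<times> signs" by (simp add: sgnvecs_def)
  moreover have "e = (\<lambda>(a, b, c). vector [a, b, c]) (e $ 1, e $ 2, e $ 3)" by (simp add: vec3_eq_iff vector_3)
  ultimately show "e \<in> (\<lambda>(a, b, c). vector [a, b, c]) ` (signs \<times> signs \<times> signs)" by (rule rev_image_eqI)
qed (auto simp: sgnvecs_def forall_3 vector_3)

lemma sum_sgnvecs: "(\<Sum>e\<in>sgnvecs. f (e $ 1) (e $ 2) (e $ 3)) = (\<Sum>a\<in>signs. \<Sum>b\<in>signs. \<Sum>c\<in>signs. f a b c :: real)"
proof -
  have "inj_on (\<lambda>(a, b, c). vector [a, b, c] :: real^3) (signs \<times> signs \<times> signs)"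
    by (auto simp: inj_on_def vec3_eq_iff vector_3)
  then show ?thesis unfolding sgnvecs_image
    by (simp add: sum.reindex split_def vector_3 sum.cartesian_product)
qed

lemma finite_sgnvecs [simp]: "finite sgnvecs" by (simp add: sgnvecs_image)

lemma skeleton_3_moment:
  assumes "r > 0"
  shows "skeleton_integral r 3 (\<lambda>y. y $ 1 ^ i * y $ 2 ^ j * y $ 3 ^ k) =
    r / 3 * (sg i * sg j * sg k * Sg 3 (r / 3) i j k)"
proof -
  let ?Y = "\<lambda>y::real^3. y $ 1 ^ i * y $ 2 ^ j * y $ 3 ^ k"
  define q where "q = r / 3"
  have q: "q > 0" using assms by (simp add: q_def)
  let ?D = "\<lambda>m::3. if m = 1 then Dm 3 q j k i else if m = 2 then Dm 3 q i k j else Dm 3 q i j k"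
  let ?I = "\<lambda>p::(real^3) \<times> 3. fst p $ 1 ^ i * fst p $ 2 ^ j * fst p $ 3 ^ k * (q * ?D (snd p))"
  have "(?Y has_integral (\<Sum>p\<in>sgnvecs \<times> UNIV. ?I p)) (\<Union>p\<in>sgnvecs \<times> UNIV. tet q (fst p) (snd p))"
  proof (rule has_integral_UN)
    show "(?Y has_integral ?I p) (tet q (fst p) (snd p))" if "p \<in> sgnvecs \<times> UNIV" for p
      using that by (intro tet_moment q) auto
    show "pairwise (\<lambda>p p'. negligible (tet q (fst p) (snd p) \<inter> tet q (fst p') (snd p'))) (sgnvecs \<times> UNIV)"
      unfolding pairwise_def by (auto intro!: tet_negligible)
  qed simp
  then have "integral (solid r) ?Y = (\<Sum>p\<in>sgnvecs \<times> UNIV. ?I p)"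
    by (simp add: solid_tets[OF assms] q_def[symmetric] integral_unique)
  also have "\<dots> = (\<Sum>e\<in>sgnvecs. \<Sum>m\<in>UNIV. e $ 1 ^ i * e $ 2 ^ j * e $ 3 ^ k * (q * ?D m))"
    by (simp only: sum.cartesian_product split_def)
  also have "\<dots> = (\<Sum>e\<in>sgnvecs. e $ 1 ^ i * e $ 2 ^ j * e $ 3 ^ k * (q * Sg 3 q i j k))"
    by (simp add: sum_3 Sg_def algebra_simps)
  also have "\<dots> = q * (sg i * sg j * sg k * Sg 3 q i j k)"
    unfolding sum_sgnvecs[of "\<lambda>a b c. a ^ i * b ^ j * c ^ k * (q * Sg 3 q i j k)"] sum_signs_monomial by simp
  finally have *: "integral (solid r) ?Y = q * (sg i * sg j * sg k * Sg 3 q i j k)" .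
  have "set_integrable lborel (solid r) ?Y"
    unfolding set_integrable_def by (intro borel_integrable_compact compact_solid assms continuous_intros)
  then have "(LINT y:solid r|lborel. ?Y y) = integral (solid r) ?Y" by (rule set_borel_integral_eq_integral(2))
  then show ?thesis using * by (simp add: skeleton_integral_def q_def)
qed

section \<open>Critical radii and positivity of the moment combinations\<close>

text \<open>A point mass is the integral over the unit interval along a constant path.\<close>

lemma nice_point: "nice (\<lambda>f. f v)"
proof -
  have "nice (\<lambda>f. LINT t:{0..1::real}|lborel. f ((\<lambda>_. v) t))"
    by (rule nice_base) auto
  then show ?thesis by (simp add: set_lebesgue_integral_def)
qed

lemma nice_skeleton:
  assumes "r > 0" "k \<in> {0, 1, 2, 3}" shows "nice (skeleton_integral r k)"
proof -
  consider "k = 0" | "k = 1" | "k = 2" | "k = 3" using assms(2) by auto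
  then show ?thesis
  proof cases
    case 1
    have "skeleton_integral r k = (\<lambda>f. \<Sum>v\<in>vertices r. f v)" by (simp add: 1 skeleton_integral_def fun_eq_iff)
    then show ?thesis by (simp only:) (intro nice_sum nice_point)
  next
    case 2
    have "skeleton_integral r k = (\<lambda>f. \<Sum>e\<in>edges r. norm (snd e - fst e) * (LINT t:{0..1}|lborel. f (fst e + t *\<^sub>R (snd e - fst e))))"
      by (simp add: 2 skeleton_integral_def fun_eq_iff split_def)
    then show ?thesis by (simp only:) (intro nice_sum nice_cmult nice_base compact_Icc continuous_intros)
  next
    case 3
    have "skeleton_integral r k = (\<lambda>f. \<Sum>e\<in>faces r. norm (cross3 (fst (snd e) - fst e) (snd (snd e) - fst e)) * (LINT p:Tri|lborel.
              f (fst e + fst p *\<^sub>R (fst (snd e) - fst e) + snd p *\<^sub>R (snd (snd e) - fst e))))"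
      by (simp add: 3 skeleton_integral_def fun_eq_iff split_def Tri_def)
    then show ?thesis by (simp only:) (intro nice_sum nice_cmult nice_base compact_Tri continuous_intros)
  next
    case 4
    have "skeleton_integral r k = (\<lambda>f. LINT y:solid r|lborel. f y)" by (simp add: 4 skeleton_integral_def fun_eq_iff)
    then show ?thesis using nice_base[OF compact_solid[OF assms(1)] continuous_on_id] by simp
  qed
qed

definition mu :: "real \<Rightarrow> nat \<Rightarrow> nat \<Rightarrow> nat \<Rightarrow> nat \<Rightarrow> real" where
  "mu r k i j l = skeleton_integral r k (\<lambda>y. y $ 1 ^ i * y $ 2 ^ j * y $ 3 ^ l)"

lemma skeleton_mnm:
  assumes "r > 0" "k \<in> {0, 1, 2, 3}"
  shows "skeleton_integral r k (mnm a b c) = mu r k a b c / (fact a * fact b * fact c)"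
proof -
  have eq: "mnm a b c = (\<lambda>y. (1 / (fact a * fact b * fact c)) * (y $ 1 ^ a * y $ 2 ^ b * y $ 3 ^ c))"
    by (simp add: mnm_def fun_eq_iff)
  have c: "continuous_on UNIV (\<lambda>y::real^3. y $ 1 ^ a * y $ 2 ^ b * y $ 3 ^ c)" by (intro continuous_intros)
  show ?thesis unfolding eq nice_cmultD[OF nice_skeleton[OF assms] c] mu_def by simp
qed

definition critical :: "real \<Rightarrow> nat \<Rightarrow> bool" where
  "critical r k \<longleftrightarrow> k = 0 \<and> r = crit_r0 \<or> k = 1 \<and> r = crit_r1 \<or> k \<in> {2, 3} \<and> r = crit_r2"

lemma crit_r0_pow: "crit_r0 > 0" "crit_r0 ^ 4 = 81 / 8"
proof -
  show "crit_r0 > 0" by (simp add: crit_r0_def)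
  have "(2 powr (- 3 / 4)) ^ 4 = (2::real) powr (- 3 / 4 * 4)" by (simp add: powr_power)
  also have "\<dots> = 1 / 8" by (simp add: powr_minus_divide)
  finally show "crit_r0 ^ 4 = 81 / 8" by (simp add: crit_r0_def power_mult_distrib)
qed

lemma crit_r0_bounds: "1.78381 \<le> crit_r0" "crit_r0 < 1.78382"
proof -
  have "(1.78381 :: real) ^ 4 \<le> crit_r0 ^ 4" unfolding crit_r0_pow(2) by (simp add: power_divide)
  then show "1.78381 \<le> crit_r0" using crit_r0_pow(1) power_le_imp_le_base[of "1.78381" 3 crit_r0] by (simp add: numeral_eq_Suc)
  have "crit_r0 ^ 4 < (1.78382 :: real) ^ 4" unfolding crit_r0_pow(2) by (simp add: power_divide)
  then show "crit_r0 < 1.78382" by (rule power_less_imp_less_base) simp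
qed

lemma inv_pow_less: "0 < x \<Longrightarrow> x < y \<Longrightarrow> c > 0 \<Longrightarrow> n > 0 \<Longrightarrow> c / y ^ n < c / (x::real) ^ n"
  by (intro divide_strict_left_mono power_strict_mono mult_pos_pos zero_less_power) auto

text \<open>Exactly one sign change in the coefficients. After division by t^5 the positive
  coefficients stand at positive powers and the negative ones at powers at most 0, so the quotient
  is strictly increasing.\<close>

lemma poly_r1_root_unique:
  assumes "0 < x" "x < y" "poly_r1 x = 0" shows "poly_r1 y > 0"
proof -
  define g where "g t = 16*t^3 + 32*t^2 + 40*t - 48 - 396/t^1 - 432/t^2 - 810/t^3 - 972/t^4 - 729/t^5" for t :: real
  have g: "poly_r1 t = t ^ 5 * g t" if "t > 0" for t
    using that unfolding poly_r1_def g_def by (simp add: field_simps eval_nat_numeral)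
  have "16*x^3 < 16*y^3" "32*x^2 < 32*y^2" "40*x < 40*y" using assms by (auto intro!: power_strict_mono)
  moreover have "396/y^1 < 396/x^1" "432/y^2 < 432/x^2" "810/y^3 < 810/x^3" "972/y^4 < 972/x^4" "729/y^5 < 729/x^5"
    using assms by (intro inv_pow_less; simp)+
  ultimately have "g x < g y" unfolding g_def by linarith
  moreover have "g x = 0" using g[of x] assms by simp
  ultimately show ?thesis using g[of y] assms by simp
qed

text \<open>The same monotonicity argument, with division by t^2.\<close>

lemma poly_r2_root_unique:
  assumes "0 < x" "x < y" "poly_r2 x = 0" shows "poly_r2 y > 0"
proof -
  define g where "g t = 4*t^2 + 8*t + 6 - 18/t^1 - 81/t^2" for t :: real
  have g: "poly_r2 t = t ^ 2 * g t" if "t > 0" for t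
    using that unfolding poly_r2_def g_def by (simp add: field_simps eval_nat_numeral)
  have "4*x^2 < 4*y^2" "8*x < 8*y" using assms by (auto intro!: power_strict_mono)
  moreover have "18/y^1 < 18/x^1" "81/y^2 < 81/x^2"
    using assms by (intro inv_pow_less; simp)+
  ultimately have "g x < g y" unfolding g_def by linarith
  moreover have "g x = 0" using g[of x] assms by simp
  ultimately show ?thesis using g[of y] assms by simp
qed

lemma unique_root:
  fixes p :: "real \<Rightarrow> real"
  assumes u: "\<And>x y. 0 < x \<Longrightarrow> x < y \<Longrightarrow> p x = 0 \<Longrightarrow> p y > 0"
    and ab: "0 < a" "a \<le> b" "p a \<le> 0" "p b > 0" and c: "continuous_on {a..b} p"
  shows "\<exists>!x. x > 0 \<and> p x = 0" "a \<le> (THE x. x > 0 \<and> p x = 0)" "(THE x. x > 0 \<and> p x = 0) < b"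
    "\<And>x. x > 0 \<Longrightarrow> p x = 0 \<longleftrightarrow> x = (THE x. x > 0 \<and> p x = 0)"
proof -
  obtain x where x: "a \<le> x" "x \<le> b" "p x = 0" using IVT'[of p a 0 b] ab c by auto
  have "x \<noteq> b" using x ab by auto
  have uq: "y = x" if "y > 0" "p y = 0" for y
    using u[of x y] u[of y x] that x ab by (cases x y rule: linorder_cases) auto
  show ex: "\<exists>!x. x > 0 \<and> p x = 0" using x ab uq by (intro ex1I[of _ x]) auto
  have t: "(THE x. x > 0 \<and> p x = 0) = x" using x ab uq by (intro the_equality) auto
  show "a \<le> (THE x. x > 0 \<and> p x = 0)" "(THE x. x > 0 \<and> p x = 0) < b" using x \<open>x \<noteq> b\<close> unfolding t by auto
  show "p y = 0 \<longleftrightarrow> y = (THE x. x > 0 \<and> p x = 0)" if "y > 0" for y using uq that x unfolding t by auto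
qed

lemma crit_r1:
  "\<exists>!x. x > 0 \<and> poly_r1 x = 0" "2.24580 \<le> crit_r1" "crit_r1 < 2.24581"
  "\<And>x. x > 0 \<Longrightarrow> poly_r1 x = 0 \<longleftrightarrow> x = crit_r1"
proof -
  have h: "0 < (2.24580::real)" "(2.24580::real) \<le> 2.24581" by simp_all
  have a: "poly_r1 2.24580 \<le> 0" and b: "0 < poly_r1 2.24581" by (simp_all add: poly_r1_def power_divide)
  have c: "continuous_on {2.24580..2.24581} poly_r1" unfolding poly_r1_def by (intro continuous_intros)
  note u = unique_root[OF poly_r1_root_unique h a b c]
  show "\<exists>!x. x > 0 \<and> poly_r1 x = 0" by (rule u(1))
  show "2.24580 \<le> crit_r1" unfolding crit_r1_def by (rule u(2))
  show "crit_r1 < 2.24581" unfolding crit_r1_def by (rule u(3))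
  show "poly_r1 x = 0 \<longleftrightarrow> x = crit_r1" if "x > 0" for x unfolding crit_r1_def by (rule u(4)) (assumption | rule that)+
qed

lemma crit_r2:
  "\<exists>!x. x > 0 \<and> poly_r2 x = 0" "1.82977 \<le> crit_r2" "crit_r2 < 1.82978"
  "\<And>x. x > 0 \<Longrightarrow> poly_r2 x = 0 \<longleftrightarrow> x = crit_r2"
proof -
  have h: "0 < (1.82977::real)" "(1.82977::real) \<le> 1.82978" by simp_all
  have a: "poly_r2 1.82977 \<le> 0" and b: "0 < poly_r2 1.82978" by (simp_all add: poly_r2_def power_divide)
  have c: "continuous_on {1.82977..1.82978} poly_r2" unfolding poly_r2_def by (intro continuous_intros)
  note u = unique_root[OF poly_r2_root_unique h a b c]
  show "\<exists>!x. x > 0 \<and> poly_r2 x = 0" by (rule u(1))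
  show "1.82977 \<le> crit_r2" unfolding crit_r2_def by (rule u(2))
  show "crit_r2 < 1.82978" unfolding crit_r2_def by (rule u(3))
  show "poly_r2 x = 0 \<longleftrightarrow> x = crit_r2" if "x > 0" for x unfolding crit_r2_def by (rule u(4)) (assumption | rule that)+
qed

text \<open>The degree 4, 6 and 8 combinations are, up to positive factors, the coefficients that decide
  whether a mean value property forces the corresponding invariant operator to annihilate.\<close>

definition good_moments :: "real \<Rightarrow> nat \<Rightarrow> bool" where
  "good_moments r k \<longleftrightarrow> symmetric_even (mu r k) \<and> mu r k 0 0 0 > 0 \<and> mu r k 2 0 0 > 0 \<and>
     mu r k 6 0 0 - 15 * mu r k 4 2 0 + 30 * mu r k 2 2 2 > 0 \<and>
     (mu r k 4 0 0 - 3 * mu r k 2 2 0 = 0 \<longleftrightarrow> critical r k) \<and>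
     (critical r k \<longrightarrow> mu r k 8 0 0 - 28 * mu r k 6 2 0 + 35 * mu r k 4 4 0 > 0)"

lemma good_moments_0:
  assumes "r > 0" shows "good_moments r 0"
proof -
  define q where "q = r / 3"
  have q: "q > 0" "r = 3 * q" using assms by (auto simp: q_def)
  have m: "mu r 0 i j k = sg i * 0 ^ j * 0 ^ k + 0 ^ i * sg j * 0 ^ k + 0 ^ i * 0 ^ j * sg k + sg i * sg j * sg k * q ^ (i + j + k)" for i j k
    unfolding mu_def q_def by (rule skeleton_0_moment[OF assms])
  have sym: "symmetric_even (mu r 0)"
    unfolding symmetric_even_def m
  proof (intro allI conjI impI)
    fix a b c :: nat
    assume nz: "sg a * 0 ^ b * 0 ^ c + 0 ^ a * sg b * 0 ^ c + 0 ^ a * 0 ^ b * sg c + sg a * sg b * sg c * q ^ (a + b + c) \<noteq> 0"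
    show "even a" by (rule ccontr) (use nz in \<open>simp add: sg_eq odd_pos zero_power\<close>)
    show "even b" by (rule ccontr) (use nz in \<open>simp add: sg_eq odd_pos zero_power\<close>)
    show "even c" by (rule ccontr) (use nz in \<open>simp add: sg_eq odd_pos zero_power\<close>)
  qed (simp_all add: mult_ac add_ac)
  have M4: "mu r 0 4 0 0 - 3 * mu r 0 2 2 0 = 2 - 16 * q ^ 4" by (simp add: m sg_eq)
  have M4z: "2 - 16 * q ^ 4 = 0 \<longleftrightarrow> r = crit_r0"
  proof -
    have "2 - 16 * q ^ 4 = 0 \<longleftrightarrow> r ^ 4 = 81 / 8" unfolding q(2) power_mult_distrib by auto
    also have "\<dots> \<longleftrightarrow> r ^ 4 = crit_r0 ^ 4" by (simp add: crit_r0_pow)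
    also have "\<dots> \<longleftrightarrow> r = crit_r0" using assms crit_r0_pow(1) by (intro power_eq_iff_eq_base) auto
    finally show ?thesis .
  qed
  have M6: "mu r 0 6 0 0 - 15 * mu r 0 4 2 0 + 30 * mu r 0 2 2 2 = 2 + 128 * q ^ 6" by (simp add: m sg_eq)
  have M8: "mu r 0 8 0 0 - 28 * mu r 0 6 2 0 + 35 * mu r 0 4 4 0 = 2 + 64 * q ^ 8" by (simp add: m sg_eq)
  have p: "mu r 0 0 0 0 > 0" "mu r 0 2 0 0 > 0" by (simp_all add: m sg_eq add_pos_nonneg)
  have p2: "2 + 128 * q ^ 6 > 0" "2 + 64 * q ^ 8 > 0" by (simp_all add: add_pos_nonneg)
  have c: "critical r 0 \<longleftrightarrow> r = crit_r0" by (simp add: critical_def)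
  show ?thesis unfolding good_moments_def c M4 M6 M8 using sym M4z p p2 by blast
qed

text \<open>The two kinds of edges have different lengths, so the critical equation 4 l h = 3 sqrt 2
  is irrational. Squaring gives \<open>poly_r1\<close> up to a positive factor; the sign of
  \<open>h\<close> then has to be examined.\<close>

lemma good_moments_1:
  assumes "r > 0" shows "good_moments r 1"
proof -
  define q where "q = r / 3"
  define l where "l = edge_len r"
  have q: "q > 0" "r = 3 * q" using assms by (auto simp: q_def)
  have l2: "1 - 2 * q + 3 * q ^ 2 = (1 - q) ^ 2 + 2 * q ^ 2" by (simp add: power2_eq_square algebra_simps)
  have l2pos: "1 - 2 * q + 3 * q ^ 2 > 0" unfolding l2 using q by (intro add_nonneg_pos) auto
  have l: "l > 0" "l ^ 2 = 1 - 2 * q + 3 * q ^ 2" using l2pos unfolding l_def edge_len_def q_def by auto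
  have m: "mu r 1 i j k = sqrt 2 * (sg i * sg j * 0 ^ k * bt i j + sg i * 0 ^ j * sg k * bt i k + 0 ^ i * sg j * sg k * bt j k)
    + l * (sg i * sg j * sg k * Gg q i j k)" for i j k
    unfolding mu_def q_def l_def Gg_def by (rule skeleton_1_moment[OF assms])
  have G: "Gg q b a c = Gg q a b c" "Gg q a c b = Gg q a b c" for a b c by (simp_all add: Gg_def add_ac)
  have sym: "symmetric_even (mu r 1)"
    unfolding symmetric_even_def
  proof (intro allI conjI impI)
    fix a b c :: nat
    show "mu r 1 b a c = mu r 1 a b c" unfolding m G(1)[of b a c] bt_swap[of b a] by (simp add: algebra_simps)
    show "mu r 1 a c b = mu r 1 a b c" unfolding m G(2)[of a c b] bt_swap[of c b] by (simp add: algebra_simps)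
    assume nz: "mu r 1 a b c \<noteq> 0"
    show "even a" by (rule ccontr) (use nz[unfolded m] in \<open>simp add: sg_eq odd_pos zero_power\<close>)
    show "even b" by (rule ccontr) (use nz[unfolded m] in \<open>simp add: sg_eq odd_pos zero_power\<close>)
    show "even c" by (rule ccontr) (use nz[unfolded m] in \<open>simp add: sg_eq odd_pos zero_power\<close>)
  qed
  have btv: "bt 4 0 = 1/5" "bt 2 2 = 1/30" "bt 6 0 = 1/7" "bt 4 2 = 1/105" "bt 8 0 = 1/9" "bt 6 2 = 1/252" "bt 4 4 = 1/630" "bt 2 0 = 1/3" "bt 0 0 = 1"
    by (simp_all add: bt_def fact_numeral)
  have M4: "mu r 1 4 0 0 - 3 * mu r 1 2 2 0 = sqrt 2 * (6/5) + 8 * l * (Gg q 4 0 0 - 3 * Gg q 2 2 0)"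
    unfolding m by (simp add: sg_eq btv algebra_simps)
  have M6: "mu r 1 6 0 0 - 15 * mu r 1 4 2 0 + 30 * mu r 1 2 2 2 = sqrt 2 * (4/7) + 8 * l * (Gg q 6 0 0 - 15 * Gg q 4 2 0 + 30 * Gg q 2 2 2)"
    unfolding m by (simp add: sg_eq btv algebra_simps)
  have M8: "mu r 1 8 0 0 - 28 * mu r 1 6 2 0 + 35 * mu r 1 4 4 0 = sqrt 2 * (2/3) + 8 * l * (Gg q 8 0 0 - 28 * Gg q 6 2 0 + 35 * Gg q 4 4 0)"
    unfolding m by (simp add: sg_eq btv algebra_simps)
  define h where "h = 6 * q ^ 4 + 2 * q ^ 3 - q - 1"
  have crit: "mu r 1 4 0 0 - 3 * mu r 1 2 2 0 = 0 \<longleftrightarrow> r = crit_r1"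
  proof -
    have "mu r 1 4 0 0 - 3 * mu r 1 2 2 0 = (2/5) * (3 * sqrt 2 - 4 * l * h)"
      unfolding M4 Gg_400 h_def by (simp add: field_simps)
    then have 1: "mu r 1 4 0 0 - 3 * mu r 1 2 2 0 = 0 \<longleftrightarrow> 4 * l * h = 3 * sqrt 2" by auto
    \<comment> \<open>The squared equation has degree 10 in q. The quadratic factor has no real
      zero, which leaves the polynomial of degree 8.\<close>
    have 2: "8 * (1 - 2 * q + 3 * q ^ 2) * h ^ 2 - 9 = (6 * q ^ 2 - 4 * q + 1) * poly_r1 r / 729"
      unfolding h_def poly_r1_def q(2) by (simp add: field_simps eval_nat_numeral)
    have "6 * q ^ 2 - 4 * q + 1 = 2 * q ^ 2 + (2 * q - 1) ^ 2" by (simp add: power2_eq_square algebra_simps)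
    also have "\<dots> > 0" using q by (intro add_pos_nonneg) auto
    finally have 3: "6 * q ^ 2 - 4 * q + 1 > 0" .
    have 4: "(4 * l * h) ^ 2 = 2 * (8 * (1 - 2 * q + 3 * q ^ 2) * h ^ 2)" unfolding power_mult_distrib l(2) by simp
    have 5: "(3 * sqrt 2) ^ 2 = (18::real)" by (simp add: power_mult_distrib)
    have sqr: "(4 * l * h) ^ 2 = (3 * sqrt 2) ^ 2 \<longleftrightarrow> poly_r1 r = 0"
    proof -
      have g: "2 * X = 18 \<longleftrightarrow> X - 9 = (0::real)" for X by auto
      show ?thesis unfolding 4 5 g 2 using 3 by simp
    qed
    show ?thesis
    proof
      assume "mu r 1 4 0 0 - 3 * mu r 1 2 2 0 = 0"
      then have "4 * l * h = 3 * sqrt 2" using 1 by simp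
      then have "poly_r1 r = 0" using sqr by simp
      then show "r = crit_r1" using crit_r1(4)[OF assms] by simp
    next
      assume r: "r = crit_r1"
      then have p: "poly_r1 r = 0" using crit_r1(4)[OF assms] by simp
      \<comment> \<open>The enclosure of the root places q between 0.74 and 0.75. There
        \<open>h\<close> is positive, so squaring has introduced no solution of the wrong
        sign.\<close>
      have qq: "0.74 \<le> q" using crit_r1(2) r q by simp
      have "0.74 ^ 4 \<le> q ^ 4" "0.74 ^ 3 \<le> q ^ 3" using qq by (auto intro!: power_mono)
      moreover have "q \<le> 0.75" using crit_r1(3) r q by simp
      ultimately have "h > 0" unfolding h_def by (simp add: power_divide)
      then have "4 * l * h \<ge> 0" using l by simp
      moreover have "(4 * l * h) ^ 2 = (3 * sqrt 2) ^ 2" using sqr p by simp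
      ultimately have "4 * l * h = 3 * sqrt 2" by (subst (asm) power2_eq_iff_nonneg) auto
      then show "mu r 1 4 0 0 - 3 * mu r 1 2 2 0 = 0" using 1 by simp
    qed
  qed
  \<comment> \<open>The only negative term is dominated by 1 + q for q at most 1 and by the term of
    degree 5 beyond.\<close>
  have c6: "1 + q - 2 * q ^ 3 + 16 * q ^ 5 + 48 * q ^ 6 > 0"
  proof (cases "q \<le> 1")
    case True
    then have "q ^ 3 \<le> q" using power_decreasing[of 1 3 q] q by simp
    moreover have "q ^ 5 > 0" "q ^ 6 > 0" using q by simp_all
    ultimately show ?thesis using True by linarith
  next
    case False
    then have "q ^ 3 \<le> q ^ 5" by (intro power_increasing) auto
    moreover have "q ^ 5 > 0" "q ^ 6 > 0" using q by simp_all
    ultimately show ?thesis using q by linarith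
  qed
  have c8: "1 + q - 2 * q ^ 3 - 4 * q ^ 4 - 4 * q ^ 5 + 8 * q ^ 7 + 24 * q ^ 8 > 0" if "r = crit_r1"
  proof -
    have a: "0.74 \<le> q" "q \<le> 0.75" using crit_r1(2,3) that q by simp_all
    have "q ^ 3 \<le> 0.75 ^ 3" "q ^ 4 \<le> 0.75 ^ 4" "q ^ 5 \<le> 0.75 ^ 5" "0.74 ^ 7 \<le> q ^ 7" "0.74 ^ 8 \<le> q ^ 8"
      using a by (auto intro!: power_mono)
    then show ?thesis using a by (simp add: power_divide)
  qed
  have "mu r 1 6 0 0 - 15 * mu r 1 4 2 0 + 30 * mu r 1 2 2 2 > 0"
    unfolding M6 Gg_600 using l c6 by (intro add_pos_pos mult_pos_pos) auto
  moreover have "mu r 1 8 0 0 - 28 * mu r 1 6 2 0 + 35 * mu r 1 4 4 0 > 0" if "r = crit_r1"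
    unfolding M8 Gg_800 using l c8[OF that] by (intro add_pos_pos mult_pos_pos) auto
  moreover have "mu r 1 0 0 0 > 0" "mu r 1 2 0 0 > 0"
    unfolding m using l Gg_pos[OF q(1)] by (auto simp: sg_eq btv intro!: add_pos_pos)
  moreover have "critical r 1 \<longleftrightarrow> r = crit_r1" by (simp add: critical_def)
  ultimately show ?thesis using sym crit unfolding good_moments_def by blast
qed

text \<open>The dimension enters through the Jacobian \<open>K\<close> and one factorial per degree,
  so all signs are those of the polynomials in \<open>Pn_400\<close>, \<open>Pn_600\<close> and
  \<open>Pn_800\<close>.\<close>

lemma good_moments_23:
  assumes r: "r > 0" and k: "k \<in> {2, 3}" and K: "K > 0"
    and m: "\<And>i j l. mu r k i j l = K * (sg i * sg j * sg l * Sg k (r / 3) i j l)"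
  shows "good_moments r k"
proof -
  define q where "q = r / 3"
  have q: "q > 0" "r = 3 * q" using r by (auto simp: q_def)
  note m = m[folded q_def]
  have sym: "symmetric_even (mu r k)"
    unfolding symmetric_even_def
  proof (intro allI conjI impI)
    fix a b c :: nat
    show "mu r k b a c = mu r k a b c" "mu r k a c b = mu r k a b c"
      unfolding m using Sg_swap by (simp_all add: mult_ac)
    assume nz: "mu r k a b c \<noteq> 0"
    show "even a" by (rule ccontr) (use nz in \<open>simp add: m sg_eq\<close>)
    show "even b" by (rule ccontr) (use nz in \<open>simp add: m sg_eq\<close>)
    show "even c" by (rule ccontr) (use nz in \<open>simp add: m sg_eq\<close>)
  qed
  have M4: "mu r k 4 0 0 - 3 * mu r k 2 2 0 = (8 * K / fact (4 + k)) * (Pn q 4 0 0 - 3 * Pn q 2 2 0)"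
    by (simp add: m sg_eq Sg_Pn right_diff_distrib diff_divide_distrib)
  have M6: "mu r k 6 0 0 - 15 * mu r k 4 2 0 + 30 * mu r k 2 2 2 = (8 * K / fact (6 + k)) * (Pn q 6 0 0 - 15 * Pn q 4 2 0 + 30 * Pn q 2 2 2)"
    by (simp add: m sg_eq Sg_Pn right_diff_distrib distrib_left diff_divide_distrib add_divide_distrib)
  have M8: "mu r k 8 0 0 - 28 * mu r k 6 2 0 + 35 * mu r k 4 4 0 = (8 * K / fact (8 + k)) * (Pn q 8 0 0 - 28 * Pn q 6 2 0 + 35 * Pn q 4 4 0)"
    by (simp add: m sg_eq Sg_Pn right_diff_distrib distrib_left diff_divide_distrib add_divide_distrib)
  have p2: "3 + 2 * q - 2 * q ^ 2 - 8 * q ^ 3 - 12 * q ^ 4 = - poly_r2 r / 27"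
    unfolding poly_r2_def q(2) by (simp add: power_mult_distrib field_simps)
  have crit: "mu r k 4 0 0 - 3 * mu r k 2 2 0 = 0 \<longleftrightarrow> r = crit_r2"
    unfolding M4 Pn_400 p2 using K crit_r2(4)[OF r] by simp
  have c6: "1 - 2 * q ^ 2 - 2 * q ^ 3 + 8 * q ^ 4 + 32 * q ^ 5 + 48 * q ^ 6 > 0"
  proof (cases "q \<le> 1 / 2")
    case True
    have "q ^ 2 \<le> (1/2) ^ 2" "q ^ 3 \<le> (1/2) ^ 3" using True q by (intro power_mono; simp)+
    then have "q ^ 2 \<le> 1 / 4" "q ^ 3 \<le> 1 / 8" by (simp_all add: power_divide)
    moreover have "q ^ 4 > 0" "q ^ 5 > 0" "q ^ 6 > 0" using q by simp_all
    ultimately show ?thesis by linarith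
  next
    case False
    then have "q ^ 2 \<ge> (1/2) ^ 2" by (intro power_mono) auto
    then have a: "4 * q ^ 2 \<ge> 1" by (simp add: power_divide)
    have "8 * q ^ 4 = 2 * q ^ 2 * (4 * q ^ 2)" "8 * q ^ 5 = 2 * q ^ 3 * (4 * q ^ 2)" by (simp_all add: eval_nat_numeral)
    moreover have "2 * q ^ 2 * (4 * q ^ 2) \<ge> 2 * q ^ 2 * 1" "2 * q ^ 3 * (4 * q ^ 2) \<ge> 2 * q ^ 3 * 1"
      using a q by (intro mult_left_mono; simp)+
    moreover have "q ^ 5 > 0" "q ^ 6 > 0" using q by simp_all
    ultimately show ?thesis by linarith
  qed
  have c8: "3 + 2 * q - 2 * q ^ 2 - 8 * q ^ 3 - 12 * q ^ 4 - 8 * q ^ 5 + 8 * q ^ 6 + 32 * q ^ 7 + 48 * q ^ 8 > 0" if "r = crit_r2"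
  proof -
    have "poly_r2 r = 0" using crit_r2(4)[OF r] that by simp
    \<comment> \<open>At the critical radius the first five terms of the degree 8 expression are the
      vanishing degree 4 combination. What remains is 8 q^5 times a cubic that is positive for q at
      least 3/5.\<close>
    then have z: "3 + 2 * q - 2 * q ^ 2 - 8 * q ^ 3 - 12 * q ^ 4 = 0" using p2 by simp
    have a: "0.6 \<le> q" using crit_r2(2) that q by simp
    have "q ^ 2 \<ge> 0.6 ^ 2" using a by (intro power_mono) simp_all
    then have "q ^ 2 \<ge> 9 / 25" by (simp add: power_divide)
    moreover have "q ^ 3 > 0" "q \<ge> 3 / 5" using q a by simp_all
    ultimately have "6 * q ^ 3 + 4 * q ^ 2 + q - 1 > 0" by linarith
    then have "8 * q ^ 5 * (6 * q ^ 3 + 4 * q ^ 2 + q - 1) > 0" using q by simp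
    moreover have "8 * q ^ 5 * (6 * q ^ 3 + 4 * q ^ 2 + q - 1) = - 8 * q ^ 5 + 8 * q ^ 6 + 32 * q ^ 7 + 48 * q ^ 8"
      by (simp add: algebra_simps eval_nat_numeral)
    ultimately show ?thesis using z by linarith
  qed
  have "mu r k 6 0 0 - 15 * mu r k 4 2 0 + 30 * mu r k 2 2 2 > 0"
    unfolding M6 Pn_600 using K c6 by simp
  moreover have "mu r k 8 0 0 - 28 * mu r k 6 2 0 + 35 * mu r k 4 4 0 > 0" if "r = crit_r2"
    unfolding M8 Pn_800 using K c8[OF that] by simp
  moreover have "mu r k 0 0 0 > 0" "mu r k 2 0 0 > 0"
    using K Pn_pos[OF q(1)] by (auto simp: m sg_eq Sg_Pn)
  moreover have "critical r k \<longleftrightarrow> r = crit_r2" using k by (auto simp: critical_def)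
  ultimately show ?thesis using sym crit unfolding good_moments_def by blast
qed

lemma good_moments:
  assumes "r > 0" "k \<in> {0, 1, 2, 3}" shows "good_moments r k"
proof -
  have f: "face_area2 r > 0" unfolding face_area2_def using assms(1) by (auto intro!: add_pos_nonneg)
  have m2: "mu r 2 i j l = face_area2 r * (sg i * sg j * sg l * Sg 2 (r / 3) i j l)" for i j l
    unfolding mu_def by (rule skeleton_2_moment[OF assms(1)])
  have m3: "mu r 3 i j l = r / 3 * (sg i * sg j * sg l * Sg 3 (r / 3) i j l)" for i j l
    unfolding mu_def by (rule skeleton_3_moment[OF assms(1)])
  show ?thesis
    using assms good_moments_0 good_moments_1 good_moments_23[OF assms(1) _ f m2] good_moments_23[OF assms(1) _ _ m3] by auto
qed

section \<open>The symmetry group of the skeleta\<close>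

lemma exists_3: "(\<exists>i::3. P i) \<longleftrightarrow> P 1 \<or> P 2 \<or> P 3"
  by (metis exhaust_3)

lemma signs_mult: "a \<in> signs \<Longrightarrow> b \<in> signs \<Longrightarrow> a * b \<in> signs"
  by (auto simp: signs_def)

lemma v_axis: "vA a = axis 1 a" "vB b = axis 2 b" "vC c = axis 3 c"
  by (simp_all add: vec3_eq_iff v_nth axis_def)

lemma vD_sgnvec: "vD r a b c = (r / 3) *\<^sub>R vector [a, b, c]"
  by (simp add: vec3_eq_iff v_nth vector_3)

lemma sgnvec_vector: "d \<in> sgnvecs \<Longrightarrow> d = vector [d $ 1, d $ 2, d $ 3]" "d \<in> sgnvecs \<Longrightarrow> d $ i \<in> signs"
  by (simp_all add: vec3_eq_iff vector_3 sgnvecs_def)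

lemma vector_sgnvecs: "a \<in> signs \<Longrightarrow> b \<in> signs \<Longrightarrow> c \<in> signs \<Longrightarrow> vector [a, b, c] \<in> sgnvecs"
  by (simp add: sgnvecs_def forall_3 vector_3)

lemma UN_sgnvecs: "(\<Union>d\<in>sgnvecs. f d) = (\<Union>a\<in>signs. \<Union>b\<in>signs. \<Union>c\<in>signs. f (vector [a, b, c]))"
proof (intro equalityI subsetI)
  fix y assume "y \<in> (\<Union>d\<in>sgnvecs. f d)"
  then obtain d where d: "d \<in> sgnvecs" "y \<in> f d" by blast
  have "y \<in> f (vector [d $ 1, d $ 2, d $ 3])" by (subst sgnvec_vector(1)[OF d(1), symmetric]) (rule d(2))
  then show "y \<in> (\<Union>a\<in>signs. \<Union>b\<in>signs. \<Union>c\<in>signs. f (vector [a, b, c]))" using sgnvec_vector(2)[OF d(1)] by blast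
next
  fix y assume "y \<in> (\<Union>a\<in>signs. \<Union>b\<in>signs. \<Union>c\<in>signs. f (vector [a, b, c]))"
  then show "y \<in> (\<Union>d\<in>sgnvecs. f d)" using vector_sgnvecs by blast
qed

text \<open>Indexing by octants and axes instead of the letters A, B, C makes the action of signed
  permutations visible.\<close>

lemma skeleton_0_eq:
  "skeleton r 0 = (\<Union>d\<in>sgnvecs. \<Union>i. {axis i (d $ i), (r / 3) *\<^sub>R d})"
proof -
  have "skeleton r 0 = (\<Union>a\<in>signs. \<Union>b\<in>signs. \<Union>c\<in>signs. {vA a, vB b, vC c, vD r a b c})"
    using one_signs(1) unfolding skeleton_def vertices_def by auto
  also have "\<dots> = (\<Union>d\<in>sgnvecs. {axis 1 (d $ 1), axis 2 (d $ 2), axis 3 (d $ 3), (r / 3) *\<^sub>R d})"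
    unfolding UN_sgnvecs v_axis vD_sgnvec vector_3 ..
  also have "\<dots> = (\<Union>d\<in>sgnvecs. \<Union>i. {axis i (d $ i), (r / 3) *\<^sub>R d})"
    by (intro SUP_cong refl) (auto simp: UNIV_3)
  finally show ?thesis .
qed

text \<open>Pairs of axes are taken in both orders and octahedral edges recur in two octants. Only
  unions are formed from these sets, and the description is stable under permuting axes.\<close>

definition edge_sets :: "real \<Rightarrow> real^3 \<Rightarrow> (real^3) set set" where
  "edge_sets r d = {{axis i (d $ i), axis j (d $ j)} | i j. i \<noteq> j} \<union> {{axis i (d $ i), (r / 3) *\<^sub>R d} | i. True}"

definition face_sets :: "real \<Rightarrow> real^3 \<Rightarrow> (real^3) set set" where
  "face_sets r d = {{axis i (d $ i), axis j (d $ j), (r / 3) *\<^sub>R d} | i j. i \<noteq> j}"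

lemma Collect_pairs3: "{f i j | i j. i \<noteq> (j::3)} = {f 1 2, f 1 3, f 2 3, f 2 1, f 3 1, f 3 2}"
proof -
  have "(\<exists>i j. y = f i j \<and> i \<noteq> (j::3)) \<longleftrightarrow> y \<in> {f 1 2, f 1 3, f 2 3, f 2 1, f 3 1, f 3 2}" for y
    unfolding exists_3 by auto
  then show ?thesis by auto
qed

lemma set_dup: "{p, q, s, p, q, s} = {p, q, s}" by auto

lemma skeleton_1_eq: "skeleton r 1 = (\<Union>d\<in>sgnvecs. \<Union>E\<in>edge_sets r d. convex hull E)"
proof -
  have *: "edge_sets r d = {{vA (d $ 1), vB (d $ 2)}, {vA (d $ 1), vC (d $ 3)}, {vB (d $ 2), vC (d $ 3)},
      {vA (d $ 1), (r / 3) *\<^sub>R d}, {vB (d $ 2), (r / 3) *\<^sub>R d}, {vC (d $ 3), (r / 3) *\<^sub>R d}}" for d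
  proof -
    have f: "{axis 2 (d $ 2), axis 1 (d $ 1)} = {axis 1 (d $ 1), axis 2 (d $ 2)}" "{axis 3 (d $ 3), axis 1 (d $ 1)} = {axis 1 (d $ 1), axis 3 (d $ 3)}"
      "{axis 3 (d $ 3), axis 2 (d $ 2)} = {axis 2 (d $ 2), axis 3 (d $ 3)}" by (rule insert_commute)+
    have "{{axis i (d $ i), (r / 3) *\<^sub>R d} | i. True} = {{vA (d $ 1), (r / 3) *\<^sub>R d}, {vB (d $ 2), (r / 3) *\<^sub>R d}, {vC (d $ 3), (r / 3) *\<^sub>R d}}"
      unfolding v_axis by (auto simp: exists_3)
    moreover have "{{axis i (d $ i), axis j (d $ j)} | i j. i \<noteq> j} = {{vA (d $ 1), vB (d $ 2)}, {vA (d $ 1), vC (d $ 3)}, {vB (d $ 2), vC (d $ 3)}}"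
      unfolding Collect_pairs3 v_axis f by (simp only: set_dup)
    ultimately show ?thesis unfolding edge_sets_def by (simp only: Un_insert_left Un_empty_left)
  qed
  show ?thesis
    unfolding UN_sgnvecs * vector_3 vD_sgnvec[symmetric] skeleton_def edges_def by simp
qed

lemma skeleton_2_eq: "skeleton r 2 = (\<Union>d\<in>sgnvecs. \<Union>E\<in>face_sets r d. convex hull E)"
proof -
  have *: "face_sets r d = {{vA (d $ 1), vB (d $ 2), (r / 3) *\<^sub>R d}, {vA (d $ 1), vC (d $ 3), (r / 3) *\<^sub>R d}, {vB (d $ 2), vC (d $ 3), (r / 3) *\<^sub>R d}}" for d
  proof -
    have f: "{axis 2 (d $ 2), axis 1 (d $ 1), (r / 3) *\<^sub>R d} = {axis 1 (d $ 1), axis 2 (d $ 2), (r / 3) *\<^sub>R d}"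
      "{axis 3 (d $ 3), axis 1 (d $ 1), (r / 3) *\<^sub>R d} = {axis 1 (d $ 1), axis 3 (d $ 3), (r / 3) *\<^sub>R d}"
      "{axis 3 (d $ 3), axis 2 (d $ 2), (r / 3) *\<^sub>R d} = {axis 2 (d $ 2), axis 3 (d $ 3), (r / 3) *\<^sub>R d}" by (rule insert_commute)+
    show ?thesis unfolding face_sets_def Collect_pairs3 v_axis f by (simp only: set_dup)
  qed
  show ?thesis
    unfolding UN_sgnvecs * vector_3 vD_sgnvec[symmetric] skeleton_def faces_def by simp
qed

context
  fixes \<sigma> :: "3 \<Rightarrow> 3" and \<epsilon> :: "3 \<Rightarrow> real"
  assumes bij: "bij \<sigma>" and sgn: "\<And>i. \<epsilon> i \<in> signs"
begin

lemma Wmat_sgnvecs: "d \<in> sgnvecs \<Longrightarrow> Wmat \<sigma> \<epsilon> *v d \<in> sgnvecs"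
  using sgn by (simp add: sgnvecs_def Wmat_mult signs_mult)

lemma Wmat_axis: "Wmat \<sigma> \<epsilon> *v axis i (d $ i) = axis (inv \<sigma> i) ((Wmat \<sigma> \<epsilon> *v d) $ inv \<sigma> i)"
  using bij by (auto simp: vec_eq_iff Wmat_mult axis_def bij_is_surj surj_f_inv_f bij_is_inj inv_f_f)

lemma Wmat_scale: "Wmat \<sigma> \<epsilon> *v (c *\<^sub>R d) = c *\<^sub>R (Wmat \<sigma> \<epsilon> *v d)"
  by (simp add: vec_eq_iff Wmat_mult)

lemma Wmat_edge_sets:
  assumes "E \<in> edge_sets r d" shows "(\<lambda>x. Wmat \<sigma> \<epsilon> *v x) ` E \<in> edge_sets r (Wmat \<sigma> \<epsilon> *v d)"
proof -
  have ne: "inv \<sigma> i \<noteq> inv \<sigma> j" if "i \<noteq> j" for i j using that bij by (metis bij_inv_eq_iff)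
  show ?thesis using assms unfolding edge_sets_def
    by (elim UnE CollectE exE conjE) (simp_all only: image_insert image_empty Wmat_axis Wmat_scale, use ne in blast, blast)
qed

lemma Wmat_face_sets:
  assumes "E \<in> face_sets r d" shows "(\<lambda>x. Wmat \<sigma> \<epsilon> *v x) ` E \<in> face_sets r (Wmat \<sigma> \<epsilon> *v d)"
proof -
  have ne: "inv \<sigma> i \<noteq> inv \<sigma> j" if "i \<noteq> j" for i j using that bij by (metis bij_inv_eq_iff)
  show ?thesis using assms unfolding face_sets_def
    by (elim CollectE exE conjE) (simp only: image_insert image_empty Wmat_axis Wmat_scale, use ne in blast)
qed

lemma Wmat_hull: "(\<lambda>x. Wmat \<sigma> \<epsilon> *v x) ` (convex hull E) = convex hull ((\<lambda>x. Wmat \<sigma> \<epsilon> *v x) ` E)"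
  by (rule convex_hull_linear_image) simp

lemma NN_Wmat: "NN r (Wmat \<sigma> \<epsilon> *v x) = NN r x"
proof -
  \<comment> \<open>Written as a sum and a minimum over all coordinates, \<open>NN\<close> is
    visibly invariant under permutations.\<close>
  have N: "NN r y = (\<Sum>i\<in>UNIV. \<bar>y $ i\<bar>) + (3 / r - 3) * Min (range (\<lambda>i. \<bar>y $ i\<bar>))" for y
    by (simp add: NN_def UNIV_3 Min_insert2 sum_3[unfolded UNIV_3])
  have a: "\<bar>(Wmat \<sigma> \<epsilon> *v x) $ i\<bar> = \<bar>x $ \<sigma> i\<bar>" for i
  proof -
    have "\<bar>\<epsilon> i\<bar> = 1" using sgn[of i] by (auto simp: signs_def)
    then show ?thesis by (simp add: Wmat_mult abs_mult)
  qed
  have "(\<Sum>i\<in>UNIV. \<bar>x $ \<sigma> i\<bar>) = (\<Sum>i\<in>UNIV. \<bar>x $ i\<bar>)"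
    by (rule sum.reindex_bij_betw[of \<sigma> UNIV UNIV "\<lambda>i. \<bar>x $ i\<bar>"]) (use bij in auto)
  moreover have "range (\<lambda>i. \<bar>x $ \<sigma> i\<bar>) = range (\<lambda>i. \<bar>x $ i\<bar>)"
  proof -
    have "range (\<lambda>i. \<bar>x $ \<sigma> i\<bar>) = (\<lambda>i. \<bar>x $ i\<bar>) ` range \<sigma>" by auto
    then show ?thesis by (simp add: bij_is_surj[OF bij])
  qed
  ultimately show ?thesis unfolding N a by simp
qed

lemma Wmat_skeleton:
  assumes "r > 0" "k \<in> {0, 1, 2, 3}" "x \<in> skeleton r k" shows "Wmat \<sigma> \<epsilon> *v x \<in> skeleton r k"
proof -
  let ?W = "\<lambda>x. Wmat \<sigma> \<epsilon> *v x"
  consider "k = 0" | "k = 1" | "k = 2" | "k = 3" using assms(2) by auto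
  then show ?thesis
  proof cases
    case 1
    obtain d i where d: "d \<in> sgnvecs" "x = axis i (d $ i) \<or> x = (r / 3) *\<^sub>R d"
      using assms(3) unfolding 1 skeleton_0_eq by auto
    have "?W x = axis (inv \<sigma> i) (?W d $ inv \<sigma> i) \<or> ?W x = (r / 3) *\<^sub>R ?W d" using d(2) Wmat_axis Wmat_scale by metis
    then show ?thesis using Wmat_sgnvecs[OF d(1)] unfolding 1 skeleton_0_eq by blast
  next
    case 2
    obtain d E where d: "d \<in> sgnvecs" "E \<in> edge_sets r d" "x \<in> convex hull E"
      using assms(3) unfolding 2 skeleton_1_eq by auto
    have "?W x \<in> convex hull (?W ` E)" using d(3) Wmat_hull[of E] by blast
    then show ?thesis using Wmat_sgnvecs[OF d(1)] Wmat_edge_sets[OF d(2)] unfolding 2 skeleton_1_eq by blast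
  next
    case 3
    obtain d E where d: "d \<in> sgnvecs" "E \<in> face_sets r d" "x \<in> convex hull E"
      using assms(3) unfolding 3 skeleton_2_eq by auto
    have "?W x \<in> convex hull (?W ` E)" using d(3) Wmat_hull[of E] by blast
    then show ?thesis using Wmat_sgnvecs[OF d(1)] Wmat_face_sets[OF d(2)] unfolding 3 skeleton_2_eq by blast
  next
    case 4
    then show ?thesis using assms(3) by (simp add: skeleton_def solid_eq[OF assms(1)] NN_Wmat)
  qed
qed

lemma Wmat_inverse:
  "Wmat \<sigma> \<epsilon> *v (Wmat (inv \<sigma>) (\<epsilon> \<circ> inv \<sigma>) *v x) = x"
proof -
  have "\<epsilon> i * (\<epsilon> i * z) = z" for i z
    using signs_mult_self[OF sgn[of i]] by (simp add: mult.assoc[symmetric])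
  then show ?thesis by (simp add: vec_eq_iff Wmat_mult inv_f_f[OF bij_is_inj[OF bij]])
qed

lemma orthogonal_Wmat: "orthogonal_matrix (Wmat \<sigma> \<epsilon>)"
proof -
  let ?W = "\<lambda>x. Wmat \<sigma> \<epsilon> *v x"
  have e: "\<epsilon> i * a * (\<epsilon> i * b) = a * b" for i a b
    using signs_mult_self[OF sgn[of i]] by (metis (no_types, lifting) mult.assoc mult.left_commute mult_1_left)
  have "?W x \<bullet> ?W y = x \<bullet> y" for x y
  proof -
    have "?W x \<bullet> ?W y = (\<Sum>i\<in>UNIV. x $ \<sigma> i * y $ \<sigma> i)" by (simp add: inner_vec_def Wmat_mult e)
    also have "\<dots> = (\<Sum>i\<in>UNIV. x $ i * y $ i)"
      by (rule sum.reindex_bij_betw[of \<sigma> UNIV UNIV "\<lambda>i. x $ i * y $ i"]) (use bij in auto)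
    finally show ?thesis by (simp add: inner_vec_def)
  qed
  then have "orthogonal_transformation ?W" by (simp add: orthogonal_transformation_def)
  then show ?thesis by (simp add: orthogonal_transformation_matrix)
qed

end

lemma W_B3_subset_sym_group:
  assumes "r > 0" "k \<in> {0, 1, 2, 3}" shows "W_B3 \<subseteq> sym_group (skeleton r k)"
proof
  fix A assume "A \<in> W_B3"
  then obtain \<sigma> \<epsilon> where A: "bij \<sigma>" "\<And>i. \<epsilon> i \<in> signs" "A = Wmat \<sigma> \<epsilon>" by (auto simp: W_B3_iff)
  have "(\<lambda>x. A *v x) ` skeleton r k = skeleton r k"
  proof (intro equalityI subsetI)
    fix y assume "y \<in> (\<lambda>x. A *v x) ` skeleton r k"
    then show "y \<in> skeleton r k" using Wmat_skeleton[OF A(1,2) assms] A(3) by auto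
  next
    fix y assume y: "y \<in> skeleton r k"
    let ?x = "Wmat (inv \<sigma>) (\<epsilon> \<circ> inv \<sigma>) *v y"
    have "?x \<in> skeleton r k" by (rule Wmat_skeleton[OF bij_imp_bij_inv[OF A(1)] _ assms y]) (simp add: A(2))
    moreover have "A *v ?x = y" unfolding A(3) by (rule Wmat_inverse[OF A(1,2)])
    ultimately show "y \<in> (\<lambda>x. A *v x) ` skeleton r k" by force
  qed
  then show "A \<in> sym_group (skeleton r k)" using orthogonal_Wmat[OF A(1,2)] A(3) by (simp add: sym_group_def)
qed

lemma finite_vertices: "finite (vertices r)" unfolding vertices_def by auto

lemma vertices_eq: "vertices r = (\<Union>d\<in>sgnvecs. \<Union>i. {axis i (d $ i), (r / 3) *\<^sub>R d})"
  using skeleton_0_eq by (simp add: skeleton_def)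

lemma other_index: obtains j :: 3 where "i \<noteq> j"
proof (cases "i = 1")
  case True then show ?thesis using that[of 2] by simp
next
  case False then show ?thesis using that[of 1] by simp
qed

lemma vertices_subset_skeleton:
  assumes "r > 0" "k \<in> {0, 1, 2, 3}" shows "vertices r \<subseteq> skeleton r k"
proof
  fix x assume x: "x \<in> vertices r"
  then obtain d i where d: "d \<in> sgnvecs" "x = axis i (d $ i) \<or> x = (r / 3) *\<^sub>R d"
    unfolding vertices_eq by auto
  obtain j :: 3 where ij: "i \<noteq> j" by (rule other_index)
  consider "k = 0" | "k = 1" | "k = 2" | "k = 3" using assms(2) by auto
  then show "x \<in> skeleton r k"
  proof cases
    case 1 then show ?thesis using x by (simp add: skeleton_def)
  next
    case 2
    have "{axis i (d $ i), (r / 3) *\<^sub>R d} \<in> edge_sets r d" unfolding edge_sets_def by blast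
    moreover have "x \<in> convex hull {axis i (d $ i), (r / 3) *\<^sub>R d}" using d(2) by (intro hull_inc) auto
    ultimately show ?thesis using d(1) unfolding 2 skeleton_1_eq by blast
  next
    case 3
    have "{axis i (d $ i), axis j (d $ j), (r / 3) *\<^sub>R d} \<in> face_sets r d" using ij unfolding face_sets_def by blast
    moreover have "x \<in> convex hull {axis i (d $ i), axis j (d $ j), (r / 3) *\<^sub>R d}" using d(2) by (intro hull_inc) auto
    ultimately show ?thesis using d(1) unfolding 3 skeleton_2_eq by blast
  next
    case 4
    have a: "\<bar>d $ l\<bar> = 1" for l using sgnvec_vector(2)[OF d(1), of l] by (auto simp: signs_def)
    have "NN r x = 1"
    proof (cases "x = (r / 3) *\<^sub>R d")
      case True
      then show ?thesis using assms(1) by (simp add: NN_def abs_mult a) (simp add: field_simps)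
    next
      case False
      then have "x = axis i (d $ i)" using d(2) by simp
      then show ?thesis using exhaust_3[of i] by (auto simp: NN_def axis_def a)
    qed
    then show ?thesis using 4 by (simp add: skeleton_def solid_eq[OF assms(1)])
  qed
qed

lemma edges_in_vertices: "d \<in> sgnvecs \<Longrightarrow> E \<in> edge_sets r d \<Longrightarrow> E \<subseteq> vertices r"
  unfolding edge_sets_def vertices_eq by auto

lemma faces_in_vertices: "d \<in> sgnvecs \<Longrightarrow> E \<in> face_sets r d \<Longrightarrow> E \<subseteq> vertices r"
  unfolding face_sets_def vertices_eq by auto

text \<open>All skeleta lie between the vertices and their hull, so the symmetry argument can be the
  same for every \<open>k\<close>.\<close>

lemma skeleton_subset_hull:
  assumes "r > 0" "k \<in> {0, 1, 2, 3}" shows "skeleton r k \<subseteq> convex hull (vertices r)"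
proof -
  consider "k = 0" | "k = 1" | "k = 2" | "k = 3" using assms(2) by auto
  then show ?thesis
  proof cases
    case 1 then show ?thesis by (simp add: skeleton_def hull_subset)
  next
    case 2 then show ?thesis using hull_mono[OF edges_in_vertices] by (simp only: skeleton_1_eq) blast
  next
    case 3 then show ?thesis using hull_mono[OF faces_in_vertices] by (simp only: skeleton_2_eq) blast
  next
    case 4
    have o: "octahedron \<subseteq> convex hull (vertices r)"
      unfolding octahedron_def by (rule hull_mono) (auto simp: vertices_def)
    have vv: "{vA a, vB b, vC c, vD r a b c} \<subseteq> vertices r" if "a \<in> signs" "b \<in> signs" "c \<in> signs" for a b c
      using that unfolding vertices_def by blast
    have p: "pyramids r \<subseteq> convex hull (vertices r)"
      unfolding pyramids_def by (intro UN_least hull_mono vv)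
    have "closed octahedron"
      unfolding octahedron_def by (intro compact_imp_closed finite_imp_compact_convex_hull) auto
    then have "closure (octahedron - pyramids r) \<subseteq> octahedron" by (intro closure_minimal) auto
    then show ?thesis using o p 4 by (auto simp: skeleton_def solid_def)
  qed
qed

text \<open>An orthogonal map keeps norms, and a point of the hull with the largest possible norm
  must be a vertex. Every symmetry of any skeleton therefore permutes the farthest vertices.\<close>

lemma sym_group_vertex:
  assumes "r > 0" "k \<in> {0, 1, 2, 3}" and A: "A \<in> sym_group (skeleton r k)"
    and R: "\<And>u. u \<in> vertices r \<Longrightarrow> norm u \<le> norm v" and v: "v \<in> vertices r"
  shows "A *v v \<in> vertices r" "norm (A *v v) = norm v"
proof -
  have "orthogonal_transformation (\<lambda>x. A *v x)" using A by (simp add: sym_group_def orthogonal_transformation_matrix)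
  then show n: "norm (A *v v) = norm v" by (rule orthogonal_transformation_norm)
  have "A *v v \<in> skeleton r k" using A v vertices_subset_skeleton[OF assms(1,2)] by (auto simp: sym_group_def)
  then have h: "A *v v \<in> convex hull (vertices r)" using skeleton_subset_hull[OF assms(1,2)] by auto
  show "A *v v \<in> vertices r"
  proof (rule ccontr)
    assume "A *v v \<notin> vertices r"
    then obtain y where y: "y \<in> convex hull (vertices r)" "norm (A *v v - 0) < norm (y - 0)"
      using simplex_furthest_lt[OF finite_vertices, of r 0] h by blast
    have "convex hull (vertices r) \<subseteq> cball 0 (norm v)" using R by (intro hull_minimal) auto
    then show False using y n by auto
  qed
qed

lemma signed_axes_W_B3:
  assumes A: "orthogonal_matrix A" and ax: "\<And>i. \<exists>j s. s \<in> signs \<and> A *v axis i 1 = axis j s"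
  shows "A \<in> W_B3"
proof -
  obtain \<tau> s where ts: "\<And>i. s i \<in> signs" "\<And>i. A *v axis i 1 = axis (\<tau> i) (s i)" using ax by metis
  have ot: "orthogonal_transformation (\<lambda>x. A *v x)" using A by (simp add: orthogonal_transformation_matrix)
  have "inj \<tau>"
  proof (rule injI, rule ccontr)
    fix i j assume e: "\<tau> i = \<tau> j" and ne: "i \<noteq> j"
    have "(A *v axis i 1) \<bullet> (A *v axis j 1) = axis i 1 \<bullet> (axis j 1 :: real^3)" using ot by (simp add: orthogonal_transformation_def)
    then have "s i * s j = 0" using ne unfolding ts e by (simp add: inner_axis_axis)
    then show False using ts(1) signs_nz by auto
  qed
  then have b: "bij \<tau>" by (simp add: finite_UNIV_inj_surj bij_def)
  have "A = Wmat (inv \<tau>) (s \<circ> inv \<tau>)"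
  proof -
    have c: "A $ l $ i = axis (\<tau> i) (s i) $ l" for l i
      using arg_cong[OF ts(2)[of i], of "\<lambda>v. v $ l"] by (simp add: matrix_vector_mul_component inner_axis)
    show ?thesis
      using b by (auto simp: vec_eq_iff Wmat_def c axis_def bij_is_surj surj_f_inv_f bij_is_inj inv_f_f)
  qed
  then show ?thesis using b ts(1) by (auto intro!: Wmat_in_W_B3 bij_imp_bij_inv)
qed

lemma norm_sq_vertices:
  assumes "d \<in> sgnvecs"
  shows "axis i (d $ i) \<bullet> axis i (d $ i) = 1" "((r / 3) *\<^sub>R d) \<bullet> ((r / 3) *\<^sub>R d) = r\<^sup>2 / 3"
proof -
  have a: "d $ l * d $ l = 1" for l using sgnvec_vector(2)[OF assms, of l] by (rule signs_mult_self)
  show "axis i (d $ i) \<bullet> axis i (d $ i) = 1" by (simp add: inner_axis' a)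
  have "d \<bullet> d = 3" by (simp add: inner_vec_def sum_3 a)
  then show "((r / 3) *\<^sub>R d) \<bullet> ((r / 3) *\<^sub>R d) = r\<^sup>2 / 3" by (simp add: power2_eq_square)
qed

text \<open>Octahedral vertices have squared norm 1 and apices r^2/3, so the size of
  \<open>r\<close> decides which of them are farthest. In either case the images of the axes turn
  out to be signed axes.\<close>

lemma sym_group_subset_W_B3:
  assumes r: "r > 0" and k: "k \<in> {0, 1, 2, 3}" shows "sym_group (skeleton r k) \<subseteq> W_B3"
proof
  fix A assume A: "A \<in> sym_group (skeleton r k)"
  then have oA: "orthogonal_matrix A" by (simp add: sym_group_def)
  then have ot: "orthogonal_transformation (\<lambda>x. A *v x)" by (simp add: orthogonal_transformation_matrix)
  have ips: "(A *v x) \<bullet> (A *v y) = x \<bullet> y" for x y using ot by (simp add: orthogonal_transformation_def)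
  define one where "one = (\<chi> i. 1 :: real^3)"
  have one: "one \<in> sgnvecs" by (simp add: one_def sgnvecs_def)
  have axv: "axis i s \<in> vertices r" if "s \<in> signs" for i s
    using that unfolding vertices_eq sgnvecs_def
    by (intro UN_I[of "\<chi> i. s"] UN_I[of i]) auto
  have cases: "(\<exists>i s. s \<in> signs \<and> u = axis i s \<and> u \<bullet> u = 1) \<or> (\<exists>d\<in>sgnvecs. u = (r / 3) *\<^sub>R d \<and> u \<bullet> u = r\<^sup>2 / 3)" if "u \<in> vertices r" for u
  proof -
    obtain d i where d: "d \<in> sgnvecs" "u = axis i (d $ i) \<or> u = (r / 3) *\<^sub>R d" using \<open>u \<in> vertices r\<close> unfolding vertices_eq by auto
    then show ?thesis using norm_sq_vertices[OF d(1)] sgnvec_vector(2)[OF d(1)] by metis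
  qed
  have ncmp: "norm u \<le> norm v \<longleftrightarrow> u \<bullet> u \<le> v \<bullet> v" for u v :: "real^3" by (rule norm_le)
  show "A \<in> W_B3"
  proof (rule signed_axes_W_B3[OF oA])
    fix i
    show "\<exists>j s. s \<in> signs \<and> A *v axis i 1 = axis j s"
    proof (cases "r\<^sup>2 / 3 \<le> 1")
      case True
      have e: "axis l 1 \<bullet> (axis l 1 :: real^3) = 1" for l by (simp add: inner_axis')
      have img: "A *v axis l 1 \<in> vertices r" for l
      proof (rule sym_group_vertex[OF r k A])
        show "norm u \<le> norm (axis l 1 :: real^3)" if "u \<in> vertices r" for u
          using cases[OF that] True unfolding ncmp e by auto
      qed (simp add: axv)
      show ?thesis
      proof (rule ccontr)
        \<comment> \<open>For r^2 = 3 both kinds of vertices are equally far, so an axis might be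
          sent to an apex. An apex is orthogonal to no vertex: its products with axes are nonzero,
          and with apices they are multiples of a sum of three signs.\<close>
        assume no: "\<not> ?thesis"
        then obtain d where d: "d \<in> sgnvecs" "A *v axis i 1 = (r / 3) *\<^sub>R d" using cases[OF img[of i]] by metis
        obtain j :: 3 where ij: "i \<noteq> j" by (rule other_index)
        have "axis i 1 \<bullet> (axis j 1 :: real^3) = 0" using ij by (simp add: inner_axis_axis)
        then have z: "d \<bullet> (A *v axis j 1) = 0" using ips[of "axis i 1" "axis j 1"] r unfolding d(2) by simp
        have nz: "d $ l \<noteq> 0" for l using sgnvec_vector(2)[OF d(1)] signs_nz by blast
        from cases[OF img[of j]] show False
        proof (elim disjE exE bexE conjE)
          fix l s assume "s \<in> signs" "A *v axis j 1 = axis l s"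
          then show False using z nz[of l] signs_nz by (simp add: inner_axis)
        next
          fix d' assume d': "d' \<in> sgnvecs" "A *v axis j 1 = (r / 3) *\<^sub>R d'"
          then have "d $ 1 * d' $ 1 + d $ 2 * d' $ 2 + d $ 3 * d' $ 3 = 0"
            using z r by (simp add: inner_vec_def[of d d'] sum_3)
          moreover have "d $ l * d' $ l \<in> {1, -1}" for l
            using sgnvec_vector(2)[OF d(1), of l] sgnvec_vector(2)[OF d'(1), of l] by (auto simp: signs_def)
          from this[of 1] this[of 2] this[of 3] have "d $ 1 * d' $ 1 + d $ 2 * d' $ 2 + d $ 3 * d' $ 3 \<noteq> 0" by auto
          ultimately show False by simp
        qed
      qed
    next
      case False
      have img: "A *v d \<in> sgnvecs" if d: "d \<in> sgnvecs" for d
      proof -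
        note n = norm_sq_vertices(2)[OF d, of r]
        have v: "(r / 3) *\<^sub>R d \<in> vertices r" using d unfolding vertices_eq by blast
        have R: "norm u \<le> norm ((r / 3) *\<^sub>R d)" if "u \<in> vertices r" for u
          using cases[OF that] False unfolding ncmp n by auto
        note s = sym_group_vertex[OF r k A R v]
        have "(A *v ((r / 3) *\<^sub>R d)) \<bullet> (A *v ((r / 3) *\<^sub>R d)) = r\<^sup>2 / 3" unfolding ips n ..
        then obtain d' where d': "d' \<in> sgnvecs" "A *v ((r / 3) *\<^sub>R d) = (r / 3) *\<^sub>R d'" using cases[OF s(1)] False by auto
        have "(r / 3) *\<^sub>R (A *v d) = (r / 3) *\<^sub>R d'" using d'(2) by (simp add: matrix_vector_mult_scaleR)
        then show ?thesis using d'(1) r by simp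
      qed
      \<comment> \<open>An axis is half the difference of two sign vectors. Both are mapped to sign
        vectors, so the image of the axis has entries 0, 1, -1 and norm 1.\<close>
      define d where "d = one - 2 *\<^sub>R axis i 1"
      have "d \<in> sgnvecs" by (auto simp: d_def one_def sgnvecs_def axis_def signs_def)
      note 1 = img[OF one] and 2 = img[OF this]
      define a where "a = A *v axis i 1"
      have "2 *\<^sub>R a = A *v one - A *v d"
        by (simp add: a_def d_def matrix_vector_mult_diff_distrib matrix_vector_mult_scaleR)
      then have e: "2 * a $ l = (A *v one) $ l - (A *v d) $ l" for l by (metis vector_minus_component vector_scaleR_component real_scaleR_def)
      have ent: "a $ l \<in> {0, 1, -1}" for l
        using e[of l] sgnvec_vector(2)[OF 1, of l] sgnvec_vector(2)[OF 2, of l] by (auto simp: signs_def)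
      have "a \<bullet> a = 1" using ips[of "axis i 1" "axis i 1"] by (simp add: a_def inner_axis_axis)
      then have "a $ 1 * a $ 1 + a $ 2 * a $ 2 + a $ 3 * a $ 3 = 1" by (simp add: inner_vec_def sum_3)
      then have "(a $ 1 \<in> signs \<and> a $ 2 = 0 \<and> a $ 3 = 0) \<or> (a $ 2 \<in> signs \<and> a $ 1 = 0 \<and> a $ 3 = 0) \<or> (a $ 3 \<in> signs \<and> a $ 1 = 0 \<and> a $ 2 = 0)"
        using ent[of 1] ent[of 2] ent[of 3] by (auto simp: signs_def)
      moreover have "a $ 2 = 0 \<Longrightarrow> a $ 3 = 0 \<Longrightarrow> a = axis 1 (a $ 1)" "a $ 1 = 0 \<Longrightarrow> a $ 3 = 0 \<Longrightarrow> a = axis 2 (a $ 2)"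
        "a $ 1 = 0 \<Longrightarrow> a $ 2 = 0 \<Longrightarrow> a = axis 3 (a $ 3)" by (simp_all add: vec3_eq_iff axis_def)
      ultimately have "\<exists>j s. s \<in> signs \<and> a = axis j s" by metis
      then show ?thesis by (simp add: a_def)
    qed
  qed
qed

theorem sym_group_skeleton: "r > 0 \<Longrightarrow> k \<in> {0, 1, 2, 3} \<Longrightarrow> sym_group (skeleton r k) = W_B3"
  using W_B3_subset_sym_group sym_group_subset_W_B3 by blast

section \<open>The harmonic spaces of the skeleta\<close>

context
  fixes r :: real and k :: nat
  assumes rk: "r > 0" "k \<in> {0, 1, 2, 3}"
begin

private definition w :: "nat \<Rightarrow> nat \<Rightarrow> nat \<Rightarrow> real" where
  "w a b c = skeleton_integral r k (mnm a b c)"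

private lemma w_mu: "w a b c = mu r k a b c / (fact a * fact b * fact c)"
  unfolding w_def by (rule skeleton_mnm[OF rk])

private lemma size_mu: "skeleton_size r k = mu r k 0 0 0"
  by (simp add: skeleton_size_def mu_def)

private lemma size_pos: "skeleton_size r k > 0"
  using good_moments[OF rk] by (simp add: size_mu good_moments_def)

private lemma w_symmetric_even: "symmetric_even w"
  using good_moments[OF rk] unfolding good_moments_def symmetric_even_def w_mu by (auto simp: mult_ac)

private lemma w_moments:
  "w 2 0 0 \<noteq> 0" "3 * w 6 0 0 - 3 * w 4 2 0 + w 2 2 2 \<noteq> 0"
  "w 2 2 0 = 2 * w 4 0 0 \<longleftrightarrow> critical r k"
  "critical r k \<Longrightarrow> 2 * w 8 0 0 - 2 * w 6 2 0 + w 4 4 0 \<noteq> 0"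
proof -
  note g = good_moments[OF rk, unfolded good_moments_def]
  show "w 2 0 0 \<noteq> 0" using g by (simp add: w_mu)
  have "3 * w 6 0 0 - 3 * w 4 2 0 + w 2 2 2 = (mu r k 6 0 0 - 15 * mu r k 4 2 0 + 30 * mu r k 2 2 2) / 240"
    by (simp add: w_mu fact_numeral)
  then show "3 * w 6 0 0 - 3 * w 4 2 0 + w 2 2 2 \<noteq> 0" using g by simp
  have "w 2 2 0 - 2 * w 4 0 0 = - (mu r k 4 0 0 - 3 * mu r k 2 2 0) / 12"
    by (simp add: w_mu fact_numeral)
  then show "w 2 2 0 = 2 * w 4 0 0 \<longleftrightarrow> critical r k" using g by auto
  have "2 * w 8 0 0 - 2 * w 6 2 0 + w 4 4 0 = (mu r k 8 0 0 - 28 * mu r k 6 2 0 + 35 * mu r k 4 4 0) / 20160"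
    by (simp add: w_mu fact_numeral)
  then show "critical r k \<Longrightarrow> 2 * w 8 0 0 - 2 * w 6 2 0 + w 4 4 0 \<noteq> 0" using g by auto
qed

private lemma P_harmonic_moments:
  assumes "f \<in> P_harmonic r k" shows "harmonic_moments (skeleton_integral r k) f w"
proof
  show "f x * skeleton_integral r k (\<lambda>_. 1) = skeleton_integral r k (\<lambda>y. f (x + \<rho> *\<^sub>R y))" if "\<rho> > 0" for x \<rho>
  proof -
    have "f x = (1 / skeleton_size r k) * skeleton_integral r k (\<lambda>y. f (x + \<rho> *\<^sub>R y))"
      using assms that unfolding P_harmonic_def by blast
    then show ?thesis using size_pos by (simp add: skeleton_size_def[symmetric])
  qed
qed (use assms nice_skeleton[OF rk] w_symmetric_even in \<open>auto simp: P_harmonic_def w_def\<close>)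

lemma noncritical_P_harmonic: "\<not> critical r k \<Longrightarrow> regular ` P_harmonic r k \<subseteq> K48"
  using harmonic_moments.regular_in_K48[OF P_harmonic_moments w_moments(1) _ w_moments(2)] w_moments(3) by blast

text \<open>Membership in \<open>K96\<close> identifies a harmonic function with a derivative of
  \<open>F_gen\<close> as functionals, and continuity makes them equal as functions. The converse is
  \<open>mean_value_F\<close>, whose condition on degree 4 is the critical equation.\<close>

lemma critical_P_harmonic:
  assumes "critical r k" shows "P_harmonic r k = range (\<lambda>q. diff_op q F_gen)"
proof (intro equalityI subsetI)
  have c: "continuous_on UNIV (diff_op q F_gen)" for q
    unfolding F_eq_dp by (intro smooth_continuous_on smooth_diff_op smooth_dp)
  {
    fix f assume f: "f \<in> P_harmonic r k"
    have "regular f \<in> K96"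
      by (rule harmonic_moments.regular_in_K96[OF P_harmonic_moments[OF f] w_moments(1,2) w_moments(4)[OF assms]])
    then obtain q where q: "regular f = regular (diff_op q F_gen)" unfolding K96_basis(1) by auto
    have "continuous_on UNIV f" using f by (simp add: P_harmonic_def)
    then have "f = diff_op q F_gen" using regular_inject[OF _ c q] by simp
    then show "f \<in> range (\<lambda>q. diff_op q F_gen)" by simp
  next
    fix f assume "f \<in> range (\<lambda>q. diff_op q F_gen)"
    then obtain q where f: "f = diff_op q F_gen" by auto
    have m4: "w 2 2 0 = 2 * w 4 0 0" using w_moments(3) assms by simp
    have "skeleton_integral r k (\<lambda>y. f (x + \<rho> *\<^sub>R y)) = skeleton_size r k * f x" for x \<rho>
      unfolding f skeleton_size_def by (rule mean_value_F[OF nice_skeleton[OF rk] w_def w_symmetric_even m4])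
    then show "f \<in> P_harmonic r k" using c size_pos by (simp add: P_harmonic_def f)
  }
qed

end

lemma regular_Delta_module: "range (\<lambda>q. dist_op q (regular Delta_B3)) = K48"
proof -
  have "smooth Delta_B3" unfolding Delta_eq_dp by (rule smooth_dp)
  then show ?thesis unfolding K48_basis(1) by (simp add: dist_op_regular image_image)
qed

lemma K48_psubset_K96: "K48 \<subset> K96"
proof -
  have "K48 \<noteq> K96" using K48_basis(2) K96_basis(2) by auto
  then show ?thesis using K48_subset_K96 by blast
qed

theorem theorem5p1:
  fixes r :: real and k :: nat
  assumes "r > 0" and "k \<in> {0, 1, 2, 3}"
  shows
    "(1.78381 \<le> crit_r0 \<and> crit_r0 < 1.78382) \<and>
     (\<exists>!x. x > 0 \<and> poly_r1 x = 0) \<and> (2.24580 \<le> crit_r1 \<and> crit_r1 < 2.24581) \<and>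
     (\<exists>!x. x > 0 \<and> poly_r2 x = 0) \<and> (1.82977 \<le> crit_r2 \<and> crit_r2 < 1.82978) \<and>
     sym_group (skeleton r k) = W_B3 \<and>
     (G_harmonic (sym_group (skeleton r k)) \<subset> regular ` P_harmonic r k \<longleftrightarrow>
        k = 0 \<and> r = crit_r0 \<or> k = 1 \<and> r = crit_r1 \<or> k \<in> {2, 3} \<and> r = crit_r2) \<and>
     (k = 0 \<and> r = crit_r0 \<or> k = 1 \<and> r = crit_r1 \<or> k \<in> {2, 3} \<and> r = crit_r2 \<longrightarrow>
        fdim (G_harmonic (sym_group (skeleton r k))) = 48 \<and>
        fdim (P_harmonic r k) = 96 \<and>
        G_harmonic (sym_group (skeleton r k)) = G_harmonic W_B3 \<and>
        G_harmonic (sym_group (skeleton r k)) = range (\<lambda>q. dist_op q (regular Delta_B3)) \<and>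
        P_harmonic r k = range (\<lambda>q. diff_op q F_gen))"
proof -
  have sym: "sym_group (skeleton r k) = W_B3" by (rule sym_group_skeleton[OF assms])
  have crit: "k = 0 \<and> r = crit_r0 \<or> k = 1 \<and> r = crit_r1 \<or> k \<in> {2, 3} \<and> r = crit_r2 \<longleftrightarrow> critical r k"
    by (simp add: critical_def)
  have P: "regular ` P_harmonic r k = K96" if "critical r k"
    unfolding critical_P_harmonic[OF assms that] K96_basis(1) ..
  \<comment> \<open>Away from the critical radii the harmonic functions lie inside
    \<open>K48\<close>, which excludes a proper inclusion; at a critical radius they are all of the
    larger \<open>K96\<close>.\<close>
  have "K48 \<subset> regular ` P_harmonic r k \<longleftrightarrow> critical r k"
    using noncritical_P_harmonic[OF assms] P K48_psubset_K96 by blast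
  moreover have "fdim (P_harmonic r k) = 96" if "critical r k"
    unfolding critical_P_harmonic[OF assms that] by (rule K96_basis(3))
  ultimately show ?thesis
    unfolding sym crit G_harmonic_eq_K48 regular_Delta_module
    using crit_r0_bounds crit_r1(1-3) crit_r2(1-3) K48_basis(2) critical_P_harmonic[OF assms] by blast
qed

end
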